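(* There is a c.c.c. poset whose generic extensions contain a piecewise proper family of reals of size $\omega_2$.
   Context: A family of reals $\mathfrak{X}\subseteq\mathcal{P}(\mathbb{N})$ is proper if it is arithmetically closed (contains every set arithmetically definable from any of its members) and the poset $\mathfrak{X}/\mathrm{Fin}$ — the infinite members of $\mathfrak{X}$ ordered by almost inclusion ($A\leq B$ iff $A\setminus B$ finite) — is a proper poset in the sense of Shelah. A family is piecewise proper if it is the union of a chain (under inclusion) of proper families each of size $\leq\omega_1$. *)

theory Defs
  imports Main
begin

text \<open>
  A model of set theory is a binary relation \<open>E\<close> on a type \<open>'a\<close>, where \<open>E x y\<close> is read
  ``\<open>x\<close> is an element of \<open>y\<close>''. Below, a quantifier over \<open>'a\<close> is a quantifier over the sets of
  the model, whereas \<open>elts E x\<close> and \<open>rel E r\<close> are the HOL sets that \<open>x\<close> and \<open>r\<close> represent. A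
  notion that is not absolute (a countable set, a cardinal, a power set, a dense set, ...) is
  always expressed by a quantifier over the sets of the model.
\<close>

definition elts :: "('a \<Rightarrow> 'a \<Rightarrow> bool) \<Rightarrow> 'a \<Rightarrow> 'a set" where
  "elts E x = {y. E y x}"

definition kpair :: "('a \<Rightarrow> 'a \<Rightarrow> bool) \<Rightarrow> 'a \<Rightarrow> 'a \<Rightarrow> 'a \<Rightarrow> bool" where
  "kpair E a b c \<longleftrightarrow> (\<exists>u v. elts E u = {a} \<and> elts E v = {a, b} \<and> elts E c = {u, v})"

definition rel :: "('a \<Rightarrow> 'a \<Rightarrow> bool) \<Rightarrow> 'a \<Rightarrow> ('a \<times> 'a) set" where
  "rel E r = {(a, b). \<exists>c. kpair E a b c \<and> E c r}"


section \<open>Transitive models of ZFC\<close>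

text \<open>Formulas of the language of set theory, with de Bruijn indices.\<close>

datatype fm = Mem nat nat | Equal nat nat | Neg fm | Conj fm fm | Exists fm

primrec sat :: "('a \<Rightarrow> 'a \<Rightarrow> bool) \<Rightarrow> 'a set \<Rightarrow> (nat \<Rightarrow> 'a) \<Rightarrow> fm \<Rightarrow> bool" where
  "sat E A s (Mem i j) \<longleftrightarrow> E (s i) (s j)"
| "sat E A s (Equal i j) \<longleftrightarrow> s i = s j"
| "sat E A s (Neg \<phi>) \<longleftrightarrow> \<not> sat E A s \<phi>"
| "sat E A s (Conj \<phi> \<psi>) \<longleftrightarrow> sat E A s \<phi> \<and> sat E A s \<psi>"
| "sat E A s (Exists \<phi>) \<longleftrightarrow> (\<exists>x\<in>A. sat E A (case_nat x s) \<phi>)"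

definition extensional :: "('a \<Rightarrow> 'a \<Rightarrow> bool) \<Rightarrow> bool" where
  "extensional E \<longleftrightarrow> (\<forall>x y. elts E x = elts E y \<longrightarrow> x = y)"

text \<open>In the two schemes the parameters are the values of the assignment \<open>s\<close>.\<close>

definition zfc :: "('a \<Rightarrow> 'a \<Rightarrow> bool) \<Rightarrow> bool" where
  "zfc E \<longleftrightarrow>
     extensional E \<and>
     \<comment> \<open>foundation\<close>
     (\<forall>a. elts E a \<noteq> {} \<longrightarrow> (\<exists>x\<in>elts E a. elts E x \<inter> elts E a = {})) \<and>
     \<comment> \<open>pairing\<close>
     (\<forall>a b. \<exists>c. elts E c = {a, b}) \<and>
     \<comment> \<open>union\<close>
     (\<forall>a. \<exists>u. elts E u = (\<Union>x\<in>elts E a. elts E x)) \<and>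
     \<comment> \<open>power set\<close>
     (\<forall>a. \<exists>p. elts E p = {x. elts E x \<subseteq> elts E a}) \<and>
     \<comment> \<open>infinity\<close>
     (\<exists>w. (\<exists>z\<in>elts E w. elts E z = {}) \<and>
          (\<forall>x\<in>elts E w. \<exists>y\<in>elts E w. elts E y = insert x (elts E x))) \<and>
     \<comment> \<open>separation\<close>
     (\<forall>\<phi> s a. \<exists>b. elts E b = {x \<in> elts E a. sat E UNIV (case_nat x s) \<phi>}) \<and>
     \<comment> \<open>replacement\<close>
     (\<forall>\<phi> s a. (\<forall>x\<in>elts E a. \<exists>!y. sat E UNIV (case_nat x (case_nat y s)) \<phi>) \<longrightarrow>
        (\<exists>b. elts E b = {y. \<exists>x\<in>elts E a. sat E UNIV (case_nat x (case_nat y s)) \<phi>})) \<and>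
     \<comment> \<open>choice\<close>
     (\<forall>a. (\<forall>x\<in>elts E a. elts E x \<noteq> {}) \<and>
          (\<forall>x\<in>elts E a. \<forall>y\<in>elts E a. x \<noteq> y \<longrightarrow> elts E x \<inter> elts E y = {}) \<longrightarrow>
        (\<exists>c. \<forall>x\<in>elts E a. \<exists>!y. y \<in> elts E x \<and> y \<in> elts E c))"

text \<open>
  By Mostowski's collapsing theorem the well-founded models of ZFC are, up to isomorphism, the
  transitive ones. There is no countability assumption.
\<close>

definition transitive_model :: "('a \<Rightarrow> 'a \<Rightarrow> bool) \<Rightarrow> bool" where
  "transitive_model E \<longleftrightarrow> wfp E \<and> zfc E"


section \<open>Ordinals and cardinalities in a model\<close>

definition trans_set :: "('a \<Rightarrow> 'a \<Rightarrow> bool) \<Rightarrow> 'a \<Rightarrow> bool" where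
  "trans_set E x \<longleftrightarrow> (\<forall>y\<in>elts E x. elts E y \<subseteq> elts E x)"

definition ordinal :: "('a \<Rightarrow> 'a \<Rightarrow> bool) \<Rightarrow> 'a \<Rightarrow> bool" where
  "ordinal E x \<longleftrightarrow> trans_set E x \<and> (\<forall>y\<in>elts E x. trans_set E y)"

text \<open>\<open>numeral_of E n x\<close>: \<open>x\<close> is the von Neumann numeral of \<open>n\<close>.\<close>

primrec numeral_of :: "('a \<Rightarrow> 'a \<Rightarrow> bool) \<Rightarrow> nat \<Rightarrow> 'a \<Rightarrow> bool" where
  "numeral_of E 0 x \<longleftrightarrow> elts E x = {}"
| "numeral_of E (Suc n) x \<longleftrightarrow> (\<exists>y. numeral_of E n y \<and> elts E x = insert y (elts E y))"

text \<open>A well-founded model has no nonstandard natural numbers, so this is its \<open>\<omega>\<close>.\<close>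

definition is_omega :: "('a \<Rightarrow> 'a \<Rightarrow> bool) \<Rightarrow> 'a \<Rightarrow> bool" where
  "is_omega E w \<longleftrightarrow> elts E w = {x. \<exists>n. numeral_of E n x}"

text \<open>
  \<open>fun_code E f x g\<close>: the set \<open>f\<close> of the model represents the function \<open>g\<close> with domain \<open>x\<close>.
  Injections and bijections have to be represented in the model.
\<close>

definition fun_code :: "('a \<Rightarrow> 'a \<Rightarrow> bool) \<Rightarrow> 'a \<Rightarrow> 'a \<Rightarrow> ('a \<Rightarrow> 'a) \<Rightarrow> bool" where
  "fun_code E f x g \<longleftrightarrow> rel E f = (\<lambda>a. (a, g a)) ` elts E x"

definition card_le :: "('a \<Rightarrow> 'a \<Rightarrow> bool) \<Rightarrow> 'a \<Rightarrow> 'a \<Rightarrow> bool" where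
  "card_le E x y \<longleftrightarrow>
     (\<exists>f g. fun_code E f x g \<and> inj_on g (elts E x) \<and> g ` elts E x \<subseteq> elts E y)"

definition card_less :: "('a \<Rightarrow> 'a \<Rightarrow> bool) \<Rightarrow> 'a \<Rightarrow> 'a \<Rightarrow> bool" where
  "card_less E x y \<longleftrightarrow> card_le E x y \<and> \<not> card_le E y x"

definition card_eq :: "('a \<Rightarrow> 'a \<Rightarrow> bool) \<Rightarrow> 'a \<Rightarrow> 'a \<Rightarrow> bool" where
  "card_eq E x y \<longleftrightarrow> (\<exists>f g. fun_code E f x g \<and> bij_betw g (elts E x) (elts E y))"

definition cardinal :: "('a \<Rightarrow> 'a \<Rightarrow> bool) \<Rightarrow> 'a \<Rightarrow> bool" where
  "cardinal E k \<longleftrightarrow> ordinal E k \<and> (\<forall>a\<in>elts E k. \<not> card_le E k a)"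

text \<open>\<open>is_omega_n E n k\<close>: \<open>k\<close> is \<open>\<omega>\<^sub>n\<close>; the successor of \<open>j\<close> is the least cardinal above \<open>j\<close>.\<close>

primrec is_omega_n :: "('a \<Rightarrow> 'a \<Rightarrow> bool) \<Rightarrow> nat \<Rightarrow> 'a \<Rightarrow> bool" where
  "is_omega_n E 0 k \<longleftrightarrow> is_omega E k"
| "is_omega_n E (Suc n) k \<longleftrightarrow>
     (\<exists>j. is_omega_n E n j \<and> cardinal E k \<and> card_less E j k \<and>
          (\<forall>a\<in>elts E k. card_le E a j))"

definition card_le_omega_n :: "('a \<Rightarrow> 'a \<Rightarrow> bool) \<Rightarrow> 'a \<Rightarrow> nat \<Rightarrow> bool" where
  "card_le_omega_n E x n \<longleftrightarrow> (\<exists>k. is_omega_n E n k \<and> card_le E x k)"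

definition card_eq_omega_n :: "('a \<Rightarrow> 'a \<Rightarrow> bool) \<Rightarrow> 'a \<Rightarrow> nat \<Rightarrow> bool" where
  "card_eq_omega_n E x n \<longleftrightarrow> (\<exists>k. is_omega_n E n k \<and> card_eq E x k)"

definition countable_in :: "('a \<Rightarrow> 'a \<Rightarrow> bool) \<Rightarrow> 'a \<Rightarrow> bool" where
  "countable_in E x \<longleftrightarrow> card_le_omega_n E x 0"


section \<open>Posets, generic filters and generic extensions\<close>

text \<open>
  A poset of the model is given by a set \<open>P\<close> and a set \<open>le\<close> of pairs, with \<open>(p, q) \<in> rel E le\<close>
  meaning that \<open>p\<close> is below (stronger than) \<open>q\<close>. A forcing poset is required to be
  nonempty, since the empty poset has no generic filter.
\<close>

definition compatible :: "('a \<Rightarrow> 'a \<Rightarrow> bool) \<Rightarrow> 'a \<Rightarrow> 'a \<Rightarrow> 'a \<Rightarrow> 'a \<Rightarrow> bool" where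
  "compatible E P le p q \<longleftrightarrow> (\<exists>r\<in>elts E P. (r, p) \<in> rel E le \<and> (r, q) \<in> rel E le)"

definition dense_in :: "('a \<Rightarrow> 'a \<Rightarrow> bool) \<Rightarrow> 'a \<Rightarrow> 'a \<Rightarrow> 'a \<Rightarrow> bool" where
  "dense_in E P le D \<longleftrightarrow>
     elts E D \<subseteq> elts E P \<and> (\<forall>p\<in>elts E P. \<exists>d\<in>elts E D. (d, p) \<in> rel E le)"

definition ccc_poset :: "('a \<Rightarrow> 'a \<Rightarrow> bool) \<Rightarrow> 'a \<Rightarrow> 'a \<Rightarrow> bool" where
  "ccc_poset E P le \<longleftrightarrow>
     elts E P \<noteq> {} \<and> partial_order_on (elts E P) (rel E le) \<and>
     (\<forall>A. elts E A \<subseteq> elts E P \<and>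
          (\<forall>p\<in>elts E A. \<forall>q\<in>elts E A. p \<noteq> q \<longrightarrow> \<not> compatible E P le p q) \<longrightarrow>
        countable_in E A)"

text \<open>
  The filter is an arbitrary HOL set of conditions; it has to meet the dense sets of the model.
\<close>

definition generic_filter :: "('a \<Rightarrow> 'a \<Rightarrow> bool) \<Rightarrow> 'a \<Rightarrow> 'a \<Rightarrow> 'a set \<Rightarrow> bool" where
  "generic_filter E P le G \<longleftrightarrow>
     G \<subseteq> elts E P \<and> G \<noteq> {} \<and>
     (\<forall>p\<in>G. \<forall>q\<in>elts E P. (p, q) \<in> rel E le \<longrightarrow> q \<in> G) \<and>
     (\<forall>p\<in>G. \<forall>q\<in>G. \<exists>r\<in>G. (r, p) \<in> rel E le \<and> (r, q) \<in> rel E le) \<and>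
     (\<forall>D. dense_in E P le D \<longrightarrow> elts E D \<inter> G \<noteq> {})"

text \<open>
  \<open>generic_extension E G F\<close>: the structure \<open>F\<close> is (isomorphic to) the extension of the model
  \<open>E\<close> by \<open>G\<close>, that is, it consists of the values of all names, where the value of \<open>\<tau>\<close> is the
  set of the values of those \<open>\<sigma>\<close> for which \<open>(\<sigma>, p) \<in> \<tau>\<close> for some \<open>p \<in> G\<close>. If \<open>E\<close> is
  well-founded, then \<open>val\<close> is determined by recursion and \<open>F\<close> is unique up to isomorphism.
  Since the extension has the same cardinality as the model, every extension has a copy on the
  type of \<open>E\<close>.
\<close>

definition generic_extension ::
    "('a \<Rightarrow> 'a \<Rightarrow> bool) \<Rightarrow> 'a set \<Rightarrow> ('b \<Rightarrow> 'b \<Rightarrow> bool) \<Rightarrow> bool" where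
  "generic_extension E G F \<longleftrightarrow>
     extensional F \<and>
     (\<exists>val. surj val \<and> (\<forall>\<tau>. elts F (val \<tau>) = {val \<sigma> |\<sigma>. \<exists>p\<in>G. (\<sigma>, p) \<in> rel E \<tau>}))"


section \<open>Proper posets\<close>

text \<open>
  \<open>is_H E l H\<close>: \<open>H\<close> is the set of all sets whose transitive closure has size less than the
  cardinal \<open>l\<close>.
\<close>

definition is_H :: "('a \<Rightarrow> 'a \<Rightarrow> bool) \<Rightarrow> 'a \<Rightarrow> 'a \<Rightarrow> bool" where
  "is_H E l H \<longleftrightarrow>
     elts E H = {x. \<exists>t. trans_set E t \<and> elts E x \<subseteq> elts E t \<and> card_less E t l}"

text \<open>
  In a well-founded model the internal satisfaction relation agrees with \<^const>\<open>sat\<close>.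
\<close>

definition elem_submodel :: "('a \<Rightarrow> 'a \<Rightarrow> bool) \<Rightarrow> 'a \<Rightarrow> 'a \<Rightarrow> bool" where
  "elem_submodel E K H \<longleftrightarrow>
     elts E K \<subseteq> elts E H \<and>
     (\<forall>\<phi> s. (\<forall>i. s i \<in> elts E K) \<longrightarrow> sat E (elts E K) s \<phi> = sat E (elts E H) s \<phi>)"

text \<open>
  \<open>q\<close> is \<open>(K, P)\<close>-generic: for every dense set \<open>D \<in> K\<close>, the set \<open>D \<inter> K\<close> is predense below \<open>q\<close>,
  that is, \<open>q\<close> forces the generic filter to meet \<open>D \<inter> K\<close>.
\<close>

definition generic_condition ::
    "('a \<Rightarrow> 'a \<Rightarrow> bool) \<Rightarrow> 'a \<Rightarrow> 'a \<Rightarrow> 'a \<Rightarrow> 'a \<Rightarrow> bool" where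
  "generic_condition E K P le q \<longleftrightarrow>
     (\<forall>D\<in>elts E K. dense_in E P le D \<longrightarrow>
        (\<forall>r\<in>elts E P. (r, q) \<in> rel E le \<longrightarrow>
           (\<exists>d\<in>elts E D \<inter> elts E K. compatible E P le r d)))"

text \<open>
  Shelah's properness: for every cardinal \<open>l\<close> above the size of the power set of \<open>P\<close> and every
  countable elementary submodel \<open>K\<close> of \<open>H\<^sub>l\<close> containing the poset, every condition in \<open>K\<close> extends
  to a \<open>(K, P)\<close>-generic one.
\<close>

definition proper_poset :: "('a \<Rightarrow> 'a \<Rightarrow> bool) \<Rightarrow> 'a \<Rightarrow> 'a \<Rightarrow> bool" where
  "proper_poset E P le \<longleftrightarrow>
     preorder_on (elts E P) (rel E le) \<and>
     (\<forall>l pw H K. cardinal E l \<and> elts E pw = {x. elts E x \<subseteq> elts E P} \<and> card_less E pw l \<and>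
          is_H E l H \<and> elem_submodel E K H \<and> countable_in E K \<and>
          P \<in> elts E K \<and> le \<in> elts E K \<longrightarrow>
        (\<forall>p\<in>elts E P \<inter> elts E K.
           \<exists>q\<in>elts E P. (q, p) \<in> rel E le \<and> generic_condition E K P le q))"


section \<open>Arithmetically closed families of reals\<close>

datatype arith_tm = AVar nat | AZero | ASuc arith_tm | AAdd arith_tm arith_tm
  | AMul arith_tm arith_tm

text \<open>
  Formulas of first-order arithmetic with set parameters: \<open>AIn t i\<close> says that \<open>t\<close> belongs to the
  \<open>i\<close>-th parameter.
\<close>

datatype arith_fm = AEq arith_tm arith_tm | AIn arith_tm nat | ANeg arith_fm
  | AConj arith_fm arith_fm | AEx arith_fm

primrec arith_val :: "(nat \<Rightarrow> nat) \<Rightarrow> arith_tm \<Rightarrow> nat" where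
  "arith_val e (AVar i) = e i"
| "arith_val e AZero = 0"
| "arith_val e (ASuc t) = Suc (arith_val e t)"
| "arith_val e (AAdd t u) = arith_val e t + arith_val e u"
| "arith_val e (AMul t u) = arith_val e t * arith_val e u"

primrec arith_sat :: "(nat \<Rightarrow> nat set) \<Rightarrow> (nat \<Rightarrow> nat) \<Rightarrow> arith_fm \<Rightarrow> bool" where
  "arith_sat S e (AEq t u) \<longleftrightarrow> arith_val e t = arith_val e u"
| "arith_sat S e (AIn t i) \<longleftrightarrow> arith_val e t \<in> S i"
| "arith_sat S e (ANeg \<phi>) \<longleftrightarrow> \<not> arith_sat S e \<phi>"
| "arith_sat S e (AConj \<phi> \<psi>) \<longleftrightarrow> arith_sat S e \<phi> \<and> arith_sat S e \<psi>"
| "arith_sat S e (AEx \<phi>) \<longleftrightarrow> (\<exists>n. arith_sat S (case_nat n e) \<phi>)"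

text \<open>
  \<open>B\<close> is arithmetically definable from (finitely many) members of \<open>X\<close>; the number parameters
  \<open>e\<close> do no harm, since every natural number is definable.
\<close>

definition arith_definable_from :: "nat set set \<Rightarrow> nat set \<Rightarrow> bool" where
  "arith_definable_from X B \<longleftrightarrow>
     (\<exists>\<phi> S e. range S \<subseteq> X \<and> B = {n. arith_sat S (case_nat n e) \<phi>})"

definition nat_set_of :: "('a \<Rightarrow> 'a \<Rightarrow> bool) \<Rightarrow> 'a \<Rightarrow> nat set" where
  "nat_set_of E A = {n. \<exists>x\<in>elts E A. numeral_of E n x}"

definition is_real :: "('a \<Rightarrow> 'a \<Rightarrow> bool) \<Rightarrow> 'a \<Rightarrow> bool" where
  "is_real E A \<longleftrightarrow> elts E A \<subseteq> {x. \<exists>n. numeral_of E n x}"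

definition family_of_reals :: "('a \<Rightarrow> 'a \<Rightarrow> bool) \<Rightarrow> 'a \<Rightarrow> bool" where
  "family_of_reals E X \<longleftrightarrow> (\<forall>A\<in>elts E X. is_real E A)"

definition arith_closed :: "('a \<Rightarrow> 'a \<Rightarrow> bool) \<Rightarrow> 'a \<Rightarrow> bool" where
  "arith_closed E X \<longleftrightarrow>
     (\<forall>B. is_real E B \<and> arith_definable_from (nat_set_of E ` elts E X) (nat_set_of E B) \<longrightarrow>
        B \<in> elts E X)"


section \<open>Proper and piecewise proper families\<close>

text \<open>
  \<open>(Q, le)\<close> is \<open>X/Fin\<close>: the infinite members of \<open>X\<close>, preordered by almost inclusion. Finiteness of
  sets is absolute for well-founded models.
\<close>

definition is_mod_fin :: "('a \<Rightarrow> 'a \<Rightarrow> bool) \<Rightarrow> 'a \<Rightarrow> 'a \<Rightarrow> 'a \<Rightarrow> bool" where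
  "is_mod_fin E X Q le \<longleftrightarrow>
     elts E Q = {A \<in> elts E X. infinite (elts E A)} \<and>
     rel E le = {(A, B). A \<in> elts E Q \<and> B \<in> elts E Q \<and> finite (elts E A - elts E B)}"

definition proper_family :: "('a \<Rightarrow> 'a \<Rightarrow> bool) \<Rightarrow> 'a \<Rightarrow> bool" where
  "proper_family E X \<longleftrightarrow>
     family_of_reals E X \<and> arith_closed E X \<and>
     (\<exists>Q le. is_mod_fin E X Q le \<and> proper_poset E Q le)"

definition piecewise_proper_family :: "('a \<Rightarrow> 'a \<Rightarrow> bool) \<Rightarrow> 'a \<Rightarrow> bool" where
  "piecewise_proper_family E X \<longleftrightarrow>
     (\<exists>C. (\<forall>Y\<in>elts E C. proper_family E Y \<and> card_le_omega_n E Y 1) \<and>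
          (\<forall>Y\<in>elts E C. \<forall>Z\<in>elts E C. elts E Y \<subseteq> elts E Z \<or> elts E Z \<subseteq> elts E Y) \<and>
          elts E X = (\<Union>Y\<in>elts E C. elts E Y))"

end

theory Submission
  imports Defs
begin

text \<open>
  The poset adds \<open>\<omega>\<^sub>2\<close> Cohen reals \<open>c \<xi>\<close>. They form a Luzin set: an open dense set of reals, coded in the
  extension, contains all but countably many of them. The rest of the argument takes place in the
  extension and uses only ZFC and this property.

  By recursion on pairs \<open>(\<xi>, \<delta>)\<close> with \<open>\<xi> < \<omega>\<^sub>2\<close> and \<open>\<delta> < \<omega>\<^sub>1\<close>, let \<open>T \<xi> \<delta>\<close> consist of \<open>c \<xi>\<close> and of
  countable closures of the earlier families \<open>T \<eta> \<delta>'\<close>, where \<open>\<delta>' < \<delta>\<close> and either \<open>\<eta> = \<xi>\<close> or the index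
  of \<open>\<eta> < \<xi>\<close> in an injection of \<open>\<xi>\<close> into \<open>\<omega>\<^sub>1\<close> is below \<open>\<delta>\<close>. Then \<open>X \<xi> = (\<Union>\<delta>. T \<xi> \<delta>)\<close> is an increasing
  chain of arithmetically closed families of size at most \<open>\<omega>\<^sub>1\<close>, each with a continuous filtration by
  countable sets. Its union contains every \<open>c \<xi>\<close>, so it has size \<open>\<omega>\<^sub>2\<close>, since no real is equal to
  uncountably many \<open>c \<xi>\<close>.

  For \<open>\<omega>\<^sub>1 \<subseteq> \<xi>\<close> the family \<open>X \<xi>\<close> is proper. A countable elementary submodel meets \<open>X \<xi>/Fin\<close> in one of the
  countable sets \<open>T \<xi> \<delta>\<close>. A code of this set and a real \<open>c \<eta>\<close> with \<open>\<eta> < \<omega>\<^sub>1\<close>, generic for the countably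
  many relevant dense sets, together define arithmetically a decreasing sequence in \<open>T \<xi> \<delta>\<close> that meets
  them all, and a pseudo-intersection of this sequence is a generic condition in \<open>X \<xi>\<close>.
\<close>

section \<open>First-order definable predicates\<close>

text \<open>The model may be uncountable, so a condition need not belong to any generic filter, and
  forcing cannot be defined by quantifying over extensions. Forcing relations are defined inside the
  ground model, by recursion on names and formulas, and compared with truth for the one given
  filter. Separation and replacement speak about formulas; hence each construction inside a model is
  accompanied by a proof that it is first-order definable, and external recursions and HOL functions
  are rewritten as statements about sets of the model. The c.c.c. is used twice: it preserves
  \<omega>_1 and \<omega>_2, and it reduces an open dense set to countably many coordinates, outside
  of which the Cohen reals remain free. The coordinate \<delta> reconciles two demands. An
  increasing chain must absorb whole families of size \<omega>_1, but each family must be built from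
  countable pieces, continuously. The injection of \<xi> into \<omega>_1 admits only countably many
  \<eta> before each \<delta>. The restriction \<open>\<omega>\<^sub>1 \<subseteq> \<xi>\<close>
  puts uncountably many Cohen reals into \<open>X \<xi>\<close>, so that one of them always avoids a
  countable exceptional set.\<close>

primrec ren :: "(nat \<Rightarrow> nat) \<Rightarrow> fm \<Rightarrow> fm" where
  "ren r (Mem i j) = Mem (r i) (r j)"
| "ren r (Equal i j) = Equal (r i) (r j)"
| "ren r (Neg p) = Neg (ren r p)"
| "ren r (Conj p q) = Conj (ren r p) (ren r q)"
| "ren r (Exists p) = Exists (ren (case_nat 0 (\<lambda>n. Suc (r n))) p)"

lemma sat_ren: "sat E A s (ren r p) = sat E A (\<lambda>n. s (r n)) p"
proof (induction p arbitrary: r s)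
  case (Exists p)
  have "(\<lambda>n. case_nat x s (case_nat 0 (\<lambda>n. Suc (r n)) n)) = case_nat x (\<lambda>n. s (r n))" for x
    by (rule ext) (simp split: nat.split)
  then show ?case using Exists by simp
qed auto

definition mix :: "(nat \<Rightarrow> 'a) \<Rightarrow> (nat \<Rightarrow> 'a) \<Rightarrow> nat \<Rightarrow> 'a" where
  "mix s t = (\<lambda>n. if even n then s (n div 2) else t (n div 2))"

lemma range_mix: "range s \<subseteq> C \<Longrightarrow> range t \<subseteq> C \<Longrightarrow> range (mix s t) \<subseteq> C"
  by (auto simp: mix_def)

text \<open>
  The variables of a formula are split into the free variables \<open>s\<close> (even indices) and the
  parameters \<open>t\<close> (odd indices), so that two parameter assignments can be merged.
\<close>

definition dfn ::
    "('a \<Rightarrow> 'a \<Rightarrow> bool) \<Rightarrow> 'a set \<Rightarrow> 'a set \<Rightarrow> ((nat \<Rightarrow> 'a) \<Rightarrow> bool) \<Rightarrow> bool" where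
  "dfn E A C R \<longleftrightarrow> (\<exists>p t. range t \<subseteq> C \<and> (\<forall>s. R s \<longleftrightarrow> sat E A (mix s t) p))"

lemma dfnI: "range t \<subseteq> C \<Longrightarrow> (\<And>s. R s \<longleftrightarrow> sat E A (mix s t) p) \<Longrightarrow> dfn E A C R"
  unfolding dfn_def by blast

lemma dfn_ren: assumes "dfn E A C R" shows "dfn E A C (\<lambda>s. R (\<lambda>i. s (r i)))"
proof -
  obtain p t where t: "range t \<subseteq> C" and p: "\<And>s. R s \<longleftrightarrow> sat E A (mix s t) p"
    using assms unfolding dfn_def by blast
  have "(\<lambda>n. mix s t (if even n then 2 * r (n div 2) else n)) = mix (\<lambda>i. s (r i)) t" for s
    by (rule ext) (auto simp: mix_def)
  then have "R (\<lambda>i. s (r i)) \<longleftrightarrow>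
      sat E A (mix s t) (ren (\<lambda>n. if even n then 2 * r (n div 2) else n) p)" for s
    by (simp add: sat_ren p)
  then show ?thesis by (rule dfnI[OF t])
qed

lemma dfn_neg: assumes "dfn E A C R" shows "dfn E A C (\<lambda>s. \<not> R s)"
proof -
  obtain p t where t: "range t \<subseteq> C" and p: "\<And>s. R s \<longleftrightarrow> sat E A (mix s t) p"
    using assms unfolding dfn_def by blast
  show ?thesis by (rule dfnI[OF t, where p="Neg p"]) (simp add: p)
qed

lemma dfn_conj: assumes "dfn E A C R" "dfn E A C Q" shows "dfn E A C (\<lambda>s. R s \<and> Q s)"
proof -
  obtain p t q u where t: "range t \<subseteq> C" and p: "\<And>s. R s \<longleftrightarrow> sat E A (mix s t) p"
    using assms(1) unfolding dfn_def by blast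
  obtain q u where u: "range u \<subseteq> C" and q: "\<And>s. Q s \<longleftrightarrow> sat E A (mix s u) q"
    using assms(2) unfolding dfn_def by blast
  \<comment> \<open>In \<open>mix t u\<close> the parameters of the first formula sit at even
    positions and those of the second at odd ones; \<open>?r1\<close> and \<open>?r2\<close>
    redirect the odd variables accordingly.\<close>
  let ?r1 = "\<lambda>n. if even n then n else 2 * (2 * (n div 2)) + 1"
  let ?r2 = "\<lambda>n. if even n then n else 2 * (2 * (n div 2) + 1) + 1"
  have "(\<lambda>n. mix s (mix t u) (?r1 n)) = mix s t" "(\<lambda>n. mix s (mix t u) (?r2 n)) = mix s u" for s
    by (rule ext, auto simp: mix_def elim!: oddE)+
  then show ?thesis
    by (intro dfnI[OF range_mix[OF t u], where p="Conj (ren ?r1 p) (ren ?r2 q)"])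
       (simp only: p q sat.simps sat_ren)
qed

lemma dfn_ex:
  assumes "dfn E A C (\<lambda>s. R (s 0) (\<lambda>i. s (Suc i)))"
  shows "dfn E A C (\<lambda>s. \<exists>x\<in>A. R x s)"
proof -
  obtain p t where t: "range t \<subseteq> C"
    and p: "\<forall>s. R (s 0) (\<lambda>i. s (Suc i)) \<longleftrightarrow> sat E A (mix s t) p"
    using assms unfolding dfn_def by (elim exE conjE)
  \<comment> \<open>Under the quantifier all variables move up by one, while the free variables
    themselves shift by two positions in the interleaving: hence \<open>n - 1\<close> for the free
    variables and \<open>Suc n\<close> for the parameters.\<close>
  let ?r = "\<lambda>n. if n = 0 then 0 else if even n then n - 1 else Suc n"
  have "(\<lambda>n. case_nat x (mix s t) (?r n)) = mix (case_nat x s) t" for x s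
  proof
    fix n show "case_nat x (mix s t) (?r n) = mix (case_nat x s) t n"
    proof (cases "even n")
      case True
      then obtain k where "n = 2 * k" by (rule evenE)
      then show ?thesis by (cases k) (auto simp: mix_def)
    qed (auto simp: mix_def)
  qed
  moreover have "R x s \<longleftrightarrow> sat E A (mix (case_nat x s) t) p" for x s
    using p[rule_format, of "case_nat x s"] by simp
  ultimately show ?thesis
    by (intro dfnI[OF t, where p="Exists (ren ?r p)"]) (simp add: sat_ren)
qed

text \<open>Over a set \<open>A\<close> only variables and parameters serve as terms: a defined
  operation such as pairing would have to be spelled out with quantifiers over
  \<open>A\<close>.\<close>

definition tmv :: "'a set \<Rightarrow> ((nat \<Rightarrow> 'a) \<Rightarrow> 'a) \<Rightarrow> bool" where
  "tmv C f \<longleftrightarrow> (\<exists>i. f = (\<lambda>s. s i)) \<or> (\<exists>c\<in>C. f = (\<lambda>s. c))"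

lemma tmv_var: "tmv C (\<lambda>s. s i)" and tmv_const: "c \<in> C \<Longrightarrow> tmv C (\<lambda>s. c)"
  by (auto simp: tmv_def)

lemma dfn_atoms:
  assumes "tmv C f" "tmv C g" "C \<noteq> {}"
  shows "dfn E A C (\<lambda>s. E (f s) (g s))" "dfn E A C (\<lambda>s. f s = g s)"
proof -
  have *: "\<exists>i t. range t \<subseteq> C \<and> (\<forall>s u. f s = mix s (mix t u) i)" if "tmv C f" for f
  proof -
    obtain d where d: "d \<in> C" using assms(3) by blast
    from that show ?thesis unfolding tmv_def
    proof (elim disjE exE bexE)
      fix i assume "f = (\<lambda>s. s i)"
      then show ?thesis using d
        by (intro exI[of _ "2*i"] exI[of _ "\<lambda>_. d"]) (auto simp: mix_def)
    next
      fix c assume "c \<in> C" "f = (\<lambda>s. c)"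
      then show ?thesis by (intro exI[of _ 1] exI[of _ "\<lambda>_. c"]) (auto simp: mix_def)
    qed
  qed
  obtain i t where t: "range t \<subseteq> C" "\<And>s u. f s = mix s (mix t u) i" using *[OF assms(1)] by blast
  obtain j u where u: "range u \<subseteq> C" "\<And>s v. g s = mix s (mix u v) j" using *[OF assms(2)] by blast
  let ?r = "\<lambda>n. if even n then n else 2 * (2 * (n div 2) + 1) + 1"
  have "mix s (mix u v) j = mix s (mix t (mix u v)) (?r j)" for s v
    by (auto simp: mix_def)
  then have g: "g s = mix s (mix t (mix u u)) (?r j)" for s using u by metis
  have r: "range (mix t (mix u u)) \<subseteq> C" using t(1) u(1) by (intro range_mix)
  show "dfn E A C (\<lambda>s. E (f s) (g s))"
    by (rule dfnI[OF r, where p="Mem i (?r j)"]) (simp only: sat.simps t(2)[of _ "mix u u"] g)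
  show "dfn E A C (\<lambda>s. f s = g s)"
    by (rule dfnI[OF r, where p="Equal i (?r j)"]) (simp only: sat.simps t(2)[of _ "mix u u"] g)
qed

lemma dfn_disj:
  assumes "dfn E A C R" "dfn E A C Q" shows "dfn E A C (\<lambda>s. R s \<or> Q s)"
proof -
  have "dfn E A C (\<lambda>s. \<not> (\<not> R s \<and> \<not> Q s))" by (intro dfn_neg dfn_conj assms)
  then show ?thesis by simp
qed

lemma dfn_imp:
  assumes "dfn E A C R" "dfn E A C Q" shows "dfn E A C (\<lambda>s. R s \<longrightarrow> Q s)"
  unfolding imp_conv_disj by (intro dfn_disj dfn_neg assms)

lemma dfn_iff:
  assumes "dfn E A C R" "dfn E A C Q" shows "dfn E A C (\<lambda>s. R s \<longleftrightarrow> Q s)"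
  unfolding iff_conv_conj_imp by (intro dfn_conj dfn_imp assms)

lemma dfn_all:
  assumes "dfn E A C (\<lambda>s. R (s 0) (\<lambda>i. s (Suc i)))" shows "dfn E A C (\<lambda>s. \<forall>x\<in>A. R x s)"
proof -
  have "dfn E A C (\<lambda>s. \<not> (\<exists>x\<in>A. \<not> R x s))" by (rule dfn_neg, rule dfn_ex, rule dfn_neg, rule assms)
  then show ?thesis by simp
qed

section \<open>Definability over a whole model, with arbitrary parameters\<close>

definition df :: "('a \<Rightarrow> 'a \<Rightarrow> bool) \<Rightarrow> ((nat \<Rightarrow> 'a) \<Rightarrow> bool) \<Rightarrow> bool" where
  "df E = dfn E UNIV UNIV"

text \<open>Defined operations are handled through their graphs, so that no syntax of terms has to
  be introduced.\<close>

definition dt :: "('a \<Rightarrow> 'a \<Rightarrow> bool) \<Rightarrow> ((nat \<Rightarrow> 'a) \<Rightarrow> 'a) \<Rightarrow> bool" where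
  "dt E f \<longleftrightarrow> df E (\<lambda>s. s 0 = f (\<lambda>i. s (Suc i)))"

named_theorems dfi

lemma df_neg [dfi]: "df E R \<Longrightarrow> df E (\<lambda>s. \<not> R s)"
  and df_conj [dfi]: "df E R \<Longrightarrow> df E Q \<Longrightarrow> df E (\<lambda>s. R s \<and> Q s)"
  and df_disj [dfi]: "df E R \<Longrightarrow> df E Q \<Longrightarrow> df E (\<lambda>s. R s \<or> Q s)"
  and df_imp [dfi]: "df E R \<Longrightarrow> df E Q \<Longrightarrow> df E (\<lambda>s. R s \<longrightarrow> Q s)"
  and df_iff [dfi]: "df E R \<Longrightarrow> df E Q \<Longrightarrow> df E (\<lambda>s. R s \<longleftrightarrow> Q s)"
  unfolding df_def by (fact dfn_neg dfn_conj dfn_disj dfn_imp dfn_iff)+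

text \<open>The bound variable is read at position 0 and all others are shifted by one. With this
  convention the rules in \<open>dfi\<close> work by backward resolution, and
  \<open>intro dfi\<close> follows the shape of the statement.\<close>

lemma df_ex [dfi]: "df E (\<lambda>s. R (s 0) (\<lambda>i. s (Suc i))) \<Longrightarrow> df E (\<lambda>s. \<exists>x. R x s)"
  and df_all [dfi]: "df E (\<lambda>s. R (s 0) (\<lambda>i. s (Suc i))) \<Longrightarrow> df E (\<lambda>s. \<forall>x. R x s)"
  unfolding df_def using dfn_ex[of E UNIV UNIV R] dfn_all[of E UNIV UNIV R] by simp_all

lemma df_ren: "df E R \<Longrightarrow> df E (\<lambda>s. R (\<lambda>i. s (r i)))"
  unfolding df_def by (rule dfn_ren)

lemma dt_ren: assumes "dt E f" shows "dt E (\<lambda>s. f (\<lambda>i. s (r i)))"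
  using df_ren[OF assms[unfolded dt_def], of "case_nat 0 (\<lambda>i. Suc (r i))"]
  unfolding dt_def by simp

lemma df_mem0: "df E (\<lambda>s. E (s i) (s j))" and df_eq0: "df E (\<lambda>s. s i = s j)"
  and df_eqc: "df E (\<lambda>s. s i = c)"
  unfolding df_def by (auto intro!: dfn_atoms tmv_var tmv_const)

lemma dt_var [dfi]: "dt E (\<lambda>s. s i)" and dt_const [dfi]: "dt E (\<lambda>s. c)"
  unfolding dt_def by (rule df_eq0, rule df_eqc)

text \<open>A definable term is substituted by quantifying over its value. The rules
  \<open>df_comp1\<close> to \<open>df_comp4\<close> and \<open>dt_comp1\<close> to
  \<open>dt_comp3\<close> derived from it carry a definability proof for variables over to arbitrary
  terms.\<close>

lemma df_subst:
  assumes "dt E f" "df E (\<lambda>s. R (s 0) (\<lambda>i. s (Suc i)))" shows "df E (\<lambda>s. R (f s) s)"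
proof -
  have "df E (\<lambda>s. \<exists>x. x = f s \<and> R x s)"
    by (intro df_ex df_conj assms(2)) (use assms(1) in \<open>simp add: dt_def\<close>)
  then show ?thesis by simp
qed

lemma df_comp1: "df E (\<lambda>s. R (s 0)) \<Longrightarrow> dt E f \<Longrightarrow> df E (\<lambda>s. R (f s))"
  by (rule df_subst)

lemma df_comp2:
  assumes "df E (\<lambda>s. R (s 0) (s 1))" "dt E f" "dt E g" shows "df E (\<lambda>s. R (f s) (g s))"
  by (rule df_subst[OF assms(2)], rule df_subst[OF dt_ren[OF assms(3)]])
     (use df_ren[OF assms(1), of "case_nat 1 (\<lambda>_. 0)"] in simp)

lemma df_comp3:
  assumes "df E (\<lambda>s. R (s 0) (s 1) (s 2))" "dt E f" "dt E g" "dt E h"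
  shows "df E (\<lambda>s. R (f s) (g s) (h s))"
  by (rule df_subst[OF assms(2)], rule df_subst[OF dt_ren[OF assms(3)]],
      rule df_subst[OF dt_ren[OF dt_ren[OF assms(4)]]])
     (use df_ren[OF assms(1), of "case_nat 2 (case_nat 1 (\<lambda>_. 0))"] in \<open>simp add: numeral_2_eq_2\<close>)

lemma df_comp4:
  assumes "df E (\<lambda>s. R (s 0) (s 1) (s 2) (s 3))" "dt E f" "dt E g" "dt E h" "dt E k"
  shows "df E (\<lambda>s. R (f s) (g s) (h s) (k s))"
  by (rule df_subst[OF assms(2)], rule df_subst[OF dt_ren[OF assms(3)]],
      rule df_subst[OF dt_ren[OF dt_ren[OF assms(4)]]],
      rule df_subst[OF dt_ren[OF dt_ren[OF dt_ren[OF assms(5)]]]])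
     (use df_ren[OF assms(1), of "case_nat 3 (case_nat 2 (case_nat 1 (\<lambda>_. 0)))"]
      in \<open>simp add: numeral_2_eq_2 numeral_3_eq_3\<close>)

lemma dt_comp1:
  assumes "dt E (\<lambda>s. h (s 0))" "dt E f" shows "dt E (\<lambda>s. h (f s))"
  unfolding dt_def
  by (rule df_comp2[of E "\<lambda>x y. x = h y"], use assms(1) in \<open>simp add: dt_def\<close>, rule dt_var,
      rule dt_ren[OF assms(2)])

lemma dt_comp2:
  assumes "dt E (\<lambda>s. h (s 0) (s 1))" "dt E f" "dt E g" shows "dt E (\<lambda>s. h (f s) (g s))"
  unfolding dt_def
  by (rule df_comp3[of E "\<lambda>x y z. x = h y z"], use assms(1) in \<open>simp add: dt_def numeral_2_eq_2\<close>,
      rule dt_var, rule dt_ren[OF assms(2)], rule dt_ren[OF assms(3)])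

lemma dt_comp3:
  assumes "dt E (\<lambda>s. h (s 0) (s 1) (s 2))" "dt E f" "dt E g" "dt E k"
  shows "dt E (\<lambda>s. h (f s) (g s) (k s))"
  unfolding dt_def
  by (rule df_comp4[of E "\<lambda>x y z w. x = h y z w"],
      use assms(1) in \<open>simp add: dt_def numeral_2_eq_2 numeral_3_eq_3\<close>, rule dt_var,
      rule dt_ren[OF assms(2)], rule dt_ren[OF assms(3)], rule dt_ren[OF assms(4)])

lemma df_mem [dfi]: "dt E f \<Longrightarrow> dt E g \<Longrightarrow> df E (\<lambda>s. E (f s) (g s))"
  by (rule df_comp2[of E E]) (rule df_mem0)

lemma df_eq [dfi]: "dt E f \<Longrightarrow> dt E g \<Longrightarrow> df E (\<lambda>s. f s = g s)"
  by (rule df_comp2[of E "(=)"]) (rule df_eq0)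

lemma df_const [dfi]: "df E (\<lambda>s. b)"
proof (cases b)
  case True
  have "df E (\<lambda>s. s 0 = s 0)" by (rule df_eq0)
  then show ?thesis using True by simp
next
  case False
  have "df E (\<lambda>s. s 0 \<noteq> s 0)" by (intro df_neg df_eq0)
  then show ?thesis using False by simp
qed

lemma df_elts [dfi]: "dt E f \<Longrightarrow> dt E g \<Longrightarrow> df E (\<lambda>s. f s \<in> elts E (g s))"
  unfolding elts_def mem_Collect_eq by (rule df_mem)

lemma df_bex [dfi]:
  assumes "dt E f" "df E (\<lambda>s. R (s 0) (\<lambda>i. s (Suc i)))"
  shows "df E (\<lambda>s. \<exists>x\<in>elts E (f s). R x s)"
  unfolding Bex_def
  by (rule df_ex, rule df_conj, rule df_elts, rule dt_var, rule dt_ren[OF assms(1)], rule assms(2))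

lemma df_ball [dfi]:
  assumes "dt E f" "df E (\<lambda>s. R (s 0) (\<lambda>i. s (Suc i)))"
  shows "df E (\<lambda>s. \<forall>x\<in>elts E (f s). R x s)"
  unfolding Ball_def
  by (rule df_all, rule df_imp, rule df_elts, rule dt_var, rule dt_ren[OF assms(1)], rule assms(2))

lemma df_subset [dfi]: "dt E f \<Longrightarrow> dt E g \<Longrightarrow> df E (\<lambda>s. elts E (f s) \<subseteq> elts E (g s))"
  unfolding subset_eq by (rule df_ball, assumption, rule df_elts, rule dt_var, rule dt_ren)

lemma dt_if [dfi]:
  assumes "df E R" "dt E f" "dt E g" shows "dt E (\<lambda>s. if R s then f s else g s)"
proof -
  have "df E (\<lambda>s. (R (\<lambda>i. s (Suc i)) \<and> s 0 = f (\<lambda>i. s (Suc i))) \<or>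
     (\<not> R (\<lambda>i. s (Suc i)) \<and> s 0 = g (\<lambda>i. s (Suc i))))"
    by (intro df_disj df_conj df_neg df_ren[OF assms(1)] assms(2,3)[unfolded dt_def])
  then show ?thesis unfolding dt_def by (rule back_subst[of "df E"]) auto
qed

text \<open>The map \<open>m\<close> renames a variable (\<open>Inl\<close>) or freezes it to a
  fixed set (\<open>Inr\<close>), which becomes a parameter. This allows comprehension under an
  assignment that is held fixed.\<close>

lemma dfn_inst:
  assumes "dfn E A UNIV R"
  shows "dfn E A UNIV (\<lambda>s. R (\<lambda>i. case m i of Inl j \<Rightarrow> s j | Inr c \<Rightarrow> c))"
proof -
  obtain p t where p: "\<And>s. R s \<longleftrightarrow> sat E A (mix s t) p"
    using assms unfolding dfn_def by blast
  define t' where "t' = mix t (\<lambda>i. case m i of Inl j \<Rightarrow> t i | Inr c \<Rightarrow> c)"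
  let ?r = "\<lambda>n. if even n then (case m (n div 2) of Inl j \<Rightarrow> 2 * j | Inr _ \<Rightarrow> 2 * (2 * (n div 2) + 1) + 1)
    else 2 * (2 * (n div 2)) + 1"
  have "(\<lambda>n. mix s t' (?r n)) = mix (\<lambda>i. case m i of Inl j \<Rightarrow> s j | Inr c \<Rightarrow> c) t" for s
    by (rule ext) (auto simp: mix_def t'_def split: sum.split elim!: evenE oddE)
  then have "R (\<lambda>i. case m i of Inl j \<Rightarrow> s j | Inr c \<Rightarrow> c) \<longleftrightarrow> sat E A (mix s t') (ren ?r p)" for s
    by (simp only: p sat_ren)
  then show ?thesis by (rule dfnI[OF subset_UNIV])
qed

lemma df_inst1: "df E (\<lambda>s. R (s 0) (\<lambda>i. s (Suc i))) \<Longrightarrow> df E (\<lambda>s. R (s 0) e)"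
  using dfn_inst[of E UNIV _ "case_nat (Inl 0) (\<lambda>i. Inr (e i))"] unfolding df_def by fastforce

lemma dt_inst1:
  assumes "dt E (\<lambda>s. f (s 0) (\<lambda>i. s (Suc i)))" shows "dt E (\<lambda>s. f (s 0) e)"
proof -
  have "df E (\<lambda>s. s 0 = f (s (Suc 0)) e)"
    using dfn_inst[OF assms[unfolded dt_def df_def], of "case_nat (Inl 0) (case_nat (Inl 1) (\<lambda>i. Inr (e i)))"]
    unfolding df_def by simp
  then show ?thesis unfolding dt_def .
qed

lemma zfc_sep:
  assumes "zfc E" "df E (\<lambda>s. R (s 0))" shows "\<exists>b. elts E b = {x \<in> elts E a. R x}"
proof -
  obtain p t where p: "\<forall>s. R (s 0) \<longleftrightarrow> sat E UNIV (mix s t) p"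
    using assms(2) unfolding df_def dfn_def by (elim exE conjE)
  have "\<exists>b. elts E b = {x \<in> elts E a. sat E UNIV (case_nat x t) (ren (\<lambda>n. if even n then 0 else Suc (n div 2)) p)}"
    using assms(1) unfolding zfc_def by blast
  moreover have "(\<lambda>n. case_nat x t (if even n then 0 else Suc (n div 2))) = mix (\<lambda>_. x) t" for x
    by (rule ext) (auto simp: mix_def)
  ultimately show ?thesis using p[rule_format, of "\<lambda>_. _"] by (simp add: sat_ren)
qed

lemma zfc_repl:
  assumes "zfc E" "df E (\<lambda>s. R (s 0) (s 1))" "\<And>x. x \<in> elts E a \<Longrightarrow> \<exists>!y. R x y"
  shows "\<exists>b. elts E b = {y. \<exists>x\<in>elts E a. R x y}"
proof -
  obtain p t where p: "\<forall>s. R (s 0) (s 1) \<longleftrightarrow> sat E UNIV (mix s t) p"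
    using assms(2) unfolding df_def dfn_def by (elim exE conjE)
  \<comment> \<open>Variable 0 is the argument and 1 the value; all other free variables are read as
    the value too, which does no harm as \<open>R\<close> looks at two of them only.\<close>
  let ?r = "\<lambda>n::nat. if n = 0 then 0 else if even n then 1 else Suc (Suc (n div 2))"
  let ?p = "ren ?r p"
  have "(\<lambda>n. case_nat x (case_nat y t) (?r n)) = mix (case_nat x (\<lambda>_. y)) t" for x y
    by (rule ext) (auto simp: mix_def split: nat.split)
  then have R: "sat E UNIV (case_nat x (case_nat y t)) ?p \<longleftrightarrow> R x y" for x y
    using p[rule_format, of "case_nat x (\<lambda>_. y)"] by (simp add: sat_ren)
  have "(\<forall>x\<in>elts E a. \<exists>!y. sat E UNIV (case_nat x (case_nat y t)) ?p) \<longrightarrow>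
        (\<exists>b. elts E b = {y. \<exists>x\<in>elts E a. sat E UNIV (case_nat x (case_nat y t)) ?p})"
    using assms(1) unfolding zfc_def by blast
  then show ?thesis using assms(3) unfolding R by blast
qed

section \<open>Set theory inside a well-founded model\<close>

locale zfm =
  fixes E :: "'a \<Rightarrow> 'a \<Rightarrow> bool"
  assumes zfc: "zfc E" and wf: "wfp E"
begin

abbreviation el :: "'a \<Rightarrow> 'a set" where "el \<equiv> elts E"

text \<open>
  The value \<open>mk A\<close> is junk unless \<open>A\<close> is represented by a set of the model.
\<close>

definition isset :: "'a set \<Rightarrow> bool" where "isset A \<longleftrightarrow> (\<exists>x. el x = A)"
definition mk :: "'a set \<Rightarrow> 'a" where "mk A = (THE x. el x = A)"

lemma el_iff: "x \<in> el y \<longleftrightarrow> E x y" by (simp add: elts_def)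

lemma ext: "el x = el y \<Longrightarrow> x = y"
  using zfc[unfolded zfc_def, THEN conjunct1] unfolding extensional_def by blast

lemma mk_el [simp]: "mk (el x) = x"
  unfolding mk_def by (rule the_equality) (auto intro: ext)

lemma el_mk [simp]: "isset A \<Longrightarrow> el (mk A) = A"
  unfolding isset_def by auto

lemma E_mk [simp]: "isset A \<Longrightarrow> E x (mk A) \<longleftrightarrow> x \<in> A"
  by (simp flip: el_iff)

lemma mk_eq: "isset A \<Longrightarrow> x = mk A \<longleftrightarrow> el x = A" by (metis el_mk mk_el)

lemma E_asym: "E x y \<Longrightarrow> \<not> E y x"
  using wf wfp_imp_asymp asympD by fast

lemma E_irrefl: "\<not> E x x" using E_asym by blast

lemma E_induct: "(\<And>x. (\<And>y. E y x \<Longrightarrow> P y) \<Longrightarrow> P x) \<Longrightarrow> P x"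
  by (rule wfp_induct_rule[OF wf]) blast

lemma E_min: assumes "P x" obtains m where "P m" "\<And>y. E y m \<Longrightarrow> \<not> P y"
proof (rule ccontr)
  assume "\<not> thesis"
  then have "\<not> P x" for x by (induction x rule: E_induct) (use that in blast)
  then show False using assms by blast
qed

lemma isset_el [simp]: "isset (el x)" by (auto simp: isset_def)

lemma isset_sep: assumes "isset A" "df E (\<lambda>s. R (s 0))" shows "isset {x \<in> A. R x}"
  using zfc_sep[OF zfc assms(2)] assms(1) unfolding isset_def by blast

lemma isset_repl:
  assumes "isset A" "df E (\<lambda>s. R (s 0) (s 1))" "\<And>x. x \<in> A \<Longrightarrow> \<exists>!y. R x y"
  shows "isset {y. \<exists>x\<in>A. R x y}"
proof -
  obtain a where a: "el a = A" using assms(1) by (auto simp: isset_def)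
  show ?thesis using zfc_repl[OF zfc assms(2), of a] assms(3) unfolding isset_def a by blast
qed

lemma isset_img: assumes "isset A" "dt E (\<lambda>s. f (s 0))" shows "isset (f ` A)"
proof -
  have "df E (\<lambda>s. s 1 = f (s 0))"
    by (rule df_eq[OF dt_var dt_comp1[OF assms(2) dt_var]])
  from isset_repl[OF assms(1) this] show ?thesis by (simp add: image_def Bex_def)
qed

lemma isset_empty [simp]: "isset {}"
  using isset_sep[OF isset_el df_const, of _ False] by simp

lemma isset_pair [simp]: "isset {a, b}"
  unfolding isset_def using zfc[unfolded zfc_def, THEN conjunct2, THEN conjunct2, THEN conjunct1] by blast

lemma isset_sing [simp]: "isset {a}" using isset_pair[of a a] by simp

lemma isset_Union [simp]: "isset A \<Longrightarrow> isset (\<Union>x\<in>A. el x)"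
  unfolding isset_def using zfc[unfolded zfc_def, THEN conjunct2, THEN conjunct2, THEN conjunct2, THEN conjunct1] by blast

lemma isset_Un [simp]: assumes "isset A" "isset B" shows "isset (A \<union> B)"
  using isset_Union[of "{mk A, mk B}"] assms by simp

lemma isset_insert [simp]: "isset A \<Longrightarrow> isset (insert a A)"
  using isset_Un[of "{a}" A] by simp

lemma isset_finite: "finite A \<Longrightarrow> isset A"
  by (induction rule: finite_induct) auto

lemma isset_Pow [simp]: "isset {x. el x \<subseteq> el a}"
  unfolding isset_def using zfc[unfolded zfc_def, THEN conjunct2, THEN conjunct2, THEN conjunct2, THEN conjunct2, THEN conjunct1] by blast

lemma dt_mk:
  assumes "\<And>s. isset {x. R x s}" "df E (\<lambda>s. R (s 0) (\<lambda>i. s (Suc i)))"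
  shows "dt E (\<lambda>s. mk {x. R x s})"
proof -
  have "df E (\<lambda>s. \<forall>x. E x (s 0) \<longleftrightarrow> R x (\<lambda>i. s (Suc i)))"
    by (intro df_all df_iff dfi)
       (use df_ren[OF assms(2), of "case_nat 0 (\<lambda>i. Suc (Suc i))"] in simp)
  then show ?thesis unfolding dt_def
    by (rule back_subst[of "df E"]) (auto simp: mk_eq assms(1) set_eq_iff el_iff)
qed

lemma dt_sep [dfi]:
  assumes "dt E a" "df E (\<lambda>s. R (s 0) (\<lambda>i. s (Suc i)))"
  shows "dt E (\<lambda>s. mk {x \<in> el (a s). R x s})"
  by (rule dt_mk, rule isset_sep[OF isset_el], rule df_inst1[OF assms(2)],
      rule df_conj, rule df_elts, rule dt_var, rule dt_ren[OF assms(1)], rule assms(2))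

lemma dt_img [dfi]:
  assumes "dt E a" "dt E (\<lambda>s. f (s 0) (\<lambda>i. s (Suc i)))"
  shows "dt E (\<lambda>s. mk ((\<lambda>x. f x s) ` el (a s)))"
proof -
  have "dt E (\<lambda>s. mk {y. \<exists>x\<in>el (a s). y = f x s})"
  proof (rule dt_mk)
    show "isset {y. \<exists>x\<in>el (a s). y = f x s}" for s
      using isset_img[OF isset_el dt_inst1[OF assms(2)]] by (simp add: image_def)
    show "df E (\<lambda>s. \<exists>x\<in>el (a (\<lambda>i. s (Suc i))). s 0 = f x (\<lambda>i. s (Suc i)))"
      by (rule df_bex, rule dt_ren[OF assms(1)], rule df_eq, rule dt_var)
         (use dt_ren[OF assms(2), of "case_nat 0 (\<lambda>i. Suc (Suc i))"] in simp)
  qed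
  then show ?thesis by (simp add: image_def)
qed

section \<open>Pairs, products and functions as terms of the model\<close>

definition "emp = mk {}"
definition "upair a b = mk {a, b}"
definition "pr a b = upair (upair a a) (upair a b)"
definition "suc x = mk (insert x (el x))"
definition "un x = mk (\<Union>y\<in>el x. el y)"
definition "bun x y = mk (el x \<union> el y)"
definition "pow x = mk {y. el y \<subseteq> el x}"

lemma el_emp [simp]: "el emp = {}" and el_upair [simp]: "el (upair a b) = {a, b}"
  and el_suc [simp]: "el (suc x) = insert x (el x)" and el_un [simp]: "el (un x) = (\<Union>y\<in>el x. el y)"
  and el_bun [simp]: "el (bun x y) = el x \<union> el y" and el_pow [simp]: "el (pow x) = {y. el y \<subseteq> el x}"
  by (simp_all add: emp_def upair_def suc_def un_def bun_def pow_def)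

lemma E_defs [simp]: "\<not> E x emp" "E x (upair a b) \<longleftrightarrow> x = a \<or> x = b" "E x (suc y) \<longleftrightarrow> x = y \<or> E x y"
   "E x (un y) \<longleftrightarrow> (\<exists>z\<in>el y. E x z)" "E x (bun y z) \<longleftrightarrow> E x y \<or> E x z" "E x (pow y) \<longleftrightarrow> el x \<subseteq> el y"
  by (simp_all flip: el_iff)

lemma el_empty_iff: "el x = {} \<longleftrightarrow> x = emp" by (metis el_emp ext)

lemma upair_eq: "upair a b = upair c d \<longleftrightarrow> {a, b} = {c, d}" by (metis el_upair ext)

lemma pr_eq [simp]: "pr a b = pr c d \<longleftrightarrow> a = c \<and> b = d"
  by (auto simp: pr_def upair_eq doubleton_eq_iff)

lemma kpair_iff [simp]: "kpair E a b c \<longleftrightarrow> c = pr a b"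
proof -
  have "elts E u = {a} \<longleftrightarrow> u = upair a a" "elts E v = {a, b} \<longleftrightarrow> v = upair a b"
     "elts E c = {u, v} \<longleftrightarrow> c = upair u v" for u v by (metis el_upair insert_absorb2 ext)+
  then show ?thesis unfolding kpair_def pr_def by simp
qed

lemma rel_iff [simp]: "(x, y) \<in> rel E r \<longleftrightarrow> E (pr x y) r" by (simp add: rel_def)

lemma dt_upair [dfi]: assumes "dt E f" "dt E g" shows "dt E (\<lambda>s. upair (f s) (g s))"
proof -
  have "{x. x = a \<or> x = b} = {a, b}" for a b :: 'a by auto
  then have *: "upair a b = mk {x. x = a \<or> x = b}" "isset {x. x = a \<or> x = b}" for a b
    by (simp_all add: upair_def)
  have "dt E (\<lambda>s. upair (s 0) (s 1))" unfolding * by (rule dt_mk[OF *(2)]) (intro dfi)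
  from dt_comp2[OF this assms] show ?thesis .
qed

lemma dt_pr [dfi]: "dt E f \<Longrightarrow> dt E g \<Longrightarrow> dt E (\<lambda>s. pr (f s) (g s))"
  unfolding pr_def by (intro dfi)

lemma dt_un [dfi]: assumes "dt E f" shows "dt E (\<lambda>s. un (f s))"
proof -
  have "dt E (\<lambda>s. mk {x. \<exists>y\<in>el (s 0). E x y})"
    by (rule dt_mk, use isset_Union[OF isset_el] in \<open>simp add: UNION_eq el_iff\<close>) (intro dfi)
  then have "dt E (\<lambda>s. un (s 0))" by (simp add: un_def UNION_eq el_iff)
  from dt_comp1[OF this assms] show ?thesis .
qed

lemma dt_bun [dfi]: assumes "dt E f" "dt E g" shows "dt E (\<lambda>s. bun (f s) (g s))"
proof -
  have "bun x y = un (upair x y)" for x y by (rule ext) auto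
  then show ?thesis by (simp add: dt_un dt_upair assms)
qed

lemma dt_suc [dfi]: assumes "dt E f" shows "dt E (\<lambda>s. suc (f s))"
proof -
  have "suc x = bun (upair x x) x" for x by (rule ext) auto
  then show ?thesis by (simp add: dt_bun dt_upair assms)
qed

lemma dt_pow [dfi]: assumes "dt E f" shows "dt E (\<lambda>s. pow (f s))"
proof -
  have "dt E (\<lambda>s. pow (s 0))" unfolding pow_def by (rule dt_mk[OF isset_Pow]) (intro dfi)
  from dt_comp1[OF this assms] show ?thesis .
qed

definition fn :: "('a \<Rightarrow> 'a) \<Rightarrow> bool" where "fn f \<longleftrightarrow> dt E (\<lambda>s. f (s 0))"

lemma fnD: "fn f \<Longrightarrow> dt E g \<Longrightarrow> dt E (\<lambda>s. f (g s))"
  unfolding fn_def by (rule dt_comp1)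

lemma isset_fn [simp]: "fn f \<Longrightarrow> isset A \<Longrightarrow> isset (f ` A)"
  unfolding fn_def by (rule isset_img)

definition "cprod a b = un (mk ((\<lambda>x. mk ((\<lambda>y. pr x y) ` el b)) ` el a))"

lemma el_cprod [simp]: "el (cprod a b) = {pr x y | x y. x \<in> el a \<and> y \<in> el b}"
proof -
  have 1: "isset ((\<lambda>y. pr x y) ` el b)" for x by (rule isset_img[OF isset_el], intro dfi)
  have 2: "isset ((\<lambda>x. mk ((\<lambda>y. pr x y) ` el b)) ` el a)" by (rule isset_img[OF isset_el], intro dfi)
  show ?thesis unfolding cprod_def by (auto simp: 1 2)
qed

lemma dt_cprod [dfi]: assumes "dt E f" "dt E g" shows "dt E (\<lambda>s. cprod (f s) (g s))"
proof -
  have "dt E (\<lambda>s. cprod (s 0) (s 1))" unfolding cprod_def by (intro dfi)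
  from dt_comp2[OF this assms] show ?thesis .
qed

definition "p1 z = (if \<exists>x y. z = pr x y then (SOME x. \<exists>y. z = pr x y) else emp)"
definition "p2 z = (if \<exists>x y. z = pr x y then (SOME y. \<exists>x. z = pr x y) else emp)"

lemma p1_pr [simp]: "p1 (pr x y) = x" and p2_pr [simp]: "p2 (pr x y) = y"
  by (auto simp: p1_def p2_def)

lemma dt_p1 [dfi]: assumes "dt E f" shows "dt E (\<lambda>s. p1 (f s))"
proof -
  have *: "w = p1 z \<longleftrightarrow> (\<exists>y. z = pr w y) \<or> (\<not> (\<exists>x y. z = pr x y) \<and> w = emp)" for w z
    by (auto simp: p1_def)
  have "dt E (\<lambda>s. p1 (s 0))" unfolding dt_def * by (intro dfi)
  from dt_comp1[OF this assms] show ?thesis .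
qed

lemma dt_p2 [dfi]: assumes "dt E f" shows "dt E (\<lambda>s. p2 (f s))"
proof -
  have *: "w = p2 z \<longleftrightarrow> (\<exists>x. z = pr x w) \<or> (\<not> (\<exists>x y. z = pr x y) \<and> w = emp)" for w z
    by (auto simp: p2_def)
  have "dt E (\<lambda>s. p2 (s 0))" unfolding dt_def * by (intro dfi)
  from dt_comp1[OF this assms] show ?thesis .
qed

text \<open>
  Total application: the value is unspecified unless exactly one pair in \<open>f\<close> has first component \<open>x\<close>.
\<close>

definition "app f x = un (mk {y \<in> el (un (un f)). E (pr x y) f})"

lemma pr_in_unun: "E (pr x y) f \<Longrightarrow> E x (un (un f)) \<and> E y (un (un f))"
proof -
  assume "E (pr x y) f"
  then have "pr x y \<in> el f" by (simp add: el_iff)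
  moreover have "upair x y \<in> el (pr x y)" by (simp add: pr_def)
  ultimately have "upair x y \<in> el (un f)" by auto
  then show ?thesis by (metis E_defs(2,4))
qed

lemma dt_app [dfi]: assumes "dt E f" "dt E g" shows "dt E (\<lambda>s. app (f s) (g s))"
proof -
  have "dt E (\<lambda>s. app (s 0) (s 1))" unfolding app_def by (intro dfi)
  from dt_comp2[OF this assms] show ?thesis .
qed

lemma app_eq: assumes "E (pr x y) f" "\<And>z. E (pr x z) f \<Longrightarrow> z = y" shows "app f x = y"
proof -
  have i: "isset {y \<in> el (un (un f)). E (pr x y) f}" by (rule isset_sep[OF isset_el], intro dfi)
  have "{y \<in> el (un (un f)). E (pr x y) f} = {y}"
    unfolding el_iff using assms(1) pr_in_unun[OF assms(1)] assms(2) by blast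
  then show ?thesis unfolding app_def by (intro ext) simp
qed

lemma app_eq': "pr x y \<in> el f \<Longrightarrow> (\<And>z. pr x z \<in> el f \<Longrightarrow> z = y) \<Longrightarrow> app f x = y"
  unfolding el_iff by (rule app_eq)

definition "lam a f = mk ((\<lambda>x. pr x (f x)) ` el a)"

lemma dt_lam [dfi]:
  assumes "dt E a" "dt E (\<lambda>s. f (s 0) (\<lambda>i. s (Suc i)))"
  shows "dt E (\<lambda>s. lam (a s) (\<lambda>x. f x s))"
  unfolding lam_def by (rule dt_img[OF assms(1)], rule dt_pr[OF dt_var assms(2)])

lemma isset_lam: "fn f \<Longrightarrow> isset ((\<lambda>x. pr x (f x)) ` el a)"
  unfolding fn_def by (rule isset_img[OF isset_el], intro dfi, assumption)

lemma el_lam [simp]: "fn f \<Longrightarrow> el (lam a f) = (\<lambda>x. pr x (f x)) ` el a"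
  unfolding lam_def by (simp add: isset_lam)

lemma app_lam [simp]: "fn f \<Longrightarrow> x \<in> el a \<Longrightarrow> app (lam a f) x = f x"
  by (rule app_eq) (auto simp flip: el_iff)

lemma fn_app [simp]: "fn (app f)" unfolding fn_def by (intro dfi)

lemma fun_code_lam: "fn g \<Longrightarrow> fun_code E (lam x g) x g"
  by (auto simp: fun_code_def simp flip: el_iff)

lemma fun_code_app: "fun_code E f x g \<Longrightarrow> y \<in> el x \<Longrightarrow> app f y = g y"
  by (rule app_eq) (auto simp: fun_code_def set_eq_iff simp flip: rel_iff)

lemma card_leI: "fn g \<Longrightarrow> inj_on g (el x) \<Longrightarrow> g ` el x \<subseteq> el y \<Longrightarrow> card_le E x y"
  unfolding card_le_def using fun_code_lam by blast

lemma card_leE: assumes "card_le E x y"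
  obtains f where "inj_on (app f) (el x)" "app f ` el x \<subseteq> el y"
proof -
  obtain f g where "fun_code E f x g" "inj_on g (el x)" "g ` el x \<subseteq> el y"
    using assms unfolding card_le_def by blast
  then have "inj_on (app f) (el x)" "app f ` el x \<subseteq> el y" using fun_code_app
    by (auto simp: inj_on_def)
  then show ?thesis by (rule that)
qed

text \<open>The HOL function in \<open>card_le\<close> is replaced by application of a set, which
  makes the comparison of sizes a first-order notion.\<close>

lemma card_le_iff: "card_le E x y \<longleftrightarrow> (\<exists>f. (\<forall>a\<in>el x. E (app f a) y) \<and>
    (\<forall>a\<in>el x. \<forall>b\<in>el x. app f a = app f b \<longrightarrow> a = b))"
proof
  assume "card_le E x y"
  then obtain f where "inj_on (app f) (el x)" "app f ` el x \<subseteq> el y" by (rule card_leE)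
  then show "\<exists>f. (\<forall>a\<in>el x. E (app f a) y) \<and> (\<forall>a\<in>el x. \<forall>b\<in>el x. app f a = app f b \<longrightarrow> a = b)"
    by (intro exI[of _ f]) (auto simp: inj_on_def simp flip: el_iff)
next
  assume "\<exists>f. (\<forall>a\<in>el x. E (app f a) y) \<and> (\<forall>a\<in>el x. \<forall>b\<in>el x. app f a = app f b \<longrightarrow> a = b)"
  then obtain f where "\<forall>a\<in>el x. E (app f a) y" "\<forall>a\<in>el x. \<forall>b\<in>el x. app f a = app f b \<longrightarrow> a = b"
    by blast
  then show "card_le E x y" by (intro card_leI[OF fn_app, of f]) (auto simp: inj_on_def el_iff)
qed

lemma df_card_le [dfi]: assumes "dt E f" "dt E g" shows "df E (\<lambda>s. card_le E (f s) (g s))"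
proof -
  have "df E (\<lambda>s. card_le E (s 0) (s 1))" unfolding card_le_iff by (intro dfi)
  from df_comp2[OF this assms] show ?thesis .
qed

lemma card_le_subset: "el x \<subseteq> el y \<Longrightarrow> card_le E x y"
  by (rule card_leI[of "\<lambda>x. x"]) (simp_all add: fn_def dt_var)

lemma card_le_refl: "card_le E x x" by (rule card_le_subset) simp

lemma fn_comp: "fn f \<Longrightarrow> fn g \<Longrightarrow> fn (\<lambda>x. f (g x))"
  unfolding fn_def by (rule dt_comp1)

lemma card_le_trans: assumes "card_le E x y" "card_le E y z" shows "card_le E x z"
proof -
  obtain f where f: "inj_on (app f) (el x)" "app f ` el x \<subseteq> el y" using assms(1) by (rule card_leE)
  obtain g where g: "inj_on (app g) (el y)" "app g ` el y \<subseteq> el z" using assms(2) by (rule card_leE)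
  show ?thesis
    by (rule card_leI[of "\<lambda>x. app g (app f x)"])
       (use f g in \<open>auto simp: inj_on_def fn_comp image_subset_iff\<close>)
qed

text \<open>The axiom of choice is available for disjoint families only; each member
  \<open>x\<close> is therefore replaced by \<open>{x} \<times> x\<close>.\<close>

lemma pick: assumes "\<And>x. x \<in> el a \<Longrightarrow> el x \<noteq> {}"
  shows "\<exists>g. \<forall>x\<in>el a. app g x \<in> el x"
proof -
  let ?b = "mk ((\<lambda>x. cprod (upair x x) x) ` el a)"
  have b: "el ?b = (\<lambda>x. cprod (upair x x) x) ` el a"
    by (rule el_mk, rule isset_img[OF isset_el], intro dfi)
  have "(\<forall>x\<in>el ?b. el x \<noteq> {}) \<and> (\<forall>x\<in>el ?b. \<forall>y\<in>el ?b. x \<noteq> y \<longrightarrow> el x \<inter> el y = {})"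
    using assms unfolding b by auto
  from mp[OF spec[OF zfc[unfolded zfc_def, THEN conjunct2, THEN conjunct2, THEN conjunct2, THEN conjunct2, THEN conjunct2, THEN conjunct2, THEN conjunct2, THEN conjunct2]] this]
  obtain c where c: "\<forall>x\<in>el ?b. \<exists>!y. y \<in> el x \<and> y \<in> el c" by (elim exE)
  \<comment> \<open>The choice set may contain other elements; only pairs \<open>(x, y)\<close> with
    \<open>x\<close> in \<open>a\<close> and \<open>y\<close> in \<open>x\<close> are kept, which
    makes \<open>?g\<close> single-valued on \<open>a\<close>.\<close>
  let ?g = "mk {z \<in> el c. z \<in> el (cprod a (un a)) \<and> E (p2 z) (p1 z)}"
  have g: "el ?g = {z \<in> el c. z \<in> el (cprod a (un a)) \<and> E (p2 z) (p1 z)}"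
    by (rule el_mk, rule isset_sep[OF isset_el], intro dfi)
  show ?thesis
  proof (intro exI ballI)
    fix x assume x: "x \<in> el a"
    then have "\<exists>!y. y \<in> el (cprod (upair x x) x) \<and> y \<in> el c" using c unfolding b by blast
    then obtain w where w: "w \<in> el (cprod (upair x x) x)" "w \<in> el c"
      and u: "\<forall>v. v \<in> el (cprod (upair x x) x) \<and> v \<in> el c \<longrightarrow> v = w" by (elim ex1E conjE)
    from w(1) obtain y where y: "w = pr x y" "y \<in> el x" by auto
    then have "y \<in> el x" "pr x y \<in> el c" "\<And>z. z \<in> el x \<Longrightarrow> pr x z \<in> el c \<Longrightarrow> z = y"
      using w(2) u by auto
    note y' = this
    have "pr x y \<in> el ?g" unfolding g using x y'(1,2) by (auto simp: el_iff)
    moreover have "z = y" if "pr x z \<in> el ?g" for z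
      using that y'(3)[of z] unfolding g by (simp add: el_iff)
    ultimately have "app ?g x = y" by (rule app_eq')
    then show "app ?g x \<in> el x" using y'(1) by simp
  qed
qed

lemma choice:
  assumes "df E (\<lambda>s. R (s 0) (s 1))" "\<And>x. x \<in> el a \<Longrightarrow> \<exists>y\<in>el b. R x y"
  shows "\<exists>g. \<forall>x\<in>el a. app g x \<in> el b \<and> R x (app g x)"
proof -
  note R = df_comp2[of E R, OF assms(1)]
  let ?B = "\<lambda>x. mk {y \<in> el b. R x y}"
  have B: "el (?B x) = {y \<in> el b. R x y}" for x
    by (rule el_mk, rule isset_sep[OF isset_el], intro R dfi)
  have fB: "fn ?B" unfolding fn_def by (rule dt_sep, rule dt_const, rule R; rule dt_var)
  let ?a = "mk (?B ` el a)"
  have a: "el ?a = ?B ` el a" by (rule el_mk, rule isset_fn[OF fB]) simp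
  have ne: "el x \<noteq> {}" if "x \<in> el ?a" for x
  proof -
    from that obtain z where "z \<in> el a" "x = ?B z" unfolding a by blast
    then show ?thesis using assms(2)[of z] B[of z] by blast
  qed
  have "\<exists>g. \<forall>x\<in>el ?a. app g x \<in> el x" by (rule pick) (rule ne)
  then obtain g where g: "\<forall>x\<in>el ?a. app g x \<in> el x" by (elim exE)
  have f: "fn (\<lambda>x. app g (?B x))" by (rule fn_comp[OF fn_app fB])
  show ?thesis
  proof (intro exI[of _ "lam a (\<lambda>x. app g (?B x))"] ballI)
    fix x assume "x \<in> el a"
    then show "app (lam a (\<lambda>x. app g (?B x))) x \<in> el b \<and> R x (app (lam a (\<lambda>x. app g (?B x))) x)"
      using bspec[OF g, of "?B x"] f B[of x] unfolding a by auto
  qed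
qed

lemma card_le_surj:
  assumes "fn f" "el y \<subseteq> f ` el x" shows "card_le E y x"
proof -
  have "\<exists>g. \<forall>z\<in>el y. app g z \<in> el x \<and> f (app g z) = z"
    by (rule choice[of "\<lambda>z w. f w = z" y x]) (intro dfi fnD[OF assms(1)], use assms(2) in blast)
  then obtain g where g: "\<forall>z\<in>el y. app g z \<in> el x \<and> f (app g z) = z" by (elim exE)
  have "inj_on (app g) (el y)" by (rule inj_onI) (metis g)
  then show ?thesis by (rule card_leI[OF fn_app]) (use g in blast)
qed

subsection \<open>Well-founded recursion\<close>

lemma lam_cong: "(\<And>y. y \<in> el a \<Longrightarrow> f y = g y) \<Longrightarrow> lam a f = lam a g"
  unfolding lam_def by (metis (no_types, lifting) image_cong)

lemma df_trans_set [dfi]: assumes "dt E f" shows "df E (\<lambda>s. trans_set E (f s))"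
proof -
  have "df E (\<lambda>s. trans_set E (s 0))" unfolding trans_set_def by (intro dfi)
  from df_comp1[OF this assms] show ?thesis .
qed

lemma df_ordinal [dfi]: assumes "dt E f" shows "df E (\<lambda>s. ordinal E (f s))"
proof -
  have "df E (\<lambda>s. ordinal E (s 0))" unfolding ordinal_def by (intro dfi)
  from df_comp1[OF this assms] show ?thesis .
qed

text \<open>In HOL the function exists by \<open>wfrec\<close>; the point is that it is definable.
  Its graph is described by approximations that are sets: the function restricted to the closure of
  \<open>{x}\<close> under \<open>S u\<close>. These exist by induction along \<open>S\<close>,
  using replacement. The parameter \<open>u\<close> lets the recursion depend on a fixed
  set.\<close>

lemma rec_ex:
  assumes H: "dt E (\<lambda>s. H (s 0) (s 1) (s 2))" and S: "dt E (\<lambda>s. S (s 0) (s 1))"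
    and wfS: "\<And>u. wfp (\<lambda>y x. E y (S u x))"
  shows "\<exists>f. dt E (\<lambda>s. f (s 0) (s 1)) \<and> (\<forall>u x. f u x = H u x (lam (S u x) (f u)))"
proof -
  define f where "f u = wfrec {(y, x). E y (S u x)} (\<lambda>g x. H u x (lam (S u x) g))" for u
  have f: "f u x = H u x (lam (S u x) (f u))" for u x
  proof -
    have w: "Wellfounded.wf {(y, x). E y (S u x)}" using wfS[of u] by (simp add: wfp_def)
    have "lam (S u x) (cut (f u) {(y, x). E y (S u x)} x) = lam (S u x) (f u)"
      by (rule lam_cong) (simp add: cut_def el_iff)
    then show ?thesis unfolding f_def by (subst wfrec[OF w]) simp
  qed
  note dS = dt_comp2[of E S, OF S] and dH = dt_comp3[of E H, OF H]
  \<comment> \<open>\<open>cl\<close> expresses closure under \<open>S u\<close>,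
    \<open>T u x d\<close> that \<open>d\<close> is the least closed set containing
    \<open>x\<close>, and \<open>A u x g\<close> that \<open>g\<close> is the approximation with
    this domain.\<close>
  define cl where "cl u d \<longleftrightarrow> (\<forall>x\<in>el d. el (S u x) \<subseteq> el d)" for u d
  define T where "T u x d \<longleftrightarrow> cl u d \<and> E x d \<and> (\<forall>d'. cl u d' \<and> E x d' \<longrightarrow> el d \<subseteq> el d')" for u x d
  define A where "A u x g \<longleftrightarrow> (\<exists>d. T u x d \<and> g = lam d (app g) \<and>
      (\<forall>y\<in>el d. app g y = H u y (lam (S u y) (app g))))" for u x g
  have "df E (\<lambda>s. T (s 0) (s 1) (s 2))" unfolding T_def cl_def by (intro dfi dS)
  note dT = df_comp3[of E T, OF this]
  have "df E (\<lambda>s. A (s 0) (s 1) (s 2))" unfolding A_def by (intro dfi dT dH dS)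
  note dA = df_comp3[of E A, OF this]
  have Tu: "d = d'" if "T u x d" "T u x d'" for u x d d'
    using that unfolding T_def by (intro ext) blast
  have Af: "app g y = f u y" if d: "T u x d" "g = lam d (app g)"
    "\<And>y. y \<in> el d \<Longrightarrow> app g y = H u y (lam (S u y) (app g))" and y: "y \<in> el d" for u x d g y
    using wfS[of u] y
  proof (induction y rule: wfp_induct_rule)
    case (less y)
    have "app g z = f u z" if z: "z \<in> el (S u y)" for z
    proof -
      have "z \<in> el d" using d(1) less.prems z unfolding T_def cl_def by blast
      then show ?thesis using less.IH z unfolding el_iff by blast
    qed
    then have "lam (S u y) (app g) = lam (S u y) (f u)" by (rule lam_cong)
    then show ?case using d(3)[OF less.prems] f[of u y] by simp
  qed
  have Ag: "\<exists>d. T u x d \<and> el g = (\<lambda>y. pr y (f u y)) ` el d" if g: "A u x g" for u x g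
  proof -
    obtain d where d: "T u x d" "g = lam d (app g)"
      "\<forall>y\<in>el d. app g y = H u y (lam (S u y) (app g))" using g unfolding A_def by (elim exE conjE)
    have "el g = (\<lambda>y. pr y (app g y)) ` el d" by (subst d(2)) simp
    also have "\<dots> = (\<lambda>y. pr y (f u y)) ` el d"
      by (rule image_cong) (use Af[OF d(1,2)] d(3) in auto)
    finally show ?thesis using d(1) by blast
  qed
  have Au: "g = g'" if g: "A u x g" and g': "A u x g'" for u x g g'
  proof -
    obtain d where d: "T u x d" "el g = (\<lambda>y. pr y (f u y)) ` el d" using Ag[OF g] by blast
    obtain d' where d': "T u x d'" "el g' = (\<lambda>y. pr y (f u y)) ` el d'" using Ag[OF g'] by blast
    show ?thesis using d d' Tu[OF d(1) d'(1)] by (intro ext) simp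
  qed
  have AT: "\<exists>d. T u x d" if "A u x g" for u x g using that unfolding A_def by blast
  have ex: "\<exists>g. A u x g" for u x
    using wfS[of u]
  proof (induction x rule: wfp_induct_rule)
    case (less x)
    have IH: "\<exists>g. A u y g" if "y \<in> el (S u x)" for y using less that by (simp add: el_iff)
    have "isset {g. \<exists>y\<in>el (S u x). A u y g}"
      by (rule isset_repl, simp, intro dfi dA, use IH Au in blast)
    moreover have "isset {d. \<exists>y\<in>el (S u x). T u y d}"
      by (rule isset_repl, simp, intro dfi dT, use IH AT Tu in blast)
    ultimately have i: "isset (\<Union>g\<in>{g. \<exists>y\<in>el (S u x). A u y g}. el g)"
      "isset (\<Union>d\<in>{d. \<exists>y\<in>el (S u x). T u y d}. el d)" by simp_all
    \<comment> \<open>The domain and the approximation for \<open>x\<close> are glued from those of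
      its predecessors; the only new point is \<open>x\<close> itself.\<close>
    define D where "D = insert x (\<Union>d\<in>{d. \<exists>y\<in>el (S u x). T u y d}. el d)"
    define d0 where "d0 = mk D"
    define g0 where "g0 = mk (insert (pr x (f u x)) (\<Union>g\<in>{g. \<exists>y\<in>el (S u x). A u y g}. el g))"
    have d0: "el d0 = D" unfolding d0_def D_def using i by simp
    have SD: "el (S u x) \<subseteq> D"
    proof
      fix y assume y: "y \<in> el (S u x)"
      then obtain d where "T u y d" using IH AT by blast
      moreover have "y \<in> el d" using \<open>T u y d\<close> by (simp add: T_def el_iff)
      ultimately show "y \<in> D" unfolding D_def using y by blast
    qed
    have cD: "el (S u y) \<subseteq> D" if y: "y \<in> D" for y
    proof (cases "y = x")
      case False
      then obtain z d where "z \<in> el (S u x)" "T u z d" "y \<in> el d" using y unfolding D_def by blast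
      then show ?thesis unfolding D_def T_def cl_def by blast
    qed (use SD in simp)
    have T0: "T u x d0" unfolding T_def
    proof (intro conjI allI impI)
      show "cl u d0" unfolding cl_def d0 using cD by blast
      have "x \<in> el d0" unfolding d0 D_def by (rule insertI1)
      then show "E x d0" by (simp only: el_iff)
      fix d' assume d': "cl u d' \<and> E x d'"
      have x: "x \<in> el d'" using d' by (simp only: el_iff)
      have "el d \<subseteq> el d'" if y: "y \<in> el (S u x)" and T: "T u y d" for y d
      proof -
        have "y \<in> el d'" using conjunct1[OF d'] x y unfolding cl_def by blast
        then show ?thesis using T conjunct1[OF d'] unfolding T_def el_iff by simp
      qed
      then show "el d0 \<subseteq> el d'" unfolding d0 D_def using x by blast
    qed
    have g0: "el g0 = (\<lambda>y. pr y (f u y)) ` D"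
    proof -
      have "(\<Union>g\<in>{g. \<exists>y\<in>el (S u x). A u y g}. el g) =
          (\<lambda>y. pr y (f u y)) ` (\<Union>d\<in>{d. \<exists>y\<in>el (S u x). T u y d}. el d)" (is "?L = ?R")
      proof (intro equalityI subsetI)
        fix z assume "z \<in> ?L"
        then obtain g y where y: "y \<in> el (S u x)" "A u y g" "z \<in> el g" by blast
        then obtain d where "T u y d" "el g = (\<lambda>y. pr y (f u y)) ` el d" using Ag by blast
        then show "z \<in> ?R" using y by blast
      next
        fix z assume "z \<in> ?R"
        then obtain d y w where y: "y \<in> el (S u x)" "T u y d" "w \<in> el d" "z = pr w (f u w)" by blast
        then obtain g where g: "A u y g" using IH by blast
        then obtain d' where "T u y d'" "el g = (\<lambda>y. pr y (f u y)) ` el d'" using Ag by blast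
        then have "z \<in> el g" using y Tu by blast
        then show "z \<in> ?L" using y g by blast
      qed
      then show ?thesis unfolding g0_def D_def using i by simp
    qed
    have ag: "app g0 y = f u y" if "y \<in> D" for y
      by (rule app_eq') (use that in \<open>auto simp: g0\<close>)
    have "g0 = lam d0 (app g0)"
      by (rule ext) (use ag in \<open>auto simp: g0 d0 image_iff\<close>)
    moreover have "app g0 y = H u y (lam (S u y) (app g0))" if "y \<in> el d0" for y
    proof -
      have "lam (S u y) (app g0) = lam (S u y) (f u)"
        by (rule lam_cong) (use cD ag that d0 in blast)
      then show ?thesis using ag that f[of u y] d0 by simp
    qed
    ultimately show ?case unfolding A_def using T0 by blast
  qed
  have val: "app g x = f u x" if g: "A u x g" for u x g
  proof -
    obtain d where d: "T u x d" "g = lam d (app g)"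
      "\<forall>y\<in>el d. app g y = H u y (lam (S u y) (app g))" using g unfolding A_def by (elim exE conjE)
    have "x \<in> el d" using d(1) by (simp add: T_def el_iff)
    then show ?thesis using Af[OF d(1,2)] d(3) by blast
  qed
  have "z = f u x \<longleftrightarrow> (\<exists>g. A u x g \<and> z = app g x)" for z u x
    using ex[of u x] val by metis
  moreover have "df E (\<lambda>s. \<exists>g. A (s 1) (s 2) g \<and> s 0 = app g (s 2))" by (intro dfi dA)
  ultimately have "dt E (\<lambda>s. f (s 0) (s 1))" unfolding dt_def by (simp add: numeral_2_eq_2)
  then show ?thesis using f by blast
qed

lemma rec_mem:
  assumes "dt E (\<lambda>s. H (s 0) (s 1) (s 2))"
  shows "\<exists>f. dt E (\<lambda>s. f (s 0) (s 1)) \<and> (\<forall>u x. f u x = H u x (lam x (f u)))"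
  by (rule rec_ex[OF assms, of "\<lambda>u x. x"], rule dt_var) (rule wf)

lemma fn_dt2: "dt E (\<lambda>s. f (s 0) (s 1)) \<Longrightarrow> fn (f u)"
  unfolding fn_def by (rule dt_comp2[of E f], assumption, rule dt_const, rule dt_var)

subsection \<open>Ordinals\<close>

abbreviation ord :: "'a \<Rightarrow> bool" where "ord \<equiv> ordinal E"

lemma ordI: "(\<And>x y. x \<in> el a \<Longrightarrow> y \<in> el x \<Longrightarrow> y \<in> el a) \<Longrightarrow> (\<And>x. x \<in> el a \<Longrightarrow> ord x) \<Longrightarrow> ord a"
  unfolding ordinal_def trans_set_def by blast

lemma ord_tr: "ord a \<Longrightarrow> x \<in> el a \<Longrightarrow> y \<in> el x \<Longrightarrow> y \<in> el a"
  unfolding ordinal_def trans_set_def by blast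

lemma ord_el: "ord a \<Longrightarrow> x \<in> el a \<Longrightarrow> ord x"
  unfolding ordinal_def trans_set_def by blast

lemma ord_lin: "ord x \<Longrightarrow> ord y \<Longrightarrow> x \<in> el y \<or> x = y \<or> y \<in> el x"
proof (induction x arbitrary: y rule: E_induct)
  case (1 x)
  note IHx = 1
  show ?case using \<open>ord y\<close>
  proof (induction y rule: E_induct)
    case (1 y)
    show ?case
    proof (rule ccontr)
      assume n: "\<not> ?case"
      have "z \<in> el y" if "z \<in> el x" for z
        using IHx(1)[of z y] that n ord_el[OF IHx(2) that] ord_tr[OF IHx(2) that] 1(2)
        by (auto simp: el_iff)
      moreover have "z \<in> el x" if "z \<in> el y" for z
        using 1(1)[of z] that n ord_el[OF 1(2) that] ord_tr[OF 1(2) that] by (auto simp: el_iff)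
      ultimately have "x = y" by (intro ext) blast
      then show False using n by blast
    qed
  qed
qed

lemma ord_subset_iff: "ord x \<Longrightarrow> ord y \<Longrightarrow> el x \<subseteq> el y \<longleftrightarrow> x \<in> el y \<or> x = y"
  using ord_lin[of x y] ord_tr[of y x] E_irrefl by (auto simp: el_iff)

lemma ord_un: "(\<And>x. x \<in> el a \<Longrightarrow> ord x) \<Longrightarrow> ord (un a)"
  by (rule ordI) (simp, meson ord_tr, simp, meson ord_el)

lemma ord_suc: "ord a \<Longrightarrow> ord (suc a)"
  by (rule ordI) (auto intro: ord_tr ord_el)

lemma ord_emp: "ord emp" by (rule ordI) auto

lemma ord_least: assumes "ord a" "P a"
  shows "\<exists>b. ord b \<and> P b \<and> (\<forall>c\<in>el b. \<not> P c) \<and> (b = a \<or> b \<in> el a)"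
proof -
  obtain b where b: "ord b \<and> P b" "\<And>c. E c b \<Longrightarrow> \<not> (ord c \<and> P c)"
    by (rule E_min[of "\<lambda>x. ord x \<and> P x" a]) (use assms in blast)+
  have "a \<notin> el b" using b assms by (auto simp: el_iff)
  then show ?thesis using b ord_lin[OF assms(1), of b] ord_el[of b] by (auto simp: el_iff)
qed

lemma ord_least_ex1: assumes "ord a" "P a"
  shows "\<exists>!b. ord b \<and> P b \<and> (\<forall>c\<in>el b. \<not> P c)"
  using ord_least[of a P, OF assms] ord_lin by metis

subsection \<open>Collection\<close>

text \<open>The sets \<open>V b\<close> for ordinals \<open>b\<close> form the cumulative hierarchy.
  Each \<open>x\<close> has a least ordinal whose level contains a witness; replacement collects
  these ordinals, and the level of their supremum bounds witnesses for all \<open>x\<close>.\<close>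

lemma collection:
  assumes R: "df E (\<lambda>s. R (s 0) (s 1))" and ex: "\<And>x. x \<in> el a \<Longrightarrow> \<exists>y. R x y"
  shows "\<exists>b. \<forall>x\<in>el a. \<exists>y\<in>el b. R x y"
proof -
  have "dt E (\<lambda>s. un (mk ((\<lambda>y. pow (app (s 2) y)) ` el (s 1))))" by (intro dfi)
  from rec_mem[of "\<lambda>u x g. un (mk ((\<lambda>y. pow (app g y)) ` el x))", OF this]
  obtain V' where V': "dt E (\<lambda>s. V' (s 0) (s 1))"
    "\<forall>u x. V' u x = un (mk ((\<lambda>y. pow (app (lam x (V' u)) y)) ` el x))" by (elim exE conjE)
  define V where "V = V' emp"
  have fV: "fn V" unfolding V_def by (rule fn_dt2[OF V'(1)])
  have "(\<lambda>y. pow (app (lam x V) y)) ` el x = (\<lambda>y. pow (V y)) ` el x" for x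
    by (rule image_cong) (simp_all add: fV)
  moreover have "isset ((\<lambda>y. pow (V y)) ` el x)" for x
    by (rule isset_img[OF isset_el], intro dfi fnD[OF fV])
  ultimately have elV: "el (V x) = (\<Union>y\<in>el x. {z. el z \<subseteq> el (V y)})" for x
    unfolding V_def V'(2)[rule_format, of emp x] by (simp add: V_def[symmetric])
  have Vmono: "el (V x) \<subseteq> el (V y)" if "el x \<subseteq> el y" for x y using that unfolding elV[of x] elV[of y] by blast
  \<comment> \<open>This is needed twice: for equality, to show that the levels exhaust the model,
    and then for \<open>R\<close>.\<close>
  have key: "\<exists>b. ord b \<and> (\<forall>x\<in>el a. \<exists>y\<in>el (V b). Q x y)"
    if Q: "df E (\<lambda>s. Q (s 0) (s 1))" and ex: "\<And>x. x \<in> el a \<Longrightarrow> \<exists>c. ord c \<and> (\<exists>y\<in>el (V c). Q x y)" for Q a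
  proof -
    let ?L = "\<lambda>x c. ord c \<and> (\<exists>y\<in>el (V c). Q x y) \<and> (\<forall>d\<in>el c. \<not> (\<exists>y\<in>el (V d). Q x y))"
    have "\<exists>!c. ?L x c" if "x \<in> el a" for x using ex[OF that] ord_least_ex1[of _ "\<lambda>c. \<exists>y\<in>el (V c). Q x y"] by blast
    then have i: "isset {c. \<exists>x\<in>el a. ?L x c}"
      by (intro isset_repl[OF isset_el], intro dfi fnD[OF fV] df_comp2[of E Q, OF Q])
    let ?b = "un (mk {c. \<exists>x\<in>el a. ?L x c})"
    have "ord ?b" by (rule ord_un) (unfold el_mk[OF i], blast)
    moreover have "\<exists>y\<in>el (V ?b). Q x y" if x: "x \<in> el a" for x
    proof -
      obtain c where c: "?L x c" using \<open>x \<in> el a \<Longrightarrow> \<exists>!c. ?L x c\<close>[OF x] by blast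
      then have "el c \<subseteq> el ?b" using x unfolding el_un el_mk[OF i] by blast
      from Vmono[OF this] c show ?thesis by blast
    qed
    ultimately show ?thesis by blast
  qed
  have all: "\<exists>c. ord c \<and> y \<in> el (V c)" for y
  proof (induction y rule: E_induct)
    case (1 y)
    have "\<exists>b. ord b \<and> (\<forall>x\<in>el y. \<exists>z\<in>el (V b). x = z)"
      by (rule key, intro dfi) (use 1 in \<open>auto simp: el_iff\<close>)
    then obtain b where b: "ord b" "el y \<subseteq> el (V b)" by blast
    then have "y \<in> el (V (suc b))" unfolding elV[of "suc b"] by auto
    then show ?case using ord_suc[OF b(1)] by blast
  qed
  have "\<exists>b. ord b \<and> (\<forall>x\<in>el a. \<exists>y\<in>el (V b). R x y)"
    by (rule key[OF R]) (use ex all in blast)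
  then show ?thesis by blast
qed

lemma choice_class:
  assumes R: "df E (\<lambda>s. R (s 0) (s 1))" and ex: "\<And>x. x \<in> el a \<Longrightarrow> \<exists>y. R x y"
  shows "\<exists>g. \<forall>x\<in>el a. R x (app g x)"
proof -
  have "\<exists>b. \<forall>x\<in>el a. \<exists>y\<in>el b. R x y" by (rule collection[OF R]) (rule ex)
  then obtain b where b: "\<forall>x\<in>el a. \<exists>y\<in>el b. R x y" by (elim exE)
  have "\<exists>g. \<forall>x\<in>el a. app g x \<in> el b \<and> R x (app g x)" by (rule choice[OF R]) (use b in blast)
  then show ?thesis by blast
qed

subsection \<open>Natural numbers\<close>

primrec num :: "nat \<Rightarrow> 'a" where "num 0 = emp" | "num (Suc n) = suc (num n)"

lemma numeral_of_iff [simp]: "numeral_of E n x \<longleftrightarrow> x = num n"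
proof (induction n arbitrary: x)
  case (Suc n)
  then show ?case by simp (metis el_suc ext)
qed (simp add: el_empty_iff)

lemma el_num: "el (num n) = num ` {..<n}"
  by (induction n) (auto simp: lessThan_Suc)

lemma num_inj [simp]: "num m = num n \<longleftrightarrow> m = n"
proof -
  have "num m \<noteq> num n" if "m < n" for m n
    using el_num[of n] that E_irrefl[of "num n"] by (metis el_iff image_eqI lessThan_iff)
  then show ?thesis by (metis linorder_neqE_nat)
qed

lemma ord_num: "ord (num n)" by (induction n) (auto simp: ord_emp ord_suc)

lemma E_num [simp]: "E (num m) (num n) \<longleftrightarrow> m < n"
  using el_num[of n] by (auto simp flip: el_iff)

text \<open>The axiom of infinity gives some inductive set. The numerals are separated from it as
  the ordinals that are 0 or successors and have only such members; in a well-founded model these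
  are standard.\<close>

lemma isset_range_num: "isset (range num)"
proof -
  let ?N = "\<lambda>x. ord x \<and> (\<forall>y\<in>el (suc x). y = emp \<or> (\<exists>z. y = suc z))"
  obtain w where w: "\<exists>z\<in>el w. el z = {}" "\<forall>x\<in>el w. \<exists>y\<in>el w. el y = insert x (el x)"
    using zfc[unfolded zfc_def, THEN conjunct2, THEN conjunct2, THEN conjunct2, THEN conjunct2,
        THEN conjunct2, THEN conjunct1] by blast
  have w0: "num n \<in> el w" for n
  proof (induction n)
    case 0 show ?case using w(1) by (auto simp: el_empty_iff)
  next
    case (Suc n)
    then show ?case using w(2) by (metis el_suc ext num.simps(2))
  qed
  have N: "?N (num n)" for n
  proof (intro conjI ballI)
    fix y assume "y \<in> el (suc (num n))"
    then have "y \<in> el (num (Suc n))" by simp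
    then obtain m where "y = num m" unfolding el_num by blast
    then show "y = emp \<or> (\<exists>z. y = suc z)" by (cases m) auto
  qed (rule ord_num)
  have N': "x \<in> range num" if "?N x" for x
    using that
  proof (induction x rule: E_induct)
    case (1 x)
    show ?case
    proof (cases "x = emp")
      case True then show ?thesis by (metis num.simps(1) rangeI)
    next
      case False
      then obtain z where z: "x = suc z" using 1(2) by auto
      have "?N z" using 1(2) ord_el[of x z] unfolding z by auto
      then obtain n where "z = num n" using 1(1)[of z] z by auto
      then show ?thesis using z by (metis num.simps(2) rangeI)
    qed
  qed
  have "isset {x \<in> el w. ?N x}" by (rule isset_sep[OF isset_el], intro dfi)
  moreover have "{x \<in> el w. ?N x} = range num"
  proof (intro equalityI subsetI)
    fix x assume "x \<in> {x \<in> el w. ?N x}" then show "x \<in> range num" using N'[of x] by blast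
  next
    fix x assume "x \<in> range num"
    then obtain n where "x = num n" by blast
    then show "x \<in> {x \<in> el w. ?N x}" using w0[of n] N[of n] by simp
  qed
  ultimately show ?thesis by simp
qed

definition "om = mk (range num)"

lemma el_om [simp]: "el om = range num" unfolding om_def by (simp add: isset_range_num)

lemma E_om [simp]: "E x om \<longleftrightarrow> x \<in> range num" by (simp flip: el_iff)

lemma is_omega_iff [simp]: "is_omega E w \<longleftrightarrow> w = om"
  unfolding is_omega_def by (auto simp: full_SetCompr_eq intro!: ext)

lemma ord_om: "ord om" by (rule ordI) (auto simp: el_num ord_num)

definition nt :: "'a \<Rightarrow> nat" where "nt x = (if x \<in> range num then (THE n. x = num n) else 0)"

lemma nt_num [simp]: "nt (num n) = n" unfolding nt_def by simp

text \<open>Finiteness in HOL thus becomes first-order over the model (\<open>df_finite\<close>);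
  finite HOL sets are always represented, by \<open>isset_finite\<close>.\<close>

lemma finite_iff_card: "finite (el x) \<longleftrightarrow> (\<exists>n\<in>el om. card_le E x n)"
proof
  assume "\<exists>n\<in>el om. card_le E x n"
  then obtain n where "card_le E x (num n)" by auto
  then obtain f where "inj_on (app f) (el x)" "app f ` el x \<subseteq> el (num n)" by (rule card_leE)
  moreover have "finite (el (num n))" by (simp add: el_num)
  ultimately show "finite (el x)" by (metis finite_imageD finite_subset)
next
  have "\<exists>n. card_le E (mk A) (num n)" if "finite A" for A
    using that
  proof induction
    case empty
    show ?case by (rule exI[of _ 0], rule card_le_subset) simp
  next
    case (insert a A)
    then obtain n f where f: "inj_on (app f) (el (mk A))" "app f ` el (mk A) \<subseteq> el (num n)"
      by (metis card_leE)
    have i: "isset A" "isset (insert a A)" using insert(1) by (simp_all add: isset_finite)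
    have "card_le E (mk (insert a A)) (num (Suc n))"
    proof (rule card_leI[of "\<lambda>z. if z = a then num n else app f z"])
      show "fn (\<lambda>z. if z = a then num n else app f z)" unfolding fn_def by (intro dfi)
      have "app f z \<in> el (num n)" if "z \<in> A" for z using f(2) that i by auto
      then have "num n \<noteq> app f z" "app f z \<noteq> num n" if "z \<in> A" for z
        using that E_irrefl[of "num n"] by (metis el_iff)+
      then show "inj_on (\<lambda>z. if z = a then num n else app f z) (el (mk (insert a A)))"
        using f(1) insert(2) by (auto simp: i inj_on_def)
      show "(\<lambda>z. if z = a then num n else app f z) ` el (mk (insert a A)) \<subseteq> el (num (Suc n))"
        using f(2) by (auto simp: i)
    qed
    then show ?case by blast
  qed
  moreover assume "finite (el x)"
  ultimately show "\<exists>n\<in>el om. card_le E x n" by fastforce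
qed

lemma df_finite [dfi]: assumes "dt E f" shows "df E (\<lambda>s. finite (el (f s)))"
proof -
  have "df E (\<lambda>s. finite (el (s 0)))" unfolding finite_iff_card by (intro dfi)
  from df_comp1[of E "\<lambda>x. finite (el x)", OF this assms] show ?thesis .
qed

subsection \<open>Cardinal arithmetic\<close>

text \<open>An ordinal is determined by any copy of its order, because an isomorphism of ordinals is
  the identity. The order is taken reflexive so that its field can be recovered; the strict orders
  of 0 and 1 are both empty.\<close>

lemma ord_unique_order:
  assumes b: "ord b" and b': "ord b'" and f: "inj_on f (el b)" and f': "inj_on f' (el b')"
    and R: "{pr (f x) (f y) | x y. x \<in> el b \<and> y \<in> el b \<and> (x \<in> el y \<or> x = y)} =
      {pr (f' x) (f' y) | x y. x \<in> el b' \<and> y \<in> el b' \<and> (x \<in> el y \<or> x = y)}" (is "?R = ?R'")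
  shows "el b \<subseteq> el b'"
proof -
  have mem: "pr (f z) (f x) \<in> ?R \<longleftrightarrow> z \<in> el x \<or> z = x" if "x \<in> el b" "z \<in> el b" for x z
    using f that by (auto simp: inj_on_def)
  have mem': "pr (f' z) (f' x) \<in> ?R' \<longleftrightarrow> z \<in> el x \<or> z = x" if "x \<in> el b'" "z \<in> el b'" for x z
    using f' that by (auto simp: inj_on_def)
  have dom: "\<exists>y\<in>el b'. f' y = f x" if x: "x \<in> el b" for x
  proof -
    have "pr (f x) (f x) \<in> ?R" using mem[OF x x] by simp
    then show ?thesis unfolding R by auto
  qed
  have dom': "\<exists>y\<in>el b. f y = f' x" if x: "x \<in> el b'" for x
  proof -
    have "pr (f' x) (f' x) \<in> ?R'" using mem'[OF x x] by simp
    then show ?thesis unfolding R[symmetric] by auto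
  qed
  have "x \<in> el b' \<and> f' x = f x" if "x \<in> el b" for x
    using that
  proof (induction x rule: E_induct)
    case (1 x)
    obtain y where y: "y \<in> el b'" "f' y = f x" using dom[OF 1(2)] by blast
    have "el y = el x"
    proof (intro equalityI subsetI)
      fix z assume z: "z \<in> el y"
      then have zb': "z \<in> el b'" using ord_tr[OF b' y(1)] by blast
      then obtain w where w: "w \<in> el b" "f w = f' z" using dom' by blast
      have "pr (f' z) (f' y) \<in> ?R'" using mem'[OF y(1) zb'] z by blast
      then have "pr (f w) (f x) \<in> ?R" using R y w by simp
      then have "w \<in> el x \<or> w = x" using mem[OF 1(2) w(1)] by blast
      moreover have "w \<noteq> x"
      proof
        assume "w = x"
        then have "f' z = f' y" using w(2) y(2) by metis
        then have "z = y" by (rule inj_onD[OF f' _ zb' y(1)])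
        then show False using z E_irrefl[of y] by (simp add: el_iff)
      qed
      ultimately have "w \<in> el x" by blast
      then have "w \<in> el b' \<and> f' w = f w" using 1(1)[of w] w(1) unfolding el_iff by blast
      then have "f' w = f' z" using w(2) by simp
      then have "w = z" by (rule inj_onD[OF f']) (use \<open>w \<in> el b' \<and> f' w = f w\<close> zb' in blast)+
      then show "z \<in> el x" using \<open>w \<in> el x\<close> by simp
    next
      fix z assume z: "z \<in> el x"
      then have zb: "z \<in> el b" using ord_tr[OF b 1(2)] by blast
      then have IH: "z \<in> el b'" "f' z = f z" using 1(1)[of z] z unfolding el_iff by blast+
      have "pr (f z) (f x) \<in> ?R" using mem[OF 1(2) zb] z by blast
      then have "pr (f' z) (f' y) \<in> ?R'" using R y IH by simp
      then have "z \<in> el y \<or> z = y" using mem'[OF y(1) IH(1)] by blast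
      moreover have "z \<noteq> y"
      proof
        assume "z = y"
        then have "f z = f x" using IH(2) y(2) by metis
        then have "z = x" by (rule inj_onD[OF f _ zb 1(2)])
        then show False using z E_irrefl[of x] by (simp add: el_iff)
      qed
      ultimately show "z \<in> el y" by blast
    qed
    then have "y = x" by (rule ext)
    then show ?case using y by blast
  qed
  then show ?thesis by blast
qed

definition "hart a = mk {b. ord b \<and> card_le E b a}"

text \<open>Whether an ordinal embeds into \<open>a\<close> is read off from relations on
  \<open>a\<close>. Each relation is the copy of at most one ordinal, so replacement over the
  subsets of \<open>a \<times> a\<close> yields a set.\<close>

lemma el_hart [simp]: "el (hart a) = {b. ord b \<and> card_le E b a}"
proof -
  let ?r = "\<lambda>f b. {pr (app f x) (app f y) | x y. x \<in> el b \<and> y \<in> el b \<and> (x \<in> el y \<or> x = y)}"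
  let ?inj = "\<lambda>f b. (\<forall>x\<in>el b. E (app f x) a) \<and> (\<forall>x\<in>el b. \<forall>y\<in>el b. app f x = app f y \<longrightarrow> x = y)"
  define Q where "Q R b \<longleftrightarrow> ord b \<and> (\<exists>f. ?inj f b \<and> (\<forall>z. E z R \<longleftrightarrow>
      (\<exists>x\<in>el b. \<exists>y\<in>el b. z = pr (app f x) (app f y) \<and> (x \<in> el y \<or> x = y))))" for R b
  have "df E (\<lambda>s. Q (s 0) (s 1))" unfolding Q_def by (intro dfi)
  note dQ = df_comp2[of E Q, OF this]
  have Qr: "Q R b \<longleftrightarrow> ord b \<and> (\<exists>f. ?inj f b \<and> el R = ?r f b)" for R b
  proof -
    have r: "?r f b = {z. \<exists>x\<in>el b. \<exists>y\<in>el b. z = pr (app f x) (app f y) \<and> (x \<in> el y \<or> x = y)}" for f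
      by blast
    show ?thesis unfolding Q_def r set_eq_iff mem_Collect_eq el_iff[of _ R] by (rule refl)
  qed
  have u: "b = b'" if Q: "Q R b" "Q R b'" for R b b'
  proof -
    obtain f where f: "ord b" "?inj f b" "el R = ?r f b"
      using Q(1)[unfolded Qr] by (elim exE conjE) iprover
    obtain f' where f': "ord b'" "?inj f' b'" "el R = ?r f' b'"
      using Q(2)[unfolded Qr] by (elim exE conjE) iprover
    have i: "inj_on (app f) (el b)" "inj_on (app f') (el b')" using f(2) f'(2) by (auto simp: inj_on_def)
    have r: "?r f b = ?r f' b'" by (rule trans[OF f(3)[symmetric] f'(3)])
    show ?thesis
      by (intro ext equalityI ord_unique_order[OF f(1) f'(1) i r] ord_unique_order[OF f'(1) f(1) i(2,1) r[symmetric]])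
  qed
  let ?A = "{R \<in> el (pow (cprod a a)). \<exists>b. Q R b}"
  have A: "isset ?A" by (rule isset_sep[OF isset_el], intro dfi dQ)
  have "\<exists>!b. Q R b" if R: "R \<in> ?A" for R
  proof -
    have "\<exists>b. Q R b" using R unfolding mem_Collect_eq by (rule conjunct2)
    then show ?thesis by (rule ex_ex1I) (rule u)
  qed
  then have i: "isset {b. \<exists>R\<in>?A. Q R b}" by (intro isset_repl[OF A], intro dfi dQ)
  have Qc: "card_le E b a \<and> ord b" if "Q R b" for R b
    using that unfolding Q_def card_le_iff by (elim exE conjE) iprover
  have cQ: "\<exists>R. Q R b \<and> R \<in> el (pow (cprod a a))" if b: "card_le E b a" "ord b" for b
  proof -
    obtain f where f: "?inj f b" using b(1) unfolding card_le_iff by (elim exE)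
    let ?R = "{z \<in> el (cprod a a). \<exists>x\<in>el b. \<exists>y\<in>el b. z = pr (app f x) (app f y) \<and> (x \<in> el y \<or> x = y)}"
    have i: "isset ?R" by (rule isset_sep[OF isset_el], intro dfi)
    have fa: "\<And>x. x \<in> el b \<Longrightarrow> app f x \<in> el a" using conjunct1[OF f] by (auto simp: el_iff)
    have "?R = ?r f b" using fa unfolding el_cprod by blast
    then have R: "el (mk ?R) = ?r f b" using el_mk[OF i] by simp
    have "Q (mk ?R) b" unfolding Qr by (rule conjI[OF b(2)], rule exI[of _ f], rule conjI[OF f R])
    moreover have "mk ?R \<in> el (pow (cprod a a))" unfolding el_pow mem_Collect_eq el_mk[OF i] by blast
    ultimately show ?thesis by blast
  qed
  have "{b. \<exists>R\<in>?A. Q R b} = {b. ord b \<and> card_le E b a}"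
  proof (intro equalityI subsetI)
    fix b assume "b \<in> {b. \<exists>R\<in>?A. Q R b}"
    then show "b \<in> {b. ord b \<and> card_le E b a}" using Qc by blast
  next
    fix b assume "b \<in> {b. ord b \<and> card_le E b a}"
    then show "b \<in> {b. \<exists>R\<in>?A. Q R b}" using cQ[of b] by blast
  qed
  then show ?thesis unfolding hart_def using i by simp
qed

lemma card_le_mono: "card_le E x a \<Longrightarrow> el y \<subseteq> el x \<Longrightarrow> card_le E y a"
  using card_le_trans card_le_subset by blast

lemma ord_hart: "ord (hart a)"
proof (rule ordI)
  fix x y assume x: "x \<in> el (hart a)" and y: "y \<in> el x"
  have "el y \<subseteq> el x" using x y by (auto simp: ordinal_def trans_set_def)
  then show "y \<in> el (hart a)" using x ord_el[OF _ y] card_le_mono by auto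
qed simp

lemma hart_not_le: "\<not> card_le E (hart a) a"
proof
  assume "card_le E (hart a) a"
  then have "hart a \<in> el (hart a)" using ord_hart by simp
  then show False using E_irrefl unfolding el_iff by blast
qed

lemma hart_cardinal: "cardinal E (hart a)"
  unfolding cardinal_def using ord_hart hart_not_le[of a] card_le_trans[of "hart a" _ a] by auto

lemma hart_less: "ord a \<Longrightarrow> card_less E a (hart a)"
proof -
  assume a: "ord a"
  then have "a \<in> el (hart a)" by (simp add: card_le_refl)
  then have "el a \<subseteq> el (hart a)" using ord_tr[OF ord_hart] by blast
  then show ?thesis unfolding card_less_def using hart_not_le card_le_subset by blast
qed

definition "w1 = hart om"
definition "w2 = hart w1"

lemma is_omega_w1: "is_omega_n E 1 w1" and is_omega_w2: "is_omega_n E 2 w2"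
proof -
  show 1: "is_omega_n E 1 w1"
    using hart_cardinal[of om] hart_less[OF ord_om] by (simp add: w1_def)
  have "is_omega_n E (Suc 1) w2"
    unfolding is_omega_n.simps(2)[of E 1] w2_def
    using 1 hart_cardinal[of w1] hart_less[of w1] ord_hart[of om] by (auto simp: w1_def)
  then show "is_omega_n E 2 w2" by (simp add: numeral_2_eq_2)
qed

text \<open>Transfinite recursion takes new elements of \<open>a\<close> as long as there are any.
  It must stop before \<open>hart a\<close>, since otherwise \<open>hart a\<close> would embed into
  \<open>a\<close>.\<close>

lemma wellorder: "\<exists>b. ord b \<and> card_le E a b"
proof -
  have "isset {x \<in> el (pow a). x \<noteq> emp}" by (rule isset_sep[OF isset_el], intro dfi)
  then have e: "el (mk {x \<in> el (pow a). x \<noteq> emp}) = {x \<in> el (pow a). x \<noteq> emp}" by (rule el_mk)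
  have "\<exists>g. \<forall>x\<in>el (mk {x \<in> el (pow a). x \<noteq> emp}). app g x \<in> el x"
    by (rule pick) (unfold e, use el_empty_iff in blast)
  then obtain ch where ch: "\<And>x. el x \<subseteq> el a \<Longrightarrow> x \<noteq> emp \<Longrightarrow> app ch x \<in> el x" unfolding e by auto
  let ?r = "\<lambda>x g. mk {z \<in> el a. \<not> (\<exists>y\<in>el x. z = app g y)}"
  let ?H = "\<lambda>(u::'a) x g. if ?r x g = emp then a else app ch (?r x g)"
  have "dt E (\<lambda>s. ?H (s 0) (s 1) (s 2))" by (intro dfi)
  from rec_mem[of ?H, OF this] obtain f' where f': "dt E (\<lambda>s. f' (s 0) (s 1))"
    "\<forall>u x. f' u x = ?H u x (lam x (f' u))" by (elim exE conjE)
  define f where "f = f' emp"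
  have fn: "fn f" unfolding f_def by (rule fn_dt2[OF f'(1)])
  define r where "r x = mk {z \<in> el a. z \<notin> f ` el x}" for x
  have elr: "el (r x) = {z \<in> el a. z \<notin> f ` el x}" for x
  proof -
    have "isset {z \<in> el a. \<not> (\<exists>y\<in>el x. z = f y)}" by (rule isset_sep[OF isset_el], intro dfi fnD[OF fn])
    then show ?thesis unfolding r_def by (intro el_mk) (simp add: image_iff)
  qed
  have "?r x (lam x f) = r x" for x unfolding r_def using fn by (auto simp: image_iff intro!: arg_cong[of _ _ mk])
  then have f: "f x = (if r x = emp then a else app ch (r x))" for x
    using f'(2)[rule_format, of emp x] unfolding f_def[symmetric] by simp
  have f1: "f x \<in> el a \<and> f x \<notin> f ` el x" if "r x \<noteq> emp" for x
    using ch[of "r x"] that unfolding f[of x] elr by simp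
  have "\<exists>x\<in>el (hart a). r x = emp"
  proof (rule ccontr)
    assume n: "\<not> ?thesis"
    have "inj_on f (el (hart a))"
    proof (rule inj_onI)
      fix x y assume xy: "x \<in> el (hart a)" "y \<in> el (hart a)" "f x = f y"
      then have "x \<notin> el y" "y \<notin> el x" using f1[of x] f1[of y] n by (metis imageI)+
      then show "x = y" using ord_lin[of x y] xy(1,2) by auto
    qed
    then have "card_le E (hart a) a" by (rule card_leI[OF fn]) (use f1 n in blast)
    then show False using hart_not_le by blast
  qed
  then obtain x where x: "x \<in> el (hart a)" "r x = emp" by blast
  then have "el a \<subseteq> f ` el x" using elr[of x] by auto
  then have "card_le E a x" by (rule card_le_surj[OF fn])
  then show ?thesis using x(1) by auto
qed

lemma card_le_cprod:
  assumes "card_le E x x'" "card_le E y y'" shows "card_le E (cprod x y) (cprod x' y')"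
proof -
  obtain f where f: "inj_on (app f) (el x)" "app f ` el x \<subseteq> el x'" using assms(1) by (rule card_leE)
  obtain g where g: "inj_on (app g) (el y)" "app g ` el y \<subseteq> el y'" using assms(2) by (rule card_leE)
  show ?thesis
  proof (rule card_leI[of "\<lambda>z. pr (app f (p1 z)) (app g (p2 z))"])
    show "fn (\<lambda>z. pr (app f (p1 z)) (app g (p2 z)))" unfolding fn_def by (intro dfi)
  qed (use f g in \<open>auto simp: inj_on_def image_subset_iff\<close>)
qed

text \<open>The counting property \<open>\<kappa> \<times> \<kappa> \<le> \<kappa>\<close> of
  infinite cardinals, isolated from \<open>cardinal\<close>. It is proved for \<omega> and passes to
  Hartogs numbers, which gives \<omega>_1 and \<omega>_2.\<close>

definition smal :: "'a \<Rightarrow> bool" where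
  "smal k \<longleftrightarrow> ord k \<and> el om \<subseteq> el k \<and> card_le E (cprod k k) k"

text \<open>Choice supplies injections \<open>g\<close> for all members of the union at once and an
  index \<open>h x\<close> for each element \<open>x\<close>, so that elements are coded by pairs in
  \<open>k \<times> k\<close>.\<close>

lemma smal_UN:
  assumes k: "smal k" and U: "fn U" and I: "card_le E I k" and le: "\<And>i. i \<in> el I \<Longrightarrow> card_le E (U i) k"
  shows "card_le E (un (mk (U ` el I))) k"
proof -
  have e: "el (un (mk (U ` el I))) = (\<Union>i\<in>el I. el (U i))" by (simp add: U)
  have "\<exists>g. \<forall>i\<in>el I. (\<forall>x\<in>el (U i). E (app (app g i) x) k) \<and>
      (\<forall>x\<in>el (U i). \<forall>y\<in>el (U i). app (app g i) x = app (app g i) y \<longrightarrow> x = y)"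
    by (rule choice_class[of "\<lambda>i f. (\<forall>x\<in>el (U i). E (app f x) k) \<and>
      (\<forall>x\<in>el (U i). \<forall>y\<in>el (U i). app f x = app f y \<longrightarrow> x = y)"], intro dfi fnD[OF U])
       (use le in \<open>simp add: card_le_iff\<close>)
  then obtain g where g: "\<forall>i\<in>el I. (\<forall>x\<in>el (U i). E (app (app g i) x) k) \<and>
      (\<forall>x\<in>el (U i). \<forall>y\<in>el (U i). app (app g i) x = app (app g i) y \<longrightarrow> x = y)" by (elim exE)
  have "\<exists>h. \<forall>x\<in>el (un (mk (U ` el I))). app h x \<in> el I \<and> x \<in> el (U (app h x))"
    by (rule choice, intro dfi fnD[OF U]) (unfold e, blast)
  then obtain h where h: "\<forall>x\<in>el (un (mk (U ` el I))). app h x \<in> el I \<and> x \<in> el (U (app h x))" by (elim exE)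
  obtain j where j: "inj_on (app j) (el I)" "app j ` el I \<subseteq> el k" using I by (rule card_leE)
  have "card_le E (un (mk (U ` el I))) (cprod k k)"
  proof (rule card_leI[of "\<lambda>x. pr (app j (app h x)) (app (app g (app h x)) x)"])
    show "fn (\<lambda>x. pr (app j (app h x)) (app (app g (app h x)) x))" unfolding fn_def by (intro dfi)
    show "inj_on (\<lambda>x. pr (app j (app h x)) (app (app g (app h x)) x)) (el (un (mk (U ` el I))))"
    proof (rule inj_onI)
      fix x y assume xy: "x \<in> el (un (mk (U ` el I)))" "y \<in> el (un (mk (U ` el I)))"
        and eq: "pr (app j (app h x)) (app (app g (app h x)) x) = pr (app j (app h y)) (app (app g (app h y)) y)"
      have hx: "app h x \<in> el I" "x \<in> el (U (app h x))" using h xy(1) by blast+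
      have hy: "app h y \<in> el I" "y \<in> el (U (app h y))" using h xy(2) by blast+
      have "app h x = app h y" using eq hx hy j(1) by (auto simp: inj_on_def)
      then show "x = y" using eq hx hy g by auto
    qed
    show "(\<lambda>x. pr (app j (app h x)) (app (app g (app h x)) x)) ` el (un (mk (U ` el I))) \<subseteq> el (cprod k k)"
    proof (rule image_subsetI)
      fix x assume "x \<in> el (un (mk (U ` el I)))"
      then have hx: "app h x \<in> el I" "x \<in> el (U (app h x))" using h by blast+
      have "app j (app h x) \<in> el k" using j(2) hx(1) by blast
      moreover have "app (app g (app h x)) x \<in> el k"
        using bspec[OF conjunct1[OF bspec[OF g hx(1)]] hx(2)] unfolding el_iff .
      ultimately show "pr (app j (app h x)) (app (app g (app h x)) x) \<in> el (cprod k k)" by simp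
    qed
  qed
  then show ?thesis using k card_le_trans unfolding smal_def by blast
qed

lemma smal_num: "smal k \<Longrightarrow> card_le E (num n) k"
  unfolding smal_def by (rule card_le_subset) (auto simp: el_num)

lemma smal_bun: assumes k: "smal k" and "card_le E a k" "card_le E b k"
  shows "card_le E (bun a b) k"
proof -
  let ?U = "\<lambda>i. if i = emp then a else b"
  have U: "fn ?U" unfolding fn_def by (intro dfi)
  have n2: "el (num 2) = {emp, suc emp}" by (auto simp: numeral_2_eq_2)
  have "suc emp \<noteq> emp" using num_inj[of 1 0] by simp
  then have e: "el (un (mk (?U ` el (num 2)))) = el (bun a b)"
    unfolding el_un el_mk[OF isset_fn[OF U isset_el]] n2 by auto
  have "bun a b = un (mk (?U ` el (num 2)))" by (rule ext) (rule e[symmetric])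
  moreover have "card_le E (un (mk (?U ` el (num 2)))) k"
    by (rule smal_UN[OF k U smal_num[OF k]]) (use assms in simp)
  ultimately show ?thesis by simp
qed

lemma smal_suc: assumes k: "smal k" and "card_le E a k" shows "card_le E (suc a) k"
proof -
  have "card_le E (upair a a) (num 1)"
    by (rule card_leI[of "\<lambda>_. emp"]) (auto simp: fn_def intro: dt_const)
  then have "card_le E (bun a (upair a a)) k"
    using smal_bun[OF k assms(2)] card_le_trans smal_num[OF k] by blast
  then show ?thesis by (rule card_le_mono) auto
qed

text \<open>Pairs are ordered by maximum first (as in Goedel's pairing), so that initial segments are small.\<close>

lemma card_le_square:
  assumes k: "ord k" and lim: "\<And>m. m \<in> el k \<Longrightarrow> \<not> card_le E k (cprod (suc m) (suc m))"
  shows "card_le E (cprod k k) k"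
proof -
  define mx where "mx z = bun (p1 z) (p2 z)" for z
  define lt where "lt w z \<longleftrightarrow> E (mx w) (mx z) \<or> mx w = mx z \<and>
      (E (p1 w) (p1 z) \<or> p1 w = p1 z \<and> E (p2 w) (p2 z))" for w z
  define S where "S u z = mk {w \<in> el (cprod u u). lt w z}" for u z
  have Sel: "el (S u z) = {w \<in> el (cprod u u). lt w z}" for u z
    unfolding S_def by (rule el_mk, rule isset_sep[OF isset_el], unfold lt_def mx_def, intro dfi)
  have S: "dt E (\<lambda>s. S (s 0) (s 1))" unfolding S_def lt_def mx_def by (intro dfi)
  let ?e = "{(x, y). E x y}"
  have we: "Wellfounded.wf ?e" using wf by (simp add: wfp_def)
  have "Wellfounded.wf (inv_image (?e <*lex*> ?e <*lex*> ?e) (\<lambda>z. (mx z, p1 z, p2 z)))"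
    using we by (intro wf_inv_image wf_lex_prod)
  then have wlt: "wfp lt" unfolding wfp_def
    by (rule wf_subset) (auto simp: lt_def)
  have "wfp (\<lambda>y x. E y (S u x))" for u
    by (rule wfp_subset[OF wlt]) (auto simp: Sel simp flip: el_iff)
  note wfS = this
  have "dt E (\<lambda>s. mk ((\<lambda>w. app (s 2) w) ` el (S (s 0) (s 1))))" by (intro dfi dt_comp2[of E S, OF S])
  from rec_ex[of "\<lambda>u z g. mk ((\<lambda>w. app g w) ` el (S u z))" S, OF this S wfS]
  obtain f' where f': "dt E (\<lambda>s. f' (s 0) (s 1))"
    "\<forall>u z. f' u z = mk ((\<lambda>w. app (lam (S u z) (f' u)) w) ` el (S u z))" by (elim exE conjE)
  \<comment> \<open>\<open>f\<close> collapses the order \<open>lt\<close> on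
    \<open>k \<times> k\<close>: a pair is sent to the ordinal formed by the values at its
    predecessors.\<close>
  define f where "f = f' k"
  have fn: "fn f" unfolding f_def by (rule fn_dt2[OF f'(1)])
  have "(\<lambda>w. app (lam (S k z) f) w) ` el (S k z) = f ` el (S k z)" for z
    by (rule image_cong) (simp_all add: fn)
  then have elf: "el (f z) = f ` el (S k z)" for z
    using f'(2)[rule_format, of k z] fn unfolding f_def[symmetric] by simp
  have P: "el (cprod k k) = {pr x y | x y. x \<in> el k \<and> y \<in> el k}" by simp
  have mxk: "mx z \<in> el k \<and> (mx z = p1 z \<or> mx z = p2 z)" if zk: "z \<in> el (cprod k k)" for z
  proof -
    obtain x y where z: "z = pr x y" "x \<in> el k" "y \<in> el k" using zk by auto
    then have "ord x" "ord y" using ord_el[OF k] by blast+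
    then have "el x \<subseteq> el y \<or> el y \<subseteq> el x" using ord_subset_iff ord_lin by metis
    then have "bun x y = y \<or> bun x y = x" by (metis el_bun ext sup.absorb1 sup.absorb2)
    then show ?thesis using z by (auto simp: mx_def)
  qed
  have tot: "w = z \<or> lt w z \<or> lt z w" if wz: "w \<in> el (cprod k k)" "z \<in> el (cprod k k)" for w z
  proof -
    obtain x y x' y' where z: "w = pr x y" "x \<in> el k" "y \<in> el k" "z = pr x' y'" "x' \<in> el k" "y' \<in> el k"
      using wz by auto
    note L = ord_lin[OF ord_el[OF k] ord_el[OF k], unfolded el_iff]
    show ?thesis using L[of "mx w" "mx z"] L[of x x'] L[of y y'] mxk[OF that(1)] mxk[OF that(2)] z
      unfolding lt_def by (auto simp: el_iff)
  qed
  have trn: "lt v z" if "lt v w" "lt w z" "v \<in> el (cprod k k)" "w \<in> el (cprod k k)" "z \<in> el (cprod k k)" for v w z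
  proof -
    have o: "ord (mx z)" "ord (p1 z)" "ord (p2 z)" using mxk[OF that(5)] ord_el[OF k] that(5) by auto
    have t: "E a c" if "E a b" "E b c" "ord c" for a b c using ord_tr[of c b a] that by (simp add: el_iff)
    show ?thesis using that(1,2) t o unfolding lt_def by metis
  qed
  have Sk: "v \<in> el (S k z)" if "w \<in> el (S k z)" "v \<in> el (S k w)" "z \<in> el (cprod k k)" for v w z
    using that trn[of v w z] unfolding Sel by blast
  have of: "ord (f z)" if "z \<in> el (cprod k k)" for z
    using wlt that
  proof (induction z rule: wfp_induct_rule)
    case (less z)
    show ?case
    proof (rule ordI)
      fix x y assume "x \<in> el (f z)" "y \<in> el x"
      then obtain w v where "w \<in> el (S k z)" "v \<in> el (S k w)" "y = f v" unfolding elf by (metis elf imageE)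
      then show "y \<in> el (f z)" using Sk[OF _ _ less.prems] unfolding elf by blast
    next
      fix x assume "x \<in> el (f z)"
      then obtain w where "w \<in> el (S k z)" "x = f w" unfolding elf by blast
      then show "ord x" using less.IH unfolding Sel by blast
    qed
  qed
  have fk: "f z \<in> el k" if z: "z \<in> el (cprod k k)" for z
  proof (rule ccontr)
    assume n: "f z \<notin> el k"
    then have "el k \<subseteq> el (f z)" using ord_lin[OF of[OF z] k] ord_subset_iff[OF k of[OF z]] by blast
    then have "card_le E k (f z)" by (rule card_le_subset)
    moreover have "card_le E (f z) (S k z)" by (rule card_le_surj[OF fn]) (simp add: elf)
    \<comment> \<open>Predecessors of \<open>z\<close> have both coordinates at most
      \<open>mx z\<close>, so a value outside \<open>k\<close> would embed \<open>k\<close> into the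
      square of \<open>suc (mx z)\<close>, against \<open>lim\<close>.\<close>
    moreover have "el (S k z) \<subseteq> el (cprod (suc (mx z)) (suc (mx z)))"
    proof
      fix w assume w: "w \<in> el (S k z)"
      then have wk: "w \<in> el (cprod k k)" "lt w z" unfolding Sel by blast+
      have om: "ord (mx z)" "ord (mx w)" using mxk[OF z] mxk[OF wk(1)] ord_el[OF k] by blast+
      have "mx w \<in> el (mx z) \<or> mx w = mx z" using wk(2) unfolding lt_def el_iff by blast
      then have s: "el (mx w) \<subseteq> el (mx z)" using ord_subset_iff[OF om(2,1)] by blast
      obtain x y where xy: "w = pr x y" "x \<in> el k" "y \<in> el k" using wk(1) by auto
      then have oxy: "ord x" "ord y" using ord_el[OF k] by blast+
      have "el x \<subseteq> el (mx z)" "el y \<subseteq> el (mx z)" using s unfolding xy(1) mx_def by auto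
      then have "x \<in> el (suc (mx z))" "y \<in> el (suc (mx z))"
        using ord_subset_iff[OF oxy(1) om(1)] ord_subset_iff[OF oxy(2) om(1)] by auto
      then show "w \<in> el (cprod (suc (mx z)) (suc (mx z)))" unfolding xy(1) by simp
    qed
    ultimately have "card_le E k (cprod (suc (mx z)) (suc (mx z)))"
      using card_le_trans card_le_subset by blast
    then show False using lim mxk[OF z] by blast
  qed
  show ?thesis
  proof (rule card_leI[OF fn])
    show "inj_on f (el (cprod k k))"
    proof (rule inj_onI)
      fix w z assume wz: "w \<in> el (cprod k k)" "z \<in> el (cprod k k)" "f w = f z"
      have "f w \<noteq> f z" if "lt w z" "w \<in> el (cprod k k)" for w z
      proof -
        have "f w \<in> el (f z)" unfolding elf Sel using that by blast
        then show ?thesis using E_irrefl by (auto simp: el_iff)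
      qed
      then show "w = z" using tot[OF wz(1,2)] wz by metis
    qed
    show "f ` el (cprod k k) \<subseteq> el k" using fk by blast
  qed
qed

lemma smal_om: "smal om"
  unfolding smal_def
proof (intro conjI)
  show "card_le E (cprod om om) om"
  proof (rule card_le_square[OF ord_om])
    fix m assume "m \<in> el om"
    then obtain n where m: "m = num n" by auto
    have "el (cprod (suc m) (suc m)) = (\<lambda>(x, y). pr x y) ` (el (num (Suc n)) \<times> el (num (Suc n)))"
      unfolding m by auto
    then have "finite (el (cprod (suc m) (suc m)))" by (simp add: el_num)
    moreover have "infinite (el om)" unfolding el_om by (metis finite_imageD infinite_UNIV_nat inj_onI num_inj)
    ultimately show "\<not> card_le E om (cprod (suc m) (suc m))"
      by (metis card_leE finite_imageD finite_subset)
  qed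
qed (auto simp: ord_om)

lemma smal_hart: assumes k: "smal k" shows "smal (hart k)"
proof -
  have ok: "ord k" using k by (simp add: smal_def)
  have "k \<in> el (hart k)" using ok by (simp add: card_le_refl)
  then have "el k \<subseteq> el (hart k)" using ord_tr[OF ord_hart] by blast
  moreover have "card_le E (cprod (hart k) (hart k)) (hart k)"
  proof (rule card_le_square[OF ord_hart])
    fix m assume "m \<in> el (hart k)"
    then have "card_le E (suc m) k" using smal_suc[OF k] by simp
    then have "card_le E (cprod (suc m) (suc m)) k"
      using k card_le_cprod card_le_trans unfolding smal_def by blast
    then show "\<not> card_le E (hart k) (cprod (suc m) (suc m))"
      using hart_not_le card_le_trans by blast
  qed
  ultimately show ?thesis using k ord_hart unfolding smal_def by auto
qed

lemma smal_w1: "smal w1" and smal_w2: "smal w2"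
  unfolding w1_def w2_def by (intro smal_hart smal_om)+

lemma smal_cprod: "smal k \<Longrightarrow> card_le E a k \<Longrightarrow> card_le E b k \<Longrightarrow> card_le E (cprod a b) k"
  unfolding smal_def using card_le_cprod card_le_trans by blast

text \<open>The image of \<open>X\<close> in \<open>k\<close> is collapsed to an ordinal. Collapsing
  never increases an ordinal, so the result is at most \<open>k\<close>, and by minimality it is
  \<open>k\<close>; this yields the bijection that \<open>card_eq\<close> demands.\<close>

lemma card_eq_ordinal:
  assumes k: "ord k" and le: "card_le E X k" and n: "\<And>b. b \<in> el k \<Longrightarrow> \<not> card_le E X b"
  shows "card_eq E X k"
proof -
  obtain h where h: "inj_on (app h) (el X)" "app h ` el X \<subseteq> el k" using le by (rule card_leE)
  define I where "I = mk (app h ` el X)"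
  have I: "el I = app h ` el X" unfolding I_def by simp
  define S where "S u z = mk {w \<in> el z. E w u}" for u z
  have Sel: "el (S u z) = {w \<in> el z. E w u}" for u z
    unfolding S_def by (rule el_mk, rule isset_sep[OF isset_el], intro dfi)
  have S: "dt E (\<lambda>s. S (s 0) (s 1))" unfolding S_def by (intro dfi)
  have "wfp (\<lambda>y x. E y (S u x))" for u
    by (rule wfp_subset[OF wf]) (auto simp: Sel simp flip: el_iff)
  note wfS = this
  have "dt E (\<lambda>s. mk ((\<lambda>w. app (s 2) w) ` el (S (s 0) (s 1))))" by (intro dfi dt_comp2[of E S, OF S])
  from rec_ex[of "\<lambda>u z g. mk ((\<lambda>w. app g w) ` el (S u z))" S, OF this S wfS]
  obtain f' where f': "dt E (\<lambda>s. f' (s 0) (s 1))"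
    "\<forall>u z. f' u z = mk ((\<lambda>w. app (lam (S u z) (f' u)) w) ` el (S u z))" by (elim exE conjE)
  define f where "f = f' I"
  have fn: "fn f" unfolding f_def by (rule fn_dt2[OF f'(1)])
  have "(\<lambda>w. app (lam (S I z) f) w) ` el (S I z) = f ` el (S I z)" for z
    by (rule image_cong) (simp_all add: fn)
  then have elf: "el (f z) = f ` {w \<in> el z. E w I}" for z
    using f'(2)[rule_format, of I z] isset_fn[OF fn isset_el, of "S I z"] unfolding f_def[symmetric] Sel by simp
  have fo: "ord (f z) \<and> el (f z) \<subseteq> el z" if "ord z" for z
    using that
  proof (induction z rule: E_induct)
    case (1 z)
    have IH: "ord (f w)" "el (f w) \<subseteq> el w" "ord w" if "w \<in> el z" for w
      using 1 that ord_el[OF 1(2) that] by (auto simp: el_iff)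
    have "ord (f z)"
    proof (rule ordI)
      fix x y assume "x \<in> el (f z)" "y \<in> el x"
      then obtain w v where "w \<in> el z" "E w I" "v \<in> el w" "E v I" "y = f v" unfolding elf by (auto simp: elf)
      then show "y \<in> el (f z)" using ord_tr[OF 1(2)] unfolding elf by blast
    qed (use IH elf in auto)
    moreover have "f w \<in> el z" if "w \<in> el z" for w
      using IH[OF that] ord_subset_iff[of "f w" w] ord_tr[OF 1(2) that] that by auto
    ultimately show ?case using elf[of z] by auto
  qed
  define b where "b = mk (f ` el I)"
  have b: "el b = f ` el I" unfolding b_def by (simp add: fn)
  have Ik: "el I \<subseteq> el k" using h(2) I by simp
  have Io: "ord z" if "z \<in> el I" for z using that Ik ord_el[OF k] by blast
  have ob: "ord b"
  proof (rule ordI)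
    fix x y assume x: "x \<in> el b" and y: "y \<in> el x"
    obtain z where "x = f z" "z \<in> el I" using x unfolding b by blast
    then obtain w where "y = f w" "E w I" using y elf[of z] by blast
    then show "y \<in> el b" unfolding b by (auto simp: el_iff)
  qed (use fo Io b in auto)
  have fk: "f z \<in> el k" if "z \<in> el I" for z
    using fo[OF Io[OF that]] that Ik ord_subset_iff[of "f z" z] ord_tr[OF k, of z] Io[OF that] by auto
  have inj: "inj_on f (el I)"
  proof (rule inj_onI)
    fix x y assume xy: "x \<in> el I" "y \<in> el I" "f x = f y"
    have "f x \<noteq> f y" if "x \<in> el y" "x \<in> el I" for x y
    proof -
      have "f x \<in> el (f y)" using that unfolding elf el_iff by blast
      then show ?thesis using E_irrefl by (auto simp: el_iff)
    qed
    then show "x = y" using ord_lin[OF Io Io] xy by metis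
  qed
  let ?g = "\<lambda>x. f (app h x)"
  have g: "fn ?g" by (rule fn_comp[OF fn fn_app])
  have bij: "bij_betw ?g (el X) (el b)"
    using inj h(1) unfolding bij_betw_def b I by (auto simp: inj_on_def)
  have "el b \<subseteq> el k" using fk b by auto
  then have "b \<in> el k \<or> b = k" using ord_subset_iff[OF ob k] by blast
  moreover have "card_le E X b" using bij by (intro card_leI[OF g]) (auto simp: bij_betw_def)
  ultimately have "b = k" using n by blast
  then show ?thesis unfolding card_eq_def using fun_code_lam[OF g] bij by blast
qed

end

section \<open>The forcing theorem\<close>

locale forcing = zfm E for E :: "'a \<Rightarrow> 'a \<Rightarrow> bool" +
  fixes P le one :: 'a and G :: "'a set" and F :: "'a \<Rightarrow> 'a \<Rightarrow> bool" and val :: "'a \<Rightarrow> 'a"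
  assumes pre: "preorder_on (el P) (rel E le)"
    and one: "one \<in> el P" "\<And>p. p \<in> el P \<Longrightarrow> (p, one) \<in> rel E le"
    and gen: "generic_filter E P le G"
    and extF: "extensional F"
    and surj: "surj val"
    and val: "\<And>t. elts F (val t) = {val s | s. \<exists>p\<in>G. (s, p) \<in> rel E t}"
begin

definition leq :: "'a \<Rightarrow> 'a \<Rightarrow> bool" where "leq p q \<longleftrightarrow> E (pr p q) le"

lemma leq_rel: "(p, q) \<in> rel E le \<longleftrightarrow> leq p q" by (simp add: leq_def)

lemma df_leq [dfi]: "dt E f \<Longrightarrow> dt E g \<Longrightarrow> df E (\<lambda>s. leq (f s) (g s))"
  unfolding leq_def by (intro dfi)

lemma leq_P: "leq p q \<Longrightarrow> p \<in> el P \<and> q \<in> el P"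
  using pre unfolding preorder_on_def leq_rel[symmetric] by blast

lemma leq_refl: "p \<in> el P \<Longrightarrow> leq p p"
  using pre unfolding preorder_on_def leq_rel[symmetric] by (auto simp: refl_on_def)

lemma leq_trans: "leq p q \<Longrightarrow> leq q r \<Longrightarrow> leq p r"
  using pre unfolding preorder_on_def leq_rel[symmetric] by (auto dest: transD)

lemma leq_one: "p \<in> el P \<Longrightarrow> leq p one" using one(2) unfolding leq_rel by blast

lemmas gen' = gen[unfolded generic_filter_def leq_rel]

lemma G_P: "p \<in> G \<Longrightarrow> p \<in> el P"
  using gen'[THEN conjunct1] by blast

lemma G_up: "p \<in> G \<Longrightarrow> leq p q \<Longrightarrow> q \<in> G"
  using gen'[THEN conjunct2, THEN conjunct2, THEN conjunct1] leq_P[of p q] by blast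

lemma G_dir: "p \<in> G \<Longrightarrow> q \<in> G \<Longrightarrow> \<exists>r\<in>G. leq r p \<and> leq r q"
  using gen'[THEN conjunct2, THEN conjunct2, THEN conjunct2, THEN conjunct1] by blast

lemma one_G: "one \<in> G"
proof -
  obtain p where "p \<in> G" using gen'[THEN conjunct2, THEN conjunct1] by blast
  then show ?thesis using G_up leq_one G_P by blast
qed

lemma G_dense:
  assumes "df E (\<lambda>s. R (s 0))" "\<And>p. p \<in> el P \<Longrightarrow> \<exists>q. leq q p \<and> R q"
  shows "\<exists>p\<in>G. R p"
proof -
  have i: "isset {p \<in> el P. R p}" by (rule isset_sep[OF isset_el assms(1)])
  have "dense_in E P le (mk {p \<in> el P. R p})"
    unfolding dense_in_def el_mk[OF i] leq_rel using assms(2) leq_P by blast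
  then have "el (mk {p \<in> el P. R p}) \<inter> G \<noteq> {}"
    using gen'[THEN conjunct2, THEN conjunct2, THEN conjunct2, THEN conjunct2] by blast
  then show ?thesis unfolding el_mk[OF i] by blast
qed

definition mon :: "('a \<Rightarrow> bool) \<Rightarrow> bool" where
  "mon R \<longleftrightarrow> (\<forall>p q. leq q p \<longrightarrow> R p \<longrightarrow> R q)"

lemma monD: "mon R \<Longrightarrow> R p \<Longrightarrow> leq q p \<Longrightarrow> R q" by (simp add: mon_def)

definition forces_not :: "('a \<Rightarrow> bool) \<Rightarrow> 'a \<Rightarrow> bool" where
  "forces_not R p \<longleftrightarrow> p \<in> el P \<and> (\<forall>q\<in>el P. leq q p \<longrightarrow> \<not> R q)"

lemma mon_not: "mon (forces_not R)"
  unfolding mon_def forces_not_def using leq_trans leq_P by blast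

text \<open>Conditions that satisfy \<open>R\<close> or rule it out are dense, so \<open>G\<close>
  contains one; since \<open>R\<close> is monotone and \<open>G\<close> is directed, it cannot
  contain both kinds.\<close>

lemma truth_not:
  assumes d: "df E (\<lambda>s. R (s 0))" and m: "mon R"
  shows "(\<exists>p\<in>G. forces_not R p) \<longleftrightarrow> \<not> (\<exists>p\<in>G. R p)"
proof
  assume "\<exists>p\<in>G. forces_not R p"
  then show "\<not> (\<exists>p\<in>G. R p)" unfolding forces_not_def using G_dir G_P monD[OF m] by blast
next
  assume n: "\<not> (\<exists>p\<in>G. R p)"
  have "\<exists>p\<in>G. R p \<or> forces_not R p"
  proof (rule G_dense)
    show "df E (\<lambda>s. R (s 0) \<or> forces_not R (s 0))" unfolding forces_not_def
      by (intro dfi d df_comp1[of E R, OF d])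
    fix p assume p: "p \<in> el P"
    show "\<exists>q. leq q p \<and> (R q \<or> forces_not R q)"
      using leq_refl[OF p] p unfolding forces_not_def by blast
  qed
  then show "\<exists>p\<in>G. forces_not R p" using n by blast
qed

lemma valF: "F y (val t) \<longleftrightarrow> (\<exists>s p. p \<in> G \<and> E (pr s p) t \<and> y = val s)"
proof -
  have "F y (val t) \<longleftrightarrow> y \<in> elts F (val t)" by (simp add: elts_def)
  then show ?thesis unfolding val rel_iff by blast
qed

section \<open>Forcing of equality and membership\<close>

definition "dm t = mk {s \<in> el (un (un t)). \<exists>p\<in>el (un (un t)). E (pr s p) t}"

lemma el_dm: "s \<in> el (dm t) \<longleftrightarrow> (\<exists>p. E (pr s p) t)"
proof -
  have "isset {s \<in> el (un (un t)). \<exists>p\<in>el (un (un t)). E (pr s p) t}"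
    by (rule isset_sep[OF isset_el], intro dfi)
  then have "el (dm t) = {s \<in> el (un (un t)). \<exists>p\<in>el (un (un t)). E (pr s p) t}"
    unfolding dm_def by (rule el_mk)
  then have e: "s \<in> el (dm t) \<longleftrightarrow> s \<in> el (un (un t)) \<and> (\<exists>p\<in>el (un (un t)). E (pr s p) t)"
    by (simp only: mem_Collect_eq)
  have "s \<in> el (un (un t)) \<and> p \<in> el (un (un t))" if "E (pr s p) t" for p
    using pr_in_unun[OF that] by (simp only: el_iff)
  then show ?thesis unfolding e by blast
qed

lemma dt_dm [dfi]: assumes "dt E f" shows "dt E (\<lambda>s. dm (f s))"
proof -
  have "dt E (\<lambda>s. dm (s 0))" unfolding dm_def by (intro dfi)
  from dt_comp1[OF this assms] show ?thesis .
qed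

lemma dm_tranclp: "s \<in> el (dm t) \<Longrightarrow> E\<^sup>+\<^sup>+ s t"
proof -
  assume "s \<in> el (dm t)"
  then obtain p where p: "E (pr s p) t" unfolding el_dm by blast
  have "E s (upair s s)" "E (upair s s) (pr s p)" by (simp_all add: pr_def)
  then show ?thesis using p
    by (intro tranclp.trancl_into_trancl[OF tranclp.trancl_into_trancl[OF tranclp.r_into_trancl]])
qed

text \<open>The recursion passes from a pair of names to pairs from their domains; watching the
  first component is enough for termination.\<close>

lemma wf_dm: "wfp (\<lambda>w z. E\<^sup>+\<^sup>+ (p1 w) (p1 z))"
proof -
  have "wfp E\<^sup>+\<^sup>+" by (rule wfp_tranclp[OF wf])
  then have "Wellfounded.wf (inv_image {(x, y). E\<^sup>+\<^sup>+ x y} p1)"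
    by (intro wf_inv_image) (simp add: wfp_def)
  then show ?thesis by (simp add: wfp_def inv_image_def)
qed

text \<open>The recursion of Cohen's strong forcing of \<open>s \<noteq> t\<close>; \<open>R\<close> is the relation between the smaller names.\<close>

definition ne_part :: "'a \<Rightarrow> 'a \<Rightarrow> ('a \<Rightarrow> 'a \<Rightarrow> 'a \<Rightarrow> bool) \<Rightarrow> 'a \<Rightarrow> bool" where
  "ne_part s t R p \<longleftrightarrow> (\<exists>a\<in>el (dm s). \<exists>r\<in>el P. E (pr a r) s \<and> leq p r \<and>
     (\<forall>q\<in>el P. leq q p \<longrightarrow> (\<forall>b\<in>el (dm t). \<forall>u\<in>el P. E (pr b u) t \<and> leq q u \<longrightarrow>
        (\<exists>q'\<in>el P. leq q' q \<and> R q' a b))))"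

text \<open>\<open>rec_ex\<close> defines functions, so the forcing relation is obtained as the
  function that sends a pair of names to the set of conditions forcing them to differ.\<close>

lemma ne_ex: "\<exists>ne. df E (\<lambda>s. ne (s 0) (s 1) (s 2)) \<and> (\<forall>p s t. ne p s t \<longleftrightarrow> p \<in> el P \<and>
    (ne_part s t ne p \<or> ne_part t s (\<lambda>q' b a. ne q' a b) p))"
proof -
  let ?B = "\<lambda>s t g p. ne_part s t (\<lambda>q' a b. E q' (app g (pr a b))) p \<or>
     ne_part t s (\<lambda>q' b a. E q' (app g (pr a b))) p"
  let ?H = "\<lambda>(u::'a) z g. mk {p \<in> el P. ?B (p1 z) (p2 z) g p}"
  let ?S = "\<lambda>(u::'a) z. cprod (dm (p1 z)) (dm (p2 z))"
  have H: "dt E (\<lambda>s. ?H (s 0) (s 1) (s 2))" unfolding ne_part_def by (intro dfi)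
  have S: "dt E (\<lambda>s. ?S (s 0) (s 1))" by (intro dfi)
  have w: "wfp (\<lambda>y x. E y (?S u x))" for u
    by (rule wfp_subset[OF wf_dm]) (auto simp: dm_tranclp simp flip: el_iff)
  from rec_ex[of ?H ?S, OF H S w] obtain f where f: "dt E (\<lambda>s. f (s 0) (s 1))"
    "\<forall>u z. f u z = ?H u z (lam (?S u z) (f u))" by (elim exE conjE)
  have fn: "fn (f emp)" by (rule fn_dt2[OF f(1)])
  define ne where "ne p s t \<longleftrightarrow> E p (f emp (pr s t))" for p s t
  have "df E (\<lambda>s. ne (s 0) (s 1) (s 2))" unfolding ne_def by (intro dfi fnD[OF fn])
  moreover have "ne p s t \<longleftrightarrow> p \<in> el P \<and>
    (ne_part s t ne p \<or> ne_part t s (\<lambda>q' b a. ne q' a b) p)" for p s t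
  proof -
    let ?g = "lam (cprod (dm s) (dm t)) (f emp)"
    have i: "isset {p \<in> el P. ?B s t ?g p}" by (rule isset_sep[OF isset_el], unfold ne_part_def, intro dfi)
    have g: "E q (app ?g (pr a b)) \<longleftrightarrow> ne q a b" if "a \<in> el (dm s)" "b \<in> el (dm t)" for q a b
      using that fn by (simp add: ne_def)
    have "ne p s t \<longleftrightarrow> p \<in> {p \<in> el P. ?B s t ?g p}"
      unfolding ne_def f(2)[rule_format, of emp "pr s t"] p1_pr p2_pr by (rule E_mk[OF i])
    moreover have "ne_part s t (\<lambda>q' a b. E q' (app ?g (pr a b))) p \<longleftrightarrow> ne_part s t ne p"
      unfolding ne_part_def by (intro bex_cong ball_cong conj_cong imp_cong refl) (rule g)
    moreover have "ne_part t s (\<lambda>q' b a. E q' (app ?g (pr a b))) p \<longleftrightarrow> ne_part t s (\<lambda>q' b a. ne q' a b) p"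
      unfolding ne_part_def by (intro bex_cong ball_cong conj_cong imp_cong refl) (rule g)
    ultimately show ?thesis by simp
  qed
  ultimately show ?thesis by (intro exI[of _ ne]) iprover
qed

definition ne :: "'a \<Rightarrow> 'a \<Rightarrow> 'a \<Rightarrow> bool" where
  "ne = (SOME ne. df E (\<lambda>s. ne (s 0) (s 1) (s 2)) \<and> (\<forall>p s t. ne p s t \<longleftrightarrow> p \<in> el P \<and>
    (ne_part s t ne p \<or> ne_part t s (\<lambda>q' b a. ne q' a b) p)))"

lemmas ne_props = someI_ex[OF ne_ex, folded ne_def]

lemma df_ne [dfi]: "dt E f \<Longrightarrow> dt E g \<Longrightarrow> dt E h \<Longrightarrow> df E (\<lambda>s. ne (f s) (g s) (h s))"
  by (rule df_comp3[of E ne, OF conjunct1[OF ne_props]])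

lemma ne_iff: "ne p s t \<longleftrightarrow> p \<in> el P \<and> (ne_part s t ne p \<or> ne_part t s (\<lambda>q' b a. ne q' a b) p)"
  using conjunct2[OF ne_props] by blast

lemma ne_part_mono: assumes "ne_part s t R p" and q: "leq q p" shows "ne_part s t R q"
proof -
  obtain a r where a: "a \<in> el (dm s)" "r \<in> el P" "E (pr a r) s" "leq p r"
    "\<forall>q\<in>el P. leq q p \<longrightarrow> (\<forall>b\<in>el (dm t). \<forall>u\<in>el P. E (pr b u) t \<and> leq q u \<longrightarrow>
        (\<exists>q'\<in>el P. leq q' q \<and> R q' a b))"
    using assms(1) unfolding ne_part_def by (elim bexE conjE)
  have "leq q r" by (rule leq_trans[OF q a(4)])
  moreover have "leq q'' p" if "leq q'' q" for q'' by (rule leq_trans[OF that q])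
  ultimately show ?thesis unfolding ne_part_def
    by (intro bexI[OF _ a(1)] bexI[OF _ a(2)] conjI a(3)) (use a(5) in simp_all)
qed

lemma mon_ne: "mon (\<lambda>p. ne p s t)"
  unfolding mon_def using ne_iff ne_part_mono leq_P by metis

definition "eqf p s t \<longleftrightarrow> forces_not (\<lambda>q. ne q s t) p"
definition "memf p s t \<longleftrightarrow> (\<exists>b\<in>el (dm t). \<exists>u\<in>el P. E (pr b u) t \<and> leq p u \<and> eqf p s b)"

lemma df_eqf [dfi]: assumes "dt E f" "dt E g" "dt E h" shows "df E (\<lambda>s. eqf (f s) (g s) (h s))"
proof -
  have "df E (\<lambda>s. eqf (s 0) (s 1) (s 2))" unfolding eqf_def forces_not_def by (intro dfi)
  from df_comp3[of E eqf, OF this assms] show ?thesis .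
qed

lemma df_memf [dfi]: assumes "dt E f" "dt E g" "dt E h" shows "df E (\<lambda>s. memf (f s) (g s) (h s))"
proof -
  have "df E (\<lambda>s. memf (s 0) (s 1) (s 2))" unfolding memf_def by (intro dfi)
  from df_comp3[of E memf, OF this assms] show ?thesis .
qed

lemma mon_eqf: "mon (\<lambda>p. eqf p s t)" unfolding eqf_def by (rule mon_not)

lemma mon_memf: "mon (\<lambda>p. memf p s t)"
  unfolding mon_def memf_def using leq_trans monD[OF mon_eqf] by meson

text \<open>The relation \<open>R\<close> is left open because the lemma serves twice: for the
  negated inequality during the recursion and for \<open>eqf\<close> afterwards.\<close>

lemma truth_mem_aux:
  assumes "\<And>b. b \<in> el (dm t) \<Longrightarrow> (val s = val b) = (\<exists>p\<in>G. R p b)" "\<And>b. mon (\<lambda>p. R p b)"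
  shows "F (val s) (val t) \<longleftrightarrow> (\<exists>p\<in>G. \<exists>b\<in>el (dm t). \<exists>u\<in>el P. E (pr b u) t \<and> leq p u \<and> R p b)"
proof
  assume "F (val s) (val t)"
  then obtain b u where b: "u \<in> G" "E (pr b u) t" "val s = val b" unfolding valF by blast
  then have bd: "b \<in> el (dm t)" unfolding el_dm by blast
  then obtain p where p: "p \<in> G" "R p b" using assms(1) b(3) by blast
  then obtain r where r: "r \<in> G" "leq r p" "leq r u" using G_dir b(1) by blast
  have "R r b" by (rule monD[OF assms(2) p(2) r(2)])
  then show "\<exists>p\<in>G. \<exists>b\<in>el (dm t). \<exists>u\<in>el P. E (pr b u) t \<and> leq p u \<and> R p b"
    using r b bd G_P by blast
next
  assume "\<exists>p\<in>G. \<exists>b\<in>el (dm t). \<exists>u\<in>el P. E (pr b u) t \<and> leq p u \<and> R p b"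
  then obtain p b u where b: "p \<in> G" "b \<in> el (dm t)" "E (pr b u) t" "leq p u" "R p b" by blast
  then have "val s = val b" "u \<in> G" using assms(1) G_up by blast+
  then show "F (val s) (val t)" unfolding valF using b by blast
qed

lemma truth_ne_part:
  assumes d: "df E (\<lambda>s. R (s 0) (s 1) (s 2))" and m: "\<And>a b. mon (\<lambda>q. R q a b)"
    and t: "\<And>a b. a \<in> el (dm s) \<Longrightarrow> b \<in> el (dm t) \<Longrightarrow> val a \<noteq> val b \<longleftrightarrow> (\<exists>p\<in>G. R p a b)"
  shows "(\<exists>p\<in>G. ne_part s t R p) \<longleftrightarrow> \<not> elts F (val s) \<subseteq> elts F (val t)"
proof -
  \<comment> \<open>\<open>M a q\<close> is the forcing of \<open>a \<in> t\<close> computed from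
    \<open>R\<close>; \<open>ne_part\<close> then says that \<open>p\<close> forces some member of
    \<open>s\<close> to lie outside \<open>t\<close>.\<close>
  define M where "M a q \<longleftrightarrow> (\<exists>b\<in>el (dm t). \<exists>u\<in>el P. E (pr b u) t \<and> leq q u \<and> forces_not (\<lambda>q. R q a b) q)" for a q
  note dR = df_comp3[of E R, OF d]
  have dM: "df E (\<lambda>s. M a (s 0))" for a unfolding M_def forces_not_def by (intro dfi dR)
  have mM: "mon (M a)" for a
    unfolding mon_def M_def using leq_trans monD[OF mon_not] by meson
  have tM: "F (val a) (val t) \<longleftrightarrow> (\<exists>p\<in>G. M a p)" if a: "a \<in> el (dm s)" for a
    unfolding M_def
  proof (rule truth_mem_aux)
    fix b assume b: "b \<in> el (dm t)"
    have "df E (\<lambda>s. R (s 0) a b)" by (intro dR dfi)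
    from truth_not[of "\<lambda>q. R q a b", OF this m] t[OF a b]
    show "(val a = val b) = (\<exists>p\<in>G. forces_not (\<lambda>q. R q a b) p)" by blast
  qed (rule mon_not)
  have nM: "\<not> F (val a) (val t) \<longleftrightarrow> (\<exists>p\<in>G. forces_not (M a) p)" if a: "a \<in> el (dm s)" for a
    using truth_not[OF dM mM, of a] tM[OF a] by blast
  have np: "ne_part s t R p \<longleftrightarrow> (\<exists>a\<in>el (dm s). \<exists>r\<in>el P. E (pr a r) s \<and> leq p r \<and> forces_not (M a) p)"
    if p: "p \<in> el P" for p
    unfolding ne_part_def forces_not_def M_def
    by (intro bex_cong refl conj_cong) (use p in blast)
  show ?thesis
  proof
    assume "\<exists>p\<in>G. ne_part s t R p"
    then obtain p a r where a: "p \<in> G" "a \<in> el (dm s)" "E (pr a r) s" "leq p r" "forces_not (M a) p"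
      using np G_P by blast
    then have "\<not> F (val a) (val t)" "F (val a) (val s)" using nM valF G_up by blast+
    then show "\<not> elts F (val s) \<subseteq> elts F (val t)" unfolding elts_def by blast
  next
    assume "\<not> elts F (val s) \<subseteq> elts F (val t)"
    then obtain y where "F y (val s)" "\<not> F y (val t)" unfolding elts_def by blast
    then obtain a r where a: "r \<in> G" "E (pr a r) s" "\<not> F (val a) (val t)" unfolding valF[of y s] by blast
    then have ad: "a \<in> el (dm s)" unfolding el_dm by blast
    then obtain p where p: "p \<in> G" "forces_not (M a) p" using nM a by blast
    then obtain q where q: "q \<in> G" "leq q p" "leq q r" using G_dir a(1) by blast
    have "forces_not (M a) q" by (rule monD[OF mon_not p(2) q(2)])
    then have "ne_part s t R q" using np[OF G_P[OF q(1)]] ad a q G_P by blast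
    then show "\<exists>p\<in>G. ne_part s t R p" using q(1) by blast
  qed
qed

text \<open>Induction on the first name alone suffices: the second disjunct of \<open>ne_iff\<close>
  exchanges the two names, but its recursive calls still take their first argument from the domain
  of \<open>s\<close>.\<close>

lemma truth_ne: "val s \<noteq> val t \<longleftrightarrow> (\<exists>p\<in>G. ne p s t)"
proof -
  have "wfp E\<^sup>+\<^sup>+" by (rule wfp_tranclp[OF wf])
  then show ?thesis
  proof (induction s arbitrary: t rule: wfp_induct_rule)
    case (less s)
    have IH: "val a \<noteq> val b \<longleftrightarrow> (\<exists>p\<in>G. ne p a b)" if "a \<in> el (dm s)" for a b
      using less dm_tranclp that by blast
    have IH': "val b \<noteq> val a \<longleftrightarrow> (\<exists>p\<in>G. ne p a b)" if "a \<in> el (dm s)" for a b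
      using IH[OF that, of b] by (metis (no_types))
    have d: "df E (\<lambda>s. ne (s 0) (s 1) (s 2))" "df E (\<lambda>s. ne (s 0) (s 2) (s 1))" by (intro dfi)+
    have "(\<exists>p\<in>G. ne_part s t ne p) \<longleftrightarrow> \<not> elts F (val s) \<subseteq> elts F (val t)"
      by (rule truth_ne_part[OF d(1) mon_ne]) (rule IH)
    moreover have "(\<exists>p\<in>G. ne_part t s (\<lambda>q' b a. ne q' a b) p) \<longleftrightarrow> \<not> elts F (val t) \<subseteq> elts F (val s)"
      by (rule truth_ne_part[of "\<lambda>q' b a. ne q' a b", OF d(2) mon_ne]) (rule IH')
    moreover have "val s \<noteq> val t \<longleftrightarrow> \<not> elts F (val s) \<subseteq> elts F (val t) \<or> \<not> elts F (val t) \<subseteq> elts F (val s)"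
      using extF[unfolded extensional_def, rule_format, of "val s" "val t"] by auto
    ultimately show ?case unfolding ne_iff[of _ s t] using G_P by blast
  qed
qed

lemma truth_eq: "val s = val t \<longleftrightarrow> (\<exists>p\<in>G. eqf p s t)"
proof -
  have "df E (\<lambda>x. ne (x 0) s t)" by (intro dfi)
  from truth_not[OF this mon_ne] truth_ne[of s t] show ?thesis unfolding eqf_def by blast
qed

lemma truth_mem: "F (val s) (val t) \<longleftrightarrow> (\<exists>p\<in>G. memf p s t)"
  unfolding memf_def by (rule truth_mem_aux[OF truth_eq mon_eqf])

text \<open>
  Only three properties of the forcing relation \<open>R\<close> of a formula \<open>Q\<close> are ever used: it is
  definable in the ground model, it is monotone, and \<open>Q\<close> holds iff some condition in \<open>G\<close> forces it.
\<close>

definition FT :: "('a \<Rightarrow> (nat \<Rightarrow> 'a) \<Rightarrow> bool) \<Rightarrow> ((nat \<Rightarrow> 'a) \<Rightarrow> bool) \<Rightarrow> bool" where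
  "FT R Q \<longleftrightarrow> df E (\<lambda>s. R (s 0) (\<lambda>i. s (Suc i))) \<and> (\<forall>s. mon (\<lambda>p. R p s)) \<and>
     (\<forall>s. Q (\<lambda>i. val (s i)) \<longleftrightarrow> (\<exists>p\<in>G. R p s))"

text \<open>An existential formula counts as forced only when a single name serves as a witness.
  This gives all that \<open>FT\<close> asks for, because every element of the extension has a
  name.\<close>

lemma forcing_sat: "\<exists>R. FT R (\<lambda>s. sat F UNIV s f)"
proof (induction f)
  case (Mem i j)
  have "df E (\<lambda>s. memf (s 0) (s (Suc i)) (s (Suc j)))" by (intro dfi)
  then show ?case unfolding FT_def
    by (intro exI[of _ "\<lambda>p s. memf p (s i) (s j)"]) (simp add: truth_mem mon_memf)
next
  case (Equal i j)
  have "df E (\<lambda>s. eqf (s 0) (s (Suc i)) (s (Suc j)))" by (intro dfi)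
  then show ?case unfolding FT_def
    by (intro exI[of _ "\<lambda>p s. eqf p (s i) (s j)"]) (simp add: truth_eq mon_eqf)
next
  case (Neg f)
  then obtain R where R: "df E (\<lambda>s. R (s 0) (\<lambda>i. s (Suc i)))" "\<forall>s. mon (\<lambda>p. R p s)"
    "\<forall>s. sat F UNIV (\<lambda>i. val (s i)) f \<longleftrightarrow> (\<exists>p\<in>G. R p s)" unfolding FT_def by blast
  have "df E (\<lambda>s. forces_not (\<lambda>q. R q (\<lambda>i. s (Suc i))) (s 0))"
    unfolding forces_not_def
    by (intro dfi) (use df_ren[OF R(1), of "case_nat 0 (\<lambda>i. Suc (Suc i))"] in simp)
  moreover have "(\<exists>p\<in>G. forces_not (\<lambda>q. R q s) p) \<longleftrightarrow> \<not> (\<exists>p\<in>G. R p s)" for s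
    by (rule truth_not[OF df_inst1[OF R(1)]]) (use R(2) in blast)
  ultimately have "FT (\<lambda>p s. forces_not (\<lambda>q. R q s) p) (\<lambda>s. sat F UNIV s (Neg f))"
    unfolding FT_def using mon_not R(3) by simp
  then show ?case by blast
next
  case (Conj f g)
  then obtain R where R: "df E (\<lambda>s. R (s 0) (\<lambda>i. s (Suc i)))" "\<forall>s. mon (\<lambda>p. R p s)"
    "\<forall>s. sat F UNIV (\<lambda>i. val (s i)) f \<longleftrightarrow> (\<exists>p\<in>G. R p s)" unfolding FT_def by blast
  obtain Q where Q: "df E (\<lambda>s. Q (s 0) (\<lambda>i. s (Suc i)))" "\<forall>s. mon (\<lambda>p. Q p s)"
    "\<forall>s. sat F UNIV (\<lambda>i. val (s i)) g \<longleftrightarrow> (\<exists>p\<in>G. Q p s)" using Conj unfolding FT_def by blast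
  have "mon (\<lambda>p. R p s \<and> Q p s)" for s using R(2) Q(2) unfolding mon_def by blast
  moreover have "(\<exists>p\<in>G. R p s) \<and> (\<exists>p\<in>G. Q p s) \<longleftrightarrow> (\<exists>p\<in>G. R p s \<and> Q p s)" for s
    using G_dir R(2) Q(2) unfolding mon_def by meson
  ultimately have "FT (\<lambda>p s. R p s \<and> Q p s) (\<lambda>s. sat F UNIV s (Conj f g))"
    unfolding FT_def using R(3) Q(3) df_conj[OF R(1) Q(1)] by simp
  then show ?case by blast
next
  case (Exists f)
  then obtain R where R: "df E (\<lambda>s. R (s 0) (\<lambda>i. s (Suc i)))" "\<forall>s. mon (\<lambda>p. R p s)"
    "\<forall>s. sat F UNIV (\<lambda>i. val (s i)) f \<longleftrightarrow> (\<exists>p\<in>G. R p s)" unfolding FT_def by blast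
  have c: "(\<lambda>i. s (case_nat 0 (\<lambda>i. Suc (Suc i)) i)) = case_nat (s 0) (\<lambda>i. s (Suc (Suc i)))" for s :: "nat \<Rightarrow> 'a"
    by (rule HOL.ext) (simp split: nat.split)
  have "df E (\<lambda>s. \<exists>x. R (s 0) (case_nat x (\<lambda>i. s (Suc i))))"
    by (rule df_ex) (use df_ren[OF R(1), of "case_nat 1 (case_nat 0 (\<lambda>i. Suc (Suc i)))"] in \<open>simp add: c\<close>)
  moreover have "mon (\<lambda>p. \<exists>x. R p (case_nat x s))" for s using R(2) unfolding mon_def by blast
  moreover have "(\<exists>x. sat F UNIV (case_nat x (\<lambda>i. val (s i))) f) \<longleftrightarrow> (\<exists>p\<in>G. \<exists>x. R p (case_nat x s))" for s
  proof -
    have e: "(\<lambda>i. val (case_nat x s i)) = case_nat (val x) (\<lambda>i. val (s i))" for x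
      by (rule HOL.ext) (simp split: nat.split)
    have "(\<exists>x. sat F UNIV (case_nat x (\<lambda>i. val (s i))) f) \<longleftrightarrow> (\<exists>x. sat F UNIV (case_nat (val x) (\<lambda>i. val (s i))) f)"
      using surj by (metis surjD)
    also have "\<dots> \<longleftrightarrow> (\<exists>x. \<exists>p\<in>G. R p (case_nat x s))" unfolding e[symmetric] using R(3) by blast
    finally show ?thesis by blast
  qed
  ultimately have "FT (\<lambda>p s. \<exists>x. R p (case_nat x s)) (\<lambda>s. sat F UNIV s (Exists f))"
    unfolding FT_def by simp
  then show ?case by blast
qed

theorem forcing_theorem: assumes "df F Q" shows "\<exists>R. FT R Q"
proof -
  obtain f t where t: "\<forall>s. Q s \<longleftrightarrow> sat F UNIV (mix s t) f"
    using assms unfolding df_def dfn_def by (elim exE conjE)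
  obtain t' where t': "t = (\<lambda>i. val (t' i))" using surj by (metis surj_def)
  obtain R where R: "df E (\<lambda>s. R (s 0) (\<lambda>i. s (Suc i)))" "\<forall>s. mon (\<lambda>p. R p s)"
    "\<forall>s. sat F UNIV (\<lambda>i. val (s i)) f \<longleftrightarrow> (\<exists>p\<in>G. R p s)" using forcing_sat[of f] unfolding FT_def by blast
  have v: "(\<lambda>i. val (mix s t' i)) = mix (\<lambda>i. val (s i)) t" for s
    by (rule HOL.ext) (simp add: mix_def t')
  let ?m = "case_nat (Inl 0) (\<lambda>n. if even n then Inl (Suc (n div 2)) else Inr (t' (n div 2)))"
  have "(\<lambda>i. case ?m (Suc i) of Inl j \<Rightarrow> s j | Inr c \<Rightarrow> c) = mix (\<lambda>i. s (Suc i)) t'" for s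
    by (rule HOL.ext) (simp add: mix_def)
  then have "df E (\<lambda>s. R (s 0) (mix (\<lambda>i. s (Suc i)) t'))"
    using dfn_inst[OF R(1)[unfolded df_def], of ?m] unfolding df_def by simp
  then have "FT (\<lambda>p s. R p (mix s t')) Q" unfolding FT_def using R(2,3) t v by metis
  then show ?thesis by blast
qed

lemma forcing1:
  assumes "df F (\<lambda>s. Q (s 0))"
  shows "\<exists>R. df E (\<lambda>s. R (s 0) (s 1)) \<and> (\<forall>x. mon (\<lambda>p. R p x)) \<and> (\<forall>x. Q (val x) \<longleftrightarrow> (\<exists>p\<in>G. R p x))"
proof -
  obtain R where R: "df E (\<lambda>s. R (s 0) (\<lambda>i. s (Suc i)))" "\<forall>s. mon (\<lambda>p. R p s)"
    "\<forall>s. Q (val (s 0)) \<longleftrightarrow> (\<exists>p\<in>G. R p s)" using forcing_theorem[OF assms] unfolding FT_def by blast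
  have "df E (\<lambda>s. R (s 0) (\<lambda>i. s 1))" using df_ren[OF R(1), of "case_nat 0 (\<lambda>i. 1)"] by simp
  then show ?thesis
    by (intro exI[of _ "\<lambda>p x. R p (\<lambda>_. x)"]) (use R(2,3) in auto)
qed

lemma forcing2:
  assumes "df F (\<lambda>s. Q (s 0) (s 1))"
  shows "\<exists>R. df E (\<lambda>s. R (s 0) (s 1) (s 2)) \<and> (\<forall>x y. mon (\<lambda>p. R p x y)) \<and>
    (\<forall>x y. Q (val x) (val y) \<longleftrightarrow> (\<exists>p\<in>G. R p x y))"
proof -
  obtain R where R: "df E (\<lambda>s. R (s 0) (\<lambda>i. s (Suc i)))" "\<forall>s. mon (\<lambda>p. R p s)"
    "\<forall>s. Q (val (s 0)) (val (s 1)) \<longleftrightarrow> (\<exists>p\<in>G. R p s)" using forcing_theorem[OF assms] unfolding FT_def by blast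
  have c: "(\<lambda>i. s (case i of 0 \<Rightarrow> 1 | Suc i \<Rightarrow> 2)) = case_nat (s 1) (\<lambda>_. s 2)" for s :: "nat \<Rightarrow> 'a"
    by (rule HOL.ext) (simp split: nat.split)
  have "df E (\<lambda>s. R (s 0) (case_nat (s 1) (\<lambda>_. s 2)))"
    using df_ren[OF R(1), of "case_nat 0 (case_nat 1 (\<lambda>i. 2))"] by (simp add: c del: One_nat_def)
  moreover have "Q (val x) (val y) \<longleftrightarrow> (\<exists>p\<in>G. R p (case_nat x (\<lambda>_. y)))" for x y
    using R(3)[rule_format, of "case_nat x (\<lambda>_. y)"] by simp
  ultimately show ?thesis
    by (intro exI[of _ "\<lambda>p x y. R p (case_nat x (\<lambda>_. y))"]) (use R(2) in auto)
qed

end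

section \<open>The generic extension is a model of ZFC\<close>

lemma df_sat: "df E (\<lambda>s. sat E UNIV s p)"
proof -
  have "(\<lambda>n. mix s t (2 * n)) = s" for s t :: "nat \<Rightarrow> 'a" by (rule HOL.ext) (simp add: mix_def)
  then show ?thesis unfolding df_def
    by (intro dfnI[OF subset_UNIV, where p="ren (\<lambda>n. 2 * n) p"]) (simp add: sat_ren)
qed

lemma df_sat1: "df E (\<lambda>s. sat E UNIV (case_nat (s 0) e) p)"
proof -
  have e: "(\<lambda>i. s (case_nat 0 Suc i)) = s" for s :: "nat \<Rightarrow> 'a"
    by (rule HOL.ext) (simp split: nat.split)
  have "case_nat (s 0) (\<lambda>i. s (Suc i)) = s" for s :: "nat \<Rightarrow> 'a"
    by (rule HOL.ext) (simp split: nat.split)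
  then have "df E (\<lambda>s. sat E UNIV (case_nat (s 0) (\<lambda>i. s (Suc i))) p)" by (simp add: df_sat)
  then show ?thesis by (rule df_inst1)
qed

lemma df_sat2: "df E (\<lambda>s. sat E UNIV (case_nat (s 0) (case_nat (s 1) e)) p)"
proof -
  let ?m = "case_nat (Inl 0) (case_nat (Inl (Suc 0)) (\<lambda>i. Inr (e i)))"
  have "(\<lambda>i. case ?m i of Inl j \<Rightarrow> s j | Inr c \<Rightarrow> c) = case_nat (s 0) (case_nat (s (Suc 0)) e)" for s
    by (rule HOL.ext) (simp split: nat.split)
  then show ?thesis using dfn_inst[OF df_sat[of E p, unfolded df_def], where m="?m"] unfolding df_def by simp
qed

text \<open>The definition of pairs is unfolded completely, because the lemma is applied to the
  extension before this is known to satisfy \<open>zfc\<close>, when \<open>pr\<close> is not yet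
  available for it.\<close>

lemma df_rel: assumes "dt E f" "dt E g" "dt E h" shows "df E (\<lambda>s. (f s, g s) \<in> rel E (h s))"
proof -
  have *: "(a, b) \<in> rel E r \<longleftrightarrow> (\<exists>c. (\<exists>u v. (\<forall>z. E z u \<longleftrightarrow> z = a) \<and> (\<forall>z. E z v \<longleftrightarrow> z = a \<or> z = b) \<and>
     (\<forall>z. E z c \<longleftrightarrow> z = u \<or> z = v)) \<and> E c r)" for a b r
    by (simp add: rel_def kpair_def set_eq_iff elts_def)
  have "df E (\<lambda>s. (s 0, s 1) \<in> rel E (s 2))" unfolding * by (intro dfi)
  from df_comp3[of E "\<lambda>a b r. (a, b) \<in> rel E r", OF this assms] show ?thesis .
qed

context forcing
begin

lemma extF': "elts F x = elts F y \<Longrightarrow> x = y"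
  using extF unfolding extensional_def by blast

lemma ex_name: "\<exists>t. x = val t" using surj by (metis surjD)

lemma wfF: "wfp F"
proof -
  have "\<forall>P. (\<forall>x. (\<forall>y. F y x \<longrightarrow> P y) \<longrightarrow> P x) \<longrightarrow> P (val t)" for t
    using wfp_tranclp[OF wf]
  proof (induction t rule: wfp_induct_rule)
    case (less t)
    show ?case
    proof (intro allI impI)
      fix P assume P: "\<forall>x. (\<forall>y. F y x \<longrightarrow> P y) \<longrightarrow> P x"
      have "P y" if Fy: "F y (val t)" for y
      proof -
        obtain s p where s: "E (pr s p) t" "y = val s" using Fy unfolding valF by blast
        then have "E\<^sup>+\<^sup>+ s t" by (intro dm_tranclp) (auto simp: el_dm)
        then show ?thesis using less P s(2) by blast
      qed
      then show "P (val t)" using P by blast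
    qed
  qed
  note * = this
  show ?thesis
  proof (rule wfpUNIVI)
    fix P x assume P: "\<forall>x. (\<forall>y. F y x \<longrightarrow> P y) \<longrightarrow> P x"
    obtain t where x: "x = val t" using ex_name by blast
    show "P x" unfolding x by (rule mp[OF spec[OF *] P])
  qed
qed

text \<open>The name pairs each \<open>s\<close> in the domain of \<open>t\<close> with the
  conditions that force \<open>s \<in> t\<close> and \<open>R\<close>. The bound on \<open>u\<close>
  is recorded for the power set axiom: names for all subsets are found inside one set.\<close>

lemma sep_name:
  assumes "df F (\<lambda>s. R (s 0))"
  shows "\<exists>u. el u \<subseteq> el (cprod (dm t) P) \<and> elts F (val u) = {x \<in> elts F (val t). R x}"
proof -
  have "df F (\<lambda>s. F (s 0) (val t) \<and> R (s 0))" by (intro dfi assms)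
  from forcing1[of "\<lambda>x. F x (val t) \<and> R x", OF this] obtain Q where
    Q: "df E (\<lambda>s. Q (s 0) (s 1))" "\<forall>x. F (val x) (val t) \<and> R (val x) \<longleftrightarrow> (\<exists>p\<in>G. Q p x)" by (elim exE conjE)
  let ?u = "mk {z \<in> el (cprod (dm t) P). Q (p2 z) (p1 z)}"
  have i: "isset {z \<in> el (cprod (dm t) P). Q (p2 z) (p1 z)}"
    by (rule isset_sep[OF isset_el], intro df_comp2[of E Q, OF Q(1)] dfi)
  then have u: "el ?u = {z \<in> el (cprod (dm t) P). Q (p2 z) (p1 z)}" by (rule el_mk)
  have pu: "E (pr s p) ?u \<longleftrightarrow> s \<in> el (dm t) \<and> p \<in> el P \<and> Q p s" for s p
    unfolding E_mk[OF i] by simp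
  have "F x (val ?u) \<longleftrightarrow> F x (val t) \<and> R x" for x
  proof
    assume "F x (val ?u)"
    then obtain s p where "p \<in> G" "E (pr s p) ?u" "x = val s" unfolding valF by (elim exE conjE)
    then show "F x (val t) \<and> R x" using Q(2) unfolding pu by blast
  next
    assume x: "F x (val t) \<and> R x"
    then obtain s r where s: "E (pr s r) t" "x = val s" unfolding valF by blast
    then obtain p where p: "p \<in> G" "Q p s" using x Q(2) by blast
    have "E (pr s p) ?u" unfolding pu using s p G_P by (auto simp: el_dm)
    then show "F x (val ?u)" unfolding valF using p s by blast
  qed
  then have "elts F (val ?u) = {x \<in> elts F (val t). R x}" by (simp add: elts_def)
  moreover have "el ?u \<subseteq> el (cprod (dm t) P)" unfolding u by blast
  ultimately show ?thesis by blast
qed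

lemma sepF: assumes "df F (\<lambda>s. R (s 0))" shows "\<exists>b. elts F b = {x \<in> elts F a. R x}"
proof -
  obtain t where "a = val t" using ex_name by blast
  then show ?thesis using sep_name[OF assms, of t] by blast
qed

lemma sepF_super: assumes "df F (\<lambda>s. R (s 0))" "\<And>x. R x \<Longrightarrow> F x a" shows "\<exists>b. elts F b = {x. R x}"
proof -
  have "{x \<in> elts F a. R x} = {x. R x}" using assms(2) by (auto simp: elts_def)
  then show ?thesis using sepF[OF assms(1), of a] by simp
qed

text \<open>Since \<open>one\<close> belongs to \<open>G\<close>, nothing is lost in the evaluation:
  the value is the set of the values of all members of \<open>B\<close>.\<close>

definition "nm B = mk ((\<lambda>s. pr s one) ` el B)"

lemma el_nm [simp]: "el (nm B) = (\<lambda>s. pr s one) ` el B"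
  unfolding nm_def by (rule el_mk, rule isset_img[OF isset_el], intro dfi)

lemma dt_nm [dfi]: "dt E f \<Longrightarrow> dt E (\<lambda>s. nm (f s))"
  unfolding nm_def by (intro dfi)

lemma F_nm: "F x (val (nm B)) \<longleftrightarrow> x \<in> val ` el B"
proof -
  have "pr s p \<in> el (nm B) \<longleftrightarrow> s \<in> el B \<and> p = one" for s p by auto
  then have "E (pr s p) (nm B) \<longleftrightarrow> s \<in> el B \<and> p = one" for s p by (simp only: el_iff)
  then show ?thesis unfolding valF using one_G by auto
qed

lemma eltsF_nm: "elts F (val (nm B)) = val ` el B" by (auto simp: elts_def F_nm)

definition "opn s t = nm (upair (nm (upair s s)) (nm (upair s t)))"

lemma dt_opn [dfi]: "dt E f \<Longrightarrow> dt E g \<Longrightarrow> dt E (\<lambda>s. opn (f s) (g s))"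
  unfolding opn_def by (intro dfi)

lemma kpair_opn: "kpair F (val s) (val t) c \<longleftrightarrow> c = val (opn s t)"
proof
  have u: "elts F (val (nm (upair s s))) = {val s}" "elts F (val (nm (upair s t))) = {val s, val t}" for s t
    by (simp_all add: eltsF_nm)
  have o: "elts F (val (opn s t)) = {val (nm (upair s s)), val (nm (upair s t))}"
    unfolding opn_def eltsF_nm by simp
  {
    assume "kpair F (val s) (val t) c"
    then obtain v w where vw: "elts F v = {val s}" "elts F w = {val s, val t}" "elts F c = {v, w}"
      unfolding kpair_def by blast
    then have "v = val (nm (upair s s))" "w = val (nm (upair s t))" by (intro extF', simp add: u)+
    then show "c = val (opn s t)" using vw(3) o by (intro extF') simp
  }
  assume "c = val (opn s t)" then show "kpair F (val s) (val t) c" unfolding kpair_def using u o by blast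
qed

lemma rel_opn: "(val s, val t) \<in> rel F r \<longleftrightarrow> F (val (opn s t)) r"
  by (simp add: rel_def kpair_opn)

lemma chk_ex: "\<exists>c. dt E (\<lambda>s. c (s 0)) \<and> (\<forall>x. c x = mk ((\<lambda>y. pr (c y) one) ` el x))"
proof -
  have "dt E (\<lambda>s. mk ((\<lambda>y. pr (app (s 2) y) one) ` el (s 1)))" by (intro dfi)
  from rec_mem[of "\<lambda>u x g. mk ((\<lambda>y. pr (app g y) one) ` el x)", OF this]
  obtain f where f: "dt E (\<lambda>s. f (s 0) (s 1))"
    "\<forall>u x. f u x = mk ((\<lambda>y. pr (app (lam x (f u)) y) one) ` el x)" by (elim exE conjE)
  have fn: "fn (f emp)" by (rule fn_dt2[OF f(1)])
  have "(\<lambda>y. pr (app (lam x (f emp)) y) one) ` el x = (\<lambda>y. pr (f emp y) one) ` el x" for x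
    by (rule image_cong) (simp_all add: fn)
  then have "f emp x = mk ((\<lambda>y. pr (f emp y) one) ` el x)" for x using f(2)[rule_format, of emp x] by metis
  then show ?thesis using fn unfolding fn_def by blast
qed

definition "chk = (SOME c. dt E (\<lambda>s. c (s 0)) \<and> (\<forall>x. c x = mk ((\<lambda>y. pr (c y) one) ` el x)))"

lemmas chk_props = someI_ex[OF chk_ex, folded chk_def]

lemma dt_chk [dfi]: "dt E f \<Longrightarrow> dt E (\<lambda>s. chk (f s))"
  by (rule dt_comp1[OF conjunct1[OF chk_props]])

lemma el_chk [simp]: "el (chk x) = (\<lambda>y. pr (chk y) one) ` el x"
proof -
  have "isset ((\<lambda>y. pr (chk y) one) ` el x)" by (rule isset_img[OF isset_el], intro dfi)
  then show ?thesis by (subst conjunct2[OF chk_props, rule_format]) simp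
qed

text \<open>The embedding of the ground model. The extension is another relation on the same type
  and not a superset of the model, so ground-model sets have to be transported.\<close>

definition j :: "'a \<Rightarrow> 'a" where "j x = val (chk x)"

lemma F_j: "F y (j x) \<longleftrightarrow> y \<in> j ` el x"
proof -
  have "pr s p \<in> el (chk x) \<longleftrightarrow> s \<in> chk ` el x \<and> p = one" for s p by auto
  then have "E (pr s p) (chk x) \<longleftrightarrow> s \<in> chk ` el x \<and> p = one" for s p by (simp only: el_iff)
  then show ?thesis unfolding j_def valF using one_G by auto
qed

lemma eltsF_j [simp]: "elts F (j x) = j ` el x" by (auto simp: elts_def F_j)

lemma j_inj: "j x = j y \<Longrightarrow> x = y"
proof (induction x arbitrary: y rule: E_induct)
  case (1 x)
  have e: "j ` el x = j ` el y" using 1(2) eltsF_j by metis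
  show ?case
  proof (intro ext equalityI subsetI)
    fix z assume z: "z \<in> el x"
    then obtain w where "w \<in> el y" "j z = j w" using e by blast
    then show "z \<in> el y" using 1(1)[of z w] z by (simp add: el_iff)
  next
    fix z assume z: "z \<in> el y"
    then obtain w where w: "w \<in> el x" "j w = j z" using e by (metis imageE imageI)
    then show "z \<in> el x" using 1(1)[of w z] by (simp add: el_iff)
  qed
qed

lemma F_jj [simp]: "F (j x) (j y) \<longleftrightarrow> E x y"
  by (auto simp: F_j el_iff dest!: j_inj)

lemma j_eq [simp]: "j x = j y \<longleftrightarrow> x = y" using j_inj by blast

lemma pairF: "\<exists>c. elts F c = {a, b}"
proof -
  obtain s t where "a = val s" "b = val t" using ex_name by metis
  then have "elts F (val (nm (upair s t))) = {a, b}" by (simp add: eltsF_nm)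
  then show ?thesis by blast
qed

lemma unionF: "\<exists>u. elts F u = (\<Union>x\<in>elts F a. elts F x)"
proof -
  obtain t where t: "a = val t" using ex_name by blast
  let ?B = "un (mk (dm ` el (dm t)))"
  have B: "el ?B = (\<Union>s\<in>el (dm t). el (dm s))"
  proof -
    have "isset (dm ` el (dm t))" by (rule isset_img[OF isset_el], intro dfi)
    then show ?thesis by simp
  qed
  have "\<exists>b. elts F b = {x. \<exists>y\<in>elts F a. F x y}"
  proof (rule sepF_super)
    show "df F (\<lambda>s. \<exists>y\<in>elts F a. F (s 0) y)" by (intro dfi)
    fix x assume "\<exists>y\<in>elts F a. F x y"
    then obtain s p where s: "E (pr s p) t" "F x (val s)" unfolding t elts_def valF[of _ t] by blast
    then obtain r q where "E (pr r q) s" "x = val r" unfolding valF by blast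
    moreover from this have "s \<in> el (dm t)" "r \<in> el (dm s)" using s unfolding el_dm by blast+
    ultimately show "F x (val (nm ?B))" unfolding F_nm B by blast
  qed
  moreover have "{x. \<exists>y\<in>elts F a. F x y} = (\<Union>x\<in>elts F a. elts F x)" by (auto simp: elts_def)
  ultimately show ?thesis by simp
qed

lemma powF: "\<exists>p. elts F p = {x. elts F x \<subseteq> elts F a}"
proof -
  obtain t where t: "a = val t" using ex_name by blast
  show ?thesis
  proof (rule sepF_super)
    show "df F (\<lambda>s. elts F (s 0) \<subseteq> elts F a)" by (intro dfi)
    fix x assume x: "elts F x \<subseteq> elts F a"
    have "df F (\<lambda>s. F (s 0) x)" by (intro dfi)
    from sep_name[of "\<lambda>z. F z x", OF this, of t] obtain u where
      u: "el u \<subseteq> el (cprod (dm t) P)" "elts F (val u) = {z \<in> elts F (val t). F z x}" by (elim exE conjE)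
    have "elts F (val u) = elts F x" unfolding u(2) using x t by (auto simp: elts_def)
    then have "x = val u" using extF' by metis
    then show "F x (val (nm (pow (cprod (dm t) P))))" unfolding F_nm using u(1) by auto
  qed
qed

lemma infF: "\<exists>w. (\<exists>z\<in>elts F w. elts F z = {}) \<and>
    (\<forall>x\<in>elts F w. \<exists>y\<in>elts F w. elts F y = insert x (elts F x))"
proof (intro exI[of _ "j om"] conjI)
  show "\<exists>z\<in>elts F (j om). elts F z = {}"
    by (rule bexI[of _ "j emp"]) (auto simp: image_iff intro: exI[of _ 0])
  show "\<forall>x\<in>elts F (j om). \<exists>y\<in>elts F (j om). elts F y = insert x (elts F x)"
  proof
    fix x assume "x \<in> elts F (j om)"
    then obtain n where x: "x = j (num n)" by auto
    have "j (num (Suc n)) \<in> elts F (j om)" by (simp del: num.simps)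
    moreover have "elts F (j (num (Suc n))) = insert x (elts F x)" unfolding x by simp
    ultimately show "\<exists>y\<in>elts F (j om). elts F y = insert x (elts F x)" by blast
  qed
qed

text \<open>Collection is applied in the ground model to pairs of a name \<open>s\<close> and a
  condition \<open>p\<close>: if \<open>p\<close> forces \<open>R\<close> for \<open>s\<close> and
  some name, such a name is collected. The values of the collected names contain the
  witnesses.\<close>

lemma collF:
  assumes "df F (\<lambda>s. R (s 0) (s 1))"
  shows "\<exists>b. \<forall>x\<in>elts F a. (\<exists>y. R x y) \<longrightarrow> (\<exists>y\<in>elts F b. R x y)"
proof -
  obtain t where t: "a = val t" using ex_name by blast
  obtain Q where Q: "df E (\<lambda>s. Q (s 0) (s 1) (s 2))"
    "\<forall>x y. R (val x) (val y) \<longleftrightarrow> (\<exists>p\<in>G. Q p x y)" using forcing2[OF assms] by (elim exE conjE)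
  note dQ = df_comp3[of E Q, OF Q(1)]
  have "\<exists>b. \<forall>z\<in>el (cprod (dm t) P). \<exists>u\<in>el b. Q (p2 z) (p1 z) u \<or> \<not> (\<exists>v. Q (p2 z) (p1 z) v)"
    by (rule collection[of "\<lambda>z u. Q (p2 z) (p1 z) u \<or> \<not> (\<exists>v. Q (p2 z) (p1 z) v)"], intro dfi dQ) blast
  then obtain b where b: "\<forall>z\<in>el (cprod (dm t) P). \<exists>u\<in>el b. Q (p2 z) (p1 z) u \<or> \<not> (\<exists>v. Q (p2 z) (p1 z) v)"
    by (elim exE)
  show ?thesis
  proof (intro exI[of _ "val (nm b)"] ballI impI)
    fix x assume x: "x \<in> elts F a" and "\<exists>y. R x y"
    then obtain y where y: "R x y" by blast
    obtain v where v: "y = val v" using ex_name by blast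
    obtain s r where s: "E (pr s r) t" "x = val s" using x unfolding t elts_def valF by blast
    obtain p where p: "p \<in> G" "Q p s v" using y Q(2) unfolding v s(2) by blast
    have "pr s p \<in> el (cprod (dm t) P)" using s p G_P by (auto simp: el_dm)
    from bspec[OF b this] obtain u where u: "u \<in> el b" "Q p s u" unfolding p1_pr p2_pr using p by blast
    then have "R x (val u)" using Q(2) p s by blast
    then show "\<exists>y\<in>elts F (val (nm b)). R x y" unfolding eltsF_nm using u by blast
  qed
qed

lemma replF:
  assumes "df F (\<lambda>s. R (s 0) (s 1))" "\<forall>x\<in>elts F a. \<exists>!y. R x y"
  shows "\<exists>b. elts F b = {y. \<exists>x\<in>elts F a. R x y}"
proof -
  obtain b where b: "\<forall>x\<in>elts F a. (\<exists>y. R x y) \<longrightarrow> (\<exists>y\<in>elts F b. R x y)" using collF[OF assms(1)] by blast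
  show ?thesis
  proof (rule sepF_super[of _ b])
    show "df F (\<lambda>s. \<exists>x\<in>elts F a. R x (s 0))" by (intro dfi df_comp2[of F R, OF assms(1)])
    fix y assume "\<exists>x\<in>elts F a. R x y"
    then obtain x where x: "x \<in> elts F a" "R x y" by blast
    then obtain y' where y': "y' \<in> elts F b" "R x y'" using b by blast
    have "y' = y" using assms(2) x y'(2) by blast
    then show "F y b" using y'(1) by (simp add: elts_def)
  qed
qed

text \<open>An enumeration in the ground model of the names in the domain of \<open>t\<close>
  induces, in the extension, a partial map from an ordinal whose values cover \<open>a\<close>.
  Different names may have the same value, so an element may receive several indices.\<close>

lemma enumF: "\<exists>b g. ord b \<and> (\<forall>y\<in>elts F a. \<exists>i\<in>el b. (j i, y) \<in> rel F g) \<and>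
   (\<forall>i y y'. (j i, y) \<in> rel F g \<longrightarrow> (j i, y') \<in> rel F g \<longrightarrow> y = y')"
proof -
  obtain t where t: "a = val t" using ex_name by blast
  obtain b where b: "ord b" "card_le E (dm t) b" using wellorder by blast
  obtain f where f: "inj_on (app f) (el (dm t))" "app f ` el (dm t) \<subseteq> el b" using b(2) by (rule card_leE)
  let ?B = "mk ((\<lambda>s. opn (chk (app f s)) s) ` el (dm t))"
  have B: "el ?B = (\<lambda>s. opn (chk (app f s)) s) ` el (dm t)" by (rule el_mk, rule isset_img[OF isset_el], intro dfi)
  have r: "(j i, y) \<in> rel F (val (nm ?B)) \<longleftrightarrow> (\<exists>s\<in>el (dm t). i = app f s \<and> y = val s)" for i y
  proof -
    obtain u where u: "y = val u" using ex_name by blast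
    have inj: "val (opn (chk i) u) = val (opn (chk i') s) \<longleftrightarrow> i = i' \<and> val u = val s" for i' s
    proof
      assume "val (opn (chk i) u) = val (opn (chk i') s)"
      then have "elts F (val (opn (chk i) u)) = elts F (val (opn (chk i') s))" by simp
      then have "{val (nm (upair (chk i) (chk i))), val (nm (upair (chk i) u))} =
        {val (nm (upair (chk i') (chk i'))), val (nm (upair (chk i') s))}"
        unfolding opn_def eltsF_nm by simp
      then have "{elts F (val (nm (upair (chk i) (chk i)))), elts F (val (nm (upair (chk i) u)))} =
        {elts F (val (nm (upair (chk i') (chk i')))), elts F (val (nm (upair (chk i') s)))}"
        by (auto simp: doubleton_eq_iff)
      then have "{{j i}, {j i, val u}} = {{j i'}, {j i', val s}}" by (simp add: eltsF_nm j_def)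
      then show "i = i' \<and> val u = val s" by (auto simp: doubleton_eq_iff)
    next
      assume "i = i' \<and> val u = val s"
      then have "kpair F (val (chk i)) (val u) (val (opn (chk i') s))" by (simp add: kpair_opn)
      then show "val (opn (chk i) u) = val (opn (chk i') s)" by (simp add: kpair_opn)
    qed
    show ?thesis unfolding j_def u rel_opn F_nm B image_image by (auto simp: image_iff inj)
  qed
  show ?thesis
  proof (rule exI[of _ b], rule exI[of _ "val (nm ?B)"], intro conjI b(1) ballI allI impI)
    fix y assume "y \<in> elts F a"
    then obtain s p where "E (pr s p) t" "y = val s" unfolding t elts_def valF by blast
    then have "s \<in> el (dm t)" "y = val s" unfolding el_dm by blast+
    then show "\<exists>i\<in>el b. (j i, y) \<in> rel F (val (nm ?B))" unfolding r using f(2) by blast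
  next
    fix i y y' assume "(j i, y) \<in> rel F (val (nm ?B))" "(j i, y') \<in> rel F (val (nm ?B))"
    then show "y = y'" unfolding r using inj_onD[OF f(1)] by metis
  qed
qed

text \<open>From each member the element that carries the least index under \<open>enumF\<close> is
  selected.\<close>

lemma choiceF:
  assumes "\<forall>x\<in>elts F a. elts F x \<noteq> {}" "\<forall>x\<in>elts F a. \<forall>y\<in>elts F a. x \<noteq> y \<longrightarrow> elts F x \<inter> elts F y = {}"
  shows "\<exists>c. \<forall>x\<in>elts F a. \<exists>!y. y \<in> elts F x \<and> y \<in> elts F c"
proof -
  obtain A where A: "elts F A = (\<Union>x\<in>elts F a. elts F x)" using unionF by blast
  obtain b g where b: "ord b" and g: "\<forall>y\<in>elts F A. \<exists>i\<in>el b. (j i, y) \<in> rel F g"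
    and fg: "\<forall>i y y'. (j i, y) \<in> rel F g \<longrightarrow> (j i, y') \<in> rel F g \<longrightarrow> y = y'" using enumF[of A] by (elim exE conjE)
  let ?R = "\<lambda>x y. F y x \<and> (\<exists>i\<in>elts F (j b). (i, y) \<in> rel F g \<and>
     (\<forall>y'\<in>elts F x. \<forall>i'\<in>elts F (j b). (i', y') \<in> rel F g \<longrightarrow> \<not> F i' i))"
  have "\<exists>c. elts F c = {y \<in> elts F A. \<exists>x\<in>elts F a. ?R x y}"
    by (rule sepF, intro dfi df_rel)
  then obtain c where c: "elts F c = {y \<in> elts F A. \<exists>x\<in>elts F a. ?R x y}" by (elim exE)
  show ?thesis
  proof (intro exI[of _ c] ballI)
    fix x assume x: "x \<in> elts F a"
    obtain y0 where y0: "y0 \<in> elts F x" using assms(1) x by blast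
    have xA: "elts F x \<subseteq> elts F A" using A x by blast
    obtain i0 where i0: "i0 \<in> el b" "(j i0, y0) \<in> rel F g" using g y0 xA by blast
    let ?Q = "\<lambda>i. i \<in> el b \<and> (\<exists>y\<in>elts F x. (j i, y) \<in> rel F g)"
    obtain i where i: "ord i" "?Q i" "\<forall>k\<in>el i. \<not> ?Q k"
      using ord_least[of i0 ?Q] ord_el[OF b i0(1)] i0 y0 by blast
    then obtain y where y: "y \<in> elts F x" "(j i, y) \<in> rel F g" by blast
    have "?R x y"
    proof (intro conjI bexI[of _ "j i"] ballI impI)
      fix y' i' assume y': "y' \<in> elts F x" "i' \<in> elts F (j b)" "(i', y') \<in> rel F g"
      then obtain k where k: "k \<in> el b" "i' = j k" by auto
      show "\<not> F i' (j i)"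
      proof
        assume "F i' (j i)"
        then have "k \<in> el i" unfolding k(2) by (simp add: el_iff)
        then show False using i(3) k y' by blast
      qed
    qed (use y i(2) in \<open>auto simp: elts_def\<close>)
    moreover have "y' = y" if y': "y' \<in> elts F x" "y' \<in> elts F c" for y'
    proof -
      obtain x' where x': "x' \<in> elts F a" "?R x' y'" using y'(2) c by blast
      then have "x' = x" using assms(2) x y'(1) by (auto simp: elts_def)
      then have "?R x y'" using x' by simp
      then obtain i' where i': "i' \<in> elts F (j b)" "(i', y') \<in> rel F g"
        "\<forall>y'\<in>elts F x. \<forall>k\<in>elts F (j b). (k, y') \<in> rel F g \<longrightarrow> \<not> F k i'" by blast
      then obtain k where k: "k \<in> el b" "i' = j k" by auto
      have "?Q k" using k i'(2) y' by blast
      then have "k \<notin> el i" using i(3) by blast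
      moreover have "i \<notin> el k"
      proof
        assume "i \<in> el k"
        then have "F (j i) i'" using k by (simp add: el_iff)
        then show False using i'(3) y i(2) by auto
      qed
      ultimately have "k = i" using ord_lin[OF ord_el[OF b k(1)] i(1)] by blast
      then show ?thesis using fg k(2) i'(2) y(2) by blast
    qed
    moreover have "y \<in> elts F c" unfolding c using y xA x \<open>?R x y\<close> by blast
    ultimately show "\<exists>!y. y \<in> elts F x \<and> y \<in> elts F c" using y(1) by (intro ex1I[of _ y]) blast+
  qed
qed

theorem zfcF: "zfc F"
  unfolding zfc_def
proof (intro conjI allI impI)
  show "extensional F" by (rule extF)
  fix a assume a: "elts F a \<noteq> {}"
  obtain x where "x \<in> elts F a" "\<And>y. F y x \<Longrightarrow> y \<notin> elts F a"
    using wfF a unfolding wfp_iff_ex_minimal by blast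
  then show "\<exists>x\<in>elts F a. elts F x \<inter> elts F a = {}" unfolding elts_def by blast
next
  fix f s a
  show "\<exists>b. elts F b = {x \<in> elts F a. sat F UNIV (case_nat x s) f}"
    by (rule sepF[OF df_sat1])
next
  fix f s a
  assume "\<forall>x\<in>elts F a. \<exists>!y. sat F UNIV (case_nat x (case_nat y s)) f"
  then show "\<exists>b. elts F b = {y. \<exists>x\<in>elts F a. sat F UNIV (case_nat x (case_nat y s)) f}"
    by (rule replF[OF df_sat2])
next
  fix a
  assume "(\<forall>x\<in>elts F a. elts F x \<noteq> {}) \<and> (\<forall>x\<in>elts F a. \<forall>y\<in>elts F a. x \<noteq> y \<longrightarrow> elts F x \<inter> elts F y = {})"
  then show "\<exists>c. \<forall>x\<in>elts F a. \<exists>!y. y \<in> elts F x \<and> y \<in> elts F c" by (intro choiceF) blast+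
qed (rule pairF unionF powF infF)+

end

sublocale forcing \<subseteq> M: zfm F by unfold_locales (rule zfcF wfF)+

subsection \<open>The ground model inside the extension\<close>

context forcing
begin

lemma j_emp [simp]: "j emp = M.emp" by (rule M.ext) simp

lemma j_suc [simp]: "j (suc x) = M.suc (j x)" by (rule M.ext) simp

lemma j_num [simp]: "j (num n) = M.num n" by (induction n) simp_all

lemma j_om [simp]: "j om = M.om" by (rule M.ext) (simp add: image_image)

lemma j_upair: "j (upair a b) = M.upair (j a) (j b)" by (rule M.ext) simp

lemma j_pr: "j (pr a b) = M.pr (j a) (j b)" unfolding pr_def M.pr_def j_upair by simp

lemma j_ord: assumes "ord x" shows "ordinal F (j x)"
  using assms
proof (induction x rule: E_induct)
  case (1 x)
  show ?case
  proof (rule M.ordI)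
    fix y z assume "y \<in> elts F (j x)" "z \<in> elts F y"
    then obtain a b where "a \<in> el x" "b \<in> el a" "z = j b" by auto
    then show "z \<in> elts F (j x)" using ord_tr[OF 1(2)] by auto
  next
    fix y assume "y \<in> elts F (j x)"
    then obtain a where "a \<in> el x" "y = j a" by auto
    then show "ordinal F y" using 1(1)[of a] ord_el[OF 1(2)] by (simp add: el_iff)
  qed
qed

lemma j_card_le: assumes "card_le E x y" shows "card_le F (j x) (j y)"
proof -
  obtain f where f: "inj_on (app f) (el x)" "app f ` el x \<subseteq> el y" using assms by (rule card_leE)
  let ?g = "j (lam x (app f))"
  have g: "M.app ?g (j a) = j (app f a)" if "a \<in> el x" for a
  proof (rule M.app_eq')
    show "M.pr (j a) (j (app f a)) \<in> elts F ?g" unfolding j_pr[symmetric] using that by simp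
    fix z assume "M.pr (j a) z \<in> elts F ?g"
    then obtain b where "M.pr (j a) z = j (pr b (app f b))" by auto
    then have "M.pr (j a) z = M.pr (j b) (j (app f b))" unfolding j_pr .
    then show "z = j (app f a)" by auto
  qed
  show ?thesis
  proof (rule M.card_leI[OF M.fn_app, of ?g])
    show "inj_on (M.app ?g) (elts F (j x))"
      using f(1) by (auto simp: inj_on_def g)
    show "M.app ?g ` elts F (j x) \<subseteq> elts F (j y)"
      using f(2) by (auto simp: g)
  qed
qed

subsection \<open>Forcing with the countable chain condition preserves cardinals\<close>

lemma truth_notE:
  assumes "df E (\<lambda>s. R (s 0))" "mon R" "\<not> (\<exists>p\<in>G. R p)"
  shows "\<exists>p\<in>G. forces_not R p"
  using truth_not[OF assms(1,2)] assms(3) by blast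

lemma compatible_iff: "compatible E P le p q \<longleftrightarrow> (\<exists>r\<in>el P. leq r p \<and> leq r q)"
  unfolding compatible_def leq_rel by (rule refl)

text \<open>At each argument from the ground model, different possible values of \<open>g\<close>
  are forced by incompatible conditions, so there are only countably many, and the ground model
  contains a set \<open>V x\<close> of them.\<close>

lemma ccc_approx:
  assumes ccc: "ccc_poset E P le"
  shows "\<exists>V. fn V \<and> (\<forall>x\<in>el X. card_le E (V x) om \<and>
    (\<forall>y\<in>el Y. M.app g (j x) = j y \<longrightarrow> y \<in> el (V x)))"
proof -
  have "df F (\<lambda>s. M.app g (s 0) = s 1)" by (intro dfi)
  from forcing2[of "\<lambda>x y. M.app g x = y", OF this] obtain Q where
    Q: "df E (\<lambda>s. Q (s 0) (s 1) (s 2))" "\<forall>x y. mon (\<lambda>p. Q p x y)"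
    "\<forall>x y. M.app g (val x) = val y \<longleftrightarrow> (\<exists>p\<in>G. Q p x y)" by (elim exE conjE)
  note dQ = df_comp3[of E Q, OF Q(1)]
  define R where "R p x y \<longleftrightarrow> Q p (chk x) (chk y)" for p x y
  have "df E (\<lambda>s. R (s 0) (s 1) (s 2))" unfolding R_def by (intro dfi dQ)
  note dR = df_comp3[of E R, OF this]
  have mR: "R q x y" if "R p x y" "leq q p" for p q x y
    using that Q(2) unfolding R_def mon_def by blast
  have tR: "M.app g (j x) = j y \<longleftrightarrow> (\<exists>p\<in>G. R p x y)" for x y
    using Q(3) unfolding R_def j_def by blast
  \<comment> \<open>\<open>A p\<close> says that \<open>p\<close> forces two values at one argument.
    No condition in \<open>G\<close> does, so some \<open>p0\<close> in \<open>G\<close> has no such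
    extension; below \<open>p0\<close> distinct values require incompatible conditions.\<close>
  define A where "A p \<longleftrightarrow> (\<exists>x\<in>el X. \<exists>y\<in>el Y. \<exists>y'\<in>el Y. y \<noteq> y' \<and> R p x y \<and> R p x y')" for p
  have dA: "df E (\<lambda>s. A (s 0))" unfolding A_def by (intro dfi dR)
  have mA: "mon A" unfolding mon_def A_def using mR by blast
  have nA: "\<not> (\<exists>p\<in>G. A p)"
  proof
    assume "\<exists>p\<in>G. A p"
    then obtain p x y y' where p: "p \<in> G" "y \<noteq> y'" "R p x y" "R p x y'" unfolding A_def by blast
    then have "M.app g (j x) = j y" "M.app g (j x) = j y'" using tR by blast+
    then show False using p(2) by simp
  qed
  obtain p0 where p0: "p0 \<in> G" "forces_not A p0" using truth_notE[OF dA mA nA] by blast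
  have un: "y = y'" if "leq p p0" "R p x y" "R p x y'" "x \<in> el X" "y \<in> el Y" "y' \<in> el Y" for p x y y'
    using p0(2) that leq_P[OF that(1)] unfolding forces_not_def A_def by blast
  define V where "V x = mk {y \<in> el Y. \<exists>p\<in>el P. leq p p0 \<and> R p x y}" for x
  have V: "el (V x) = {y \<in> el Y. \<exists>p\<in>el P. leq p p0 \<and> R p x y}" for x
    unfolding V_def by (rule el_mk, rule isset_sep[OF isset_el], intro dfi dR)
  have fV: "fn V" unfolding fn_def V_def by (intro dfi dR)
  have "card_le E (V x) om" if x: "x \<in> el X" for x
  proof -
    have "\<exists>c. \<forall>y\<in>el (V x). app c y \<in> el P \<and> (leq (app c y) p0 \<and> R (app c y) x y)"
      by (rule choice[of "\<lambda>y p. leq p p0 \<and> R p x y"], intro dfi dR) (unfold V, blast)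
    then obtain c where c: "\<forall>y\<in>el (V x). app c y \<in> el P \<and> (leq (app c y) p0 \<and> R (app c y) x y)"
      by (elim exE)
    let ?A = "mk (app c ` el (V x))"
    have A: "el ?A = app c ` el (V x)" by simp
    have inc: "y = y'" if r: "leq r (app c y)" "leq r (app c y')" and y: "y \<in> el (V x)" "y' \<in> el (V x)" for r y y'
    proof -
      have "leq r p0" "R r x y" "R r x y'" using c y r leq_trans mR by blast+
      then show ?thesis using un[OF _ _ _ x] y V by blast
    qed
    have "el ?A \<subseteq> el P" unfolding A using c by blast
    moreover have "\<forall>p\<in>el ?A. \<forall>q\<in>el ?A. p \<noteq> q \<longrightarrow> \<not> compatible E P le p q"
      unfolding A compatible_iff using inc by blast
    ultimately have "countable_in E ?A"
      using ccc[unfolded ccc_poset_def, THEN conjunct2, THEN conjunct2] by blast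
    then have "card_le E ?A om" by (simp add: countable_in_def card_le_omega_n_def)
    moreover have "card_le E (V x) ?A"
    proof (rule card_leI[OF fn_app])
      show "inj_on (app c) (el (V x))"
      proof (rule inj_onI)
        fix y y' assume y: "y \<in> el (V x)" "y' \<in> el (V x)" "app c y = app c y'"
        have "leq (app c y) (app c y)" using c y(1) leq_refl by blast
        then show "y = y'" using inc[OF _ _ y(1,2), of "app c y"] y(3) by simp
      qed
    qed (simp add: A)
    ultimately show ?thesis using card_le_trans by blast
  qed
  moreover have "y \<in> el (V x)" if y: "y \<in> el Y" "M.app g (j x) = j y" for x y
  proof -
    obtain p where p: "p \<in> G" "R p x y" using y(2) tR by blast
    then obtain r where r: "r \<in> G" "leq r p" "leq r p0" using G_dir p0(1) by blast
    then have "R r x y" using mR p(2) by blast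
    then show ?thesis unfolding V using r G_P y(1) by blast
  qed
  ultimately show ?thesis using fV by blast
qed

text \<open>The inverse \<open>g\<close> of an injection of \<open>K\<close> into \<open>X\<close>
  is approximated in the ground model; the countable sets \<open>V x\<close> with \<open>x\<close>
  in \<open>X\<close> then cover \<open>K\<close>, which bounds \<open>K\<close> by
  \<open>m\<close>.\<close>

lemma ccc_no_collapse:
  assumes ccc: "ccc_poset E P le" and m: "smal m" and X: "card_le E X m" and K: "\<not> card_le E K m"
  shows "\<not> card_le F (j K) (j X)"
proof
  assume "card_le F (j K) (j X)"
  then obtain f where f: "inj_on (M.app f) (elts F (j K))" "M.app f ` elts F (j K) \<subseteq> elts F (j X)"
    by (rule M.card_leE)
  define g where "g = M.mk ((\<lambda>k. M.pr (M.app f k) k) ` elts F (j K))"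
  have "M.isset ((\<lambda>k. M.pr (M.app f k) k) ` elts F (j K))" by (rule M.isset_img[OF M.isset_el], intro dfi)
  then have g: "elts F g = (\<lambda>k. M.pr (M.app f k) k) ` elts F (j K)" unfolding g_def by (rule M.el_mk)
  have gf: "M.app g (M.app f k) = k" if k: "k \<in> elts F (j K)" for k
  proof (rule M.app_eq')
    show "M.pr (M.app f k) k \<in> elts F g" unfolding g using k by blast
    fix z assume "M.pr (M.app f k) z \<in> elts F g"
    then obtain k' where "k' \<in> elts F (j K)" "M.pr (M.app f k) z = M.pr (M.app f k') k'" unfolding g by blast
    then show "z = k" using inj_onD[OF f(1)] k by auto
  qed
  obtain V where V: "fn V" "\<forall>x\<in>el X. card_le E (V x) om \<and>
    (\<forall>y\<in>el K. M.app g (j x) = j y \<longrightarrow> y \<in> el (V x))" using ccc_approx[OF ccc, of X K g] by blast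
  have "card_le E (un (mk (V ` el X))) m"
  proof (rule smal_UN[OF m V(1) X])
    fix i assume "i \<in> el X"
    moreover have "card_le E om m" using m unfolding smal_def by (intro card_le_subset) blast
    ultimately show "card_le E (V i) m" using V(2) card_le_trans by blast
  qed
  moreover have "el K \<subseteq> el (un (mk (V ` el X)))"
  proof
    fix k assume k: "k \<in> el K"
    then have "M.app f (j k) \<in> elts F (j X)" using f(2) by auto
    then obtain x where x: "x \<in> el X" "M.app f (j k) = j x" by auto
    have "M.app g (j x) = j k" unfolding x(2)[symmetric] by (rule gf) (use k in simp)
    then have "k \<in> el (V x)" using V(2) x k by blast
    then show "k \<in> el (un (mk (V ` el X)))" using x V(1) by auto
  qed
  ultimately show False using K card_le_mono by blast
qed

text \<open>The image of \<open>hart m\<close> is an ordinal at most the Hartogs number of the image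
  of \<open>m\<close>, and if it were smaller it would inject into \<open>j m\<close>.\<close>

lemma ccc_hart:
  assumes ccc: "ccc_poset E P le" and m: "smal m"
  shows "j (hart m) = M.hart (j m)"
proof -
  have o: "ordinal F (j (hart m))" by (rule j_ord[OF ord_hart])
  have "elts F (j (hart m)) \<subseteq> elts F (M.hart (j m))"
  proof
    fix x assume "x \<in> elts F (j (hart m))"
    then obtain b where b: "b \<in> el (hart m)" "x = j b" by auto
    then have "ord b" "card_le E b m" by auto
    then show "x \<in> elts F (M.hart (j m))" using j_ord j_card_le b(2) by simp
  qed
  then have "j (hart m) \<in> elts F (M.hart (j m)) \<or> j (hart m) = M.hart (j m)"
    using M.ord_subset_iff[OF o M.ord_hart] by blast
  moreover have "\<not> card_le F (j (hart m)) (j m)"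
    by (rule ccc_no_collapse[OF ccc m card_le_refl hart_not_le])
  ultimately show ?thesis by auto
qed

lemma ccc_w1: "ccc_poset E P le \<Longrightarrow> j w1 = M.w1"
  unfolding w1_def M.w1_def using ccc_hart[OF _ smal_om] by simp

lemma ccc_w2: "ccc_poset E P le \<Longrightarrow> j w2 = M.w2"
  unfolding w2_def M.w2_def using ccc_hart[OF _ smal_w1] ccc_w1 by simp

end

subsection \<open>The Cohen poset\<close>

text \<open>Induction on the size bound. Every member other than a fixed \<open>p\<close> contains
  the negation of one of the finitely many literals of \<open>p\<close>; the members with a given
  such literal, after its removal, satisfy the hypotheses for the smaller bound. This takes the
  place of a \<Delta>-system argument.\<close>

lemma finite_antichain:
  assumes "\<And>p. p \<in> A \<Longrightarrow> finite p \<and> card p \<le> n" "\<And>p l. p \<in> A \<Longrightarrow> l \<in> p \<Longrightarrow> neg l \<notin> p"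
    "\<And>p q. p \<in> A \<Longrightarrow> q \<in> A \<Longrightarrow> p \<noteq> q \<Longrightarrow> \<exists>l\<in>p. neg l \<in> q"
  shows "finite A"
  using assms
proof (induction n arbitrary: A)
  case 0
  have "p = {}" if "p \<in> A" for p using 0(1)[OF that] by (metis card_0_eq le_zero_eq)
  then have "A \<subseteq> {{}}" by blast
  then show ?case using finite_subset by blast
next
  case (Suc n)
  note fin = Suc.prems(1) and cons = Suc.prems(2) and anti = Suc.prems(3)
  show ?case
  proof (cases "A = {}")
    case False
    then obtain p where p: "p \<in> A" by blast
    have B: "finite {q \<in> A. neg l \<in> q}" for l
    proof -
      let ?f = "\<lambda>q. q - {neg l}" and ?B = "{q \<in> A. neg l \<in> q}"
      have "finite (?f ` ?B)"
      proof (rule Suc.IH)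
        fix p assume "p \<in> ?f ` ?B"
        then obtain q where q: "q \<in> A" "neg l \<in> q" "p = q - {neg l}" by blast
        then show "finite p \<and> card p \<le> n" using fin[OF q(1)] by (auto simp: card_Diff_singleton)
      next
        fix p m assume "p \<in> ?f ` ?B" "m \<in> p"
        then show "neg m \<notin> p" using cons by blast
      next
        fix p q assume pq: "p \<in> ?f ` ?B" "q \<in> ?f ` ?B" "p \<noteq> q"
        then obtain p' q' where p': "p' \<in> A" "neg l \<in> p'" "p = p' - {neg l}"
          "q' \<in> A" "neg l \<in> q'" "q = q' - {neg l}" by blast
        then have "p' \<noteq> q'" using pq(3) by blast
        then obtain m where m: "m \<in> p'" "neg m \<in> q'" using anti p' by blast
        have "m \<noteq> neg l" using cons[OF p'(4,5)] m(2) by blast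
        moreover have "neg m \<noteq> neg l" using cons[OF p'(1) m(1)] p'(2) by auto
        ultimately show "\<exists>m\<in>p. neg m \<in> q" using m p' by blast
      qed
      moreover have "inj_on ?f ?B" by (rule inj_onI) blast
      ultimately show ?thesis by (rule finite_imageD)
    qed
    have "A \<subseteq> {p} \<union> (\<Union>l\<in>p. {q \<in> A. neg l \<in> q})" using anti[OF p] by blast
    moreover have "finite ({p} \<union> (\<Union>l\<in>p. {q \<in> A. neg l \<in> q}))" using B fin[OF p] by simp
    ultimately show ?thesis by (rule finite_subset)
  qed simp
qed

context zfm
begin

definition "cidx = cprod w2 om"

definition cons :: "'a \<Rightarrow> bool" where
  "cons p \<longleftrightarrow> (\<forall>i\<in>el cidx. \<not> (E (pr i (num 0)) p \<and> E (pr i (num 1)) p))"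

text \<open>A condition is a finite consistent set of literals \<open>(i, b)\<close> with \<open>i \<in> \<omega>\<^sub>2 \<times> \<omega>\<close> and \<open>b < 2\<close>.\<close>

definition "cohP = mk {p \<in> el (pow (cprod cidx (num 2))). finite (el p) \<and> cons p}"
definition "cohle = mk {z \<in> el (cprod cohP cohP). el (p2 z) \<subseteq> el (p1 z)}"

lemma el_cohP: "p \<in> el cohP \<longleftrightarrow> el p \<subseteq> el (cprod cidx (num 2)) \<and> finite (el p) \<and> cons p"
proof -
  have "isset {p \<in> el (pow (cprod cidx (num 2))). finite (el p) \<and> cons p}"
    by (rule isset_sep[OF isset_el], unfold cons_def, intro dfi)
  then have "el cohP = {p \<in> el (pow (cprod cidx (num 2))). finite (el p) \<and> cons p}"
    unfolding cohP_def by (rule el_mk)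
  then show ?thesis by (simp only: el_pow mem_Collect_eq)
qed

lemma cohP_cons: "p \<in> el cohP \<Longrightarrow> i \<in> el cidx \<Longrightarrow> \<not> (E (pr i (num 0)) p \<and> E (pr i (num 1)) p)"
  unfolding el_cohP cons_def by blast

lemma cohle_iff: "E (pr p q) cohle \<longleftrightarrow> p \<in> el cohP \<and> q \<in> el cohP \<and> el q \<subseteq> el p"
proof -
  have "isset {z \<in> el (cprod cohP cohP). el (p2 z) \<subseteq> el (p1 z)}"
    by (rule isset_sep[OF isset_el], intro dfi)
  then show ?thesis unfolding cohle_def by simp
qed

lemma coh_compat:
  assumes p: "p \<in> el cohP" and q: "q \<in> el cohP" and c: "cons (bun p q)"
  shows "compatible E cohP cohle p q"
proof -
  have "bun p q \<in> el cohP" using p q c unfolding el_cohP by auto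
  then show ?thesis unfolding compatible_def rel_iff cohle_iff using p q
    by (intro bexI[of _ "bun p q"]) auto
qed

lemma emp_cohP: "emp \<in> el cohP" unfolding el_cohP by (simp add: cons_def)

lemma card_le_num: "card_le E x (num n) \<Longrightarrow> finite (el x) \<and> card (el x) \<le> n"
proof -
  assume "card_le E x (num n)"
  then obtain f where f: "inj_on (app f) (el x)" "app f ` el x \<subseteq> el (num n)" by (rule card_leE)
  have fin: "finite (el (num n))" and c: "card (el (num n)) = n"
    by (simp_all add: el_num card_image inj_on_def)
  show ?thesis using card_inj_on_le[OF f fin] c finite_imageD[OF finite_subset[OF f(2) fin] f(1)] by simp
qed

lemma finite_card_le_om: "finite (el x) \<Longrightarrow> card_le E x om"
  unfolding finite_iff_card using card_le_trans smal_num[OF smal_om] by auto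

lemma coh_ccc: "ccc_poset E cohP cohle"
  unfolding ccc_poset_def
proof (intro conjI allI impI)
  show "el cohP \<noteq> {}" using emp_cohP by blast
  show "partial_order_on (el cohP) (rel E cohle)"
    unfolding partial_order_on_def preorder_on_def
  proof (intro conjI)
    show "rel E cohle \<subseteq> el cohP \<times> el cohP" by (auto simp: cohle_iff)
    show "refl_on (el cohP) (rel E cohle)" by (rule refl_onI) (simp add: cohle_iff)
    show "trans (rel E cohle)" by (rule transI) (auto simp: cohle_iff)
    show "antisym (rel E cohle)" by (rule antisymI) (auto simp: cohle_iff intro!: ext)
  qed
  fix A assume "el A \<subseteq> el cohP \<and> (\<forall>p\<in>el A. \<forall>q\<in>el A. p \<noteq> q \<longrightarrow> \<not> compatible E cohP cohle p q)"
  then have AP: "el A \<subseteq> el cohP"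
    and anti: "\<And>p q. p \<in> el A \<Longrightarrow> q \<in> el A \<Longrightarrow> p \<noteq> q \<Longrightarrow> \<not> compatible E cohP cohle p q" by blast+
  \<comment> \<open>The antichain is cut into countably many pieces by the size of the conditions;
    each piece is finite by \<open>finite_antichain\<close>.\<close>
  let ?U = "\<lambda>n. mk {p \<in> el A. card_le E p n}"
  have U: "el (?U n) = {p \<in> el A. card_le E p n}" for n
    by (rule el_mk, rule isset_sep[OF isset_el], intro dfi)
  have fU: "fn ?U" unfolding fn_def by (intro dfi)
  define neg where "neg l = pr (p1 l) (if p2 l = num 0 then num 1 else num 0)" for l
  have n01: "num (Suc 0) \<noteq> num 0" by (simp del: num.simps)
  have "card_le E (?U i) om" if i: "i \<in> el om" for i
  proof -
    obtain n where n: "i = num n" using i by auto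
    have PU: "p \<in> el cohP" "card_le E p (num n)" "p \<in> el A" if "p \<in> el (?U i)" for p
      using that AP unfolding U n by blast+
    have lit: "\<exists>i\<in>el cidx. l = pr i (num 0) \<or> l = pr i (num 1)" if "p \<in> el cohP" "l \<in> el p" for p l
    proof -
      have "l \<in> el (cprod cidx (num 2))" using that unfolding el_cohP by blast
      then show ?thesis by (auto simp: numeral_2_eq_2)
    qed
    have neg: "neg (pr k (num 0)) = pr k (num 1)" "neg (pr k (num 1)) = pr k (num 0)" for k
      using n01 by (simp_all add: neg_def del: num.simps)
    have "finite (el ` el (?U i))"
    proof (rule finite_antichain[where n=n and neg=neg])
      fix p assume "p \<in> el ` el (?U i)"
      then show "finite p \<and> card p \<le> n" using PU(2) card_le_num by blast
    next
      fix p l assume "p \<in> el ` el (?U i)" and l: "l \<in> p"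
      then obtain p' where p: "p = el p'" "p' \<in> el cohP" using PU(1) by blast
      obtain k where k: "k \<in> el cidx" "l = pr k (num 0) \<or> l = pr k (num 1)" using lit p l by blast
      have "\<not> (pr k (num 0) \<in> p \<and> pr k (num 1) \<in> p)"
        using cohP_cons[OF p(2) k(1)] unfolding p(1) el_iff by blast
      then show "neg l \<notin> p" using k(2) l neg by auto
    next
      fix p q assume "p \<in> el ` el (?U i)" "q \<in> el ` el (?U i)" and pq: "p \<noteq> q"
      then obtain p' q' where p: "p = el p'" "p' \<in> el (?U i)" and q: "q = el q'" "q' \<in> el (?U i)" by blast
      have "\<not> compatible E cohP cohle p' q'" using anti PU(3)[OF p(2)] PU(3)[OF q(2)] pq p(1) q(1) by blast
      then have "\<not> cons (bun p' q')" using coh_compat PU(1)[OF p(2)] PU(1)[OF q(2)] by blast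
      then obtain k where k: "k \<in> el cidx" "E (pr k (num 0)) p' \<or> E (pr k (num 0)) q'"
        "E (pr k (num 1)) p' \<or> E (pr k (num 1)) q'" unfolding cons_def by auto
      have "\<not> (E (pr k (num 0)) p' \<and> E (pr k (num 1)) p')" "\<not> (E (pr k (num 0)) q' \<and> E (pr k (num 1)) q')"
        using cohP_cons[OF PU(1)[OF p(2)] k(1)] cohP_cons[OF PU(1)[OF q(2)] k(1)] by blast+
      then have "(E (pr k (num 0)) p' \<and> E (pr k (num 1)) q') \<or> (E (pr k (num 1)) p' \<and> E (pr k (num 0)) q')"
        using k(2,3) by blast
      then show "\<exists>l\<in>p. neg l \<in> q"
      proof
        assume "E (pr k (num 0)) p' \<and> E (pr k (num 1)) q'"
        then show ?thesis unfolding p(1) q(1) by (intro bexI[of _ "pr k (num 0)"]) (simp_all only: neg el_iff)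
      next
        assume "E (pr k (num 1)) p' \<and> E (pr k (num 0)) q'"
        then show ?thesis unfolding p(1) q(1) by (intro bexI[of _ "pr k (num 1)"]) (simp_all only: neg el_iff)
      qed
    qed
    moreover have "inj_on el (el (?U i))" by (rule inj_onI) (rule ext)
    ultimately show ?thesis using finite_imageD finite_card_le_om by blast
  qed
  then have "card_le E (un (mk (?U ` el om))) om" by (rule smal_UN[OF smal_om fU card_le_refl])
  moreover have "el A \<subseteq> el (un (mk (?U ` el om)))"
  proof
    fix p assume p: "p \<in> el A"
    then have "p \<in> el cohP" using AP by blast
    then have "\<exists>n\<in>el om. card_le E p n" unfolding el_cohP finite_iff_card by (elim conjE)
    then obtain n where n: "n \<in> el om" "card_le E p n" by (elim bexE)
    have "p \<in> el (?U n)" unfolding U using p n(2) by blast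
    moreover have "?U n \<in> el (mk (?U ` el om))"
      unfolding el_mk[OF isset_fn[OF fU isset_el]] using n(1) by (rule imageI)
    ultimately show "p \<in> el (un (mk (?U ` el om)))" unfolding el_un by (rule UN_I[rotated])
  qed
  ultimately have "card_le E A om" by (rule card_le_mono)
  then show "countable_in E A" by (simp add: countable_in_def card_le_omega_n_def)
qed

end

section \<open>The Cohen reals form a Luzin set\<close>

context forcing
begin

definition compat :: "'a \<Rightarrow> 'a \<Rightarrow> bool" where
  "compat p q \<longleftrightarrow> (\<exists>r\<in>el P. leq r p \<and> leq r q)"

lemma df_compat [dfi]: assumes "dt E f" "dt E g" shows "df E (\<lambda>s. compat (f s) (g s))"
proof -
  have "df E (\<lambda>s. compat (s 0) (s 1))" unfolding compat_def by (intro dfi)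
  from df_comp2[of E compat, OF this assms] show ?thesis .
qed

lemma compat_sym: "compat p q \<Longrightarrow> compat q p" unfolding compat_def by blast

text \<open>A greedy choice along a well-order of \<open>D\<close>, carried out by recursion so that
  the result is a set of the model.\<close>

lemma max_antichain:
  assumes D: "el D \<subseteq> el P"
  shows "\<exists>A. el A \<subseteq> el D \<and> (\<forall>p\<in>el A. \<forall>q\<in>el A. p \<noteq> q \<longrightarrow> \<not> compat p q) \<and>
    (\<forall>p\<in>el D. \<exists>q\<in>el A. compat q p)"
proof -
  obtain b where b: "ord b" "card_le E D b" using wellorder by blast
  obtain e where e: "inj_on (app e) (el D)" "app e ` el D \<subseteq> el b" using b(2) by (rule card_leE)
  define S where "S u p = mk {q \<in> el D. E (app e q) (app e p)}" for u p :: 'a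
  have S: "el (S u p) = {q \<in> el D. E (app e q) (app e p)}" for u p
    unfolding S_def by (rule el_mk, rule isset_sep[OF isset_el], intro dfi)
  have dS: "dt E (\<lambda>s. S (s 0) (s 1))" unfolding S_def by (intro dfi)
  have "wfp (\<lambda>q p. E (app e q) (app e p))"
  proof -
    have "Wellfounded.wf (inv_image {(x, y). E x y} (app e))" using wf by (intro wf_inv_image) (simp add: wfp_def)
    then show ?thesis by (simp add: wfp_def inv_image_def)
  qed
  then have wS: "wfp (\<lambda>y x. E y (S u x))" for u
    by (rule wfp_subset) (auto simp: S simp flip: el_iff)
  \<comment> \<open>Value 1 means that \<open>p\<close> is taken: no earlier taken condition is
    compatible with it.\<close>
  let ?H = "\<lambda>u p g. if \<exists>q\<in>el (S u p). app g q = num 1 \<and> compat q p then num 0 else num 1"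
  have H: "dt E (\<lambda>s. ?H (s 0) (s 1) (s 2))" by (intro dfi dt_comp2[of E S, OF dS])
  from rec_ex[of ?H S, OF H dS wS] obtain f' where f': "dt E (\<lambda>s. f' (s 0) (s 1))"
    "\<forall>u x. f' u x = ?H u x (lam (S u x) (f' u))" by (elim exE conjE)
  define f where "f = f' emp"
  have fn: "fn f" unfolding f_def by (rule fn_dt2[OF f'(1)])
  have f: "f p = (if \<exists>q\<in>el (S emp p). f q = num 1 \<and> compat q p then num 0 else num 1)" for p
  proof -
    have "(\<exists>q\<in>el (S emp p). app (lam (S emp p) f) q = num 1 \<and> compat q p) \<longleftrightarrow>
        (\<exists>q\<in>el (S emp p). f q = num 1 \<and> compat q p)"
      by (intro bex_cong refl) (simp add: fn)
    then show ?thesis using f'(2)[rule_format, of emp p] unfolding f_def[symmetric] by (simp only:)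
  qed
  define A where "A = mk {p \<in> el D. f p = num 1}"
  have A: "el A = {p \<in> el D. f p = num 1}"
    unfolding A_def by (rule el_mk, rule isset_sep[OF isset_el], intro dfi fnD[OF fn])
  have n01: "num 0 \<noteq> num 1" unfolding num_inj by simp
  have no: "\<not> compat q p" if "p \<in> el A" "q \<in> el A" "E (app e q) (app e p)" for p q
  proof
    assume c: "compat q p"
    have "q \<in> el (S emp p)" "f q = num 1" using that unfolding A S by blast+
    then have "f p = num 0" using f[of p] c by auto
    then show False using that(1) n01 unfolding A by simp
  qed
  have "\<not> compat p q" if pq: "p \<in> el A" "q \<in> el A" "p \<noteq> q" for p q
  proof -
    have pD: "p \<in> el D" "q \<in> el D" using pq A by blast+
    then have "app e p \<noteq> app e q" using inj_onD[OF e(1)] pq(3) by blast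
    moreover have "ord (app e p)" "ord (app e q)" using e(2) pD ord_el[OF b(1)] by blast+
    ultimately show ?thesis using ord_lin no pq(1,2) compat_sym unfolding el_iff by blast
  qed
  moreover have "\<exists>q\<in>el A. compat q p" if p: "p \<in> el D" for p
  proof (cases "f p = num 1")
    case True
    have "compat p p" unfolding compat_def using leq_refl D p by blast
    then show ?thesis using True p unfolding A by blast
  next
    case False
    then show ?thesis using f[of p] unfolding A S by (auto split: if_splits)
  qed
  ultimately show ?thesis using A by blast
qed

end

locale cohen = forcing E "zfm.cohP E" "zfm.cohle E" "zfm.emp E" G F val
  for E :: "'a \<Rightarrow> 'a \<Rightarrow> bool" and G F val
begin

lemma leq_iff: "leq p q \<longleftrightarrow> p \<in> el cohP \<and> q \<in> el cohP \<and> el q \<subseteq> el p"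
  unfolding leq_def by (rule cohle_iff)

lemma cohP_fin: "p \<in> el cohP \<Longrightarrow> finite (el p)" and cohP_sub: "p \<in> el cohP \<Longrightarrow> el p \<subseteq> el (cprod cidx (num 2))"
  unfolding el_cohP by blast+

lemma consI:
  assumes "\<And>i. i \<in> el cidx \<Longrightarrow> pr i (num 0) \<in> el p \<and> pr i (num 1) \<in> el p \<Longrightarrow> False" shows "cons p"
  unfolding cons_def by (intro ballI notI, rule assms, assumption, simp only: el_iff)

lemma ccc_predense:
  assumes D: "el D \<subseteq> el cohP"
  shows "\<exists>A. el A \<subseteq> el D \<and> card_le E A om \<and> (\<forall>p\<in>el D. \<exists>q\<in>el A. compat q p)"
proof -
  obtain A where A: "el A \<subseteq> el D" "\<forall>p\<in>el A. \<forall>q\<in>el A. p \<noteq> q \<longrightarrow> \<not> compat p q"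
    "\<forall>p\<in>el D. \<exists>q\<in>el A. compat q p" using max_antichain[OF D] by (elim exE conjE)
  have "\<forall>p\<in>el A. \<forall>q\<in>el A. p \<noteq> q \<longrightarrow> \<not> compatible E cohP cohle p q"
    using A(2) unfolding compatible_iff compat_def by blast
  moreover have "el A \<subseteq> el cohP" using A(1) D by blast
  ultimately have "countable_in E A"
    using coh_ccc[unfolded ccc_poset_def, THEN conjunct2, THEN conjunct2] by blast
  then have "card_le E A om" by (simp add: countable_in_def card_le_omega_n_def)
  then show ?thesis using A by blast
qed

text \<open>A name for the set of all indices to which some condition in \<open>G\<close> assigns 1;
  the Cohen reals are its columns.\<close>

definition "gname = mk {z \<in> el (cprod (mk (chk ` el cidx)) cohP).
   \<exists>i\<in>el cidx. p1 z = chk i \<and> E (pr i (num 1)) (p2 z)}"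

lemma F_gname: assumes i: "i \<in> el cidx" shows "F (j i) (val gname) \<longleftrightarrow> (\<exists>p\<in>G. E (pr i (num 1)) p)"
proof -
  have "isset (chk ` el cidx)" by (rule isset_img[OF isset_el], intro dfi)
  then have c: "el (cprod (mk (chk ` el cidx)) cohP) = {pr (chk i) p | i p. i \<in> el cidx \<and> p \<in> el cohP}"
    by auto
  have "isset {z \<in> el (cprod (mk (chk ` el cidx)) cohP). \<exists>i\<in>el cidx. p1 z = chk i \<and> E (pr i (num 1)) (p2 z)}"
    by (rule isset_sep[OF isset_el], intro dfi)
  note E_mk[OF this, folded gname_def]
  then have g: "E (pr s p) gname \<longleftrightarrow> (\<exists>i\<in>el cidx. s = chk i \<and> p \<in> el cohP \<and> E (pr i (num 1)) p)" for s p
    unfolding c by auto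
  show ?thesis
  proof
    assume "F (j i) (val gname)"
    then obtain s p where s: "p \<in> G" "E (pr s p) gname" "j i = val s" unfolding valF by blast
    then obtain k where k: "s = chk k" "E (pr k (num 1)) p" unfolding g by blast
    then have "i = k" using s(3) j_inj[of i k] unfolding j_def by blast
    then show "\<exists>p\<in>G. E (pr i (num 1)) p" using s(1) k(2) by blast
  next
    assume "\<exists>p\<in>G. E (pr i (num 1)) p"
    then obtain p where p: "p \<in> G" "E (pr i (num 1)) p" by blast
    then have "E (pr (chk i) p) gname" unfolding g using i G_P by blast
    then show "F (j i) (val gname)" unfolding valF j_def using p(1) by blast
  qed
qed

definition "creal x = M.mk {n \<in> elts F M.om. F (M.pr x n) (val gname)}"

lemma dt_creal [dfi]: assumes "dt F f" shows "dt F (\<lambda>s. creal (f s))"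
proof -
  have "dt F (\<lambda>s. creal (s 0))" unfolding creal_def by (intro dfi)
  from dt_comp1[OF this assms] show ?thesis .
qed

lemma el_creal: "elts F (creal x) = {n \<in> elts F M.om. F (M.pr x n) (val gname)}"
  unfolding creal_def by (rule M.el_mk, rule M.isset_sep[OF M.isset_el], intro dfi)

lemma creal_mem: "x \<in> el w2 \<Longrightarrow> F (M.num n) (creal (j x)) \<longleftrightarrow> (\<exists>p\<in>G. E (pr (pr x (num n)) (num 1)) p)"
proof -
  assume x: "x \<in> el w2"
  have "F (M.num n) (creal (j x)) \<longleftrightarrow> F (j (pr x (num n))) (val gname)"
    unfolding M.el_iff[symmetric, of "M.num n"] el_creal by (simp add: j_pr M.el_iff)
  also have "\<dots> \<longleftrightarrow> (\<exists>p\<in>G. E (pr (pr x (num n)) (num 1)) p)"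
    by (rule F_gname) (simp add: cidx_def x)
  finally show ?thesis .
qed

text \<open>Finite binary strings: \<open>(A, n)\<close> is the string of length \<open>n\<close>
  whose ones are at the positions in \<open>A\<close>.\<close>

definition "Str = mk {z \<in> el (cprod (pow om) om). el (p1 z) \<subseteq> el (p2 z)}"

lemma el_Str: "el Str = {pr (mk (num ` A)) (num n) | A n. A \<subseteq> {..<n}}"
proof -
  have "isset {z \<in> el (cprod (pow om) om). el (p1 z) \<subseteq> el (p2 z)}"
    by (rule isset_sep[OF isset_el], intro dfi)
  then have s: "el Str = {z \<in> el (cprod (pow om) om). el (p1 z) \<subseteq> el (p2 z)}" unfolding Str_def by (rule el_mk)
  show ?thesis
  proof (intro equalityI subsetI)
    fix z assume "z \<in> el Str"
    then obtain a n where z: "z = pr a (num n)" "el a \<subseteq> num ` {..<n}" unfolding s by (auto simp: el_num)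
    then obtain A where A: "A \<subseteq> {..<n}" "el a = num ` A" by (meson subset_imageE)
    then have "a = mk (num ` A)" using mk_el[of a] by simp
    then show "z \<in> {pr (mk (num ` A)) (num n) | A n. A \<subseteq> {..<n}}" using z A by blast
  next
    fix z assume "z \<in> {pr (mk (num ` A)) (num n) | A n. A \<subseteq> {..<n}}"
    then obtain A n where z: "z = pr (mk (num ` A)) (num n)" "A \<subseteq> {..<n}" by blast
    have "finite A" using z(2) finite_subset by blast
    then have "el (mk (num ` A)) = num ` A" by (intro el_mk isset_finite) simp
    then show "z \<in> el Str" unfolding s z(1) using z(2) by (auto simp: el_num)
  qed
qed

lemma card_Str: "card_le E Str om"
proof -
  let ?U = "\<lambda>n. mk {z \<in> el Str. p2 z = n}"
  have U: "el (?U n) = {z \<in> el Str. p2 z = n}" for n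
    by (rule el_mk, rule isset_sep[OF isset_el], intro dfi)
  have fU: "fn ?U" unfolding fn_def by (intro dfi)
  have "card_le E (?U i) om" if i: "i \<in> el om" for i
  proof (rule finite_card_le_om)
    obtain n where n: "i = num n" using i by auto
    have "el (?U i) \<subseteq> (\<lambda>A. pr (mk (num ` A)) (num n)) ` Pow {..<n}"
    proof
      fix z assume "z \<in> el (?U i)"
      then have z: "z \<in> el Str" "p2 z = i" unfolding U by blast+
      obtain A m where "z = pr (mk (num ` A)) (num m)" "A \<subseteq> {..<m}" using z(1) unfolding el_Str by blast
      then show "z \<in> (\<lambda>A. pr (mk (num ` A)) (num n)) ` Pow {..<n}" using z(2) n by auto
    qed
    then show "finite (el (?U i))" by (rule finite_subset) simp
  qed
  then have "card_le E (un (mk (?U ` el om))) om" by (rule smal_UN[OF smal_om fU card_le_refl])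
  moreover have "el Str \<subseteq> el (un (mk (?U ` el om)))"
  proof
    fix z assume z: "z \<in> el Str"
    then have "p2 z \<in> el om" unfolding el_Str by auto
    moreover have "z \<in> el (?U (p2 z))" unfolding U using z by blast
    ultimately show "z \<in> el (un (mk (?U ` el om)))"
      unfolding el_un el_mk[OF isset_fn[OF fU isset_el]] by blast
  qed
  ultimately show ?thesis by (rule card_le_mono)
qed

text \<open>A literal has the form \<open>((x, n), b)\<close>, so two first projections give the
  index of the real that it speaks about.\<close>

definition "supp p = mk ((\<lambda>l. p1 (p1 l)) ` el p)"

lemma fn_supp: "fn supp" unfolding fn_def supp_def by (intro dfi)

lemma el_supp: "el (supp p) = (\<lambda>l. p1 (p1 l)) ` el p"
  unfolding supp_def by (rule el_mk, rule isset_img[OF isset_el], intro dfi)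

text \<open>For each string a countable predense set of conditions deciding \<open>Q\<close> is
  chosen, and \<open>S\<close> collects their supports. A condition with \<open>Q\<close> is
  compatible with some chosen \<open>a\<close>, and then \<open>a\<close> cannot have decided
  against \<open>Q\<close>. The final equation says that the support of \<open>a\<close> is
  contained in \<open>S\<close>.\<close>

lemma countable_support:
  assumes Q: "df E (\<lambda>s. Q (s 0) (s 1))" and m: "\<And>z. mon (\<lambda>p. Q p z)"
  shows "\<exists>S. card_le E S om \<and> (\<forall>z\<in>el Str. \<forall>q\<in>el cohP. Q q z \<longrightarrow>
    (\<exists>a\<in>el cohP. Q a z \<and> compat a q \<and> el (supp a) \<inter> el S = el (supp a)))"
proof -
  note dQ = df_comp2[of E Q, OF Q]
  define D where "D z = mk {p \<in> el cohP. Q p z \<or> forces_not (\<lambda>p. Q p z) p}" for z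
  have D: "el (D z) = {p \<in> el cohP. Q p z \<or> forces_not (\<lambda>p. Q p z) p}" for z
    unfolding D_def by (rule el_mk, rule isset_sep[OF isset_el], unfold forces_not_def, intro dfi dQ)
  have dD: "dt E (\<lambda>s. D (s 0))" unfolding D_def forces_not_def by (intro dfi dQ)
  have "\<exists>g. \<forall>z\<in>el Str. el (app g z) \<subseteq> el (D z) \<and> card_le E (app g z) om \<and>
      (\<forall>p\<in>el (D z). \<exists>q\<in>el (app g z). compat q p)"
  proof (rule choice_class[of "\<lambda>z A. el A \<subseteq> el (D z) \<and> card_le E A om \<and>
      (\<forall>p\<in>el (D z). \<exists>q\<in>el A. compat q p)"])
    show "df E (\<lambda>s. el (s 1) \<subseteq> el (D (s 0)) \<and> card_le E (s 1) om \<and>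
      (\<forall>p\<in>el (D (s 0)). \<exists>q\<in>el (s 1). compat q p))" by (intro dfi dt_comp1[of E D, OF dD])
    show "\<exists>A. el A \<subseteq> el (D z) \<and> card_le E A om \<and> (\<forall>p\<in>el (D z). \<exists>q\<in>el A. compat q p)" for z
      by (rule ccc_predense) (unfold D, blast)
  qed
  then obtain g where g: "\<forall>z\<in>el Str. el (app g z) \<subseteq> el (D z) \<and> card_le E (app g z) om \<and>
      (\<forall>p\<in>el (D z). \<exists>q\<in>el (app g z). compat q p)" by (elim exE)
  let ?A = "un (mk (app g ` el Str))"
  let ?S = "un (mk (supp ` el ?A))"
  have A: "el ?A = (\<Union>z\<in>el Str. el (app g z))" by simp
  have S: "el ?S = (\<Union>a\<in>el ?A. el (supp a))"
    unfolding el_un[of "mk (supp ` el ?A)"] el_mk[OF isset_fn[OF fn_supp isset_el]] by blast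
  have AP: "el ?A \<subseteq> el cohP" unfolding A using g D by blast
  have "card_le E ?A om" by (rule smal_UN[OF smal_om fn_app card_Str]) (use g in blast)
  then have "card_le E ?S om"
  proof (rule smal_UN[OF smal_om fn_supp])
    fix p assume "p \<in> el ?A"
    then have "p \<in> el cohP" using AP by blast
    then have "finite (el p)" by (rule cohP_fin)
    then show "card_le E (supp p) om" by (intro finite_card_le_om) (simp add: el_supp)
  qed
  moreover have "\<exists>a\<in>el cohP. Q a z \<and> compat a q \<and> el (supp a) \<inter> el ?S = el (supp a)"
    if z: "z \<in> el Str" and q: "q \<in> el cohP" "Q q z" for z q
  proof -
    have "q \<in> el (D z)" unfolding D using q by blast
    then obtain a where a: "a \<in> el (app g z)" "compat a q" using g z by blast
    have aA: "a \<in> el ?A" unfolding A using a(1) z by blast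
    have "a \<in> el (D z)" using g z a(1) by blast
    moreover have "\<not> forces_not (\<lambda>p. Q p z) a"
    proof
      assume n: "forces_not (\<lambda>p. Q p z) a"
      obtain r where r: "r \<in> el cohP" "leq r a" "leq r q" using a(2) unfolding compat_def by blast
      then have "Q r z" using monD[OF m q(2)] by blast
      then show False using n r unfolding forces_not_def by blast
    qed
    ultimately have "a \<in> el cohP" "Q a z" unfolding D by blast+
    moreover have "el (supp a) \<subseteq> el ?S" unfolding S using aA by blast
    ultimately show ?thesis using a(2) by blast
  qed
  ultimately show ?thesis by (intro exI[of _ ?S]) blast
qed

lemma G_lit: "p \<in> G \<Longrightarrow> q \<in> G \<Longrightarrow> i \<in> el cidx \<Longrightarrow> E (pr i (num 0)) p \<Longrightarrow> \<not> E (pr i (num 1)) q"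
proof
  assume p: "p \<in> G" "q \<in> G" "i \<in> el cidx" "E (pr i (num 0)) p" "E (pr i (num 1)) q"
  then obtain r where r: "r \<in> G" "leq r p" "leq r q" using G_dir by blast
  then have "pr i (num 0) \<in> el r" "pr i (num 1) \<in> el r" using p unfolding leq_iff el_iff by (auto simp flip: el_iff)
  then show False using cohP_cons[OF G_P[OF r(1)] p(3)] unfolding el_iff by blast
qed

text \<open>The hypothesis says that \<open>B\<close> has dense interior. Forcing a cone to lie in
  \<open>B\<close> involves only a countable set \<open>S\<close> of coordinates. For
  \<open>x\<close> outside \<open>S\<close>, a condition can be replaced by one that forces the same
  and leaves the real \<open>x\<close> free, and this real can then be steered into the
  cone.\<close>

theorem luzin:
  assumes B: "\<And>k A. \<exists>k'\<ge>k. \<exists>A'. (\<forall>n<k. n \<in> A' \<longleftrightarrow> n \<in> A) \<and>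
    (\<forall>C. elts F C \<subseteq> range M.num \<longrightarrow> (\<forall>n<k'. F (M.num n) C \<longleftrightarrow> n \<in> A') \<longrightarrow> F C B)"
  shows "\<exists>S. card_le F S M.om \<and> (\<forall>x\<in>elts F M.w2. x \<notin> elts F S \<longrightarrow> F (creal x) B)"
proof -
  \<comment> \<open>\<open>N a k\<close> says that the cone of the string given by \<open>a\<close>
    below \<open>k\<close> is contained in \<open>B\<close>; \<open>R\<close> forces this for
    strings of the ground model.\<close>
  define N where "N a k \<longleftrightarrow> (\<forall>C. elts F C \<subseteq> elts F M.om \<longrightarrow> (\<forall>n\<in>elts F k. F n C \<longleftrightarrow> F n a) \<longrightarrow> F C B)" for a k
  have "df F (\<lambda>s. N (s 0) (s 1))" unfolding N_def by (intro dfi)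
  from forcing2[of N, OF this] obtain Q where
    Q: "df E (\<lambda>s. Q (s 0) (s 1) (s 2))" "\<forall>x y. mon (\<lambda>p. Q p x y)"
    "\<forall>x y. N (val x) (val y) \<longleftrightarrow> (\<exists>p\<in>G. Q p x y)" by (elim exE conjE)
  define R where "R p z = Q p (chk (p1 z)) (chk (p2 z))" for p z
  have "df E (\<lambda>s. R (s 0) (s 1))" unfolding R_def by (intro dfi df_comp3[of E Q, OF Q(1)])
  note dR0 = this and dR = df_comp2[of E R, OF this]
  have mR: "mon (\<lambda>p. R p z)" for z unfolding R_def using Q(2) by blast
  have tR: "N (j a) (j k) \<longleftrightarrow> (\<exists>p\<in>G. R p (pr a k))" for a k using Q(3) unfolding R_def j_def by simp
  obtain S where S: "card_le E S om" "\<forall>z\<in>el Str. \<forall>q\<in>el cohP. R q z \<longrightarrow>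
    (\<exists>a\<in>el cohP. R a z \<and> compat a q \<and> el (supp a) \<inter> el S = el (supp a))"
    using countable_support[OF dR0 mR] by (elim exE conjE)
  have "F (creal (j x)) B" if x: "x \<in> el w2" and xS: "x \<notin> el S" for x
  proof -
    let ?l = "\<lambda>n b. pr (pr x n) (num b)"
    have ci: "pr x (num n) \<in> el cidx" for n using x by (simp add: cidx_def)
    have lit: "?l (num n) 0 \<in> el (cprod cidx (num 2))" "?l (num n) 1 \<in> el (cprod cidx (num 2))" for n
      using ci unfolding el_cprod el_num by (auto simp del: num.simps)
    \<comment> \<open>With \<open>dec\<close>, the condition decides that the real \<open>x\<close>
      begins with the string \<open>z\<close>. A condition is bad if for some string it rules out
      that the cone of any extension is forced into \<open>B\<close>, and good if it forces such a
      cone and puts the real \<open>x\<close> into it.\<close>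
    define dec where "dec p z \<longleftrightarrow> (\<forall>n\<in>el (p2 z). (E n (p1 z) \<longrightarrow> E (?l n 1) p) \<and> (\<not> E n (p1 z) \<longrightarrow> E (?l n 0) p))" for p z
    define exts where "exts z z0 \<longleftrightarrow> el (p2 z0) \<subseteq> el (p2 z) \<and> (\<forall>n\<in>el (p2 z0). E n (p1 z) \<longleftrightarrow> E n (p1 z0))" for z z0
    define bad where "bad p \<longleftrightarrow> (\<exists>z0\<in>el Str. \<forall>z\<in>el Str. exts z z0 \<longrightarrow> forces_not (\<lambda>p. R p z) p)" for p
    define good where "good p \<longleftrightarrow> (\<exists>z\<in>el Str. R p z \<and> dec p z)" for p
    have Ea: "E (num m) (mk (num ` A)) \<longleftrightarrow> m \<in> A" if "A \<subseteq> {..<n}" for m n A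
    proof -
      have "isset (num ` A)" using that finite_subset by (intro isset_finite) blast
      then show ?thesis by auto
    qed
    have decN: "dec p (pr (mk (num ` A)) (num n)) \<longleftrightarrow>
      (\<forall>m<n. (m \<in> A \<longrightarrow> E (?l (num m) 1) p) \<and> (m \<notin> A \<longrightarrow> E (?l (num m) 0) p))" if "A \<subseteq> {..<n}" for p A n
      unfolding dec_def p1_pr p2_pr el_num using Ea[OF that] by auto
    have extN: "exts (pr (mk (num ` A)) (num n)) (pr (mk (num ` A0)) (num n0)) \<longleftrightarrow>
      n0 \<le> n \<and> (\<forall>m<n0. m \<in> A \<longleftrightarrow> m \<in> A0)" if "A \<subseteq> {..<n}" "A0 \<subseteq> {..<n0}" for A n A0 n0
    proof -
      have "num ` {..<n0} \<subseteq> num ` {..<n} \<longleftrightarrow> n0 \<le> n" by (simp add: inj_image_subset_iff inj_def)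
      then show ?thesis unfolding exts_def p1_pr p2_pr el_num using Ea[OF that(1)] Ea[OF that(2)] by auto
    qed
    have "\<exists>p\<in>G. good p \<or> bad p"
    proof (rule G_dense)
      show "df E (\<lambda>s. good (s 0) \<or> bad (s 0))"
        unfolding good_def bad_def dec_def exts_def forces_not_def by (intro dfi dR)
      fix p assume p: "p \<in> el cohP"
      have fp: "finite (el p)" by (rule cohP_fin[OF p])
      have "finite {n. ?l (num n) 0 \<in> el p \<or> ?l (num n) 1 \<in> el p}"
      proof (rule finite_subset)
        show "{n. ?l (num n) 0 \<in> el p \<or> ?l (num n) 1 \<in> el p} \<subseteq> (\<lambda>l. nt (p2 (p1 l))) ` el p"
        proof
          fix n assume "n \<in> {n. ?l (num n) 0 \<in> el p \<or> ?l (num n) 1 \<in> el p}"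
          then obtain b where "?l (num n) b \<in> el p" by blast
          then show "n \<in> (\<lambda>l. nt (p2 (p1 l))) ` el p" by (intro image_eqI[of _ _ "?l (num n) b"]) simp_all
        qed
      qed (use fp in simp)
      then obtain k where "\<forall>n\<in>{n. ?l (num n) 0 \<in> el p \<or> ?l (num n) 1 \<in> el p}. n < k"
        unfolding finite_nat_set_iff_bounded by blast
      then have k: "n < k" if "?l (num n) 0 \<in> el p \<or> ?l (num n) 1 \<in> el p" for n using that by blast
      define A where "A = {n. n < k \<and> ?l (num n) 1 \<in> el p}"
      have Ak: "A \<subseteq> {..<k}" unfolding A_def by blast
      define z0 where "z0 = pr (mk (num ` A)) (num k)"
      have z0: "z0 \<in> el Str" unfolding el_Str z0_def using Ak by blast
      show "\<exists>q. leq q p \<and> (good q \<or> bad q)"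
      proof (cases "bad p")
        case True then show ?thesis using leq_refl[OF p] by blast
      next
        case False
        \<comment> \<open>The bound \<open>k\<close> exceeds all digits of the real \<open>x\<close>
          that \<open>p\<close> mentions. The undecided digits below \<open>k\<close> are set to 0,
          so that \<open>p1'\<close> decides exactly the string \<open>z0\<close>.\<close>
        define p1' where "p1' = mk (el p \<union> (\<lambda>n. ?l (num n) (if n \<in> A then 1 else 0)) ` {..<k})"
        have "isset (el p \<union> (\<lambda>n. ?l (num n) (if n \<in> A then 1 else 0)) ` {..<k})"
          using fp by (intro isset_finite) simp
        then have elp1: "el p1' = el p \<union> (\<lambda>n. ?l (num n) (if n \<in> A then 1 else 0)) ` {..<k}"
          unfolding p1'_def by (rule el_mk)
        have n01: "num (Suc 0) \<noteq> num 0" "num 0 \<noteq> num (Suc 0)" unfolding num_inj by simp_all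
        have p1x: "?l (num n) 1 \<in> el p1' \<longleftrightarrow> n \<in> A" "?l (num n) 0 \<in> el p1' \<longleftrightarrow> n < k \<and> n \<notin> A" for n
        proof -
          have "\<not> (?l (num n) 0 \<in> el p \<and> ?l (num n) 1 \<in> el p)" using cohP_cons[OF p ci] unfolding el_iff by blast
          moreover have mp: "?l (num n) b \<in> el p1' \<longleftrightarrow> ?l (num n) b \<in> el p \<or> (n < k \<and> b = (if n \<in> A then 1 else 0))" for b
            unfolding elp1 by (auto simp: image_iff)
          moreover have "n \<in> A \<longleftrightarrow> ?l (num n) 1 \<in> el p" using k[of n] unfolding A_def by blast
          ultimately show "?l (num n) 1 \<in> el p1' \<longleftrightarrow> n \<in> A" "?l (num n) 0 \<in> el p1' \<longleftrightarrow> n < k \<and> n \<notin> A"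
            using mp[of 0] mp[of 1] k[of n] by (cases "n \<in> A"; simp del: num.simps; blast)+
        qed
        have p1P: "p1' \<in> el cohP" unfolding el_cohP
        proof (intro conjI)
          show "el p1' \<subseteq> el (cprod cidx (num 2))" unfolding elp1 using cohP_sub[OF p] lit by auto
          show "finite (el p1')" unfolding elp1 using fp by simp
          show "cons p1'"
          proof (rule consI)
            fix i assume i: "i \<in> el cidx" "pr i (num 0) \<in> el p1' \<and> pr i (num 1) \<in> el p1'"
            then have "\<not> (pr i (num 0) \<in> el p \<and> pr i (num 1) \<in> el p)" using cohP_cons[OF p] unfolding el_iff by blast
            then obtain n where "i = pr x (num n)" using i(2) unfolding elp1 by auto
            then show False using i(2) p1x by blast
          qed
        qed
        have p1p: "leq p1' p" unfolding leq_iff using p p1P elp1 by blast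
        show ?thesis
        proof (cases "bad p1'")
          case True then show ?thesis using p1p by blast
        next
          case False
          then obtain z where z: "z \<in> el Str" "exts z z0" "\<not> forces_not (\<lambda>p. R p z) p1'"
            unfolding bad_def using z0 by blast
          then obtain q where q: "q \<in> el cohP" "leq q p1'" "R q z" using p1P unfolding forces_not_def by blast
          \<comment> \<open>\<open>q\<close> may restrict the real \<open>x\<close>;
            \<open>a\<close> has the same forcing property and does not mention \<open>x\<close>,
            because its support lies in \<open>S\<close>.\<close>
          obtain a where a: "a \<in> el cohP" "R a z" "compat a q" "el (supp a) \<inter> el S = el (supp a)"
            using S(2) z(1) q(1,3) by blast
          obtain r0 where r0: "r0 \<in> el cohP" "leq r0 a" "leq r0 q" using a(3) unfolding compat_def by blast
          obtain A1 n where zA: "z = pr (mk (num ` A1)) (num n)" "A1 \<subseteq> {..<n}" using z(1) unfolding el_Str by blast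
          have ex: "k \<le> n" "\<And>m. m < k \<Longrightarrow> m \<in> A1 \<longleftrightarrow> m \<in> A" using z(2) extN[OF zA(2) Ak] unfolding zA(1) z0_def by blast+
          have ax: "?l n' b \<notin> el a" for n' b
          proof
            assume "?l n' b \<in> el a"
            then have "x \<in> el (supp a)" unfolding el_supp by (intro image_eqI[of _ _ "?l n' b"]) simp_all
            then show False using a(4) xS by blast
          qed
          let ?L = "(\<lambda>m. ?l (num m) (if m \<in> A1 then 1 else 0)) ` {..<n}"
          \<comment> \<open>\<open>p1'\<close> and \<open>a\<close> agree because \<open>r0\<close>
            contains both, and at the index \<open>x\<close> the digits fixed by \<open>p1'\<close>
            are those of \<open>z0\<close>, which \<open>z\<close> extends.\<close>
          define r where "r = mk (el p1' \<union> el a \<union> ?L)"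
          have fin: "finite (el p1')" "finite (el a)" using cohP_fin p1P a(1) by blast+
          have "isset (el p1' \<union> el a \<union> ?L)" using fin by (intro isset_finite) simp
          then have elr: "el r = el p1' \<union> el a \<union> ?L" unfolding r_def by (rule el_mk)
          have mr: "?l (num m) b \<in> el r \<longleftrightarrow> ?l (num m) b \<in> el p1' \<or> (m < n \<and> b = (if m \<in> A1 then 1 else 0))" for m b
            unfolding elr using ax by (auto simp: image_iff)
          have rx: "?l (num m) 1 \<in> el r \<longleftrightarrow> m \<in> A1" "?l (num m) 0 \<in> el r \<longleftrightarrow> m < n \<and> m \<notin> A1" for m
          proof -
            have "m \<in> A \<Longrightarrow> m < k" "m \<in> A1 \<Longrightarrow> m < n" using Ak zA(2) by blast+
            then show "?l (num m) 1 \<in> el r \<longleftrightarrow> m \<in> A1" "?l (num m) 0 \<in> el r \<longleftrightarrow> m < n \<and> m \<notin> A1"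
              using mr[of m 1] mr[of m 0] p1x[of m] ex(1) ex(2)[of m] by (simp_all del: num.simps) linarith+
          qed
          have rP: "r \<in> el cohP" unfolding el_cohP
          proof (intro conjI)
            show "el r \<subseteq> el (cprod cidx (num 2))"
              unfolding elr using cohP_sub[OF p1P] cohP_sub[OF a(1)] lit by auto
            show "finite (el r)" unfolding elr using fin by simp
            show "cons r"
            proof (rule consI)
              fix i assume i: "i \<in> el cidx" "pr i (num 0) \<in> el r \<and> pr i (num 1) \<in> el r"
              have s: "el p1' \<union> el a \<subseteq> el r0" using r0 q(2) unfolding leq_iff by blast
              have "\<not> (pr i (num 0) \<in> el r0 \<and> pr i (num 1) \<in> el r0)" using cohP_cons[OF r0(1) i(1)] unfolding el_iff by blast
              then obtain m where "i = pr x (num m)" using i(2) s unfolding elr by auto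
              then show False using i(2) rx by blast
            qed
          qed
          have "leq r a" "leq r p1'" unfolding leq_iff using rP a(1) p1P elr by blast+
          then have "R r z" using monD[OF mR a(2)] by blast
          moreover have "dec r z" unfolding zA(1) decN[OF zA(2)] using rx unfolding el_iff by blast
          ultimately have "good r" unfolding good_def using z(1) by blast
          then show ?thesis using leq_trans[OF \<open>leq r p1'\<close> p1p] by blast
        qed
      qed
    qed
    then obtain p where p: "p \<in> G" "good p \<or> bad p" by blast
    \<comment> \<open>Density of \<open>B\<close> in the extension gives a cone above
      \<open>z0\<close> that lies in \<open>B\<close>; some condition in \<open>G\<close> forces
      this, and a common extension with \<open>p\<close> refutes badness.\<close>
    have "\<not> bad p"
    proof
      assume "bad p"
      then obtain z0 where z0: "z0 \<in> el Str" "\<forall>z\<in>el Str. exts z z0 \<longrightarrow> forces_not (\<lambda>p. R p z) p"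
        unfolding bad_def by blast
      obtain A k where zA: "z0 = pr (mk (num ` A)) (num k)" "A \<subseteq> {..<k}" using z0(1) unfolding el_Str by blast
      obtain k' A' where k': "k \<le> k'" "\<forall>n<k. n \<in> A' \<longleftrightarrow> n \<in> A"
        "\<forall>C. elts F C \<subseteq> range M.num \<longrightarrow> (\<forall>n<k'. F (M.num n) C \<longleftrightarrow> n \<in> A') \<longrightarrow> F C B" using B[of k A] by blast
      let ?A = "A' \<inter> {..<k'}"
      let ?z = "pr (mk (num ` ?A)) (num k')"
      have z: "?z \<in> el Str" unfolding el_Str by blast
      have "exts ?z z0" unfolding zA(1) using extN[of ?A k' A k] zA(2) k' by auto
      then have fz: "forces_not (\<lambda>p. R p ?z) p" using z0(2) z by blast
      have "N (j (mk (num ` ?A))) (j (num k'))" unfolding N_def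
      proof (intro allI impI)
        fix C assume C: "elts F C \<subseteq> elts F M.om" "\<forall>n\<in>elts F (j (num k')). F n C \<longleftrightarrow> F n (j (mk (num ` ?A)))"
        have "F (M.num n) C \<longleftrightarrow> n \<in> A'" if n: "n < k'" for n
        proof -
          have "M.num n \<in> elts F (j (num k'))" using n by (simp add: M.el_num)
          then have "F (M.num n) C \<longleftrightarrow> F (j (num n)) (j (mk (num ` ?A)))" using C(2) by simp
          also have "\<dots> \<longleftrightarrow> n \<in> A'" unfolding F_jj using Ea[of ?A k' n] n by simp
          finally show ?thesis .
        qed
        then show "F C B" using k'(3) C(1) by simp
      qed
      then obtain q where q: "q \<in> G" "R q ?z" using tR by blast
      obtain r where r: "r \<in> G" "leq r p" "leq r q" using G_dir p(1) q(1) by blast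
      have "R r ?z" by (rule monD[OF mR q(2) r(3)])
      then show False using fz r G_P unfolding forces_not_def by blast
    qed
    then have "good p" using p(2) by blast
    then obtain z where z: "z \<in> el Str" "R p z" "dec p z" unfolding good_def by blast
    obtain A n where zA: "z = pr (mk (num ` A)) (num n)" "A \<subseteq> {..<n}" using z(1) unfolding el_Str by blast
    have NA: "N (j (mk (num ` A))) (j (num n))" using tR p(1) z(2) unfolding zA(1) by blast
    have dA: "m \<in> A \<Longrightarrow> E (?l (num m) 1) p" "m \<notin> A \<Longrightarrow> E (?l (num m) 0) p" if "m < n" for m
      using z(3) that unfolding zA(1) decN[OF zA(2)] by blast+
    have cA: "F (M.num m) (creal (j x)) \<longleftrightarrow> m \<in> A" if m: "m < n" for m
      unfolding creal_mem[OF x] using dA[OF m] p(1) G_lit[OF p(1) _ ci] by blast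
    have "\<forall>k\<in>elts F (j (num n)). F k (creal (j x)) \<longleftrightarrow> F k (j (mk (num ` A)))"
    proof
      fix k assume "k \<in> elts F (j (num n))"
      then obtain m where m: "m < n" "k = j (num m)" by (auto simp: M.el_num)
      have "F k (j (mk (num ` A))) \<longleftrightarrow> m \<in> A" unfolding m(2) F_jj by (rule Ea[OF zA(2)])
      then show "F k (creal (j x)) \<longleftrightarrow> F k (j (mk (num ` A)))" using cA[OF m(1)] m(2) by simp
    qed
    moreover have "elts F (creal (j x)) \<subseteq> elts F M.om" unfolding el_creal by blast
    ultimately show ?thesis using NA unfolding N_def by blast
  qed
  then have "\<forall>x\<in>elts F M.w2. x \<notin> elts F (j S) \<longrightarrow> F (creal x) B"
    unfolding ccc_w2[OF coh_ccc, symmetric] eltsF_j by blast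
  moreover have "card_le F (j S) M.om" using j_card_le[OF S(1)] by simp
  ultimately show ?thesis by blast
qed

end

section \<open>Sets of natural numbers\<close>

subsection \<open>Families coded by a single set\<close>

text \<open>An injective pairing that is a polynomial; it need not be surjective.\<close>

definition pp :: "nat \<Rightarrow> nat \<Rightarrow> nat" where "pp m n = (m + n) * (m + n) + m"

lemma pp_inj [simp]: "pp m n = pp m' n' \<longleftrightarrow> m = m' \<and> n = n'"
proof
  assume e: "pp m n = pp m' n'"
  have *: "pp m n < pp m' n'" if "m + n < m' + n'" for m n m' n'
  proof -
    have "pp m n < (m + n + 1) * (m + n + 1)" by (simp add: pp_def)
    also have "\<dots> \<le> (m' + n') * (m' + n')" using that by (intro mult_le_mono) auto
    also have "\<dots> \<le> pp m' n'" by (simp add: pp_def)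
    finally show ?thesis .
  qed
  have "m + n = m' + n'" using *[of m n m' n'] *[of m' n' m n] e by linarith
  then show "m = m' \<and> n = n'" using e by (simp add: pp_def)
qed simp

lemma pp_ge: "m \<le> pp m n" "n \<le> pp m n"
proof -
  have "x \<le> x * x" for x :: nat by (cases x) auto
  from this[of "m + n"] show "m \<le> pp m n" "n \<le> pp m n" unfolding pp_def by linarith+
qed

text \<open>The pairing is not onto; the default 0 keeps the projections total and bounded by their
  argument, on which the termination of \<open>tm\<close> rests.\<close>

definition pfst :: "nat \<Rightarrow> nat" where "pfst v = (if \<exists>m n. v = pp m n then (THE m. \<exists>n. v = pp m n) else 0)"
definition psnd :: "nat \<Rightarrow> nat" where "psnd v = (if \<exists>m n. v = pp m n then (THE n. \<exists>m. v = pp m n) else 0)"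

lemma pfst_pp [simp]: "pfst (pp m n) = m" and psnd_pp [simp]: "psnd (pp m n) = n"
  by (auto simp: pfst_def psnd_def)

lemma pfst_iff: "pfst v = a \<longleftrightarrow> (\<exists>n. v = pp a n) \<or> (\<not> (\<exists>m n. v = pp m n) \<and> a = 0)"
  and psnd_iff: "psnd v = a \<longleftrightarrow> (\<exists>m. v = pp m a) \<or> (\<not> (\<exists>m n. v = pp m n) \<and> a = 0)"
  by (cases "\<exists>m n. v = pp m n"; auto simp: pfst_def psnd_def)+

lemma pfst_le: "pfst v \<le> v" and psnd_le: "psnd v \<le> v"
  by (cases "\<exists>m n. v = pp m n"; auto simp: pp_ge pfst_def psnd_def)+

definition sec :: "nat set \<Rightarrow> nat \<Rightarrow> nat set" where "sec r n = {m. pp n m \<in> r}"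

subsection \<open>Closure under arithmetic definability\<close>

text \<open>
  A formula is represented by the set of the codes \<open>v\<close> of the assignments \<open>dec v\<close> that satisfy it, and
  a term by the graph of its value as a function of \<open>v\<close>; each clause below imitates one syntactic
  constructor. The last one specializes the first variable to a number.
\<close>

primrec arop :: "nat \<Rightarrow> nat \<Rightarrow> nat set \<Rightarrow> nat set \<Rightarrow> nat set" where
  "arop 0 k A B = {x. \<exists>v. x = pp v (pfst v)}"
| "arop (Suc n) k A B =
    (if n = 0 then {x. \<exists>v w. x = pp v w \<and> pp (psnd v) w \<in> A}
     else if n = 1 then {x. \<exists>v. x = pp v 0}
     else if n = 2 then {x. \<exists>v w. x = pp v (Suc w) \<and> pp v w \<in> A}
     else if n = 3 then {x. \<exists>v a b. x = pp v (a + b) \<and> pp v a \<in> A \<and> pp v b \<in> B}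
     else if n = 4 then {x. \<exists>v a b. x = pp v (a * b) \<and> pp v a \<in> A \<and> pp v b \<in> B}
     else if n = 5 then {v. \<exists>w. pp v w \<in> A \<and> pp v w \<in> B}
     else if n = 6 then {v. \<exists>w. pp v w \<in> A \<and> w \<in> B}
     else if n = 7 then {v. v \<notin> A}
     else if n = 8 then {v. v \<in> A \<and> v \<in> B}
     else if n = 9 then {v. \<exists>n. pp n v \<in> A}
     else {n. pp n k \<in> A})"

text \<open>Operation 0 projects to the first variable and 1 shifts the variables; 2 to 5 are zero,
  successor, sum and product, 6 and 7 the atomic formulas, 8 to 10 negation, conjunction and the
  quantifier. All larger numbers denote instantiation, so \<open>n\<close> may range over all
  numbers.\<close>

definition aclosed :: "nat set set \<Rightarrow> bool" where
  "aclosed X \<longleftrightarrow> (\<forall>n k A B. A \<in> X \<longrightarrow> B \<in> X \<longrightarrow> arop n k A B \<in> X)"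

text \<open>Each number decodes to a total assignment. Any finite part of an assignment can be
  realized (\<open>dec_surj\<close>), which suffices because a formula depends on finitely many
  variables.\<close>

primrec dec :: "nat \<Rightarrow> nat \<Rightarrow> nat" where
  "dec v 0 = pfst v"
| "dec v (Suc i) = dec (psnd v) i"

lemma dec_pp: "dec (pp n v) = case_nat n (dec v)"
  by (rule HOL.ext) (simp split: nat.split)

lemma arith_tm_closed:
  assumes X: "aclosed X" "X \<noteq> {}"
  shows "{x. \<exists>v. x = pp v (arith_val (dec v) t)} \<in> X"
proof -
  obtain A0 where A0: "A0 \<in> X" using X(2) by blast
  have op: "arop n k A B \<in> X" if "A \<in> X" "B \<in> X" for n k A B using X(1) that unfolding aclosed_def by blast
  have var: "{x. \<exists>v. x = pp v (dec v i)} \<in> X" for i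
  proof (induction i)
    case 0
    show ?case using op[OF A0 A0, of 0] by simp
  next
    case (Suc i)
    have "{x. \<exists>v. x = pp v (dec v (Suc i))} = arop 1 0 {x. \<exists>v. x = pp v (dec v i)} A0"
      by (auto simp: One_nat_def)
    then show ?case using op[OF Suc A0, of 1 0] by simp
  qed
  show ?thesis
  proof (induction t)
    case (AVar i) then show ?case using var by simp
  next
    case AZero
    have "arop 2 0 A0 A0 = {x. \<exists>v. x = pp v 0}" by (simp add: numeral_2_eq_2)
    then show ?case using op[OF A0 A0, of 2 0] by simp
  next
    case (ASuc t)
    have "arop 3 0 A A0 = {x. \<exists>v w. x = pp v (Suc w) \<and> pp v w \<in> A}" for A by (simp add: eval_nat_numeral)
    from this[of "{x. \<exists>v. x = pp v (arith_val (dec v) t)}"] show ?case using op[OF ASuc A0, of 3 0] by simp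
  next
    case (AAdd t u)
    have "arop 4 0 A B = {x. \<exists>v a b. x = pp v (a + b) \<and> pp v a \<in> A \<and> pp v b \<in> B}" for A B by (simp add: eval_nat_numeral)
    from this[of "{x. \<exists>v. x = pp v (arith_val (dec v) t)}" "{x. \<exists>v. x = pp v (arith_val (dec v) u)}"]
    show ?case using op[OF AAdd, of 4 0] by simp
  next
    case (AMul t u)
    have "arop 5 0 A B = {x. \<exists>v a b. x = pp v (a * b) \<and> pp v a \<in> A \<and> pp v b \<in> B}" for A B by (simp add: eval_nat_numeral)
    from this[of "{x. \<exists>v. x = pp v (arith_val (dec v) t)}" "{x. \<exists>v. x = pp v (arith_val (dec v) u)}"]
    show ?case using op[OF AMul, of 5 0] by simp
  qed
qed

lemma arith_fm_closed:
  assumes X: "aclosed X" and S: "range S \<subseteq> X"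
  shows "{v. arith_sat S (dec v) f} \<in> X"
proof -
  have ne: "X \<noteq> {}" using S by auto
  have op: "arop n k A B \<in> X" if "A \<in> X" "B \<in> X" for n k A B using X(1) that unfolding aclosed_def by blast
  note tm = arith_tm_closed[OF X ne]
  show ?thesis
  proof (induction f)
    case (AEq t u)
    have "arop 6 0 A B = {v. \<exists>w. pp v w \<in> A \<and> pp v w \<in> B}" for A B by (simp add: eval_nat_numeral)
    from this[of "{x. \<exists>v. x = pp v (arith_val (dec v) t)}" "{x. \<exists>v. x = pp v (arith_val (dec v) u)}"]
    show ?case using op[OF tm[of t] tm[of u], of 6 0] by simp
  next
    case (AIn t i)
    have "arop 7 0 A B = {v. \<exists>w. pp v w \<in> A \<and> w \<in> B}" for A B by (simp add: eval_nat_numeral)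
    from this[of "{x. \<exists>v. x = pp v (arith_val (dec v) t)}" "S i"]
    show ?case using op[OF tm[of t], of "S i" 7 0] S by auto
  next
    case (ANeg f)
    have "arop 8 0 A A = {v. v \<notin> A}" for A by (simp add: eval_nat_numeral)
    from this[of "{v. arith_sat S (dec v) f}"] show ?case using op[OF ANeg ANeg, of 8 0] by simp
  next
    case (AConj f g)
    have "arop 9 0 A B = {v. v \<in> A \<and> v \<in> B}" for A B by (simp add: eval_nat_numeral)
    from this[of "{v. arith_sat S (dec v) f}" "{v. arith_sat S (dec v) g}"]
    show ?case using op[OF AConj, of 9 0] by simp
  next
    case (AEx f)
    have "arop 10 0 A A = {v. \<exists>n. pp n v \<in> A}" for A by (simp add: eval_nat_numeral)
    from this[of "{v. arith_sat S (dec v) f}"] show ?case using op[OF AEx AEx, of 10 0] by (simp add: dec_pp)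
  qed
qed

lemma arith_val_local: "\<exists>N. \<forall>e e'. (\<forall>i<N. e i = e' i) \<longrightarrow> arith_val e t = arith_val e' t"
proof (induction t)
  case (AVar i) show ?case by (rule exI[of _ "Suc i"]) simp
next
  case (AAdd t u)
  then obtain M N where "\<forall>e e'. (\<forall>i<M. e i = e' i) \<longrightarrow> arith_val e t = arith_val e' t"
    "\<forall>e e'. (\<forall>i<N. e i = e' i) \<longrightarrow> arith_val e u = arith_val e' u" by blast
  note MN = this
  show ?case
  proof (intro exI[of _ "M + N"] allI impI)
    fix e e' :: "nat \<Rightarrow> nat" assume "\<forall>i<M + N. e i = e' i"
    then have "\<forall>i<M. e i = e' i" "\<forall>i<N. e i = e' i" by auto
    then have "arith_val e t = arith_val e' t" "arith_val e u = arith_val e' u" using MN by blast+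
    then show "arith_val e (AAdd t u) = arith_val e' (AAdd t u)" by simp
  qed
next
  case (AMul t u)
  then obtain M N where "\<forall>e e'. (\<forall>i<M. e i = e' i) \<longrightarrow> arith_val e t = arith_val e' t"
    "\<forall>e e'. (\<forall>i<N. e i = e' i) \<longrightarrow> arith_val e u = arith_val e' u" by blast
  note MN = this
  show ?case
  proof (intro exI[of _ "M + N"] allI impI)
    fix e e' :: "nat \<Rightarrow> nat" assume "\<forall>i<M + N. e i = e' i"
    then have "\<forall>i<M. e i = e' i" "\<forall>i<N. e i = e' i" by auto
    then have "arith_val e t = arith_val e' t" "arith_val e u = arith_val e' u" using MN by blast+
    then show "arith_val e (AMul t u) = arith_val e' (AMul t u)" by simp
  qed
qed auto

lemma arith_sat_local: "\<exists>N. \<forall>e e'. (\<forall>i<N. e i = e' i) \<longrightarrow> arith_sat S e f = arith_sat S e' f"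
proof (induction f)
  case (AEq t u)
  obtain M N where "\<forall>e e'. (\<forall>i<M. e i = e' i) \<longrightarrow> arith_val e t = arith_val e' t"
    "\<forall>e e'. (\<forall>i<N. e i = e' i) \<longrightarrow> arith_val e u = arith_val e' u" using arith_val_local[of t] arith_val_local[of u] by blast
  note MN = this
  show ?case
  proof (intro exI[of _ "M + N"] allI impI)
    fix e e' :: "nat \<Rightarrow> nat" assume "\<forall>i<M + N. e i = e' i"
    then have "\<forall>i<M. e i = e' i" "\<forall>i<N. e i = e' i" by auto
    then have "arith_val e t = arith_val e' t" "arith_val e u = arith_val e' u" using MN by blast+
    then show "arith_sat S e (AEq t u) = arith_sat S e' (AEq t u)" by simp
  qed
next
  case (AIn t i)
  obtain M where "\<forall>e e'. (\<forall>i<M. e i = e' i) \<longrightarrow> arith_val e t = arith_val e' t" using arith_val_local[of t] by blast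
  then have "\<forall>e e'. (\<forall>i<M. e i = e' i) \<longrightarrow> arith_sat S e (AIn t i) = arith_sat S e' (AIn t i)"
    unfolding arith_sat.simps by metis
  then show ?case by blast
next
  case (AConj f g)
  then obtain M N where "\<forall>e e'. (\<forall>i<M. e i = e' i) \<longrightarrow> arith_sat S e f = arith_sat S e' f"
    "\<forall>e e'. (\<forall>i<N. e i = e' i) \<longrightarrow> arith_sat S e g = arith_sat S e' g" by blast
  note MN = this
  show ?case
  proof (intro exI[of _ "M + N"] allI impI)
    fix e e' :: "nat \<Rightarrow> nat" assume "\<forall>i<M + N. e i = e' i"
    then have "\<forall>i<M. e i = e' i" "\<forall>i<N. e i = e' i" by auto
    then have "arith_sat S e f = arith_sat S e' f" "arith_sat S e g = arith_sat S e' g" using MN by blast+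
    then show "arith_sat S e (AConj f g) = arith_sat S e' (AConj f g)" by simp
  qed
next
  case (AEx f)
  then obtain M where M: "\<forall>e e'. (\<forall>i<M. e i = e' i) \<longrightarrow> arith_sat S e f = arith_sat S e' f" by blast
  have "arith_sat S (case_nat n e) f = arith_sat S (case_nat n e') f" if "\<forall>i<M. e i = e' i" for n e e'
    using M that by (auto split: nat.split)
  then show ?case by (intro exI[of _ M]) (simp, blast)
qed auto

lemma dec_surj: "\<exists>v. \<forall>i<N. dec v i = e i"
proof (induction N arbitrary: e)
  case (Suc N)
  obtain v where "\<forall>i<N. dec v i = e (Suc i)" using Suc[of "\<lambda>i. e (Suc i)"] by blast
  then have "\<forall>i<Suc N. dec (pp (e 0) v) i = e i" by (auto simp: dec_pp split: nat.split)
  then show ?case by blast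
qed simp

text \<open>The formula looks at finitely many number parameters, which are packed into one code
  \<open>v\<close>; \<open>arop 11 v\<close> inserts it behind the argument.\<close>

theorem aclosed_arith:
  assumes X: "aclosed X" and B: "arith_definable_from X B" shows "B \<in> X"
proof -
  obtain f S e where f: "range S \<subseteq> X" "B = {n. arith_sat S (case_nat n e) f}"
    using B unfolding arith_definable_from_def by blast
  obtain N where N: "\<forall>e e'. (\<forall>i<N. e i = e' i) \<longrightarrow> arith_sat S e f = arith_sat S e' f" using arith_sat_local by blast
  obtain v where v: "\<forall>i<N. dec v i = e i" using dec_surj by blast
  have "arith_sat S (case_nat n e) f = arith_sat S (dec (pp n v)) f" for n
    unfolding dec_pp using N v by (auto split: nat.split)
  then have "B = arop 11 v {v. arith_sat S (dec v) f} {v. arith_sat S (dec v) f}"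
    unfolding f(2) by (simp add: eval_nat_numeral)
  then show ?thesis using X arith_fm_closed[OF X f(1), of f] unfolding aclosed_def by simp
qed

subsection \<open>Diagonal intersections along a real\<close>

definition asub :: "nat set \<Rightarrow> nat set \<Rightarrow> bool" where "asub A B \<longleftrightarrow> (\<exists>k. \<forall>m\<ge>k. m \<in> A \<longrightarrow> m \<in> B)"

lemma asub_finite: "asub A B \<longleftrightarrow> finite (A - B)"
proof
  assume "asub A B"
  then obtain k where "\<forall>m\<ge>k. m \<in> A \<longrightarrow> m \<in> B" unfolding asub_def by blast
  then have "A - B \<subseteq> {..<k}" by (meson DiffE lessThan_iff not_le subsetI)
  then show "finite (A - B)" by (rule finite_subset) simp
next
  assume "finite (A - B)"
  then obtain k where "\<forall>m\<in>A - B. m < k" unfolding finite_nat_set_iff_bounded by blast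
  then have "\<forall>m\<ge>k. m \<in> A \<longrightarrow> m \<in> B" by (meson DiffI leD)
  then show "asub A B" unfolding asub_def by blast
qed

lemma infinite_unbounded: "infinite S \<longleftrightarrow> (\<forall>k. \<exists>n\<ge>k. n \<in> S)" for S :: "nat set"
  unfolding finite_nat_set_iff_bounded by (meson not_less)

lemma asub_refl: "asub A A" unfolding asub_def by blast

lemma asub_trans: "asub A B \<Longrightarrow> asub B C \<Longrightarrow> asub A C"
  unfolding asub_finite by (rule finite_subset[of _ "(A - B) \<union> (B - C)"]) auto

lemma asub_infinite: "asub A B \<Longrightarrow> infinite A \<Longrightarrow> infinite B"
  unfolding asub_finite by (metis Diff_infinite_finite finite_Diff2)

lemma asub_Int: "asub A B \<Longrightarrow> asub A C \<Longrightarrow> asub A (B \<inter> C)"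
  unfolding asub_finite by (metis Diff_Int finite_UnI)

text \<open>
  At stage \<open>k\<close> the real \<open>c\<close> decides whether the descending sequence moves on to the set with
  index \<open>pfst k\<close>; every index is offered arbitrarily late.
\<close>

primrec ix :: "nat set \<Rightarrow> nat set \<Rightarrow> nat \<Rightarrow> nat \<Rightarrow> nat" where
  "ix r c i 0 = i"
| "ix r c i (Suc k) = (if k \<in> c \<and> asub (sec r (pfst k)) (sec r (ix r c i k)) \<and>
     infinite (sec r (pfst k)) then pfst k else ix r c i k)"

definition inb :: "nat set \<Rightarrow> nat set \<Rightarrow> nat \<Rightarrow> nat \<Rightarrow> nat \<Rightarrow> bool" where
  "inb r c i k m \<longleftrightarrow> k \<le> m \<and> (\<forall>l\<le>k. m \<in> sec r (ix r c i l))"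

text \<open>A pseudo-intersection of the sequence: for each \<open>k\<close> it receives the least
  number from \<open>k\<close> on that lies in all sets up to the \<open>k\<close>-th.\<close>

definition thin :: "nat set \<Rightarrow> nat set \<Rightarrow> nat \<Rightarrow> nat set" where
  "thin r c i = {m. \<exists>k. inb r c i k m \<and> (\<forall>m'<m. \<not> inb r c i k m')}"

lemma ix_local: "(\<forall>n<k. n \<in> c \<longleftrightarrow> n \<in> c') \<Longrightarrow> ix r c i k = ix r c' i k"
  by (induction k) auto

lemma ix_infinite: "infinite (sec r i) \<Longrightarrow> infinite (sec r (ix r c i k))"
  by (induction k) auto

lemma ix_step: "asub (sec r (ix r c i (Suc k))) (sec r (ix r c i k))"
  by (simp add: asub_refl)

lemma ix_asub: "l \<le> k \<Longrightarrow> asub (sec r (ix r c i k)) (sec r (ix r c i l))"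
proof (induction k)
  case (Suc k)
  then show ?case using ix_step asub_trans asub_refl le_Suc_eq by metis
qed (simp add: asub_refl)

text \<open>The sequence decreases only modulo finite sets. Almost inclusion in the finite
  intersections is what makes these infinite, and hence provides elements for
  \<open>thin\<close>.\<close>

lemma ix_Inter: "asub (sec r (ix r c i k)) (\<Inter>l\<in>{..n}. sec r (ix r c i l))" if "n \<le> k"
  using that
proof (induction n)
  case 0 then show ?case using ix_asub[of 0 k] by simp
next
  case (Suc n)
  have "(\<Inter>l\<in>{..Suc n}. sec r (ix r c i l)) = (\<Inter>l\<in>{..n}. sec r (ix r c i l)) \<inter> sec r (ix r c i (Suc n))"
    by (auto simp: atMost_Suc)
  then show ?case using asub_Int[OF Suc.IH ix_asub[OF Suc.prems]] Suc.prems by simp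
qed

lemma inb_ex: assumes "infinite (sec r i)" shows "\<exists>m. inb r c i k m"
proof -
  have "infinite (\<Inter>l\<in>{..k}. sec r (ix r c i l))"
    using asub_infinite[OF ix_Inter[OF order_refl] ix_infinite[OF assms]] .
  then obtain m where "m \<ge> k" "m \<in> (\<Inter>l\<in>{..k}. sec r (ix r c i l))"
    unfolding infinite_unbounded by blast
  then show ?thesis unfolding inb_def by auto
qed

lemma thin_ex: assumes "infinite (sec r i)" shows "\<exists>m\<in>thin r c i. inb r c i k m \<and> (\<forall>m'<m. \<not> inb r c i k m')"
proof -
  have "inb r c i k (LEAST m. inb r c i k m)" using inb_ex[OF assms] by (metis LeastI)
  moreover have "\<forall>m'<(LEAST m. inb r c i k m). \<not> inb r c i k m'" using not_less_Least by blast
  ultimately show ?thesis unfolding thin_def by blast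
qed

lemma thin_infinite: assumes "infinite (sec r i)" shows "infinite (thin r c i)"
  unfolding infinite_unbounded
proof
  fix k show "\<exists>n\<ge>k. n \<in> thin r c i" using thin_ex[OF assms, of c k] unfolding inb_def by blast
qed

lemma thin_asub: "asub (thin r c i) (sec r (ix r c i l))"
proof -
  \<comment> \<open>An element outside the \<open>l\<close>-th set was chosen for some
    \<open>k < l\<close>, and each \<open>k\<close> contributes only one element.\<close>
  have "thin r c i - sec r (ix r c i l) \<subseteq> (\<lambda>k. LEAST m. inb r c i k m) ` {..<l}"
  proof
    fix m assume m: "m \<in> thin r c i - sec r (ix r c i l)"
    then obtain k where k: "inb r c i k m" "\<forall>m'<m. \<not> inb r c i k m'" unfolding thin_def by blast
    have "k < l" using k(1) m unfolding inb_def by (metis DiffD2 not_le)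
    moreover have "m = (LEAST m. inb r c i k m)"
      using k by (metis LeastI not_less_Least linorder_neqE_nat)
    ultimately show "m \<in> (\<lambda>k. LEAST m. inb r c i k m) ` {..<l}" by blast
  qed
  then show ?thesis unfolding asub_finite by (rule finite_subset) simp
qed

text \<open>Every finite string can be prolonged so that the sequence enters \<open>D\<close>; this
  is why a sufficiently generic real meets all the relevant dense sets.\<close>

lemma ix_dense:
  assumes D: "\<And>x. infinite (sec r x) \<Longrightarrow> \<exists>d. d \<in> D \<and> infinite (sec r d) \<and> asub (sec r d) (sec r x)"
    and i: "infinite (sec r i)"
  shows "\<exists>k'\<ge>k. \<exists>A'. (\<forall>n<k. n \<in> A' \<longleftrightarrow> n \<in> A) \<and>
    (\<forall>C. (\<forall>n<k'. n \<in> C \<longleftrightarrow> n \<in> A') \<longrightarrow> (\<exists>l. ix r C i l \<in> D))"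
proof -
  let ?x = "ix r A i k"
  obtain d where d: "d \<in> D" "infinite (sec r d)" "asub (sec r d) (sec r ?x)" using D ix_infinite[OF i] by blast
  \<comment> \<open>Stage \<open>pp d k\<close> offers \<open>d\<close> and is not below
    \<open>k\<close>. With only zeros from \<open>k\<close> up to it, the sequence stays at
    \<open>?x\<close> until then.\<close>
  let ?k = "pp d k"
  let ?A = "(A \<inter> {..<k}) \<union> {?k}"
  have kk: "k \<le> ?k" by (rule pp_ge)
  have e: "ix r ?A i l = ?x" if "k \<le> l" "l \<le> ?k" for l
    using that
  proof (induction l rule: dec_induct)
    case base show ?case by (rule ix_local) (use kk in auto)
  next
    case (step l)
    then show ?case by auto
  qed
  have "ix r C i (Suc ?k) = d" if C: "\<forall>n<Suc ?k. n \<in> C \<longleftrightarrow> n \<in> ?A" for C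
  proof -
    have "ix r C i (Suc ?k) = ix r ?A i (Suc ?k)" by (rule ix_local[OF C])
    also have "\<dots> = d" using e[OF kk order_refl] d by simp
    finally show ?thesis .
  qed
  then have "\<forall>C. (\<forall>n<Suc ?k. n \<in> C \<longleftrightarrow> n \<in> ?A) \<longrightarrow> (\<exists>l. ix r C i l \<in> D)" using d(1) by metis
  moreover have "\<forall>n<k. n \<in> ?A \<longleftrightarrow> n \<in> A" using kk by auto
  ultimately show ?thesis using le_SucI[OF kk] by blast
qed

subsection \<open>The closure of a countable family\<close>

definition clop :: "nat set \<Rightarrow> nat \<Rightarrow> nat \<Rightarrow> nat set \<Rightarrow> nat set \<Rightarrow> nat set" where
  "clop r n k A B = (if n = 0 then sec r k else if n = 1 then thin A B k else arop (n - 2) k A B)"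

definition tsub :: "nat \<Rightarrow> nat" where "tsub w = psnd (psnd w)"

text \<open>
  The numbers serve as closure terms: \<open>Suc (pp n (pp k (pp a b)))\<close> is the operation \<open>n\<close> with number
  parameter \<open>k\<close> applied to the terms \<open>a\<close> and \<open>b\<close>.
\<close>

function tm :: "nat set \<Rightarrow> nat \<Rightarrow> nat set" where
  "tm r 0 = {}"
| "tm r (Suc w) = clop r (pfst w) (pfst (psnd w)) (tm r (pfst (tsub w))) (tm r (psnd (tsub w)))"
  by pat_completeness auto
termination
  by (relation "measure snd")
     (auto simp: tsub_def less_Suc_eq_le intro: order_trans[OF pfst_le] order_trans[OF psnd_le] psnd_le)

text \<open>All closure terms are evaluated in one set, so that the closure of a coded family is
  again coded by a single real.\<close>

definition cl :: "nat set \<Rightarrow> nat set" where "cl r = {x. \<exists>v m. x = pp v m \<and> m \<in> tm r v}"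

definition fam :: "nat set \<Rightarrow> nat set set" where "fam r = range (sec r)"

lemma sec_cl: "sec (cl r) v = tm r v" by (auto simp: sec_def cl_def)

lemma fam_cl_op: assumes "A \<in> fam (cl r)" "B \<in> fam (cl r)" shows "clop r n k A B \<in> fam (cl r)"
proof -
  obtain a b where "A = tm r a" "B = tm r b" using assms by (auto simp: fam_def sec_cl)
  then have "clop r n k A B = tm r (Suc (pp n (pp k (pp a b))))" by (simp add: tsub_def)
  then show ?thesis by (simp add: fam_def flip: sec_cl)
qed

lemma fam_cl_base: "fam r \<subseteq> fam (cl r)"
proof
  fix A assume "A \<in> fam r"
  then obtain k where "A = sec r k" by (auto simp: fam_def)
  then have "A = clop r 0 k {} {}" by (simp add: clop_def)
  moreover have "{} \<in> fam (cl r)" unfolding fam_def by (metis rangeI sec_cl tm.simps(1))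
  ultimately show "A \<in> fam (cl r)" using fam_cl_op by simp
qed

lemma aclosed_cl: "aclosed (fam (cl r))"
  unfolding aclosed_def
proof (intro allI impI)
  fix n k A B assume "A \<in> fam (cl r)" "B \<in> fam (cl r)"
  then have "clop r (n + 2) k A B \<in> fam (cl r)" by (rule fam_cl_op)
  then show "arop n k A B \<in> fam (cl r)" by (simp add: clop_def)
qed

lemma thin_cl: "A \<in> fam (cl r) \<Longrightarrow> B \<in> fam (cl r) \<Longrightarrow> thin A B k \<in> fam (cl r)"
  using fam_cl_op[of A r B 1 k] by (simp add: clop_def)

section \<open>Arithmetic inside a model\<close>

context zfm
begin

section \<open>Reals of the model as sets of natural numbers\<close>

definition st :: "'a \<Rightarrow> nat set" where "st x = {n. E (num n) x}"
text \<open>HOL may have more sets of natural numbers than the model; \<open>isr\<close> singles out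
  those that the model contains.\<close>

definition isr :: "nat set \<Rightarrow> bool" where "isr A \<longleftrightarrow> isset (num ` A)"
definition rl :: "nat set \<Rightarrow> 'a" where "rl A = mk (num ` A)"

lemma el_rl: "isr A \<Longrightarrow> el (rl A) = num ` A" by (simp add: isr_def rl_def)

lemma st_rl [simp]: "isr A \<Longrightarrow> st (rl A) = A"
proof -
  assume "isr A"
  then have "num n \<in> el (rl A) \<longleftrightarrow> n \<in> A" for n by (auto simp: el_rl)
  then show ?thesis unfolding st_def el_iff by simp
qed

lemma num_st: "num ` st x = {y \<in> el x. y \<in> el om}" by (auto simp: st_def el_iff)

lemma isr_st [simp]: "isr (st x)"
  unfolding isr_def num_st by (rule isset_sep[OF isset_el], intro dfi)

lemma rl_st: "el x \<subseteq> el om \<Longrightarrow> rl (st x) = x"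
proof -
  assume "el x \<subseteq> el om"
  then have "{y \<in> el x. y \<in> el om} = el x" by blast
  then show ?thesis unfolding rl_def num_st by simp
qed

lemma real_eq: "el x \<subseteq> el om \<Longrightarrow> el y \<subseteq> el om \<Longrightarrow> st x = st y \<Longrightarrow> x = y"
  using rl_st by metis

lemma rl_real: "isr A \<Longrightarrow> el (rl A) \<subseteq> el om" by (auto simp: el_rl)

lemma finite_st: "el x \<subseteq> el om \<Longrightarrow> finite (st x) \<longleftrightarrow> finite (el x)"
proof -
  assume "el x \<subseteq> el om"
  then have "el x = num ` st x" unfolding num_st by blast
  then show ?thesis using finite_image_iff[of num "st x"] by (simp add: inj_on_def)
qed

text \<open>Number terms keep their HOL type, and their definability is that of the numeral.
  Formulas about the model can thus use arithmetic on \<open>nat\<close> directly.\<close>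

definition dn :: "((nat \<Rightarrow> 'a) \<Rightarrow> nat) \<Rightarrow> bool" where "dn f \<longleftrightarrow> dt E (\<lambda>s. num (f s))"

lemma dn_const [dfi]: "dn (\<lambda>s. n)" unfolding dn_def by (rule dt_const)

lemma dt_num [dfi]: "dn f \<Longrightarrow> dt E (\<lambda>s. num (f s))" unfolding dn_def .

lemma dn_nt [dfi]: assumes "dt E f" shows "dn (\<lambda>s. nt (f s))"
proof -
  have *: "num (nt x) = (if E x om then x else emp)" for x by (auto simp: nt_def)
  have "dt E (\<lambda>s. num (nt (s 0)))" unfolding * by (intro dfi)
  from dt_comp1[of E "\<lambda>x. num (nt x)", OF this assms] show ?thesis unfolding dn_def .
qed

lemma dn_Suc [dfi]: "dn f \<Longrightarrow> dn (\<lambda>s. Suc (f s))"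
  unfolding dn_def num.simps by (rule dt_suc)

text \<open>Primitive recursion is derived from \<in>-recursion; \<open>un\<close> is the
  predecessor function on successor numerals.\<close>

lemma nrec_ex:
  assumes H: "dt E (\<lambda>s. H (s 0) (s 1))" and Z: "dt E (\<lambda>s. Z (s 0))"
  shows "\<exists>f. dt E (\<lambda>s. f (s 0) (s 1)) \<and> (\<forall>u. f u (num 0) = Z u) \<and> (\<forall>u n. f u (num (Suc n)) = H u (f u (num n)))"
proof -
  let ?H = "\<lambda>u x g. if x = emp then Z u else H u (app g (un x))"
  have "dt E (\<lambda>s. ?H (s 0) (s 1) (s 2))" by (intro dfi dt_comp1[of E Z, OF Z] dt_comp2[of E H, OF H])
  from rec_mem[of ?H, OF this] obtain f where f: "dt E (\<lambda>s. f (s 0) (s 1))"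
    "\<forall>u x. f u x = ?H u x (lam x (f u))" by (elim exE conjE)
  have fn: "fn (f u)" for u by (rule fn_dt2[OF f(1)])
  have "un (num (Suc n)) = num n" for n
  proof (rule ext)
    have "el (un (num (Suc n))) = (\<Union>m\<in>{..n}. num ` {..<m})"
      unfolding el_un el_num[of "Suc n"] by (simp add: el_num lessThan_Suc_atMost)
    also have "\<dots> = num ` {..<n}" by (auto simp: less_le_trans)
    finally show "el (un (num (Suc n))) = el (num n)" by (simp only: el_num)
  qed
  moreover have "num (Suc n) \<noteq> emp" for n using num_inj[of "Suc n" 0] by simp
  moreover have "num n \<in> el (num (Suc n))" for n unfolding el_num by blast
  ultimately have "f u (num (Suc n)) = H u (f u (num n))" for u n
    using f(2)[rule_format, of u "num (Suc n)"] fn[of u] by (simp del: num.simps)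
  moreover have "f u (num 0) = Z u" for u using f(2)[rule_format, of u "num 0"] by simp
  ultimately show ?thesis using f(1) by blast
qed

lemma dn_add [dfi]: assumes "dn f" "dn g" shows "dn (\<lambda>s. f s + g s)"
proof -
  have "dt E (\<lambda>s. suc (s 1))" "dt E (\<lambda>s. s 0)" by (intro dfi)+
  from nrec_ex[of "\<lambda>u x. suc x" "\<lambda>u. u", OF this] obtain h where h: "dt E (\<lambda>s. h (s 0) (s 1))"
    "\<forall>u. h u (num 0) = u" "\<forall>u n. h u (num (Suc n)) = suc (h u (num n))" by (elim exE conjE)
  have "h (num m) (num n) = num (m + n)" for m n
    by (induction n) (use h(2,3) in \<open>simp_all del: num.simps, simp_all add: num.simps(2)\<close>)
  then show ?thesis using dt_comp2[of E h, OF h(1) assms[unfolded dn_def]] unfolding dn_def by simp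
qed

lemma dn_mult [dfi]: assumes "dn f" "dn g" shows "dn (\<lambda>s. f s * g s)"
proof -
  have "dt E (\<lambda>s. num (nt (s 0) + nt (s 1)))" "dt E (\<lambda>s. num 0)" by (intro dfi)+
  from nrec_ex[of "\<lambda>u x. num (nt u + nt x)" "\<lambda>u. num 0", OF this] obtain h where h: "dt E (\<lambda>s. h (s 0) (s 1))"
    "\<forall>u. h u (num 0) = num 0" "\<forall>u n. h u (num (Suc n)) = num (nt u + nt (h u (num n)))" by (elim exE conjE)
  have "h (num m) (num n) = num (m * n)" for m n
    by (induction n) (use h(2,3) in \<open>simp_all del: num.simps\<close>)
  then show ?thesis using dt_comp2[of E h, OF h(1) assms[unfolded dn_def]] unfolding dn_def by simp
qed

lemma dn_pp [dfi]: "dn f \<Longrightarrow> dn g \<Longrightarrow> dn (\<lambda>s. pp (f s) (g s))"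
  unfolding pp_def by (intro dfi)

lemma df_eqn [dfi]: assumes "dn f" "dn g" shows "df E (\<lambda>s. f s = g s)"
proof -
  have "df E (\<lambda>s. num (f s) = num (g s))" by (intro dfi assms)
  then show ?thesis by simp
qed

lemma df_lessn [dfi]: assumes "dn f" "dn g" shows "df E (\<lambda>s. f s < g s)"
proof -
  have "df E (\<lambda>s. E (num (f s)) (num (g s)))" by (intro dfi assms)
  then show ?thesis by simp
qed

lemma df_len [dfi]: assumes "dn f" "dn g" shows "df E (\<lambda>s. f s \<le> g s)"
  unfolding not_less[symmetric] by (intro dfi assms)

lemma df_in [dfi]: "dn f \<Longrightarrow> dt E g \<Longrightarrow> df E (\<lambda>s. f s \<in> st (g s))"
  unfolding st_def mem_Collect_eq by (intro dfi)

lemma df_exn [dfi]: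
  assumes "df E (\<lambda>s. R (nt (s 0)) (\<lambda>i. s (Suc i)))" shows "df E (\<lambda>s. \<exists>n::nat. R n s)"
proof -
  have "df E (\<lambda>s. \<exists>x\<in>el om. R (nt x) s)" by (rule df_bex, rule dt_const, rule assms)
  then show ?thesis by simp
qed

lemma df_alln [dfi]:
  assumes "df E (\<lambda>s. R (nt (s 0)) (\<lambda>i. s (Suc i)))" shows "df E (\<lambda>s. \<forall>n::nat. R n s)"
proof -
  have "df E (\<lambda>s. \<not> (\<exists>n::nat. \<not> R n s))" by (rule df_neg, rule df_exn, rule df_neg, rule assms)
  then show ?thesis by simp
qed

lemma df_exr [dfi]:
  assumes "df E (\<lambda>s. R (st (s 0)) (\<lambda>i. s (Suc i)))" shows "df E (\<lambda>s. \<exists>Z. isr Z \<and> R Z s)"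
proof -
  have "(\<exists>x. R (st x) s) \<longleftrightarrow> (\<exists>Z. isr Z \<and> R Z s)" for s using isr_st st_rl by metis
  moreover have "df E (\<lambda>s. \<exists>x. R (st x) s)" by (rule df_ex, rule assms)
  ultimately show ?thesis by simp
qed

lemma isrI: assumes "df E (\<lambda>s. R (nt (s 0)))" shows "isr {n. R n}"
proof -
  have e: "num ` {n. R n} = {x \<in> el om. R (nt x)}" by auto
  show ?thesis unfolding isr_def e by (rule isset_sep[OF isset_el assms])
qed

lemma dt_rl [dfi]:
  assumes "df E (\<lambda>s. R (nt (s 0)) (\<lambda>i. s (Suc i)))" shows "dt E (\<lambda>s. rl {n. R n s})"
proof -
  have e: "num ` {n. R n s} = {x \<in> el om. R (nt x) s}" for s by auto
  show ?thesis unfolding rl_def e by (rule dt_sep[OF dt_const assms])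
qed

lemma dn_pfst [dfi]: assumes "dn f" shows "dn (\<lambda>s. pfst (f s))"
proof -
  have *: "x = num (pfst n) \<longleftrightarrow> (\<exists>a. x = num a \<and> ((\<exists>b. n = pp a b) \<or> (\<not> (\<exists>m b. n = pp m b) \<and> a = 0)))" for x n
    unfolding pfst_iff[symmetric] by auto
  have "dt E (\<lambda>s. num (pfst (nt (s 0))))" unfolding dt_def * by (intro dfi)
  from dt_comp1[of E "\<lambda>x. num (pfst (nt x))", OF this assms[unfolded dn_def]]
  show ?thesis unfolding dn_def by simp
qed

lemma dn_psnd [dfi]: assumes "dn f" shows "dn (\<lambda>s. psnd (f s))"
proof -
  have *: "x = num (psnd n) \<longleftrightarrow> (\<exists>a. x = num a \<and> ((\<exists>b. n = pp b a) \<or> (\<not> (\<exists>m b. n = pp m b) \<and> a = 0)))" for x n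
    unfolding psnd_iff[symmetric] by auto
  have "dt E (\<lambda>s. num (psnd (nt (s 0))))" unfolding dt_def * by (intro dfi)
  from dt_comp1[of E "\<lambda>x. num (psnd (nt x))", OF this assms[unfolded dn_def]]
  show ?thesis unfolding dn_def by simp
qed

definition secm :: "'a \<Rightarrow> nat \<Rightarrow> 'a" where "secm x n = rl {m. pp n m \<in> st x}"

lemma st_secm [simp]: "st (secm x n) = sec (st x) n"
proof -
  have "isr {m. pp n m \<in> st x}" by (rule isrI, intro dfi)
  then show ?thesis by (simp add: secm_def sec_def)
qed

lemma secm_real: "el (secm x n) \<subseteq> el om"
  unfolding secm_def by (rule rl_real, rule isrI, intro dfi)

lemma dt_secm [dfi]: assumes "dt E f" "dn g" shows "dt E (\<lambda>s. secm (f s) (g s))"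
proof -
  have "dt E (\<lambda>s. secm (s 0) (nt (s 1)))" unfolding secm_def by (intro dfi)
  from dt_comp2[of E "\<lambda>x y. secm x (nt y)", OF this assms(1) assms(2)[unfolded dn_def]] show ?thesis by simp
qed

lemma df_asub [dfi]: assumes "dt E f" "dt E g" shows "df E (\<lambda>s. asub (st (f s)) (st (g s)))"
proof -
  have "df E (\<lambda>s. asub (st (s 0)) (st (s 1)))" unfolding asub_def by (intro dfi)
  from df_comp2[of E "\<lambda>x y. asub (st x) (st y)", OF this assms] show ?thesis .
qed

lemma df_infinite [dfi]: assumes "dt E f" shows "df E (\<lambda>s. infinite (st (f s)))"
proof -
  have "df E (\<lambda>s. infinite (st (s 0)))" unfolding infinite_unbounded by (intro dfi)
  from df_comp1[of E "\<lambda>x. infinite (st x)", OF this assms] show ?thesis .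
qed

definition stp :: "'a \<Rightarrow> 'a \<Rightarrow> nat \<Rightarrow> nat \<Rightarrow> nat \<Rightarrow> bool" where
  "stp r c k n n' \<longleftrightarrow> (if k \<in> st c \<and> asub (st (secm r (pfst k))) (st (secm r n)) \<and> infinite (st (secm r (pfst k)))
     then n' = pfst k else n' = n)"

lemma stp_ix: "stp r c k (ix (st r) (st c) i k) n \<longleftrightarrow> n = ix (st r) (st c) i (Suc k)"
  by (simp add: stp_def)

text \<open>The recursion for \<open>ix\<close> is external. For definability, its values up to
  \<open>l\<close> are collected in a finite set \<open>Z\<close>, which the model contains;
  \<open>R\<close> stands for whatever is said about the last value.\<close>

lemma ix_rel: "R (ix (st r) (st c) i l) \<longleftrightarrow> (\<exists>Z. isr Z \<and> ((\<forall>n. pp 0 n \<in> Z \<longleftrightarrow> n = i) \<and>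
   (\<forall>k. k < l \<longrightarrow> (\<forall>n. pp (Suc k) n \<in> Z \<longleftrightarrow> (\<exists>m. pp k m \<in> Z \<and> stp r c k m n))) \<and> (\<exists>n. pp l n \<in> Z \<and> R n)))"
  (is "_ \<longleftrightarrow> (\<exists>Z. isr Z \<and> ?A Z)")
proof
  assume R: "R (ix (st r) (st c) i l)"
  let ?Z = "(\<lambda>k. pp k (ix (st r) (st c) i k)) ` {..l}"
  have z: "pp k n \<in> ?Z \<longleftrightarrow> k \<le> l \<and> n = ix (st r) (st c) i k" for k n by auto
  have "isr ?Z" unfolding isr_def by (intro isset_finite) simp
  moreover have "?A ?Z" unfolding z using R by (auto simp: stp_ix simp del: ix.simps) (simp_all)
  ultimately show "\<exists>Z. isr Z \<and> ?A Z" by blast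
next
  assume "\<exists>Z. isr Z \<and> ?A Z"
  then obtain Z where "isr Z \<and> ?A Z" by (elim exE)
  note ZZ = conjunct2[OF this]
  note Z = conjunct1[OF ZZ] conjunct1[OF conjunct2[OF ZZ]] conjunct2[OF conjunct2[OF ZZ]]
  have "\<forall>n. pp k n \<in> Z \<longleftrightarrow> n = ix (st r) (st c) i k" if "k \<le> l" for k
    using that
  proof (induction k)
    case 0 then show ?case using Z(1) by simp
  next
    case (Suc k)
    then have "\<forall>n. pp k n \<in> Z \<longleftrightarrow> n = ix (st r) (st c) i k" "k < l" by simp_all
    then have "pp (Suc k) n \<in> Z \<longleftrightarrow> stp r c k (ix (st r) (st c) i k) n" for n using Z(2) by simp
    then show ?case unfolding stp_ix by blast
  qed
  then show "R (ix (st r) (st c) i l)" using Z(3) by simp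
qed

lemma df_stp [dfi]:
  assumes "dn f" "dn g" "dn h" "dt E r" "dt E c" shows "df E (\<lambda>s. stp (r s) (c s) (f s) (g s) (h s))"
proof -
  have *: "stp r c k n n' \<longleftrightarrow> (k \<in> st c \<and> asub (st (secm r (pfst k))) (st (secm r n)) \<and>
     infinite (st (secm r (pfst k))) \<and> n' = pfst k) \<or>
     (\<not> (k \<in> st c \<and> asub (st (secm r (pfst k))) (st (secm r n)) \<and> infinite (st (secm r (pfst k)))) \<and> n' = n)"
    for r c k n n' by (auto simp: stp_def)
  show ?thesis unfolding * by (intro dfi assms)
qed

lemma df_thin [dfi]:
  assumes "dn f" "dt E r" "dt E c" "dn i" shows "df E (\<lambda>s. f s \<in> thin (st (r s)) (st (c s)) (i s))"
proof -
  have *: "m \<in> sec (st r) (ix (st r) (st c) i l) \<longleftrightarrow> (\<exists>Z. isr Z \<and> ((\<forall>n. pp 0 n \<in> Z \<longleftrightarrow> n = i) \<and>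
   (\<forall>k. k < l \<longrightarrow> (\<forall>n. pp (Suc k) n \<in> Z \<longleftrightarrow> (\<exists>m. pp k m \<in> Z \<and> stp r c k m n))) \<and> (\<exists>n. pp l n \<in> Z \<and> m \<in> st (secm r n))))"
    for m r c i l unfolding st_secm by (rule ix_rel)
  have "df E (\<lambda>s. nt (s 0) \<in> thin (st (s 1)) (st (s 2)) (nt (s 3)))"
    unfolding thin_def inb_def mem_Collect_eq * by (intro dfi)
  from df_comp4[of E "\<lambda>x r c i. nt x \<in> thin (st r) (st c) (nt i)", OF this assms(1)[unfolded dn_def] assms(2,3) assms(4)[unfolded dn_def]]
  show ?thesis by simp
qed

text \<open>The nested conditional is flattened into a disjunction so that the rules in
  \<open>dfi\<close> apply to it.\<close>

lemma arop_mem: "x \<in> arop n k A B \<longleftrightarrow>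
   n = 0 \<and> (\<exists>v. x = pp v (pfst v)) \<or>
   n = 1 \<and> (\<exists>v w. x = pp v w \<and> pp (psnd v) w \<in> A) \<or>
   n = 2 \<and> (\<exists>v. x = pp v 0) \<or>
   n = 3 \<and> (\<exists>v w. x = pp v (Suc w) \<and> pp v w \<in> A) \<or>
   n = 4 \<and> (\<exists>v a b. x = pp v (a + b) \<and> pp v a \<in> A \<and> pp v b \<in> B) \<or>
   n = 5 \<and> (\<exists>v a b. x = pp v (a * b) \<and> pp v a \<in> A \<and> pp v b \<in> B) \<or>
   n = 6 \<and> (\<exists>w. pp x w \<in> A \<and> pp x w \<in> B) \<or>
   n = 7 \<and> (\<exists>w. pp x w \<in> A \<and> w \<in> B) \<or>
   n = 8 \<and> x \<notin> A \<or>
   n = 9 \<and> x \<in> A \<and> x \<in> B \<or>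
   n = 10 \<and> (\<exists>n. pp n x \<in> A) \<or>
   10 < n \<and> pp x k \<in> A"
proof (cases n)
  case (Suc m)
  have "m = 0 \<or> m = 1 \<or> m = 2 \<or> m = 3 \<or> m = 4 \<or> m = 5 \<or> m = 6 \<or> m = 7 \<or> m = 8 \<or> m = 9 \<or> 9 < m"
    by arith
  then show ?thesis unfolding Suc by (elim disjE) (simp_all add: eval_nat_numeral)
qed simp

lemma clop_mem: "x \<in> clop r n k A B \<longleftrightarrow> n = 0 \<and> pp k x \<in> r \<or> n = 1 \<and> x \<in> thin A B k \<or>
    (\<exists>n'. n = n' + 2 \<and> x \<in> arop n' k A B)"
proof -
  have "(\<exists>n'. n = n' + 2 \<and> x \<in> arop n' k A B) \<longleftrightarrow> 2 \<le> n \<and> x \<in> arop (n - 2) k A B" by (auto simp: le_iff_add)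
  then show ?thesis by (auto simp: clop_def sec_def)
qed

lemma isr_clop: assumes "isr r" "isr A" "isr B" shows "isr (clop r n k A B)"
proof -
  have "isr {x. x \<in> clop (st (rl r)) n k (st (rl A)) (st (rl B))}"
    by (rule isrI, unfold clop_mem arop_mem, intro dfi)
  then show ?thesis using assms by simp
qed

lemma isr_tm: "isr r \<Longrightarrow> isr (tm r v)"
proof (induction r v rule: tm.induct)
  case (1 r)
  have "isr {x. False}" by (rule isrI, intro dfi)
  then show ?case by simp
next
  case (2 r w)
  then show ?case by (simp add: isr_clop)
qed

lemma isr_Un: "isr A \<Longrightarrow> isr B \<Longrightarrow> isr (A \<union> B)" unfolding isr_def image_Un by (rule isset_Un)

lemma isr_pp: assumes "isr A" shows "isr {x. \<exists>m. x = pp n m \<and> m \<in> A}"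
proof -
  have "isr {x. \<exists>m. x = pp n m \<and> m \<in> st (rl A)}" by (rule isrI, intro dfi)
  then show ?thesis using assms by simp
qed

definition tmst :: "'a \<Rightarrow> nat \<Rightarrow> 'a \<Rightarrow> nat \<Rightarrow> bool" where
  "tmst r w z y \<longleftrightarrow> y \<in> clop (st r) (pfst w) (pfst (psnd w)) (st (secm z (pfst (psnd (psnd w)))))
     (st (secm z (psnd (psnd (psnd w)))))"

lemma df_tmst [dfi]: assumes "dt E r" "dn w" "dt E z" "dn y" shows "df E (\<lambda>s. tmst (r s) (w s) (z s) (y s))"
proof -
  have "df E (\<lambda>s. tmst (s 0) (nt (s 1)) (s 2) (nt (s 3)))"
    unfolding tmst_def clop_mem arop_mem by (intro dfi)
  from df_comp4[of E "\<lambda>r w z y. tmst r (nt w) z (nt y)", OF this assms(1) assms(2)[unfolded dn_def] assms(3) assms(4)[unfolded dn_def]]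
  show ?thesis by simp
qed

text \<open>As with \<open>ix\<close>, an external recursion is replaced by a set of the model, here
  coding the values of all terms up to \<open>v\<close>. These values may be infinite, so the
  existence of the set is proved by induction on \<open>v\<close>.\<close>

lemma tm_rel: "x \<in> tm (st r) v \<longleftrightarrow> (\<exists>z. (\<forall>y. pp 0 y \<notin> st z) \<and>
   (\<forall>w. w < v \<longrightarrow> (\<forall>y. pp (Suc w) y \<in> st z \<longleftrightarrow> tmst r w z y)) \<and> pp v x \<in> st z)"
proof -
  have t: "tm (st r) (Suc w) = {y. tmst r w z y}"
    if "\<And>u. u \<le> w \<Longrightarrow> sec (st z) u = tm (st r) u" for w z
  proof -
    have "pfst (psnd (psnd w)) \<le> w" "psnd (psnd (psnd w)) \<le> w"
      by (meson order_trans pfst_le psnd_le)+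
    then show ?thesis using that by (simp add: tmst_def tsub_def)
  qed
  show ?thesis
  proof
    assume x: "x \<in> tm (st r) v"
    let ?Z = "\<lambda>v. {x. \<exists>w m. x = pp w m \<and> w \<le> v \<and> m \<in> tm (st r) w}"
    have "isr (?Z v)" for v
    proof (induction v)
      case 0
      have "?Z 0 = {x. False}" by auto
      moreover have "isr {x. False}" by (rule isrI, intro dfi)
      ultimately show ?case by simp
    next
      case (Suc v)
      have "?Z (Suc v) = ?Z v \<union> {x. \<exists>m. x = pp (Suc v) m \<and> m \<in> tm (st r) (Suc v)}"
        by (auto simp: le_Suc_eq simp del: tm.simps)
      moreover have "isr {x. \<exists>m. x = pp (Suc v) m \<and> m \<in> tm (st r) (Suc v)}"
        by (rule isr_pp[OF isr_tm[OF isr_st]])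
      ultimately show ?case using isr_Un[OF Suc] by (simp only:)
    qed
    note st_rl[OF this[of v]]
    then have z: "sec (st (rl (?Z v))) w = tm (st r) w" if "w \<le> v" for w
      using that by (auto simp: sec_def simp del: tm.simps)
    have z': "pp w y \<in> st (rl (?Z v)) \<longleftrightarrow> y \<in> tm (st r) w" if "w \<le> v" for w y
      using z[OF that] unfolding sec_def by blast
    have "pp (Suc w) y \<in> st (rl (?Z v)) \<longleftrightarrow> tmst r w (rl (?Z v)) y" if "w < v" for w y
    proof -
      have "tm (st r) (Suc w) = {y. tmst r w (rl (?Z v)) y}" by (rule t, rule z) (use that in simp)
      then show ?thesis using z'[of "Suc w" y] that by (simp del: tm.simps)
    qed
    moreover have "pp 0 y \<notin> st (rl (?Z v))" for y using z'[of 0 y] by simp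
    ultimately show "\<exists>z. (\<forall>y. pp 0 y \<notin> st z) \<and>
      (\<forall>w. w < v \<longrightarrow> (\<forall>y. pp (Suc w) y \<in> st z \<longleftrightarrow> tmst r w z y)) \<and> pp v x \<in> st z"
      using z'[of v x] x by blast
  next
    assume "\<exists>z. (\<forall>y. pp 0 y \<notin> st z) \<and>
      (\<forall>w. w < v \<longrightarrow> (\<forall>y. pp (Suc w) y \<in> st z \<longleftrightarrow> tmst r w z y)) \<and> pp v x \<in> st z"
    then obtain z where z: "\<forall>y. pp 0 y \<notin> st z"
      "\<forall>w. w < v \<longrightarrow> (\<forall>y. pp (Suc w) y \<in> st z \<longleftrightarrow> tmst r w z y)" "pp v x \<in> st z" by (elim exE conjE)
    have "sec (st z) w = tm (st r) w" if "w \<le> v" for w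
      using that
    proof (induction w rule: less_induct)
      case (less w)
      show ?case
      proof (cases w)
        case 0
        then show ?thesis using z(1) by (simp add: sec_def)
      next
        case (Suc u)
        have "tm (st r) (Suc u) = {y. tmst r u z y}" by (rule t) (use less Suc in auto)
        moreover have "sec (st z) (Suc u) = {y. tmst r u z y}" using z(2) less.prems Suc by (simp add: sec_def)
        ultimately show ?thesis unfolding Suc by simp
      qed
    qed
    then show "x \<in> tm (st r) v" using z(3) unfolding sec_def by blast
  qed
qed

lemma df_tm [dfi]: assumes "dn f" "dt E r" "dn g" shows "df E (\<lambda>s. f s \<in> tm (st (r s)) (g s))"
proof -
  have "df E (\<lambda>s. nt (s 0) \<in> tm (st (s 1)) (nt (s 2)))" unfolding tm_rel by (intro dfi)
  from df_comp3[of E "\<lambda>x r v. nt x \<in> tm (st r) (nt v)", OF this assms(1)[unfolded dn_def] assms(2) assms(3)[unfolded dn_def]]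
  show ?thesis by simp
qed

text \<open>
  The set \<open>s\<close> itself is put in front of the family that it codes, so that the closure of a family
  contains a code of the family.
\<close>

definition jn :: "nat set \<Rightarrow> nat set" where
  "jn s = {x. \<exists>n m. x = pp n m \<and> (n = 0 \<and> m \<in> s \<or> (\<exists>k. n = Suc k \<and> pp k m \<in> s))}"

lemma sec_jn: "sec (jn s) 0 = s" "sec (jn s) (Suc k) = sec s k"
  by (auto simp: jn_def sec_def)

definition "jnm x = rl (jn (st x))"
definition "clm x = rl (cl (st x))"

lemma dt_jnm [dfi]: assumes "dt E f" shows "dt E (\<lambda>s. jnm (f s))"
proof -
  have "dt E (\<lambda>s. jnm (s 0))" unfolding jnm_def jn_def by (intro dfi)
  from dt_comp1[OF this assms] show ?thesis .
qed

lemma dt_clm [dfi]: assumes "dt E f" shows "dt E (\<lambda>s. clm (f s))"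
proof -
  have "dt E (\<lambda>s. clm (s 0))" unfolding clm_def cl_def by (intro dfi)
  from dt_comp1[OF this assms] show ?thesis .
qed

lemma st_jnm: "st (jnm x) = jn (st x)"
proof -
  have "isr (jn (st x))" unfolding jn_def by (rule isrI, intro dfi)
  then show ?thesis by (simp add: jnm_def)
qed

lemma st_clm: "st (clm x) = cl (st x)"
proof -
  have "isr (cl (st x))" unfolding cl_def by (rule isrI, intro dfi)
  then show ?thesis by (simp add: clm_def)
qed

end

section \<open>A criterion for properness\<close>

text \<open>The Tarski-Vaught direction: a nonempty subset of \<open>H\<close> that is definable
  over \<open>H\<close> from parameters in \<open>K\<close> meets \<open>K\<close>. Apart from
  \<open>K \<subseteq> H\<close>, elementarity is used only in this form.\<close>

lemma elem_submodel_ex: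
  assumes K: "elem_submodel E K H" and R: "dfn E (elts E H) (elts E K) (\<lambda>s. R (s 0))"
    and x: "x \<in> elts E H" "R x"
  shows "\<exists>x\<in>elts E K. R x"
proof -
  obtain p t where t: "range t \<subseteq> elts E K" and p: "\<forall>s. R (s 0) \<longleftrightarrow> sat E (elts E H) (mix s t) p"
    using R unfolding dfn_def by (elim exE conjE)
  let ?p = "ren (\<lambda>n. if even n then 0 else Suc (n div 2)) p"
  have "(\<lambda>n. case_nat x t (if even n then 0 else Suc (n div 2))) = mix (\<lambda>_. x) t" for x
    by (rule HOL.ext) (simp add: mix_def)
  then have R: "R x \<longleftrightarrow> sat E (elts E H) (case_nat x t) ?p" for x
    using p[rule_format, of "\<lambda>_. x"] by (simp add: sat_ren)
  have el: "sat E (elts E K) s f = sat E (elts E H) s f" if "\<forall>i. s i \<in> elts E K" for s f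
    using K that unfolding elem_submodel_def by blast
  have t': "\<forall>i. t i \<in> elts E K" using t by blast
  have "sat E (elts E H) t (Exists ?p)" using x unfolding R sat.simps by blast
  then have "sat E (elts E K) t (Exists ?p)" using el[OF t'] by blast
  then obtain y where y: "y \<in> elts E K" "sat E (elts E K) (case_nat y t) ?p" unfolding sat.simps by blast
  have "\<forall>i. case_nat y t i \<in> elts E K" using y(1) t' by (simp split: nat.split)
  then have "R y" unfolding R using el y(2) by blast
  then show ?thesis using y(1) by blast
qed

context zfm
begin

text \<open>
  Pairing with all quantifiers bounded by \<open>H\<close>, as required for elementarity.
\<close>

definition prH :: "'a \<Rightarrow> 'a \<Rightarrow> 'a \<Rightarrow> 'a \<Rightarrow> bool" where
  "prH H x y z \<longleftrightarrow> (\<exists>u\<in>el H. \<exists>v\<in>el H. (\<forall>w\<in>el H. E w z \<longleftrightarrow> w = u \<or> w = v) \<and>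
     (\<forall>w\<in>el H. E w u \<longleftrightarrow> w = x) \<and> (\<forall>w\<in>el H. E w v \<longleftrightarrow> w = x \<or> w = y))"

definition rlH :: "'a \<Rightarrow> 'a \<Rightarrow> 'a \<Rightarrow> 'a \<Rightarrow> bool" where
  "rlH H x y f \<longleftrightarrow> (\<exists>z\<in>el H. E z f \<and> prH H x y z)"

lemmas dhi = dfn_neg[where E=E] dfn_conj[where E=E] dfn_disj[where E=E] dfn_imp[where E=E] dfn_iff[where E=E]
  dfn_ex[where E=E] dfn_all[where E=E] dfn_atoms[where E=E] tmv_var tmv_const

lemma tmv_ren: "tmv C f \<Longrightarrow> tmv C (\<lambda>s. f (\<lambda>i. s (r i)))"
  unfolding tmv_def by fastforce

lemma dfn_rlH:
  assumes "tmv C f" "tmv C g" "tmv C h" "C \<noteq> {}"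
  shows "dfn E (el H) C (\<lambda>s. rlH H (f s) (g s) (h s))"
proof -
  let ?r = "\<lambda>i. Suc (Suc (Suc (Suc i)))"
  note t = tmv_ren[OF assms(1), of ?r] tmv_ren[OF assms(2), of ?r] tmv_ren[OF assms(3), of Suc]
  show ?thesis unfolding rlH_def prH_def by (intro dhi t assms(4))
qed

lemma rlH_iff:
  assumes tr: "\<And>x y. x \<in> el H \<Longrightarrow> E y x \<Longrightarrow> y \<in> el H" and f: "f \<in> el H" and x: "x \<in> el H" and y: "y \<in> el H"
  shows "rlH H x y f \<longleftrightarrow> E (pr x y) f"
proof -
  have "prH H x y z \<longleftrightarrow> z = pr x y" if z: "z \<in> el H" for z
  proof
    assume "prH H x y z"
    then obtain u v where u: "u \<in> el H" "v \<in> el H" "\<forall>w\<in>el H. E w z \<longleftrightarrow> w = u \<or> w = v"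
      "\<forall>w\<in>el H. E w u \<longleftrightarrow> w = x" "\<forall>w\<in>el H. E w v \<longleftrightarrow> w = x \<or> w = y" unfolding prH_def by (elim bexE conjE)
    have s: "a \<in> el H \<Longrightarrow> E w a \<Longrightarrow> w \<in> el H" for a w by (rule tr)
    have "E w u \<longleftrightarrow> w = x" for w using u(4) s[OF u(1)] x by blast
    moreover have "E w v \<longleftrightarrow> w = x \<or> w = y" for w using u(5) s[OF u(2)] x y by blast
    moreover have "E w z \<longleftrightarrow> w = u \<or> w = v" for w using u(3) s[OF z] u(1,2) by blast
    ultimately have "u = upair x x" "v = upair x y" "z = upair u v" by (auto intro!: ext simp: el_iff set_eq_iff)
    then show "z = pr x y" by (simp add: pr_def)
  next
    assume zz: "z = pr x y"
    have "upair x x \<in> el H" "upair x y \<in> el H" by (rule tr[OF z], simp add: zz pr_def)+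
    then show "prH H x y z" unfolding prH_def zz
      by (intro bexI[of _ "upair x x"] bexI[of _ "upair x y"]) (simp_all add: pr_def)
  qed
  then show ?thesis unfolding rlH_def using tr[OF f] by blast
qed

lemma H_mem: "is_H E l H \<Longrightarrow> x \<in> el H \<longleftrightarrow> (\<exists>t. trans_set E t \<and> el x \<subseteq> el t \<and> card_less E t l)"
  unfolding is_H_def by blast

lemma H_trans: assumes H: "is_H E l H" and x: "x \<in> el H" "E y x" shows "y \<in> el H"
proof -
  obtain t where t: "trans_set E t" "el x \<subseteq> el t" "card_less E t l" using x(1) unfolding H_mem[OF H] by blast
  have "y \<in> el t" using t(2) x(2) by (auto simp: el_iff)
  then have "el y \<subseteq> el t" using t(1) unfolding trans_set_def by blast
  then show ?thesis unfolding H_mem[OF H] using t by blast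
qed

text \<open>
  All hypotheses on \<open>W\<close> can be expressed in \<open>H\<close>, so some \<open>V \<in> K\<close> satisfies them there. As the members of
  \<open>V\<close> are countable, \<open>K \<inter> Q\<close> is the union of \<open>K \<inter> V\<close>; as \<open>Q\<close> is uncountable, this union is itself
  a member of \<open>V\<close>, and \<open>good\<close> applies to it and to an enumeration of the dense sets in \<open>K\<close>.
\<close>

theorem proper_criterion:
  assumes QR: "\<And>A. A \<in> el Q \<Longrightarrow> el A \<subseteq> el om"
    and le: "preorder_on (el Q) (rel E le)"
    and Q1: "card_le E Q w1" and W1: "card_le E W w1" and unc: "\<not> card_le E Q om"
    and sub: "\<And>U. U \<in> el W \<Longrightarrow> el U \<subseteq> el Q"
    and cov: "\<And>A. A \<in> el Q \<Longrightarrow> \<exists>U\<in>el W. A \<in> el U"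
    and cnt: "\<And>U. U \<in> el W \<Longrightarrow> card_le E U om"
    and uni: "\<And>Z. el Z \<subseteq> el W \<Longrightarrow> Z \<noteq> emp \<Longrightarrow> un Z \<in> el W \<or> el Q \<subseteq> el (un Z)"
    and good: "\<And>U p f. U \<in> el W \<Longrightarrow> p \<in> el U \<Longrightarrow>
       (\<And>n a. n \<in> el om \<Longrightarrow> a \<in> el U \<Longrightarrow> \<exists>d\<in>el U. E (pr n d) f \<and> E (pr d a) le) \<Longrightarrow>
       \<exists>q\<in>el Q. E (pr q p) le \<and> (\<forall>n\<in>el om. \<exists>d\<in>el U. E (pr n d) f \<and> E (pr q d) le)"
  shows "proper_poset E Q le"
  unfolding proper_poset_def
proof (intro conjI allI impI ballI le)
  fix l pw H K p
  assume "cardinal E l \<and> elts E pw = {x. elts E x \<subseteq> elts E Q} \<and> card_less E pw l \<and>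
     is_H E l H \<and> elem_submodel E K H \<and> countable_in E K \<and> Q \<in> elts E K \<and> le \<in> elts E K"
  then have pw: "el pw = {x. el x \<subseteq> el Q}" "card_less E pw l" and H: "is_H E l H"
    and K: "elem_submodel E K H" and cK: "countable_in E K" and QK: "Q \<in> el K" and lK: "le \<in> el K" by blast+
  assume "p \<in> elts E Q \<inter> elts E K"
  then have p: "p \<in> el Q" "p \<in> el K" by blast+
  have KH: "el K \<subseteq> el H" using K unfolding elem_submodel_def by blast
  have Kne: "el K \<noteq> {}" using p by blast
  note tr = H_trans[OF H]
  have trK: "E y x \<Longrightarrow> x \<in> el K \<Longrightarrow> y \<in> el H" for x y using tr KH by blast
  have rl: "rlH H x y f \<longleftrightarrow> E (pr x y) f" if "f \<in> el H" "x \<in> el H" "y \<in> el H" for f x y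
    by (rule rlH_iff[OF _ that]) (rule tr)
  note ex = elem_submodel_ex[OF K]
  have ck: "card_le E K om" using cK by (simp add: countable_in_def card_le_omega_n_def)
  have om1: "card_le E om w1" using smal_w1 unfolding smal_def by (intro card_le_subset) blast

  \<comment> \<open>The cardinal \<open>l\<close> is only known to exceed the size of the power set
    of \<open>Q\<close>. Since \<open>Q\<close> has size \<omega>_1, all sets with a transitive
    superset of size at most \<omega>_1 lie in \<open>H\<close>.\<close>
  have wQ: "card_le E w1 Q"
  proof -
    have "card_eq E Q w1"
    proof (rule card_eq_ordinal[OF _ Q1])
      show "ord w1" using smal_w1 by (simp add: smal_def)
      fix b assume "b \<in> el w1"
      then have "card_le E b om" unfolding w1_def by simp
      then show "\<not> card_le E Q b" using unc card_le_trans by blast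
    qed
    then obtain f g where "fun_code E f Q g" "bij_betw g (el Q) (el w1)" unfolding card_eq_def by blast
    then have "el w1 \<subseteq> app f ` el Q" using fun_code_app unfolding bij_betw_def by (metis image_cong subset_refl)
    then show ?thesis by (rule card_le_surj[OF fn_app])
  qed
  have "card_le E Q pw"
    by (rule card_leI[of "\<lambda>x. upair x x"]) (auto simp: fn_def pw(1) inj_on_def upair_eq intro: dt_upair dt_var)
  then have wl: "card_less E t l" if "card_le E t w1" for t
    using that wQ pw(2) card_le_trans unfolding card_less_def by blast
  have inH: "x \<in> el H" if "trans_set E t" "el x \<subseteq> el t" "card_le E t w1" for x t
    unfolding H_mem[OF H] using that wl by blast
  have tom: "trans_set E om" unfolding trans_set_def by (auto simp: el_num)
  have omH: "om \<in> el H" by (rule inH[OF tom _ om1]) simp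
  let ?tW = "bun W (bun Q om)"
  have WH: "W \<in> el H"
  proof (rule inH[of ?tW])
    show "trans_set E ?tW" unfolding trans_set_def
      using sub QR tom[unfolded trans_set_def] by auto
    show "card_le E ?tW w1" by (intro smal_bun[OF smal_w1] W1 Q1 om1)
  qed simp
  have fH: "f \<in> el H" if U: "el U \<subseteq> el Q" "card_le E U om" and f: "el f \<subseteq> el (cprod om U)" for U f
  proof -
    \<comment> \<open>\<open>B0\<close> contains the components of the pairs in \<open>f\<close>,
      \<open>B1\<close> the unordered pairs of these and \<open>B2\<close> the Kuratowski pairs.
      Their union is countable and transitive, because the members of \<open>U\<close> are
      reals.\<close>
    define B0 where "B0 = bun U om"
    define B1 where "B1 = mk ((\<lambda>z. upair (p1 z) (p2 z)) ` el (cprod B0 B0))"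
    define B2 where "B2 = mk ((\<lambda>z. upair (p1 z) (p2 z)) ` el (cprod B1 B1))"
    have fu: "fn (\<lambda>z. upair (p1 z) (p2 z))" unfolding fn_def by (intro dfi)
    have up: "el (mk ((\<lambda>z. upair (p1 z) (p2 z)) ` el (cprod B B))) = {upair x y | x y. x \<in> el B \<and> y \<in> el B}" for B
      unfolding el_mk[OF isset_fn[OF fu isset_el]] by force
    have cu: "card_le E (mk ((\<lambda>z. upair (p1 z) (p2 z)) ` el (cprod B B))) om" if "card_le E B om" for B
      using card_le_surj[OF fu] smal_cprod[OF smal_om that that] card_le_trans
      by (metis el_mk fu isset_el isset_fn subset_refl)
    have c0: "card_le E B0 om" unfolding B0_def by (intro smal_bun[OF smal_om] U card_le_refl)
    have c1: "card_le E B1 om" unfolding B1_def by (rule cu[OF c0])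
    have c2: "card_le E B2 om" unfolding B2_def by (rule cu[OF c1])
    have e1: "el B1 = {upair x y | x y. x \<in> el B0 \<and> y \<in> el B0}" unfolding B1_def by (rule up)
    have e2: "el B2 = {upair x y | x y. x \<in> el B1 \<and> y \<in> el B1}" unfolding B2_def by (rule up)
    let ?t = "bun B0 (bun B1 B2)"
    show ?thesis
    proof (rule inH[of ?t])
      have "el a \<subseteq> el om" if "a \<in> el B0" for a
        using that U(1) QR tom unfolding B0_def trans_set_def by auto
      then have t0: "el a \<subseteq> el ?t" if "a \<in> el B0" for a using that unfolding B0_def by auto
      have t1: "el a \<subseteq> el ?t" if a: "a \<in> el B1" for a
      proof -
        obtain x y where "a = upair x y" "x \<in> el B0" "y \<in> el B0" using a unfolding e1 by blast
        then show ?thesis by simp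
      qed
      have t2: "el a \<subseteq> el ?t" if a: "a \<in> el B2" for a
      proof -
        obtain x y where "a = upair x y" "x \<in> el B1" "y \<in> el B1" using a unfolding e2 by blast
        then show ?thesis by simp
      qed
      show "trans_set E ?t" unfolding trans_set_def
      proof
        fix a assume "a \<in> el ?t"
        then have "a \<in> el B0 \<or> a \<in> el B1 \<or> a \<in> el B2" by simp
        then show "el a \<subseteq> el ?t" by (elim disjE) (rule t0 t1 t2, assumption)+
      qed
      have "card_le E ?t om" by (intro smal_bun[OF smal_om] c0 c1 c2)
      then show "card_le E ?t w1" using om1 card_le_trans by blast
      show "el f \<subseteq> el ?t"
      proof
        fix z assume "z \<in> el f"
        then obtain n d where z: "z = pr n d" "n \<in> el om" "d \<in> el U" using f by auto
        then have "n \<in> el B0" "d \<in> el B0" unfolding B0_def by auto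
        then have "upair n n \<in> el B1" "upair n d \<in> el B1" unfolding e1 by blast+
        then have "z \<in> el B2" unfolding e2 z(1) pr_def by blast
        then show "z \<in> el ?t" by simp
      qed
    qed
  qed

  have omK: "om \<in> el K"
  proof -
    \<comment> \<open>A description of \<omega> with quantifiers over \<open>H\<close>: it contains
      0, is closed under successors, and each member is 0 or the successor of a member. Foundation
      excludes all other solutions.\<close>
    let ?R = "\<lambda>x. (\<exists>z\<in>el H. E z x \<and> (\<forall>w\<in>el H. \<not> E w z)) \<and>
      (\<forall>y\<in>el H. E y x \<longrightarrow> (\<exists>z\<in>el H. E z x \<and> (\<forall>w\<in>el H. E w z \<longleftrightarrow> E w y \<or> w = y))) \<and>
      (\<forall>y\<in>el H. E y x \<longrightarrow> (\<forall>w\<in>el H. \<not> E w y) \<or> (\<exists>z\<in>el H. E z x \<and> (\<forall>w\<in>el H. E w y \<longleftrightarrow> E w z \<or> w = z)))"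
    have nH: "num n \<in> el H" for n by (rule tr[OF omH]) simp
    have "?R om"
    proof (intro conjI ballI impI)
      show "\<exists>z\<in>el H. E z om \<and> (\<forall>w\<in>el H. \<not> E w z)" by (rule bexI[OF _ nH[of 0]]) (auto intro: range_eqI[of _ _ 0])
    next
      fix y assume "E y om"
      then obtain n where y: "y = num n" by auto
      show "\<exists>z\<in>el H. E z om \<and> (\<forall>w\<in>el H. E w z \<longleftrightarrow> E w y \<or> w = y)"
        by (rule bexI[OF _ nH[of "Suc n"]]) (auto simp: y image_iff intro: exI[of _ "Suc n"])
    next
      fix y assume "E y om"
      then obtain n where y: "y = num n" by auto
      show "(\<forall>w\<in>el H. \<not> E w y) \<or> (\<exists>z\<in>el H. E z om \<and> (\<forall>w\<in>el H. E w y \<longleftrightarrow> E w z \<or> w = z))"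
      proof (cases n)
        case (Suc m)
        show ?thesis by (rule disjI2, rule bexI[OF _ nH[of m]]) (auto simp: y Suc)
      qed (simp add: y)
    qed
    moreover have "dfn E (el H) (el K) (\<lambda>s. ?R (s 0))" by (intro dhi Kne)
    ultimately have "\<exists>x\<in>el K. ?R x" using ex[of ?R] omH by blast
    then obtain x where x: "x \<in> el K" "?R x" by (elim bexE)
    note x2 = conjunct1[OF x(2)] conjunct1[OF conjunct2[OF x(2)]] conjunct2[OF conjunct2[OF x(2)]]
    have xE: "E y x" and xH: "y \<in> el H" if "y \<in> el x" for y
      using that trK[of y x] x(1) by (simp_all add: el_iff)
    have x0: "emp \<in> el x"
    proof -
      obtain z where z: "z \<in> el H" "E z x" "\<forall>w\<in>el H. \<not> E w z" using x2(1) by (elim bexE conjE)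
      then have "el z = {}" using tr[OF z(1)] unfolding elts_def by blast
      then show ?thesis using z(2) by (simp add: el_empty_iff el_iff)
    qed
    have xs: "suc y \<in> el x" if y: "y \<in> el x" for y
    proof -
      have yH: "y \<in> el H" by (rule xH[OF y])
      have "\<exists>z\<in>el H. E z x \<and> (\<forall>w\<in>el H. E w z \<longleftrightarrow> E w y \<or> w = y)"
        by (rule mp[OF bspec[OF x2(2) yH] xE[OF y]])
      then obtain z where z: "z \<in> el H" "E z x" "\<forall>w\<in>el H. E w z \<longleftrightarrow> E w y \<or> w = y" by (elim bexE conjE)
      have "E w z \<longleftrightarrow> E w y \<or> w = y" for w using bspec[OF z(3), of w] tr[OF z(1)] tr[OF yH] yH by metis
      then have "z = suc y" by (intro ext) (auto simp: el_iff)
      then show ?thesis using z(2) by (simp add: el_iff)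
    qed
    have xp: "y = emp \<or> (\<exists>z\<in>el x. y = suc z)" if y: "y \<in> el x" for y
    proof -
      have yH: "y \<in> el H" by (rule xH[OF y])
      have "(\<forall>w\<in>el H. \<not> E w y) \<or> (\<exists>z\<in>el H. E z x \<and> (\<forall>w\<in>el H. E w y \<longleftrightarrow> E w z \<or> w = z))"
        by (rule mp[OF bspec[OF x2(3) yH] xE[OF y]])
      then consider "\<forall>w\<in>el H. \<not> E w y" | z where "z \<in> el H" "E z x" "\<forall>w\<in>el H. E w y \<longleftrightarrow> E w z \<or> w = z"
        by (elim disjE bexE conjE)
      then show ?thesis
      proof cases
        case 1
        then have "el y = {}" using tr[OF yH] unfolding elts_def by blast
        then show ?thesis by (simp add: el_empty_iff)
      next
        case (2 z)
        have "E w y \<longleftrightarrow> E w z \<or> w = z" for w using bspec[OF 2(3), of w] tr[OF yH] tr[OF 2(1)] 2(1) by metis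
        then have "y = suc z" by (intro ext) (auto simp: el_iff)
        then show ?thesis using 2(2) by (auto simp: el_iff)
      qed
    qed
    have "num n \<in> el x" for n by (induction n) (simp_all add: x0 xs)
    moreover have "y \<in> el x \<longrightarrow> y \<in> range num" for y
    proof (induction y rule: E_induct)
      case (1 y)
      show ?case
      proof
        assume "y \<in> el x"
        then consider "y = emp" | z where "z \<in> el x" "y = suc z" using xp by blast
        then show "y \<in> range num"
        proof cases
          case 1 then show ?thesis by (metis num.simps(1) rangeI)
        next
          case (2 z)
          then obtain n where "z = num n" using 1[of z] by auto
          then show ?thesis using 2 by (metis num.simps(2) rangeI)
        qed
      qed
    qed
    ultimately have "x = om" by (intro ext) auto
    then show ?thesis using x(1) by simp
  qed

  have numH: "num n \<in> el H" for n by (rule tr[OF omH]) simp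
  have numK: "num n \<in> el K" for n
  proof (induction n)
    case 0
    let ?R = "\<lambda>x. \<forall>w\<in>el H. \<not> E w x"
    have "dfn E (el H) (el K) (\<lambda>s. ?R (s 0))" by (intro dhi Kne)
    moreover have "emp \<in> el H" using numH[of 0] by simp
    ultimately obtain x where x: "x \<in> el K" "?R x" using ex[of ?R emp] by auto
    then have "el x = {}" using trK unfolding elts_def by blast
    then show ?case using x(1) by (simp add: el_empty_iff)
  next
    case (Suc n)
    let ?R = "\<lambda>x. \<forall>w\<in>el H. E w x \<longleftrightarrow> E w (num n) \<or> w = num n"
    have "dfn E (el H) (el K) (\<lambda>s. ?R (s 0))" by (intro dhi Kne Suc)
    moreover have "num (Suc n) \<in> el H" by (rule numH)
    moreover have "?R (num (Suc n))" by auto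
    ultimately obtain x where x: "x \<in> el K" "?R x" using ex[of ?R "num (Suc n)"] by blast
    have "E w x \<longleftrightarrow> E w (num n) \<or> w = num n" for w
      using bspec[OF x(2), of w] trK[OF _ x(1)] trK[OF _ Suc] KH Suc by blast
    then have "x = num (Suc n)" by (intro ext) (auto simp: el_iff)
    then show ?case using x(1) by simp
  qed

  \<comment> \<open>The hypotheses on \<open>W\<close> with all quantifiers restricted to
    \<open>H\<close>. Functions appear as sets of pairs: \<open>?ct U f\<close> says that the values
    of the partial map \<open>f\<close> on \<omega> include all of \<open>U\<close>.\<close>
  let ?sub = "\<lambda>W. \<forall>U\<in>el H. E U W \<longrightarrow> (\<forall>A\<in>el H. E A U \<longrightarrow> E A Q)"
  let ?cov = "\<lambda>W. \<forall>A\<in>el H. E A Q \<longrightarrow> (\<exists>U\<in>el H. E U W \<and> E A U)"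
  let ?ct = "\<lambda>U f. (\<forall>a\<in>el H. E a U \<longrightarrow> (\<exists>n\<in>el H. E n om \<and> rlH H n a f)) \<and>
    (\<forall>n\<in>el H. \<forall>a\<in>el H. \<forall>b\<in>el H. rlH H n a f \<longrightarrow> rlH H n b f \<longrightarrow> a = b)"
  let ?cnt = "\<lambda>W. \<forall>U\<in>el H. E U W \<longrightarrow> (\<exists>f\<in>el H. ?ct U f)"
  let ?uni = "\<lambda>W. \<forall>Z\<in>el H. (\<forall>U\<in>el H. E U Z \<longrightarrow> E U W) \<longrightarrow> (\<exists>U\<in>el H. E U Z) \<longrightarrow>
     (\<exists>V\<in>el H. E V W \<and> (\<forall>A\<in>el H. E A V \<longleftrightarrow> (\<exists>U\<in>el H. E U Z \<and> E A U))) \<or>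
     (\<forall>A\<in>el H. E A Q \<longrightarrow> (\<exists>U\<in>el H. E U Z \<and> E A U))"
  let ?good = "\<lambda>W. \<forall>U\<in>el H. E U W \<longrightarrow> (\<forall>p\<in>el H. E p U \<longrightarrow> (\<forall>f\<in>el H.
     (\<forall>n\<in>el H. E n om \<longrightarrow> (\<forall>a\<in>el H. E a U \<longrightarrow> (\<exists>d\<in>el H. E d U \<and> rlH H n d f \<and> rlH H d a le))) \<longrightarrow>
     (\<exists>q\<in>el H. E q Q \<and> rlH H q p le \<and> (\<forall>n\<in>el H. E n om \<longrightarrow> (\<exists>d\<in>el H. E d U \<and> rlH H n d f \<and> rlH H q d le)))))"
  let ?R = "\<lambda>W. ?sub W \<and> ?cov W \<and> ?cnt W \<and> ?uni W \<and> ?good W"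
  have lH: "le \<in> el H" and QH: "Q \<in> el H" using lK QK KH by blast+
  have "?R W"
  proof (intro conjI)
    show "?sub W" using sub unfolding elts_def by blast
    show "?cov W"
    proof (intro ballI impI)
      fix A assume A: "A \<in> el H" "E A Q"
      then obtain U where U: "U \<in> el W" "A \<in> el U" using cov[of A] unfolding elts_def by blast
      then show "\<exists>U\<in>el H. E U W \<and> E A U" using tr[OF WH, of U] unfolding elts_def by blast
    qed
    show "?cnt W"
    proof (intro ballI impI)
      fix U assume U: "U \<in> el H" "E U W"
      then have UW: "U \<in> el W" by (simp add: el_iff)
      obtain h where h: "inj_on (app h) (el U)" "app h ` el U \<subseteq> el om" using cnt[OF UW] by (rule card_leE)
      let ?f = "mk ((\<lambda>a. pr (app h a) a) ` el U)"
      have "isset ((\<lambda>a. pr (app h a) a) ` el U)" by (rule isset_img[OF isset_el], intro dfi)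
      then have f: "el ?f = (\<lambda>a. pr (app h a) a) ` el U" by (rule el_mk)
      have fH': "?f \<in> el H" by (rule fH[OF sub[OF UW] cnt[OF UW]]) (use f h(2) in auto)
      have Ef: "E (pr n a) ?f \<longleftrightarrow> a \<in> el U \<and> n = app h a" for n a
      proof -
        have "pr n a \<in> el ?f \<longleftrightarrow> a \<in> el U \<and> n = app h a" unfolding f by auto
        then show ?thesis by (simp only: el_iff)
      qed
      show "\<exists>f\<in>el H. ?ct U f"
      proof (rule bexI[OF _ fH'], intro conjI ballI impI)
        fix a assume a: "a \<in> el H" "E a U"
        then have aU: "a \<in> el U" by (simp add: el_iff)
        then have n: "app h a \<in> el om" using h(2) by blast
        then have nH: "app h a \<in> el H" using tr[OF omH] by (simp only: el_iff)
        show "\<exists>n\<in>el H. E n om \<and> rlH H n a ?f"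
          by (rule bexI[OF _ nH]) (use n aU in \<open>simp only: rl[OF fH' nH a(1)] Ef el_iff\<close>)
      next
        fix n a b assume n: "n \<in> el H" "a \<in> el H" "b \<in> el H" "rlH H n a ?f" "rlH H n b ?f"
        then have "a \<in> el U \<and> n = app h a" "b \<in> el U \<and> n = app h b"
          unfolding rl[OF fH' n(1,2)] rl[OF fH' n(1,3)] Ef by blast+
        then show "a = b" using inj_onD[OF h(1)] by metis
      qed
    qed
    show "?uni W"
    proof (intro ballI impI)
      fix Z assume Z: "Z \<in> el H" "\<forall>U\<in>el H. E U Z \<longrightarrow> E U W" "\<exists>U\<in>el H. E U Z"
      have "el Z \<subseteq> el W" using Z(2) tr[OF Z(1)] unfolding elts_def by blast
      moreover have "Z \<noteq> emp" using Z(3) by auto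
      ultimately have d: "un Z \<in> el W \<or> el Q \<subseteq> el (un Z)" by (rule uni)
      have u: "E A (un Z) \<longleftrightarrow> (\<exists>U\<in>el H. E U Z \<and> E A U)" for A using tr[OF Z(1)] by (auto simp: el_iff)
      from d show "(\<exists>V\<in>el H. E V W \<and> (\<forall>A\<in>el H. E A V \<longleftrightarrow> (\<exists>U\<in>el H. E U Z \<and> E A U))) \<or>
         (\<forall>A\<in>el H. E A Q \<longrightarrow> (\<exists>U\<in>el H. E U Z \<and> E A U))"
      proof
        assume "un Z \<in> el W"
        then have "E (un Z) W" "un Z \<in> el H" using tr[OF WH] by (simp_all only: el_iff)
        then show ?thesis using u by blast
      next
        assume "el Q \<subseteq> el (un Z)"
        then have "E A Q \<Longrightarrow> E A (un Z)" for A unfolding elts_def by blast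
        then show ?thesis using u by blast
      qed
    qed
    show "?good W"
    proof (intro ballI impI)
      fix U p f assume U: "U \<in> el H" "E U W" and p: "p \<in> el H" "E p U" and f: "f \<in> el H"
        and d: "\<forall>n\<in>el H. E n om \<longrightarrow> (\<forall>a\<in>el H. E a U \<longrightarrow> (\<exists>d\<in>el H. E d U \<and> rlH H n d f \<and> rlH H d a le))"
      have UW: "U \<in> el W" and pU: "p \<in> el U" using U p by (simp_all add: el_iff)
      have dU: "\<exists>d\<in>el U. E (pr n d) f \<and> E (pr d a) le" if n: "n \<in> el om" "a \<in> el U" for n a
      proof -
        have nH: "n \<in> el H" "E n om" "a \<in> el H" "E a U" using n tr[OF omH] tr[OF U(1)] by (simp_all only: el_iff)
        then obtain d where d: "d \<in> el H" "E d U" "rlH H n d f" "rlH H d a le" using d by blast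
        then show ?thesis unfolding rl[OF f nH(1) d(1)] rl[OF lH d(1) nH(3)] elts_def by blast
      qed
      have "\<exists>q\<in>el Q. E (pr q p) le \<and> (\<forall>n\<in>el om. \<exists>d\<in>el U. E (pr n d) f \<and> E (pr q d) le)"
        by (rule good[OF UW pU]) (rule dU)
      then obtain q where q: "q \<in> el Q" "E (pr q p) le"
        "\<forall>n\<in>el om. \<exists>d\<in>el U. E (pr n d) f \<and> E (pr q d) le" by (elim bexE conjE)
      have qH: "q \<in> el H" "E q Q" using q(1) tr[OF QH] by (simp_all only: el_iff)
      show "\<exists>q\<in>el H. E q Q \<and> rlH H q p le \<and> (\<forall>n\<in>el H. E n om \<longrightarrow> (\<exists>d\<in>el H. E d U \<and> rlH H n d f \<and> rlH H q d le))"
      proof (rule bexI[OF _ qH(1)], intro conjI qH(2) ballI impI)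
        show "rlH H q p le" using q(2) by (simp only: rl[OF lH qH(1) p(1)])
        fix n assume n: "n \<in> el H" "E n om"
        then obtain d where d: "d \<in> el U" "E (pr n d) f" "E (pr q d) le" using q(3) unfolding elts_def by blast
        have dH: "d \<in> el H" "E d U" using d(1) tr[OF U(1)] by (simp_all only: el_iff)
        show "\<exists>d\<in>el H. E d U \<and> rlH H n d f \<and> rlH H q d le"
          by (rule bexI[OF _ dH(1)]) (use d dH in \<open>simp only: rl[OF f n(1) dH(1)] rl[OF lH qH(1) dH(1)]\<close>)
      qed
    qed
  qed
  moreover have "dfn E (el H) (el K) (\<lambda>s. ?R (s 0))" by (intro dhi dfn_rlH Kne QK lK omK)
  ultimately have "\<exists>x\<in>el K. ?R x" by (intro ex[of ?R, OF _ WH])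
  then obtain V where VK: "V \<in> el K" and V: "?R V" by (elim bexE)
  have VH: "V \<in> el H" using VK KH by blast
  have V1: "?sub V" and V2: "?cov V" and V3: "?cnt V" and V4: "?uni V" and V5: "?good V"
    by (rule conjunct1[OF V], rule conjunct1[OF conjunct2[OF V]],
        rule conjunct1[OF conjunct2[OF conjunct2[OF V]]],
        rule conjunct1[OF conjunct2[OF conjunct2[OF conjunct2[OF V]]]],
        rule conjunct2[OF conjunct2[OF conjunct2[OF conjunct2[OF V]]]])

  \<comment> \<open>By elementarity some enumeration of \<open>U\<close> belongs to
    \<open>K\<close>, and with it all its values, since \<open>K\<close> contains every
    numeral.\<close>
  have UK: "el U \<subseteq> el K" if U: "U \<in> el K" "E U V" for U
  proof -
    have UH: "U \<in> el H" using U(1) KH by blast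
    have "\<exists>f\<in>el H. ?ct U f" by (rule mp[OF bspec[OF V3 UH] U(2)])
    moreover have "dfn E (el H) (el K) (\<lambda>s. ?ct U (s 0))" by (intro dhi dfn_rlH Kne U(1) omK)
    ultimately have "\<exists>f\<in>el K. ?ct U f" using ex[of "?ct U"] by blast
    then obtain f where f: "f \<in> el K" "?ct U f" by (elim bexE)
    show ?thesis
    proof
      fix a assume "a \<in> el U"
      then have a: "a \<in> el H" "E a U" using tr[OF UH] by (simp_all only: el_iff)
      then obtain n where n: "n \<in> el H" "E n om" "rlH H n a f" using f(2) by blast
      then have nK: "n \<in> el K" using numK by auto
      have "dfn E (el H) (el K) (\<lambda>s. rlH H n (s 0) f)" by (intro dhi dfn_rlH Kne nK f(1))
      then obtain b where b: "b \<in> el K" "rlH H n b f" using ex[of "\<lambda>x. rlH H n x f", OF _ a(1) n(3)] by blast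
      have "b \<in> el H" using b(1) KH by blast
      then have "a = b" using f(2) n a(1) b(2) by blast
      then show "a \<in> el K" using b(1) by simp
    qed
  qed
  have Vsub: "E U V \<Longrightarrow> E A U \<Longrightarrow> A \<in> el Q" for U A
    using V1 tr[OF VH, of U] tr[of U A] by (auto simp: el_iff)
  have KQ: "A \<in> el Q \<and> A \<in> el K \<longleftrightarrow> (\<exists>U\<in>el K. E U V \<and> E A U)" for A
  proof
    assume A: "A \<in> el Q \<and> A \<in> el K"
    then have AH: "A \<in> el H" "E A Q" using KH by (auto simp: el_iff)
    then have "\<exists>U\<in>el H. E U V \<and> E A U" using V2 by blast
    moreover have "dfn E (el H) (el K) (\<lambda>s. E (s 0) V \<and> E A (s 0))" by (intro dhi Kne VK) (use A in simp)
    ultimately show "\<exists>U\<in>el K. E U V \<and> E A U" using ex[of "\<lambda>U. E U V \<and> E A U"] by blast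
  next
    assume "\<exists>U\<in>el K. E U V \<and> E A U"
    then obtain U where U: "U \<in> el K" "E U V" "E A U" by blast
    then show "A \<in> el Q \<and> A \<in> el K" using UK[OF U(1,2)] Vsub by (auto simp: el_iff)
  qed
  \<comment> \<open>\<open>Z\<close> need not belong to \<open>K\<close>; as a subset of
    \<open>V\<close> it belongs to \<open>H\<close>, which is where \<open>?uni V\<close>
    quantifies.\<close>
  define Z where "Z = mk {U \<in> el V. E U K}"
  have Z: "el Z = {U \<in> el V. E U K}" unfolding Z_def by (rule el_mk, rule isset_sep[OF isset_el], intro dfi)
  have EZ: "E U Z \<longleftrightarrow> E U V \<and> U \<in> el K" for U using Z by (auto simp: set_eq_iff el_iff)
  have ZH: "Z \<in> el H"
  proof -
    obtain t where t: "trans_set E t" "el V \<subseteq> el t" "card_less E t l" using VH unfolding H_mem[OF H] by blast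
    then show ?thesis unfolding H_mem[OF H] Z by blast
  qed
  have KQ': "A \<in> el Q \<and> A \<in> el K \<longleftrightarrow> (\<exists>U\<in>el H. E U Z \<and> E A U)" for A
    unfolding KQ EZ using KH by blast
  have "\<exists>U\<in>el H. E U Z" using KQ'[of p] p by blast
  moreover have "\<forall>U\<in>el H. E U Z \<longrightarrow> E U V" using EZ by blast
  ultimately have "(\<exists>U\<in>el H. E U V \<and> (\<forall>A\<in>el H. E A U \<longleftrightarrow> (\<exists>U\<in>el H. E U Z \<and> E A U))) \<or>
     (\<forall>A\<in>el H. E A Q \<longrightarrow> (\<exists>U\<in>el H. E U Z \<and> E A U))" using bspec[OF V4 ZH] by blast
  moreover have "\<not> (\<forall>A\<in>el H. E A Q \<longrightarrow> (\<exists>U\<in>el H. E U Z \<and> E A U))"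
  proof
    assume "\<forall>A\<in>el H. E A Q \<longrightarrow> (\<exists>U\<in>el H. E U Z \<and> E A U)"
    then have "A \<in> el K" if A: "A \<in> el Q" for A
      using A KQ'[of A] tr[OF QH, of A] by (simp add: el_iff)
    then have "el Q \<subseteq> el K" by blast
    then show False using unc ck card_le_mono by blast
  qed
  ultimately obtain U where U: "U \<in> el H" "E U V" "\<forall>A\<in>el H. E A U \<longleftrightarrow> (\<exists>U\<in>el H. E U Z \<and> E A U)" by blast
  have UA: "A \<in> el U \<longleftrightarrow> A \<in> el Q \<and> A \<in> el K" for A
  proof -
    have "E A U \<longleftrightarrow> A \<in> el Q \<and> A \<in> el K"
      using bspec[OF U(3), of A] tr[OF U(1), of A] KQ'[of A] KH by blast
    then show ?thesis unfolding el_iff[of A U] .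
  qed
  have Uc: "card_le E U om" by (rule card_le_mono[OF ck]) (use UA in blast)
  obtain k where k: "inj_on (app k) (el K)" "app k ` el K \<subseteq> el om" using ck by (rule card_leE)
  let ?D = "\<lambda>D. (\<forall>a\<in>el U. \<exists>d\<in>el U. E d D \<and> E (pr d a) le)"
  \<comment> \<open>\<open>f\<close> relates \<open>n\<close> to the elements of \<open>U\<close>
    that lie in the dense set with number \<open>n\<close>. A number of no such set imposes no
    restriction, so that the hypothesis of \<open>?good\<close> holds for every
    \<open>n\<close>.\<close>
  define f where "f = mk {z \<in> el (cprod om U). \<forall>D\<in>el K. ?D D \<longrightarrow> app k D = p1 z \<longrightarrow> E (p2 z) D}"
  have "isset {z \<in> el (cprod om U). \<forall>D\<in>el K. ?D D \<longrightarrow> app k D = p1 z \<longrightarrow> E (p2 z) D}"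
    by (rule isset_sep[OF isset_el], intro dfi)
  note f0 = el_mk[OF this, folded f_def]
  have Ef: "E (pr n d) f \<longleftrightarrow> n \<in> el om \<and> d \<in> el U \<and> (\<forall>D\<in>el K. ?D D \<longrightarrow> app k D = n \<longrightarrow> E d D)" for n d
  proof -
    have "pr n d \<in> el f \<longleftrightarrow> n \<in> el om \<and> d \<in> el U \<and> (\<forall>D\<in>el K. ?D D \<longrightarrow> app k D = n \<longrightarrow> E d D)" unfolding f0 by simp
    then show ?thesis by (simp only: el_iff)
  qed
  have fHf: "f \<in> el H" by (rule fH[OF _ Uc]) (use UA f0 in blast)+
  have dH: "d \<in> el U \<Longrightarrow> d \<in> el H" for d using UA KH by blast
  have "\<forall>n\<in>el H. E n om \<longrightarrow> (\<forall>a\<in>el H. E a U \<longrightarrow> (\<exists>d\<in>el H. E d U \<and> rlH H n d f \<and> rlH H d a le))"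
  proof (intro ballI impI)
    fix n a assume n: "n \<in> el H" "E n om" and a: "a \<in> el H" "E a U"
    have aU: "a \<in> el U" using a(2) by (simp add: el_iff)
    have no: "n \<in> el om" using n(2) by (simp only: el_iff)
    have "\<exists>d\<in>el U. E (pr n d) f \<and> E (pr d a) le"
    proof (cases "\<exists>D\<in>el K. ?D D \<and> app k D = n")
      case True
      then obtain D where D: "D \<in> el K" "?D D" "app k D = n" by blast
      then obtain d where d: "d \<in> el U" "E d D" "E (pr d a) le" using aU by blast
      have "D' = D" if "D' \<in> el K" "app k D' = n" for D' using inj_onD[OF k(1)] D that by blast
      then have "E (pr n d) f" unfolding Ef using no d by blast
      then show ?thesis using d by blast
    next
      case False
      then have "E (pr n a) f" unfolding Ef using no aU by blast
      moreover have "E (pr a a) le" using le UA aU unfolding preorder_on_def refl_on_def rel_iff by blast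
      ultimately show ?thesis using aU by blast
    qed
    then obtain d where d: "d \<in> el U" "E (pr n d) f" "E (pr d a) le" by blast
    show "\<exists>d\<in>el H. E d U \<and> rlH H n d f \<and> rlH H d a le"
      by (rule bexI[OF _ dH[OF d(1)]])
         (use d in \<open>simp only: rl[OF fHf n(1) dH[OF d(1)]] rl[OF lH dH[OF d(1)] a(1)] el_iff\<close>)
  qed
  moreover have "p \<in> el H" "E p U" using p UA[of p] KH by (auto simp: el_iff)
  ultimately have "\<exists>q\<in>el H. E q Q \<and> rlH H q p le \<and> (\<forall>n\<in>el H. E n om \<longrightarrow> (\<exists>d\<in>el H. E d U \<and> rlH H n d f \<and> rlH H q d le))"
    using mp[OF bspec[OF V5 U(1)] U(2)] fHf by blast
  then obtain q where q: "q \<in> el H" "E q Q" "rlH H q p le"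
    "\<forall>n\<in>el H. E n om \<longrightarrow> (\<exists>d\<in>el H. E d U \<and> rlH H n d f \<and> rlH H q d le)" by blast
  have "generic_condition E K Q le q"
    unfolding generic_condition_def
  proof (intro ballI impI)
    fix D r assume D: "D \<in> el K" "dense_in E Q le D" and r: "r \<in> el Q" "(r, q) \<in> rel E le"
    have DH: "D \<in> el H" using D(1) KH by blast
    \<comment> \<open>Extensions in \<open>D\<close> exist in \<open>Q\<close>; elementarity finds
      one in \<open>K\<close> and hence in \<open>U\<close>.\<close>
    have "?D D"
    proof
      fix a assume aU: "a \<in> el U"
      then have a: "a \<in> el Q" "a \<in> el K" using UA by blast+
      have aH: "a \<in> el H" using a(2) KH by blast
      obtain d where d: "d \<in> el D" "E (pr d a) le" using D(2) a(1) unfolding dense_in_def rel_iff by blast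
      have dH: "d \<in> el H" using tr[OF DH] d(1) by (simp only: el_iff)
      have "dfn E (el H) (el K) (\<lambda>s. E (s 0) D \<and> rlH H (s 0) a le)" by (intro dhi dfn_rlH Kne D(1) a(2) lK)
      moreover have "E d D \<and> rlH H d a le" using d by (simp only: rl[OF lH dH aH] el_iff)
      ultimately obtain d' where d': "d' \<in> el K" "E d' D" "rlH H d' a le"
        using ex[of "\<lambda>x. E x D \<and> rlH H x a le", OF _ dH] by blast
      have d'H: "d' \<in> el H" using d'(1) KH by blast
      have "d' \<in> el Q" using D(2) d'(2) unfolding dense_in_def el_iff[of d' D, symmetric] by blast
      then show "\<exists>d\<in>el U. E d D \<and> E (pr d a) le" using UA d' rl[OF lH d'H aH] by blast
    qed
    have n: "app k D \<in> el om" using k(2) D(1) by blast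
    then have nH: "app k D \<in> el H" "E (app k D) om" using tr[OF omH] by (simp_all only: el_iff)
    then obtain d where d: "d \<in> el H" "E d U" "rlH H (app k D) d f" "rlH H q d le" using q(4) by blast
    have "E (pr (app k D) d) f" "E (pr q d) le" using d rl[OF fHf nH(1) d(1)] rl[OF lH q(1) d(1)] by blast+
    then have dD: "d \<in> el D" "d \<in> el K" "d \<in> el Q" using Ef D(1) \<open>?D D\<close> UA by (auto simp: el_iff)
    have "(r, d) \<in> rel E le" using le r(2) \<open>E (pr q d) le\<close> unfolding preorder_on_def rel_iff[symmetric] by (meson transD)
    moreover have "(r, r) \<in> rel E le" using le r(1) unfolding preorder_on_def refl_on_def by blast
    ultimately have "compatible E Q le r d" unfolding compatible_def using r(1) by blast
    then show "\<exists>d\<in>el D \<inter> el K. compatible E Q le r d" using dD by blast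
  qed
  moreover have "(q, p) \<in> rel E le" using q(3) rl[OF lH q(1) \<open>p \<in> el H\<close>] by simp
  moreover have "q \<in> el Q" using q(2) by (simp add: el_iff)
  ultimately show "\<exists>q\<in>elts E Q. (q, p) \<in> rel E le \<and> generic_condition E K Q le q" by blast
qed

end

section \<open>The construction from a Luzin set\<close>

context zfm
begin

text \<open>Dense interior in Cantor space: \<open>k\<close> and \<open>A\<close> stand for the
  string of length \<open>k\<close>, and only the part of \<open>A\<close> below \<open>k\<close>
  matters.\<close>

definition open_dense :: "'a \<Rightarrow> bool" where
  "open_dense B \<longleftrightarrow> (\<forall>k A. \<exists>k'\<ge>k. \<exists>A'. (\<forall>n<k. n \<in> A' \<longleftrightarrow> n \<in> A) \<and>
     (\<forall>C. el C \<subseteq> el om \<longrightarrow> (\<forall>n<k'. n \<in> st C \<longleftrightarrow> n \<in> A') \<longrightarrow> C \<in> el B))"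

definition pow_om :: 'a where "pow_om = pow om"

lemma el_pow_om: "A \<in> el pow_om \<longleftrightarrow> el A \<subseteq> el om" by (simp add: pow_om_def)

lemma open_dense_neq: "open_dense (mk {C \<in> el pow_om. C \<noteq> A})"
proof -
  have e: "el (mk {C \<in> el pow_om. C \<noteq> A}) = {C \<in> el pow_om. C \<noteq> A}"
    by (rule el_mk, rule isset_sep[OF isset_el], intro dfi)
  show ?thesis unfolding open_dense_def e
  proof (intro allI)
    fix k A0
    let ?A' = "{n. n < k \<and> n \<in> A0 \<or> n = k \<and> k \<notin> st A}"
    have "C \<noteq> A" if "\<forall>n<Suc k. n \<in> st C \<longleftrightarrow> n \<in> ?A'" for C using that by auto
    then have "(\<forall>n<k. n \<in> ?A' \<longleftrightarrow> n \<in> A0) \<and> (\<forall>C. el C \<subseteq> el om \<longrightarrow> (\<forall>n<Suc k. n \<in> st C \<longleftrightarrow> n \<in> ?A') \<longrightarrow> C \<in> {C \<in> el pow_om. C \<noteq> A})"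
      by (auto simp: el_pow_om)
    then show "\<exists>k'\<ge>k. \<exists>A'. (\<forall>n<k. n \<in> A' \<longleftrightarrow> n \<in> A0) \<and> (\<forall>C. el C \<subseteq> el om \<longrightarrow> (\<forall>n<k'. n \<in> st C \<longleftrightarrow> n \<in> A') \<longrightarrow> C \<in> {C \<in> el pow_om. C \<noteq> A})"
      by (intro exI[of _ "Suc k"] conjI exI[of _ ?A']) auto
  qed
qed

lemma open_dense_unbounded: "open_dense (mk {C \<in> el pow_om. \<exists>m. l \<le> m \<and> m \<in> st C})"
proof -
  have e: "el (mk {C \<in> el pow_om. \<exists>m. l \<le> m \<and> m \<in> st C}) = {C \<in> el pow_om. \<exists>m. l \<le> m \<and> m \<in> st C}"
    by (rule el_mk, rule isset_sep[OF isset_el], intro dfi)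
  show ?thesis unfolding open_dense_def e
  proof (intro allI)
    fix k A0
    let ?A' = "{n. n < k \<and> n \<in> A0 \<or> n = k + l}"
    have "\<exists>m. l \<le> m \<and> m \<in> st C" if "\<forall>n<Suc (k + l). n \<in> st C \<longleftrightarrow> n \<in> ?A'" for C
      by (rule exI[of _ "k + l"]) (use that in simp)
    then have "(\<forall>n<k. n \<in> ?A' \<longleftrightarrow> n \<in> A0) \<and> (\<forall>C. el C \<subseteq> el om \<longrightarrow> (\<forall>n<Suc (k + l). n \<in> st C \<longleftrightarrow> n \<in> ?A') \<longrightarrow> C \<in> {C \<in> el pow_om. \<exists>m. l \<le> m \<and> m \<in> st C})"
      by (simp add: el_pow_om)
    then show "\<exists>k'\<ge>k. \<exists>A'. (\<forall>n<k. n \<in> A' \<longleftrightarrow> n \<in> A0) \<and> (\<forall>C. el C \<subseteq> el om \<longrightarrow> (\<forall>n<k'. n \<in> st C \<longleftrightarrow> n \<in> A') \<longrightarrow> C \<in> {C \<in> el pow_om. \<exists>m. l \<le> m \<and> m \<in> st C})"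
      by (intro exI[of _ "Suc (k + l)"] conjI exI[of _ ?A']) auto
  qed
qed

lemma card_le_sing: assumes k: "smal k" shows "card_le E (upair x x) k"
proof -
  have "card_le E (upair x x) (num 1)" by (rule card_leI[of "\<lambda>_. emp"]) (auto simp: fn_def intro: dt_const)
  then show ?thesis using smal_num[OF k] card_le_trans by blast
qed

section \<open>Codes of countable families and the indices of the recursion\<close>

definition sections :: "'a \<Rightarrow> 'a" where "sections x = mk ((\<lambda>n. secm x (nt n)) ` el om)"

lemma el_sections: "el (sections x) = range (secm x)"
proof -
  have "el (sections x) = (\<lambda>n. secm x (nt n)) ` el om"
    unfolding sections_def by (rule el_mk, rule isset_img[OF isset_el], intro dfi)
  then show ?thesis by (simp add: image_image)
qed

lemma dt_sections [dfi]: assumes "dt E f" shows "dt E (\<lambda>s. sections (f s))"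
proof -
  have "dt E (\<lambda>s. sections (s 0))" unfolding sections_def by (intro dfi)
  from dt_comp1[OF this assms] show ?thesis .
qed

lemma sections_countable: "card_le E (sections x) om"
  by (rule card_le_surj[of "\<lambda>n. secm x (nt n)"]) (unfold fn_def el_sections, intro dfi, simp add: image_image)

lemma st_sections: "st ` el (sections x) = fam (st x)"
  unfolding el_sections fam_def image_image by (simp add: image_def)

lemma code_ex:
  assumes T: "\<And>A. A \<in> el T \<Longrightarrow> el A \<subseteq> el om" and ne: "T \<noteq> emp" and c: "card_le E T om"
  shows "\<exists>s. el s \<subseteq> el om \<and> sections s = T"
proof -
  obtain h where h: "inj_on (app h) (el T)" "app h ` el T \<subseteq> el om" using c by (rule card_leE)
  obtain a where a: "a \<in> el T" using ne el_empty_iff by blast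
  \<comment> \<open>Numbers that \<open>h\<close> does not use code the fixed member
    \<open>a\<close>, so that no section falls outside \<open>T\<close>.\<close>
  let ?P = "\<lambda>n m. (\<exists>A\<in>el T. app h A = num n \<and> m \<in> st A) \<or> \<not> (\<exists>A\<in>el T. app h A = num n) \<and> m \<in> st a"
  let ?s = "rl {x. \<exists>n m. x = pp n m \<and> ?P n m}"
  have i: "isr {x. \<exists>n m. x = pp n m \<and> ?P n m}" by (rule isrI, intro dfi)
  have s: "sec (st ?s) n = {m. ?P n m}" for n unfolding st_rl[OF i] sec_def by auto
  have 1: "secm ?s n \<in> el T" for n
  proof (cases "\<exists>A\<in>el T. app h A = num n")
    case True
    then obtain A where A: "A \<in> el T" "app h A = num n" by blast
    have "A' = A" if "A' \<in> el T" "app h A' = num n" for A' using inj_onD[OF h(1)] A that by metis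
    then have "st (secm ?s n) = st A" unfolding st_secm s using A by blast
    then have "secm ?s n = A" by (rule real_eq[OF secm_real T[OF A(1)]])
    then show ?thesis by (simp only: A(1))
  next
    case False
    then have "st (secm ?s n) = st a" unfolding st_secm s by blast
    then have "secm ?s n = a" by (rule real_eq[OF secm_real T[OF a]])
    then show ?thesis by (simp only: a)
  qed
  have 2: "A \<in> range (secm ?s)" if A: "A \<in> el T" for A
  proof -
    obtain n where n: "app h A = num n" using h(2) A by auto
    have "A' = A" if "A' \<in> el T" "app h A' = num n" for A' using inj_onD[OF h(1)] A n that by metis
    then have "st (secm ?s n) = st A" unfolding st_secm s using A n by blast
    then have "secm ?s n = A" by (rule real_eq[OF secm_real T[OF A]])
    then show ?thesis by (rule range_eqI[OF sym])
  qed
  have "sections ?s = T" by (rule ext, unfold el_sections) (use 1 2 in blast)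
  then show ?thesis using rl_real[OF i] by blast
qed

text \<open>The choice function is itself a set of the model, so that \<open>app cd\<close> is a
  definable term and may occur in recursive definitions; likewise for \<open>enu\<close>.\<close>

definition cd :: 'a where
  "cd = (SOME g. \<forall>T\<in>el (mk {T \<in> el (pow pow_om). T \<noteq> emp \<and> card_le E T om}).
     el (app g T) \<subseteq> el om \<and> sections (app g T) = T)"

lemma cd:
  assumes T: "\<And>A. A \<in> el T \<Longrightarrow> el A \<subseteq> el om" and ne: "T \<noteq> emp" and c: "card_le E T om"
  shows "el (app cd T) \<subseteq> el om" "sections (app cd T) = T"
proof -
  let ?a = "mk {T \<in> el (pow pow_om). T \<noteq> emp \<and> card_le E T om}"
  have e: "el ?a = {T \<in> el (pow pow_om). T \<noteq> emp \<and> card_le E T om}"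
    by (rule el_mk, rule isset_sep[OF isset_el], intro dfi)
  have "df E (\<lambda>s. el (s 1) \<subseteq> el om \<and> sections (s 1) = s 0)" by (intro dfi)
  then have "\<exists>g. \<forall>T\<in>el ?a. el (app g T) \<subseteq> el om \<and> sections (app g T) = T"
  proof (rule choice_class)
    fix x assume x: "x \<in> el ?a"
    then have x: "el x \<subseteq> el pow_om" "x \<noteq> emp" "card_le E x om" unfolding e by auto
    have "el A \<subseteq> el om" if "A \<in> el x" for A using x(1) that el_pow_om by blast
    then show "\<exists>y. el y \<subseteq> el om \<and> sections y = x" by (rule code_ex[OF _ x(2,3)])
  qed
  then have *: "\<forall>T\<in>el ?a. el (app cd T) \<subseteq> el om \<and> sections (app cd T) = T"
    unfolding cd_def by (rule someI_ex)
  have "T \<in> el ?a" unfolding e using assms by (auto simp: el_pow_om)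
  then show "el (app cd T) \<subseteq> el om" "sections (app cd T) = T" using * by blast+
qed

definition enu :: 'a where
  "enu = (SOME g. \<forall>x\<in>el w2. (\<forall>a\<in>el x. E (app (app g x) a) w1) \<and>
     (\<forall>a\<in>el x. \<forall>b\<in>el x. app (app g x) a = app (app g x) b \<longrightarrow> a = b))"

definition en :: "'a \<Rightarrow> 'a \<Rightarrow> 'a" where "en x = app (app enu x)"

lemma dt_en [dfi]: "dt E f \<Longrightarrow> dt E g \<Longrightarrow> dt E (\<lambda>s. en (f s) (g s))"
  unfolding en_def by (intro dfi)

lemma en: assumes "x \<in> el w2" shows "inj_on (en x) (el x)" "a \<in> el x \<Longrightarrow> en x a \<in> el w1"
proof -
  let ?R = "\<lambda>x f. (\<forall>a\<in>el x. E (app f a) w1) \<and> (\<forall>a\<in>el x. \<forall>b\<in>el x. app f a = app f b \<longrightarrow> a = b)"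
  have "df E (\<lambda>s. ?R (s 0) (s 1))" by (intro dfi)
  then have "\<exists>g. \<forall>x\<in>el w2. ?R x (app g x)"
  proof (rule choice_class)
    fix x assume "x \<in> el w2"
    then have "card_le E x w1" by (simp add: w2_def)
    then show "\<exists>f. ?R x f" unfolding card_le_iff .
  qed
  then have "\<forall>x\<in>el w2. ?R x (app enu x)" unfolding enu_def by (rule someI_ex)
  from bspec[OF this assms] show "inj_on (en x) (el x)" "a \<in> el x \<Longrightarrow> en x a \<in> el w1"
    unfolding en_def inj_on_def by (blast, simp only: el_iff[of _ w1])
qed

definition below :: "'a \<Rightarrow> 'a" where
  "below z = mk {w \<in> el (cprod (suc (p1 z)) (p2 z)). p1 w = p1 z \<or> E (en (p1 z) (p1 w)) (p2 z)}"

lemma dt_below [dfi]: assumes "dt E f" shows "dt E (\<lambda>s. below (f s))"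
proof -
  have "dt E (\<lambda>s. below (s 0))" unfolding below_def by (intro dfi)
  from dt_comp1[OF this assms] show ?thesis .
qed

lemma el_below: "el (below z) = {w \<in> el (cprod (suc (p1 z)) (p2 z)). p1 w = p1 z \<or> E (en (p1 z) (p1 w)) (p2 z)}"
  unfolding below_def by (rule el_mk, rule isset_sep[OF isset_el], intro dfi)

lemma below_pr: "w \<in> el (below (pr x d)) \<longleftrightarrow>
   (\<exists>y i. w = pr y i \<and> i \<in> el d \<and> (y = x \<or> y \<in> el x \<and> en x y \<in> el d))"
  unfolding el_below el_cprod by (auto simp: el_iff)

lemma wfp_below: "wfp (\<lambda>y x. E y (below x))"
proof -
  have "Wellfounded.wf (inv_image {(x, y). E x y} p2)" using wf by (intro wf_inv_image) (simp add: wfp_def)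
  then have "wfp (\<lambda>y x. E (p2 y) (p2 x))" by (simp add: wfp_def inv_image_def)
  then show ?thesis by (rule wfp_subset) (auto simp: el_below simp flip: el_iff)
qed

text \<open>Since \<open>en x\<close> is injective, only countably many \<open>y\<close> have their
  index below the countable ordinal \<open>d\<close>.\<close>

lemma below_countable: assumes x: "x \<in> el w2" and d: "d \<in> el w1" shows "card_le E (below (pr x d)) om"
proof -
  have dc: "card_le E d om" using d by (simp add: w1_def)
  define Y where "Y = mk {y \<in> el x. E (en x y) d}"
  have Y: "el Y = {y \<in> el x. E (en x y) d}" unfolding Y_def by (rule el_mk, rule isset_sep[OF isset_el], intro dfi)
  have "card_le E Y d"
    by (rule card_leI[of "en x"], unfold fn_def, intro dfi)
      (use en(1)[OF x] in \<open>auto simp: Y inj_on_def el_iff\<close>)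
  then have Yc: "card_le E Y om" using dc card_le_trans by blast
  have c: "card_le E (cprod (bun Y (upair x x)) d) om"
    by (rule smal_cprod[OF smal_om smal_bun[OF smal_om Yc card_le_sing[OF smal_om]] dc])
  show ?thesis
  proof (rule card_le_mono[OF c], rule subsetI)
    fix w assume "w \<in> el (below (pr x d))"
    then show "w \<in> el (cprod (bun Y (upair x x)) d)" unfolding below_pr by (auto simp: Y el_iff)
  qed
qed

end

locale luzin_reals = zfm E for E :: "'a \<Rightarrow> 'a \<Rightarrow> bool" +
  fixes c :: "'a \<Rightarrow> 'a"
  assumes fn_c: "fn c" and c_real: "el (c x) \<subseteq> el om"
    and luzin: "open_dense B \<Longrightarrow> \<exists>S. card_le E S om \<and> (\<forall>x\<in>el w2. x \<notin> el S \<longrightarrow> c x \<in> el B)"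
begin

lemma dt_c [dfi]: "dt E f \<Longrightarrow> dt E (\<lambda>s. c (f s))"
  by (rule fnD[OF fn_c])

lemma luzin_multi:
  assumes B: "fn B" and I: "card_le E I om" and open_dense: "\<And>i. i \<in> el I \<Longrightarrow> open_dense (B i)"
  shows "\<exists>S. card_le E S om \<and> (\<forall>x\<in>el w2. x \<notin> el S \<longrightarrow> (\<forall>i\<in>el I. c x \<in> el (B i)))"
proof -
  have "df E (\<lambda>s. card_le E (s 1) om \<and> (\<forall>x\<in>el w2. x \<notin> el (s 1) \<longrightarrow> c x \<in> el (B (s 0))))"
    by (intro dfi fnD[OF B])
  then have "\<exists>g. \<forall>i\<in>el I. card_le E (app g i) om \<and> (\<forall>x\<in>el w2. x \<notin> el (app g i) \<longrightarrow> c x \<in> el (B i))"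
    by (rule choice_class) (rule luzin, rule open_dense)
  then obtain g where g: "\<forall>i\<in>el I. card_le E (app g i) om \<and> (\<forall>x\<in>el w2. x \<notin> el (app g i) \<longrightarrow> c x \<in> el (B i))"
    by (elim exE)
  let ?S = "un (mk (app g ` el I))"
  have S: "el ?S = (\<Union>i\<in>el I. el (app g i))" by simp
  have "card_le E ?S om" by (rule smal_UN[OF smal_om fn_app I]) (use g in blast)
  moreover have "\<forall>x\<in>el w2. x \<notin> el ?S \<longrightarrow> (\<forall>i\<in>el I. c x \<in> el (B i))" unfolding S using g by blast
  ultimately show ?thesis by blast
qed

lemma w1_w2: "el w1 \<subseteq> el w2"
proof
  fix x assume "x \<in> el w1"
  then have "ord x" "card_le E x om" by (simp_all add: w1_def)
  moreover have "card_le E om w1" using smal_w1 unfolding smal_def by (intro card_le_subset) blast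
  ultimately show "x \<in> el w2" unfolding w2_def el_hart using card_le_trans by blast
qed

lemma ord_w1: "ord w1" and ord_w2: "ord w2" unfolding w1_def w2_def by (rule ord_hart)+

lemma w1_not_subset: assumes "card_le E S om" shows "\<exists>x\<in>el w1. x \<notin> el S"
proof (rule ccontr)
  assume "\<not> ?thesis"
  then have "el w1 \<subseteq> el S" by blast
  then have "card_le E w1 om" using card_le_mono[OF assms] by blast
  then show False using hart_not_le unfolding w1_def by blast
qed

text \<open>
  The recursive definition is in terms of codes: \<open>code z\<close> codes the closure of the family \<open>TT code z\<close>.
\<close>

definition TT :: "('a \<Rightarrow> 'a) \<Rightarrow> 'a \<Rightarrow> 'a" where
  "TT f z = bun (un (mk ((\<lambda>w. sections (f w)) ` el (below z)))) (upair (c (p1 z)) (c (p1 z)))"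

definition code :: "'a \<Rightarrow> 'a" where
  "code = (SOME f. fn f \<and> (\<forall>z. f z = clm (jnm (app cd (TT f z)))))"

lemma code: "fn code" "code z = clm (jnm (app cd (TT code z)))"
proof -
  let ?H = "\<lambda>u z g. clm (jnm (app cd (TT (app g) z)))"
  have "dt E (\<lambda>s. ?H (s 0) (s 1) (s 2))" unfolding TT_def by (intro dfi)
  moreover have "dt E (\<lambda>s. below (s 1))" by (intro dfi)
  ultimately have "\<exists>f. dt E (\<lambda>s. f (s 0) (s 1)) \<and> (\<forall>u x. f u x = ?H u x (lam (below x) (f u)))"
    by (rule rec_ex) (rule wfp_below)
  then obtain f where f: "dt E (\<lambda>s. f (s 0) (s 1))" "\<forall>u x. f u x = ?H u x (lam (below x) (f u))" by (elim exE conjE)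
  have ff: "fn (f emp)" by (rule fn_dt2[OF f(1)])
  have "TT (app (lam (below z) (f emp))) z = TT (f emp) z" for z
  proof -
    have "(\<lambda>w. sections (app (lam (below z) (f emp)) w)) ` el (below z) = (\<lambda>w. sections (f emp w)) ` el (below z)"
      by (rule image_cong[OF refl]) (simp add: app_lam[OF ff])
    then show ?thesis unfolding TT_def by (simp only:)
  qed
  then have "f emp z = clm (jnm (app cd (TT (f emp) z)))" for z
    using f(2)[rule_format, of emp z] by (simp only:)
  then have "\<exists>f. fn f \<and> (\<forall>z. f z = clm (jnm (app cd (TT f z))))" using ff by blast
  then have *: "fn code \<and> (\<forall>z. code z = clm (jnm (app cd (TT code z))))" unfolding code_def by (rule someI_ex)
  show "fn code" "code z = clm (jnm (app cd (TT code z)))" using * by blast+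
qed

lemma dt_code [dfi]: "dt E f \<Longrightarrow> dt E (\<lambda>s. code (f s))"
  by (rule fnD[OF code(1)])

text \<open>\<open>stage x d\<close> is \<open>T \<xi> \<delta>\<close> for \<open>\<xi> = x\<close>
  and \<open>\<delta> = d\<close>. It need not be closed; its closure \<open>clos x d\<close> is
  contained in the stage \<open>suc d\<close>. The real \<open>stc x d\<close> is the chosen code of
  the stage.\<close>

definition stage :: "'a \<Rightarrow> 'a \<Rightarrow> 'a" where "stage x d = TT code (pr x d)"
definition clos :: "'a \<Rightarrow> 'a \<Rightarrow> 'a" where "clos x d = sections (code (pr x d))"
definition stc :: "'a \<Rightarrow> 'a \<Rightarrow> 'a" where "stc x d = app cd (stage x d)"

lemma dt_stage [dfi]: "dt E f \<Longrightarrow> dt E g \<Longrightarrow> dt E (\<lambda>s. stage (f s) (g s))"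
proof -
  have "dt E (\<lambda>s. stage (s 0) (s 1))" unfolding stage_def TT_def by (intro dfi)
  then show "dt E f \<Longrightarrow> dt E g \<Longrightarrow> dt E (\<lambda>s. stage (f s) (g s))" by (rule dt_comp2)
qed

lemma el_stage: "el (stage x d) = (\<Union>w\<in>el (below (pr x d)). el (sections (code w))) \<union> {c x}"
proof -
  have "el (mk ((\<lambda>w. sections (code w)) ` el (below (pr x d)))) = (\<lambda>w. sections (code w)) ` el (below (pr x d))"
    by (rule el_mk, rule isset_img[OF isset_el], intro dfi)
  then show ?thesis unfolding stage_def TT_def by simp
qed

lemma stage_real: "A \<in> el (stage x d) \<Longrightarrow> el A \<subseteq> el om"
  unfolding el_stage el_sections using secm_real c_real by fast

lemma stage_countable: assumes "x \<in> el w2" "d \<in> el w1" shows "card_le E (stage x d) om"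
  unfolding stage_def TT_def
proof (rule smal_bun[OF smal_om])
  have "fn (\<lambda>w. sections (code w))" unfolding fn_def by (intro dfi)
  then show "card_le E (un (mk ((\<lambda>w. sections (code w)) ` el (below (pr x d))))) om"
    by (rule smal_UN[OF smal_om _ below_countable[OF assms] sections_countable])
qed (rule card_le_sing[OF smal_om])

lemma stage_ne: "stage x d \<noteq> emp" using el_empty_iff[of "stage x d"] unfolding el_stage by blast

lemma stc: assumes "x \<in> el w2" "d \<in> el w1"
  shows "el (stc x d) \<subseteq> el om" "sections (stc x d) = stage x d"
  unfolding stc_def by (rule cd[OF stage_real stage_ne stage_countable[OF assms]], assumption)+

lemma st_code: "st (code (pr x d)) = cl (jn (st (stc x d)))"
  unfolding code(2)[of "pr x d"] st_clm st_jnm stc_def stage_def ..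

lemma st_clos: "st ` el (clos x d) = fam (cl (jn (st (stc x d))))"
  unfolding clos_def st_sections st_code ..

lemma clos_real: "A \<in> el (clos x d) \<Longrightarrow> el A \<subseteq> el om"
  unfolding clos_def el_sections using secm_real by fast

lemma clos_st: assumes "el A \<subseteq> el om" "st A \<in> st ` el (clos x d)" shows "A \<in> el (clos x d)"
proof -
  obtain B where B: "B \<in> el (clos x d)" "st A = st B" using assms(2) by blast
  have "A = B" by (rule real_eq[OF assms(1) clos_real[OF B(1)] B(2)])
  then show ?thesis using B(1) by simp
qed

text \<open>\<open>jn\<close> puts the code in as section 0. Thereby the code of each stage is
  available as a parameter inside the family.\<close>

lemma clos_code: assumes x: "x \<in> el w2" and d: "d \<in> el w1" shows "stc x d \<in> el (clos x d)"
proof (rule clos_st[OF stc(1)[OF x d]])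
  have "st (stc x d) \<in> fam (jn (st (stc x d)))" unfolding fam_def using sec_jn(1) by (metis rangeI)
  then show "st (stc x d) \<in> st ` el (clos x d)" unfolding st_clos using fam_cl_base by blast
qed

lemma stage_clos: assumes x: "x \<in> el w2" and d: "d \<in> el w1" shows "el (stage x d) \<subseteq> el (clos x d)"
proof
  fix A assume A: "A \<in> el (stage x d)"
  then have "A \<in> el (sections (stc x d))" by (simp only: stc(2)[OF x d])
  then have "st A \<in> fam (st (stc x d))" unfolding st_sections[symmetric] by (rule imageI)
  then obtain k where "st A = sec (jn (st (stc x d))) (Suc k)" unfolding fam_def sec_jn by blast
  then have "st A \<in> fam (jn (st (stc x d)))" unfolding fam_def by blast
  then have "st A \<in> st ` el (clos x d)" unfolding st_clos using fam_cl_base by blast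
  then show "A \<in> el (clos x d)" by (rule clos_st[OF stage_real[OF A]])
qed

lemma clos_stage: "pr y i \<in> el (below (pr x d)) \<Longrightarrow> el (clos y i) \<subseteq> el (stage x d)"
  unfolding el_stage clos_def by blast

lemma c_stage: "c x \<in> el (stage x d)" unfolding el_stage by blast

lemma stage_mono: assumes "ord d'" "d = d' \<or> d \<in> el d'" shows "el (stage x d) \<subseteq> el (stage x d')"
proof -
  have "el d \<subseteq> el d'" using assms ord_tr[OF assms(1)] by blast
  then have "el (below (pr x d)) \<subseteq> el (below (pr x d'))" unfolding subset_iff below_pr by blast
  then show ?thesis unfolding el_stage by blast
qed

lemma w1_suc: "d \<in> el w1 \<Longrightarrow> suc d \<in> el w1"
  unfolding w1_def using smal_suc[OF smal_om] ord_suc by simp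

lemma w1_ord: "d \<in> el w1 \<Longrightarrow> ord d" by (rule ord_el[OF ord_w1])

lemma w1_max: assumes "a \<in> el w1" "b \<in> el w1" shows "\<exists>d\<in>el w1. a \<in> el d \<and> b \<in> el d"
proof -
  have o: "ord a" "ord b" using assms w1_ord by blast+
  from ord_lin[OF o] show ?thesis
  proof (elim disjE)
    assume "a \<in> el b" then show ?thesis by (intro bexI[OF _ w1_suc[OF assms(2)]]) simp
  next
    assume "a = b" then show ?thesis by (intro bexI[OF _ w1_suc[OF assms(2)]]) simp
  next
    assume "b \<in> el a" then show ?thesis by (intro bexI[OF _ w1_suc[OF assms(1)]]) simp
  qed
qed

section \<open>The families \<open>X \<xi>\<close> and their closure properties\<close>

definition XX :: "'a \<Rightarrow> 'a" where "XX x = un (mk ((\<lambda>d. stage x d) ` el w1))"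

lemma fn_stage: "fn (stage x)" unfolding fn_def by (intro dfi)

lemma el_XX: "el (XX x) = (\<Union>d\<in>el w1. el (stage x d))"
  unfolding XX_def by (simp add: fn_stage)

lemma dt_XX [dfi]: assumes "dt E f" shows "dt E (\<lambda>s. XX (f s))"
proof -
  have "dt E (\<lambda>s. XX (s 0))" unfolding XX_def by (intro dfi)
  then show ?thesis using assms by (rule dt_comp1)
qed

lemma clos_suc: "el (clos x d) \<subseteq> el (stage x (suc d))"
  by (rule clos_stage) (simp add: below_pr)

lemma clos_XX: "d \<in> el w1 \<Longrightarrow> el (clos x d) \<subseteq> el (XX x)"
  unfolding el_XX using clos_suc w1_suc by blast

lemma c_XX: "c x \<in> el (XX x)"
proof -
  obtain d where "d \<in> el w1" using w1_not_subset[OF card_le_refl] by blast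
  then show ?thesis unfolding el_XX using c_stage by blast
qed

text \<open>For \<open>d'\<close> above both \<open>d\<close> and the index of \<open>y\<close>, the
  closure at \<open>(y, d)\<close> is among those collected at \<open>(x, d')\<close>.\<close>

lemma XX_mono: assumes x: "x \<in> el w2" and y: "y \<in> el x" shows "el (XX y) \<subseteq> el (XX x)"
proof
  fix A assume "A \<in> el (XX y)"
  then obtain d where d: "d \<in> el w1" "A \<in> el (stage y d)" unfolding el_XX by blast
  have yw: "y \<in> el w2" by (rule ord_tr[OF ord_w2 x y])
  obtain d' where d': "d' \<in> el w1" "d \<in> el d'" "en x y \<in> el d'" using w1_max[OF d(1) en(2)[OF x y]] by blast
  have "pr y d \<in> el (below (pr x d'))" unfolding below_pr using d' y by blast
  then have "A \<in> el (stage x d')" using clos_stage stage_clos[OF yw d(1)] d(2) by blast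
  then show "A \<in> el (XX x)" unfolding el_XX using d'(1) by blast
qed

lemma XX_real: "A \<in> el (XX x) \<Longrightarrow> el A \<subseteq> el om" unfolding el_XX using stage_real by blast

lemma XX_common: assumes "A \<in> el (XX x)" "B \<in> el (XX x)" shows "\<exists>d\<in>el w1. A \<in> el (stage x d) \<and> B \<in> el (stage x d)"
proof -
  obtain a b where ab: "a \<in> el w1" "A \<in> el (stage x a)" "b \<in> el w1" "B \<in> el (stage x b)" using assms unfolding el_XX by blast
  obtain d where d: "d \<in> el w1" "a \<in> el d" "b \<in> el d" using w1_max[OF ab(1,3)] by blast
  show ?thesis using stage_mono[OF w1_ord[OF d(1)]] ab d by blast
qed

text \<open>Two members lie in a common stage, whose closure is contained in \<open>XX x\<close>.
  The operation is left open in order to cover both the arithmetic operations and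
  \<open>thin\<close>.\<close>

lemma XX_op:
  assumes x: "x \<in> el w2" and op: "\<And>r. st A \<in> fam (cl r) \<Longrightarrow> st B \<in> fam (cl r) \<Longrightarrow> R \<in> fam (cl r)"
    and A: "A \<in> el (XX x)" and B: "B \<in> el (XX x)"
  shows "R \<in> st ` el (XX x)"
proof -
  obtain d where d: "d \<in> el w1" "A \<in> el (stage x d)" "B \<in> el (stage x d)" using XX_common[OF A B] by blast
  then have "A \<in> el (clos x d)" "B \<in> el (clos x d)" using stage_clos[OF x d(1)] by blast+
  then have "st A \<in> st ` el (clos x d)" "st B \<in> st ` el (clos x d)" by blast+
  then have "R \<in> st ` el (clos x d)" unfolding st_clos by (rule op)
  then show ?thesis using clos_XX[OF d(1)] by blast
qed

lemma XX_aclosed: assumes x: "x \<in> el w2" shows "aclosed (st ` el (XX x))"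
  unfolding aclosed_def
proof (intro allI impI, elim imageE, hypsubst)
  fix n k A B assume AB: "A \<in> el (XX x)" "B \<in> el (XX x)"
  show "arop n k (st A) (st B) \<in> st ` el (XX x)"
    by (rule XX_op[OF x _ AB]) (use aclosed_cl in \<open>unfold aclosed_def, blast\<close>)
qed

lemma XX_arith: assumes x: "x \<in> el w2" shows "arith_closed E (XX x)"
  unfolding arith_closed_def
proof (intro allI impI, elim conjE)
  have ns: "nat_set_of E = st" by (rule HOL.ext) (auto simp: nat_set_of_def st_def el_iff)
  fix B assume B: "is_real E B" "arith_definable_from (nat_set_of E ` el (XX x)) (nat_set_of E B)"
  have "st B \<in> st ` el (XX x)" by (rule aclosed_arith[OF XX_aclosed[OF x]]) (use B(2) in \<open>simp only: ns\<close>)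
  then obtain A where A: "A \<in> el (XX x)" "st B = st A" by blast
  have "el B \<subseteq> el om" using B(1) unfolding is_real_def by auto
  then have "B = A" using real_eq[OF _ XX_real[OF A(1)] A(2)] by blast
  then show "B \<in> el (XX x)" using A(1) by simp
qed

lemma om_w1: "card_le E om w1"
  using smal_w1 unfolding smal_def by (intro card_le_subset) blast

lemma XX_card: assumes x: "x \<in> el w2" shows "card_le E (XX x) w1"
  unfolding XX_def
  by (rule smal_UN[OF smal_w1 fn_stage card_le_refl]) (use stage_countable[OF x] om_w1 card_le_trans in blast)

text \<open>\<open>QQ x\<close> ordered by \<open>LL x\<close> is the poset
  \<open>X \<xi>/Fin\<close>, and \<open>WW x\<close> is the filtration of it by the infinite
  members \<open>QS x d\<close> of the stages.\<close>

definition "QQ x = mk {A \<in> el (XX x). infinite (st A)}"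
definition "LL x = mk {z \<in> el (cprod (QQ x) (QQ x)). asub (st (p1 z)) (st (p2 z))}"
definition "QS x d = mk {A \<in> el (stage x d). infinite (st A)}"
definition "WW x = mk ((\<lambda>d. QS x d) ` el w1)"

lemma el_QQ: "el (QQ x) = {A \<in> el (XX x). infinite (st A)}"
  unfolding QQ_def by (rule el_mk, rule isset_sep[OF isset_el], intro dfi)

lemma el_QS: "el (QS x d) = {A \<in> el (stage x d). infinite (st A)}"
  unfolding QS_def by (rule el_mk, rule isset_sep[OF isset_el], intro dfi)

lemma fn_QS: "fn (QS x)" unfolding fn_def QS_def by (intro dfi)

lemma el_WW: "el (WW x) = QS x ` el w1"
  unfolding WW_def by (simp add: fn_QS)

lemma E_LL: "E (pr a b) (LL x) \<longleftrightarrow> a \<in> el (QQ x) \<and> b \<in> el (QQ x) \<and> asub (st a) (st b)"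
proof -
  have "el (LL x) = {z \<in> el (cprod (QQ x) (QQ x)). asub (st (p1 z)) (st (p2 z))}"
    unfolding LL_def by (rule el_mk, rule isset_sep[OF isset_el], intro dfi)
  then have "pr a b \<in> el (LL x) \<longleftrightarrow> a \<in> el (QQ x) \<and> b \<in> el (QQ x) \<and> asub (st a) (st b)" by simp
  then show ?thesis by (simp only: el_iff[of _ "LL x"])
qed

lemma QQ_real: "A \<in> el (QQ x) \<Longrightarrow> el A \<subseteq> el om" unfolding el_QQ using XX_real by blast

lemma st_Diff: "el A \<subseteq> el om \<Longrightarrow> finite (el A - el B) \<longleftrightarrow> finite (st A - st B)"
proof -
  assume A: "el A \<subseteq> el om"
  have "el A = num ` st A" unfolding num_st using A by blast
  then have "el A - el B = num ` (st A - st B)" by (auto simp: st_def el_iff)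
  then show ?thesis using finite_image_iff[of num] by (simp add: inj_on_def)
qed

lemma QQ_mod_fin: "is_mod_fin E (XX x) (QQ x) (LL x)"
  unfolding is_mod_fin_def
proof
  show "el (QQ x) = {A \<in> el (XX x). infinite (el A)}"
    unfolding el_QQ using finite_st XX_real by blast
  show "rel E (LL x) = {(A, B). A \<in> el (QQ x) \<and> B \<in> el (QQ x) \<and> finite (el A - el B)}"
  proof -
    have "(A, B) \<in> rel E (LL x) \<longleftrightarrow> A \<in> el (QQ x) \<and> B \<in> el (QQ x) \<and> finite (el A - el B)" for A B
      unfolding rel_iff E_LL asub_finite using st_Diff[OF QQ_real] by blast
    then show ?thesis by auto
  qed
qed

lemma QQ_preorder: "preorder_on (el (QQ x)) (rel E (LL x))"
  unfolding preorder_on_def refl_on_def trans_def subset_iff split_paired_All mem_Sigma_iff rel_iff E_LL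
  using asub_refl asub_trans by blast

lemma XX_c: assumes x: "x \<in> el w2" and y: "y = x \<or> y \<in> el x" shows "c y \<in> el (XX x)"
  using XX_mono[OF x, of y] c_XX[of y] y by blast

text \<open>If \<open>QQ x\<close> were countable, the Luzin property would give an index below
  \<omega>_1 whose real is infinite and different from all members of \<open>QQ x\<close>, although
  it belongs to \<open>XX x\<close>.\<close>

lemma QQ_uncountable: assumes x: "x \<in> el w2" and wx: "el w1 \<subseteq> el x" shows "\<not> card_le E (QQ x) om"
proof
  assume Q: "card_le E (QQ x) om"
  let ?B = "\<lambda>A. mk {C \<in> el pow_om. C \<noteq> A}"
  have e: "el (?B A) = {C \<in> el pow_om. C \<noteq> A}" for A by (rule el_mk, rule isset_sep[OF isset_el], intro dfi)
  let ?B' = "\<lambda>l. mk {C \<in> el pow_om. \<exists>m. nt l \<le> m \<and> m \<in> st C}"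
  have e': "el (?B' l) = {C \<in> el pow_om. \<exists>m. nt l \<le> m \<and> m \<in> st C}" for l
    by (rule el_mk, rule isset_sep[OF isset_el], intro dfi)
  have "fn ?B" "fn ?B'" unfolding fn_def by (intro dfi)+
  from luzin_multi[OF this(1) Q open_dense_neq] luzin_multi[OF this(2) card_le_refl open_dense_unbounded]
  obtain S S' where S: "card_le E S om" "\<forall>x'\<in>el w2. x' \<notin> el S \<longrightarrow> (\<forall>i\<in>el (QQ x). c x' \<in> el (?B i))"
    and S': "card_le E S' om" "\<forall>x\<in>el w2. x \<notin> el S' \<longrightarrow> (\<forall>i\<in>el om. c x \<in> el (?B' i))" by (elim exE conjE)
  obtain y where y: "y \<in> el w1" "y \<notin> el (bun S S')" using w1_not_subset[OF smal_bun[OF smal_om S(1) S'(1)]] by (elim bexE)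
  have y2: "y \<in> el w2" "y \<notin> el S" "y \<notin> el S'" using y w1_w2 by auto
  have "c y \<in> el (?B' (num l))" for l using S'(2) y2 by simp
  then have "\<forall>l. \<exists>m\<ge>l. m \<in> st (c y)" unfolding e' by simp
  then have "infinite (st (c y))" unfolding infinite_unbounded .
  moreover have "c y \<in> el (XX x)" by (rule XX_c[OF x]) (use y wx in blast)
  ultimately have "c y \<in> el (QQ x)" unfolding el_QQ by blast
  then have "c y \<in> el (?B (c y))" using S(2) y2 by blast
  then show False unfolding e by blast
qed

text \<open>Continuity: an index below \<open>(x, un I)\<close> is bounded by two members of
  \<open>I\<close>, and the larger of them bounds it alone.\<close>

lemma stage_un:
  assumes I: "el I \<subseteq> el w1" "el I \<noteq> {}"
  shows "el (stage x (un I)) \<subseteq> (\<Union>d\<in>el I. el (stage x d))"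
proof
  fix A assume "A \<in> el (stage x (un I))"
  then consider w where "w \<in> el (below (pr x (un I)))" "A \<in> el (sections (code w))" | "A = c x" unfolding el_stage by blast
  then show "A \<in> (\<Union>d\<in>el I. el (stage x d))"
  proof cases
    case (1 w)
    then obtain y i where w: "w = pr y i" "i \<in> el (un I)" "y = x \<or> y \<in> el x \<and> en x y \<in> el (un I)"
      unfolding below_pr by blast
    obtain a where a: "a \<in> el I" "i \<in> el a" using w(2) by auto
    have "\<exists>b\<in>el I. y = x \<or> y \<in> el x \<and> en x y \<in> el b" using w(3) I(2) by auto
    then obtain b where b: "b \<in> el I" "y = x \<or> y \<in> el x \<and> en x y \<in> el b" by blast
    have o: "ord a" "ord b" using a b I w1_ord by blast+
    have "\<exists>d\<in>el I. i \<in> el d \<and> (y = x \<or> y \<in> el x \<and> en x y \<in> el d)"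
      using ord_lin[OF o] a b ord_tr[OF o(1)] ord_tr[OF o(2)] by blast
    then obtain d where "d \<in> el I" "w \<in> el (below (pr x d))" unfolding w(1) below_pr by blast
    then show ?thesis using 1(2) unfolding el_stage by blast
  next
    case 2
    then show ?thesis using I(2) c_stage by blast
  qed
qed

text \<open>\<open>un I\<close> is the supremum of the stages that occur in \<open>Z\<close>. Below
  \<omega>_1, continuity identifies \<open>un Z\<close> with the set at this stage; if it is
  \<omega>_1, then \<open>un Z\<close> is everything.\<close>

lemma WW_union:
  assumes Z: "el Z \<subseteq> el (WW x)" "Z \<noteq> emp"
  shows "un Z \<in> el (WW x) \<or> el (QQ x) \<subseteq> el (un Z)"
proof -
  define I where "I = mk {d \<in> el w1. E (QS x d) Z}"
  have "isset {d \<in> el w1. E (QS x d) Z}" by (rule isset_sep[OF isset_el], intro dfi fnD[OF fn_QS])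
  from el_mk[OF this] have I: "el I = {d \<in> el w1. QS x d \<in> el Z}" by (simp only: I_def el_iff[of _ Z])
  have ZI: "el Z = QS x ` el I" using Z(1) unfolding I el_WW by blast
  have I1: "el I \<subseteq> el w1" using I by blast
  have I2: "el I \<noteq> {}" using Z(2) ZI el_empty_iff by blast
  have uz: "el (un Z) = {A \<in> (\<Union>d\<in>el I. el (stage x d)). infinite (st A)}" unfolding el_un ZI by (auto simp: el_QS)
  have oI: "ord (un I)" by (rule ord_un) (use I1 w1_ord in blast)
  have sub: "d \<in> el I \<Longrightarrow> d = un I \<or> d \<in> el (un I)" for d
  proof -
    assume d: "d \<in> el I"
    then have "el d \<subseteq> el (un I)" by auto
    then show ?thesis using ord_subset_iff[OF w1_ord oI, of d] d I1 by blast
  qed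
  have "un I \<notin> el (un I)" using E_irrefl by (simp only: el_iff) simp
  have "w1 \<notin> el (un I)"
  proof
    assume "w1 \<in> el (un I)"
    then obtain d where "d \<in> el I" "w1 \<in> el d" by auto
    then have "w1 \<in> el w1" using ord_tr[OF ord_w1] I1 by blast
    then show False using E_irrefl by (simp only: el_iff)
  qed
  then consider "un I \<in> el w1" | "un I = w1" using ord_lin[OF oI ord_w1] by blast
  then show ?thesis
  proof cases
    case 1
    have "(\<Union>d\<in>el I. el (stage x d)) \<subseteq> el (stage x (un I))" using stage_mono[OF oI] sub by blast
    then have "un Z = QS x (un I)" using stage_un[OF I1 I2, of x] by (intro ext) (unfold uz el_QS, blast)
    then show ?thesis unfolding el_WW using 1 by blast
  next
    case 2
    have "el (QQ x) \<subseteq> el (un Z)"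
    proof
      fix A assume "A \<in> el (QQ x)"
      then obtain d where d: "d \<in> el w1" "A \<in> el (stage x d)" "infinite (st A)" unfolding el_QQ el_XX by blast
      have "d \<in> el (un I)" using d(1) 2 by simp
      then obtain d' where d': "d' \<in> el I" "d \<in> el d'" by auto
      then have "A \<in> el (stage x d')" using stage_mono[of d' d x] w1_ord I1 d(2) by blast
      then show "A \<in> el (un Z)" unfolding uz using d' d(3) by blast
    qed
    then show ?thesis ..
  qed
qed

text \<open>The decreasing sequence starts at \<open>p\<close> and is driven by a Cohen real. Its
  pseudo-intersection lies in \<open>XX x\<close> because the code \<open>r\<close> and the real
  \<open>c y\<close> both do.\<close>

lemma WW_good:
  assumes x: "x \<in> el w2" and wx: "el w1 \<subseteq> el x" and d: "d \<in> el w1" and p: "p \<in> el (QS x d)"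
    and f: "\<And>n a. n \<in> el om \<Longrightarrow> a \<in> el (QS x d) \<Longrightarrow> \<exists>b\<in>el (QS x d). E (pr n b) f \<and> E (pr b a) (LL x)"
  shows "\<exists>q\<in>el (QQ x). E (pr q p) (LL x) \<and> (\<forall>n\<in>el om. \<exists>b\<in>el (QS x d). E (pr n b) f \<and> E (pr q b) (LL x))"
proof -
  define r where "r = stc x d"
  have r: "el (stage x d) = range (secm r)" using stc(2)[OF x d] unfolding r_def by (metis el_sections)
  have rX: "r \<in> el (XX x)" using clos_code[OF x d] clos_XX[OF d] unfolding r_def by blast
  have QSr: "secm r n \<in> el (QS x d) \<longleftrightarrow> infinite (sec (st r) n)" for n
    unfolding el_QS r by auto
  have QSe: "\<exists>n. a = secm r n \<and> infinite (sec (st r) n)" if "a \<in> el (QS x d)" for a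
    using that unfolding el_QS r by auto
  have QSQ: "el (QS x d) \<subseteq> el (QQ x)" unfolding el_QS el_QQ el_XX using d by blast
  obtain i where i: "p = secm r i" "infinite (sec (st r) i)" using QSe[OF p] by blast
  \<comment> \<open>Indices, with respect to the code \<open>r\<close>, of the elements that
    \<open>f\<close> offers at \<open>n\<close>; the hypothesis on \<open>f\<close> makes them dense
    among the infinite sections.\<close>
  define D where "D n = {b. secm r b \<in> el (QS x d) \<and> E (pr n (secm r b)) f}" for n
  have Dd: "\<exists>b. b \<in> D n \<and> infinite (sec (st r) b) \<and> asub (sec (st r) b) (sec (st r) a)"
    if n: "n \<in> el om" and a: "infinite (sec (st r) a)" for n a
  proof -
    obtain b where b: "b \<in> el (QS x d)" "E (pr n b) f" "E (pr b (secm r a)) (LL x)"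
      using f[OF n, of "secm r a"] a unfolding QSr by blast
    obtain m where m: "b = secm r m" "infinite (sec (st r) m)" using QSe[OF b(1)] by blast
    have "asub (sec (st r) m) (sec (st r) a)" using b(3) unfolding E_LL m(1) st_secm by blast
    then show ?thesis using b m unfolding D_def by blast
  qed
  \<comment> \<open>The reals whose sequence reaches such an index; open density is
    \<open>ix_dense\<close>, and definability rests on \<open>ix_rel\<close>.\<close>
  let ?B = "\<lambda>n. mk {C \<in> el pow_om. \<exists>l. ix (st r) (st C) i l \<in> D n}"
  have df: "df E (\<lambda>s. \<exists>l. ix (st r) (st (s 0)) i l \<in> D (s 1))"
    unfolding ix_rel[of "\<lambda>m. m \<in> D _"] unfolding D_def mem_Collect_eq by (intro dfi fnD[OF fn_QS])
  note df' = df_comp2[of E "\<lambda>C n. \<exists>l. ix (st r) (st C) i l \<in> D n", OF df]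
  have e: "el (?B n) = {C \<in> el pow_om. \<exists>l. ix (st r) (st C) i l \<in> D n}" for n
    by (rule el_mk, rule isset_sep[OF isset_el], rule df', (intro dfi)+)
  have fB: "fn ?B" unfolding fn_def by (rule dt_sep, intro dfi, rule df', (intro dfi)+)
  have oB: "open_dense (?B n)" if n: "n \<in> el om" for n
    unfolding open_dense_def e
  proof (intro allI)
    fix k A
    have "\<exists>k'\<ge>k. \<exists>A'. (\<forall>n<k. n \<in> A' \<longleftrightarrow> n \<in> A) \<and>
      (\<forall>C. (\<forall>n<k'. n \<in> C \<longleftrightarrow> n \<in> A') \<longrightarrow> (\<exists>l. ix (st r) C i l \<in> D n))"
      by (rule ix_dense[OF _ i(2)]) (rule Dd[OF n])
    then obtain k' A' where k: "k' \<ge> k" "\<forall>n<k. n \<in> A' \<longleftrightarrow> n \<in> A"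
      "\<forall>C. (\<forall>n<k'. n \<in> C \<longleftrightarrow> n \<in> A') \<longrightarrow> (\<exists>l. ix (st r) C i l \<in> D n)" by (elim exE conjE)
    then show "\<exists>k'\<ge>k. \<exists>A'. (\<forall>n<k. n \<in> A' \<longleftrightarrow> n \<in> A) \<and>
      (\<forall>C. el C \<subseteq> el om \<longrightarrow> (\<forall>n<k'. n \<in> st C \<longleftrightarrow> n \<in> A') \<longrightarrow> C \<in> {C \<in> el pow_om. \<exists>l. ix (st r) (st C) i l \<in> D n})"
      by (intro exI[of _ k'] conjI exI[of _ A']) (simp_all add: el_pow_om)
  qed
  have "\<exists>S. card_le E S om \<and> (\<forall>x\<in>el w2. x \<notin> el S \<longrightarrow> (\<forall>i\<in>el om. c x \<in> el (?B i)))"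
    by (rule luzin_multi[OF fB card_le_refl]) (rule oB)
  then obtain S where S: "card_le E S om" "\<forall>x\<in>el w2. x \<notin> el S \<longrightarrow> (\<forall>i\<in>el om. c x \<in> el (?B i))"
    by (elim exE conjE)
  \<comment> \<open>The exceptional set is countable, so an index below \<omega>_1 avoids it;
    \<open>wx\<close> then puts the real with this index into \<open>XX x\<close>.\<close>
  obtain y where y: "y \<in> el w1" "y \<notin> el S" using w1_not_subset[OF S(1)] by blast
  have yB: "\<exists>l. ix (st r) (st (c y)) i l \<in> D n" if "n \<in> el om" for n
    using S(2) y w1_w2 that e[of n] by blast
  have cX: "c y \<in> el (XX x)" by (rule XX_c[OF x]) (use y wx in blast)
  have "thin (st r) (st (c y)) i \<in> st ` el (XX x)"
    by (rule XX_op[OF x _ rX cX]) (rule thin_cl)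
  then obtain q where q: "q \<in> el (XX x)" "st q = thin (st r) (st (c y)) i" by (metis imageE)
  have "q \<in> el (QQ x)" unfolding el_QQ using q thin_infinite[OF i(2)] by simp
  moreover have qa: "asub (st q) (sec (st r) (ix (st r) (st (c y)) i l))" for l
    unfolding q(2) by (rule thin_asub)
  ultimately have ql: "E (pr q (secm r m)) (LL x)" if "secm r m \<in> el (QS x d)" "m = ix (st r) (st (c y)) i l" for m l
    unfolding E_LL st_secm using that QSQ by blast
  have "E (pr q p) (LL x)" using ql[of i 0] p i(1) by simp
  moreover have "\<exists>b\<in>el (QS x d). E (pr n b) f \<and> E (pr q b) (LL x)" if n: "n \<in> el om" for n
    using yB[OF n] ql unfolding D_def by blast
  ultimately show ?thesis using \<open>q \<in> el (QQ x)\<close> by blast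
qed

lemma XX_proper: assumes x: "x \<in> el w2" and wx: "el w1 \<subseteq> el x" shows "proper_family E (XX x)"
proof -
  have Q1: "card_le E (QQ x) w1" by (rule card_le_mono[OF XX_card[OF x]]) (auto simp: el_QQ)
  have W1: "card_le E (WW x) w1" by (rule card_le_surj[OF fn_QS[of x]]) (simp add: el_WW)
  have "proper_poset E (QQ x) (LL x)"
  proof (rule proper_criterion[OF QQ_real QQ_preorder Q1 W1 QQ_uncountable[OF x wx]])
    show "el U \<subseteq> el (QQ x)" if "U \<in> el (WW x)" for U
      using that unfolding el_WW el_QQ el_XX by (auto simp: el_QS)
    show "\<exists>U\<in>el (WW x). A \<in> el U" if "A \<in> el (QQ x)" for A
      using that unfolding el_WW el_QQ el_XX by (auto simp: el_QS)
    show "card_le E U om" if U: "U \<in> el (WW x)" for U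
    proof -
      obtain d where d: "d \<in> el w1" "U = QS x d" using U unfolding el_WW by blast
      show ?thesis unfolding d(2) by (rule card_le_mono[OF stage_countable[OF x d(1)]]) (auto simp: el_QS)
    qed
    show "un Z \<in> el (WW x) \<or> el (QQ x) \<subseteq> el (un Z)" if "el Z \<subseteq> el (WW x)" "Z \<noteq> emp" for Z
      using that by (rule WW_union)
    show "\<exists>q\<in>el (QQ x). E (pr q p) (LL x) \<and> (\<forall>n\<in>el om. \<exists>b\<in>el U. E (pr n b) f \<and> E (pr q b) (LL x))"
      if U: "U \<in> el (WW x)" and p: "p \<in> el U"
        and f: "\<And>n a. n \<in> el om \<Longrightarrow> a \<in> el U \<Longrightarrow> \<exists>d\<in>el U. E (pr n d) f \<and> E (pr d a) (LL x)" for U p f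
    proof -
      obtain d where d: "d \<in> el w1" "U = QS x d" using U unfolding el_WW by blast
      show ?thesis using WW_good[OF x wx d(1) p[unfolded d(2)] f[unfolded d(2)]] unfolding d(2) .
    qed
  qed
  moreover have "family_of_reals E (XX x)"
    unfolding family_of_reals_def is_real_def using XX_real by fastforce
  ultimately show ?thesis unfolding proper_family_def using XX_arith[OF x] QQ_mod_fin by blast
qed

theorem piecewise: "\<exists>X. piecewise_proper_family E X \<and> card_eq_omega_n E X 2"
proof -
  define I where "I = mk {x \<in> el w2. el w1 \<subseteq> el x}"
  have I: "el I = {x \<in> el w2. el w1 \<subseteq> el x}" unfolding I_def by (rule el_mk, rule isset_sep[OF isset_el], intro dfi)
  define C where "C = mk (XX ` el I)"
  have fX: "fn XX" unfolding fn_def by (intro dfi)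
  have C: "el C = XX ` el I" unfolding C_def by (rule el_mk[OF isset_fn[OF fX isset_el]])
  have X: "el (un C) = (\<Union>x\<in>el I. el (XX x))" unfolding el_un C by simp
  have le1: "card_le_omega_n E Y 1" if "card_le E Y w1" for Y
    unfolding card_le_omega_n_def using that is_omega_w1 by blast
  have "piecewise_proper_family E (un C)"
    unfolding piecewise_proper_family_def
  proof (intro exI[of _ C] conjI ballI)
    fix Y assume "Y \<in> el C"
    then obtain x where x: "x \<in> el w2" "el w1 \<subseteq> el x" "Y = XX x" unfolding C I by blast
    show "proper_family E Y" "card_le_omega_n E Y 1" unfolding x(3) using XX_proper[OF x(1,2)] le1[OF XX_card[OF x(1)]] by blast+
  next
    fix Y Z assume "Y \<in> el C" "Z \<in> el C"
    then obtain x y where xy: "x \<in> el w2" "Y = XX x" "y \<in> el w2" "Z = XX y" unfolding C I by blast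
    from ord_lin[OF ord_el[OF ord_w2 xy(1)] ord_el[OF ord_w2 xy(3)]]
    show "el Y \<subseteq> el Z \<or> el Z \<subseteq> el Y" unfolding xy(2,4) using XX_mono xy(1,3) by blast
  qed simp
  moreover have "card_eq E (un C) w2"
  proof (rule card_eq_ordinal[OF ord_w2])
    have w12: "card_le E w1 w2" by (rule card_le_subset[OF w1_w2])
    have "card_le E I w2" by (rule card_le_subset) (use I in blast)
    then show "card_le E (un C) w2" unfolding C_def
      by (rule smal_UN[OF smal_w2 fX]) (use I XX_card w12 card_le_trans in blast)
    fix b assume "b \<in> el w2"
    then have b: "card_le E b w1" by (simp add: w2_def)
    show "\<not> card_le E (un C) b"
    proof
      assume "card_le E (un C) b"
      then have X1: "card_le E (un C) w1" using b card_le_trans by blast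
      \<comment> \<open>If the union had size at most \<omega>_1, then \<omega>_2 would be covered
        by at most \<omega>_1 fibres of \<open>c\<close>, each of them countable because a real
        equal to \<open>A\<close> misses the open dense set of reals other than
        \<open>A\<close>.\<close>
      define fib where "fib A = mk {x \<in> el w2. c x = A}" for A
      have fib: "el (fib A) = {x \<in> el w2. c x = A}" for A
        unfolding fib_def by (rule el_mk, rule isset_sep[OF isset_el], intro dfi)
      have ff: "fn fib" unfolding fn_def fib_def by (intro dfi)
      have fc: "card_le E (fib A) w1" for A
      proof -
        have e: "el (mk {C \<in> el pow_om. C \<noteq> A}) = {C \<in> el pow_om. C \<noteq> A}"
          by (rule el_mk, rule isset_sep[OF isset_el], intro dfi)
        obtain S where S: "card_le E S om" "\<forall>x\<in>el w2. x \<notin> el S \<longrightarrow> c x \<in> el (mk {C \<in> el pow_om. C \<noteq> A})"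
          using luzin[OF open_dense_neq[of A]] by blast
        have "el (fib A) \<subseteq> el S" unfolding fib using S(2) unfolding e by blast
        then have "card_le E (fib A) om" using card_le_mono[OF S(1)] by blast
        then show ?thesis using om_w1 card_le_trans by blast
      qed
      have "card_le E (un (mk (fib ` el (un C)))) w1" by (rule smal_UN[OF smal_w1 ff X1 fc])
      moreover have "el w2 \<subseteq> el (un (mk (fib ` el (un C))))"
      proof
        fix y assume y: "y \<in> el w2"
        have w1I: "w1 \<in> el I" unfolding I w2_def using ord_w1 card_le_refl by simp
        have oy: "ord y" by (rule ord_el[OF ord_w2 y])
        have "c y \<in> el (un C)"
        proof (cases "el w1 \<subseteq> el y")
          case True
          then have "y \<in> el I" unfolding I using y by blast
          then show ?thesis unfolding X using c_XX by blast
        next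
          \<comment> \<open>An index below \<omega>_1 does not label a family of the chain; its real
            is found in the first family, \<open>XX w1\<close>.\<close>
          case False
          then have "y \<in> el w1" using ord_lin[OF oy ord_w1] ord_subset_iff[OF ord_w1 oy] by blast
          then have "c y \<in> el (XX w1)" using XX_c w1I unfolding I by blast
          then show ?thesis unfolding X using w1I by blast
        qed
        then show "y \<in> el (un (mk (fib ` el (un C))))"
          unfolding el_un[of "mk _"] el_mk[OF isset_fn[OF ff isset_el]] using y fib by blast
      qed
      ultimately have "card_le E w2 w1" using card_le_mono by blast
      then show False using hart_not_le unfolding w2_def by blast
    qed
  qed
  ultimately show ?thesis unfolding card_eq_omega_n_def using is_omega_w2 by blast
qed

end

section \<open>The theorem\<close>

context cohen
begin

lemma luzin_creal: "luzin_reals F creal"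
proof
  show "M.fn creal" unfolding M.fn_def by (rule dt_creal[OF dt_var])
  show "M.el (creal x) \<subseteq> M.el M.om" for x unfolding el_creal by blast
  show "\<exists>S. card_le F S M.om \<and> (\<forall>x\<in>M.el M.w2. x \<notin> M.el S \<longrightarrow> creal x \<in> M.el B)" if B: "M.open_dense B" for B
  proof -
    have "\<exists>k'\<ge>k. \<exists>A'. (\<forall>n<k. n \<in> A' \<longleftrightarrow> n \<in> A) \<and>
      (\<forall>C. M.el C \<subseteq> range M.num \<longrightarrow> (\<forall>n<k'. F (M.num n) C \<longleftrightarrow> n \<in> A') \<longrightarrow> F C B)" for k A
      using B[unfolded M.open_dense_def M.st_def mem_Collect_eq M.el_om M.el_iff[of _ B]] by (elim allE)
    from luzin[of B, OF this] show ?thesis unfolding M.el_iff[of _ B] .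
  qed
qed

end

theorem theorem3p15:
  fixes E :: "'a \<Rightarrow> 'a \<Rightarrow> bool"
  assumes "transitive_model E"
  shows "\<exists>P le. ccc_poset E P le \<and>
           (\<forall>G (F :: 'a \<Rightarrow> 'a \<Rightarrow> bool).
              generic_filter E P le G \<longrightarrow> generic_extension E G F \<longrightarrow>
                (\<exists>X. piecewise_proper_family F X \<and> card_eq_omega_n F X 2))"
proof -
  interpret zfm E using assms unfolding transitive_model_def by unfold_locales blast+
  have "\<exists>X. piecewise_proper_family F X \<and> card_eq_omega_n F X 2"
    if G: "generic_filter E cohP cohle G" and F: "generic_extension E G F"
    for G and F :: "'a \<Rightarrow> 'a \<Rightarrow> bool"
  proof -
    obtain val where val: "surj val" "\<forall>t. elts F (val t) = {val s | s. \<exists>p\<in>G. (s, p) \<in> rel E t}"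
      using F unfolding generic_extension_def by blast
    interpret cohen E G F val
    proof
      show "preorder_on (el cohP) (rel E cohle)"
        using coh_ccc unfolding ccc_poset_def partial_order_on_def by blast
      show "emp \<in> el cohP" by (rule emp_cohP)
      show "(p, emp) \<in> rel E cohle" if "p \<in> el cohP" for p
        using that emp_cohP by (simp add: cohle_iff)
      show "extensional F" using F unfolding generic_extension_def by blast
    qed (use G val in blast)+
    show ?thesis by (rule luzin_reals.piecewise[OF luzin_creal])
  qed
  then show ?thesis using coh_ccc by blast
qed

end
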